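(* Let $X$ be a simple point process on $\mathbb{R}^d$ whose intensity measure has a density $\lambda$ with respect to Lebesgue measure that is continuous and strictly positive, and suppose $X$ satisfies the second-order regularity assumption (it has a locally bounded second-order product density off the diagonal, as in the context). Let $X_1,X_2,\dots$ be i.i.d. copies of $X$ and $S_n:=X_1+\cdots+X_n$. Let $a:\mathbb{N}_0\to[0,\infty)$ be bounded, $q_n(k)=\frac1n a(k)$ for $k\in\mathbb{N}_0$, and let $(r_n)_{n\ge1}$ be a sequence of positive radii with $r_n\downarrow 0$ and $n v_d r_n^d\to\tau\in[0,\infty)$. Let $Y_n:=T(q_n,r_n;S_n)$ be the neighbour-count thinning of $S_n$. For $t\ge 0$ put $\alpha(t):=\mathbb{E}[a(\mathrm{Poi}(t))]$ and put $\tilde\lambda(x):=\lambda(x)\,\alpha(\tau\lambda(x))$. Then, as $n\to\infty$, $Y_n$ converges weakly to an inhomogeneous Poisson point process on $\mathbb{R}^d$ with intensity measure $\tilde\lambda(x)\,dx$. Equivalently, for every $u\in\mathcal V$, $$A_{Y_n}(u)\longrightarrow \exp\Big(-\int_{\mathbb{R}^d}u(x)\,\tilde\lambda(x)\,dx\Big).$$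
   Context: Point processes are viewed as random (locally finite) counting measures; $X(B)=\#(X\cap B)$ for Borel $B\subset\mathbb{R}^d$. The intensity measure is $\mu(B)=\mathbb{E}X(B)=\int_B\lambda(x)\,dx$ with $\lambda:\mathbb{R}^d\to[0,\infty)$ locally bounded. $B(x,r)=\{y\in\mathbb{R}^d:\|y-x\|\le r\}$ is the closed Euclidean ball and $v_d=|B(0,1)|$ is the volume of the unit ball. $\mathrm{Poi}(t)$ denotes a Poisson random variable with mean $t$ ($\mathrm{Poi}(0)=0$). Second-order regularity assumption: there is a function $\rho^{(2)}(x,y)$ such that for bounded Borel sets $B_1,B_2$, $\mathbb{E}\sum_{x\ne y\in X}\mathbf 1_{B_1}(x)\mathbf 1_{B_2}(y)=\int_{B_1}\int_{B_2}\rho^{(2)}(x,y)\,dx\,dy$, and $\sup_{(x,y)\in K^2,\,x\neq y}\rho^{(2)}(x,y)<\infty$ for each compact $K\subset\mathbb{R}^d$. Neighbour-count thinning: for a locally finite configuration $\varphi\subset\mathbb{R}^d$ and $x\in\varphi$, $N_r(x,\varphi):=\#(\varphi\cap B(x,r)\setminus\{x\})$. Given $q:\mathbb{N}_0\to[0,1]$ and $r>0$, $T(q,r;\varphi)$ is obtained as follows: conditional on $\varphi$, each point $x\in\varphi$ is retained independently with probability $q(N_r(x,\varphi))$. The rule $q_n=a/n$ takes values in $[0,1]$ once $n\ge a_\ast:=\sup_k a(k)$; only such $n$ are considered. $\mathcal V$ is the set of measurable $u:\mathbb{R}^d\to[0,1]$ with bounded support, and for a point process $\xi$ the alternate probability generating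 functional is $A_\xi(u):=\mathbb{E}\prod_{x\in\xi}(1-u(x))$. Weak convergence of point processes is convergence in distribution as random elements of the space of locally finite counting measures on $\mathbb{R}^d$ (vague topology). *)

theory Defs
  imports "HOL-Probability.Probability"
begin

section \<open>Locally finite counting measures and point processes\<close>

definition lf_counting :: "'a::euclidean_space measure set" where
  "lf_counting = {\<phi>. sets \<phi> = sets borel \<and> (\<forall>B\<in>sets borel. bounded B \<longrightarrow> emeasure \<phi> B \<in> \<nat>)}"

text \<open>The sigma-algebra generated by the evaluation maps; it is the Borel sigma-algebra of
  the vague topology below.\<close>

definition pp_space :: "'a::euclidean_space measure measure" where
  "pp_space = (SUP B \<in> sets borel. vimage_algebra lf_counting (\<lambda>\<phi>. emeasure \<phi> B) borel)"

definition point_process :: "'w measure \<Rightarrow> ('w \<Rightarrow> 'a::euclidean_space measure) \<Rightarrow> bool" where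
  "point_process M X \<longleftrightarrow> prob_space M \<and> X \<in> measurable M pp_space"

definition vague_topology :: "'a::euclidean_space measure topology" where
  "vague_topology = topology_generated_by
     {{\<phi> \<in> lf_counting. (\<integral>x. f x \<partial>\<phi>) \<in> U} | (f :: 'a \<Rightarrow> real) U.
        continuous_on UNIV f \<and> compact (closure {x. f x \<noteq> 0}) \<and> open U}"

definition pp_weak_conv ::
  "'w measure \<Rightarrow> (nat \<Rightarrow> 'w \<Rightarrow> 'a::euclidean_space measure) \<Rightarrow> 'v measure \<Rightarrow> ('v \<Rightarrow> 'a measure) \<Rightarrow> bool"
where
  "pp_weak_conv M Y Q Z \<longleftrightarrow>
     (\<forall>F :: 'a measure \<Rightarrow> real.
        continuous_map vague_topology euclideanreal F \<and> bounded (F ` lf_counting) \<longrightarrow>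
        (\<lambda>n. \<integral>\<omega>. F (Y n \<omega>) \<partial>M) \<longlonglongrightarrow> (\<integral>\<omega>. F (Z \<omega>) \<partial>Q))"

definition atoms :: "'a::euclidean_space measure \<Rightarrow> 'a set" where
  "atoms \<phi> = {x. emeasure \<phi> {x} \<noteq> 0}"

definition simple_pp :: "'w measure \<Rightarrow> ('w \<Rightarrow> 'a::euclidean_space measure) \<Rightarrow> bool" where
  "simple_pp M X \<longleftrightarrow> (AE \<omega> in M. \<forall>x. emeasure (X \<omega>) {x} \<le> 1)"

definition has_intensity ::
  "'w measure \<Rightarrow> ('w \<Rightarrow> 'a::euclidean_space measure) \<Rightarrow> ('a \<Rightarrow> real) \<Rightarrow> bool" where
  "has_intensity M X lam \<longleftrightarrow>
     (\<forall>B\<in>sets borel. (\<integral>\<^sup>+\<omega>. emeasure (X \<omega>) B \<partial>M) = (\<integral>\<^sup>+x\<in>B. ennreal (lam x) \<partial>lborel))"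

text \<open>The sum over ordered pairs of distinct points runs over the set of atoms, so this is
  the second factorial moment measure of a simple point process.\<close>

definition second_order_regular ::
  "'w measure \<Rightarrow> ('w \<Rightarrow> 'a::euclidean_space measure) \<Rightarrow> bool" where
  "second_order_regular M X \<longleftrightarrow>
     (\<exists>\<rho> :: 'a \<Rightarrow> 'a \<Rightarrow> real.
        (\<lambda>(x, y). \<rho> x y) \<in> borel_measurable (borel \<Otimes>\<^sub>M borel) \<and>
        (\<forall>x y. 0 \<le> \<rho> x y) \<and>
        (\<forall>B1\<in>sets borel. \<forall>B2\<in>sets borel. bounded B1 \<longrightarrow> bounded B2 \<longrightarrow>
           (\<integral>\<^sup>+\<omega>. (\<integral>\<^sup>+(x, y). indicator B1 x * indicator B2 y
               \<partial>count_space {(x, y). x \<in> atoms (X \<omega>) \<and> y \<in> atoms (X \<omega>) \<and> x \<noteq> y}) \<partial>M)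
           = (\<integral>\<^sup>+x\<in>B1. (\<integral>\<^sup>+y\<in>B2. ennreal (\<rho> x y) \<partial>lborel) \<partial>lborel)) \<and>
        (\<forall>K. compact K \<longrightarrow> bdd_above {\<rho> x y | x y. x \<in> K \<and> y \<in> K \<and> x \<noteq> y}))"

definition superposition :: "nat set \<Rightarrow> (nat \<Rightarrow> 'a::euclidean_space measure) \<Rightarrow> 'a measure" where
  "superposition I \<phi> = measure_of UNIV (sets borel) (\<lambda>B. \<Sum>i\<in>I. emeasure (\<phi> i) B)"

section \<open>Neighbour-count thinning\<close>

definition nbr_count :: "real \<Rightarrow> 'a::euclidean_space \<Rightarrow> 'a set \<Rightarrow> nat" where
  "nbr_count r x \<phi> = card (\<phi> \<inter> cball x r - {x})"

definition counting_measure_on :: "'a::euclidean_space set \<Rightarrow> 'a measure" where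
  "counting_measure_on A = distr (count_space A) borel (\<lambda>x. x)"

text \<open>The law of the thinning \<open>T(q, r; \<phi>)\<close> of a fixed locally finite configuration: the
  product measure carries one independent retention indicator for each point.\<close>

definition thin_law ::
  "(nat \<Rightarrow> real) \<Rightarrow> real \<Rightarrow> 'a::euclidean_space set \<Rightarrow> 'a measure measure" where
  "thin_law q r \<phi> =
     distr (PiM \<phi> (\<lambda>x. measure_pmf (bernoulli_pmf (q (nbr_count r x \<phi>))))) pp_space
       (\<lambda>b. counting_measure_on {x \<in> \<phi>. b x})"

text \<open>\<open>Y\<close> is a thinning of \<open>S\<close> if the kernel above is a regular conditional distribution of
  \<open>Y\<close> given \<open>S\<close>. A realization of \<open>S\<close> is read as the configuration of its atoms, so the
  convention matters only on the event that \<open>S\<close> has multiple points.\<close>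

definition nbr_thinning ::
  "'w measure \<Rightarrow> (nat \<Rightarrow> real) \<Rightarrow> real \<Rightarrow> ('w \<Rightarrow> 'a::euclidean_space measure) \<Rightarrow>
     ('w \<Rightarrow> 'a measure) \<Rightarrow> bool" where
  "nbr_thinning M q r S Y \<longleftrightarrow>
     Y \<in> measurable M pp_space \<and>
     (\<forall>A\<in>sets pp_space. \<forall>B\<in>sets pp_space.
        emeasure M {\<omega> \<in> space M. S \<omega> \<in> A \<and> Y \<omega> \<in> B} =
        (\<integral>\<^sup>+\<omega>. indicator A (S \<omega>) * emeasure (thin_law q r (atoms (S \<omega>))) B \<partial>M))"

section \<open>Poisson processes and generating functionals\<close>

text \<open>\<open>poisson_pmf\<close> is only specified for positive rates.\<close>

definition Poi :: "real \<Rightarrow> nat pmf" where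
  "Poi t = (if t = 0 then return_pmf 0 else poisson_pmf t)"

definition poisson_process ::
  "'w measure \<Rightarrow> ('w \<Rightarrow> 'a::euclidean_space measure) \<Rightarrow> 'a measure \<Rightarrow> bool" where
  "poisson_process M Z \<mu> \<longleftrightarrow>
     point_process M Z \<and>
     (\<forall>B\<in>sets borel. bounded B \<longrightarrow>
        (\<forall>k::nat. measure M {\<omega> \<in> space M. emeasure (Z \<omega>) B = of_nat k}
           = pmf (Poi (measure \<mu> B)) k)) \<and>
     (\<forall>(I :: nat set) B. finite I \<longrightarrow> disjoint_family_on B I \<longrightarrow>
        (\<forall>i\<in>I. B i \<in> sets borel \<and> bounded (B i)) \<longrightarrow>
        prob_space.indep_vars M (\<lambda>_. borel) (\<lambda>i \<omega>. emeasure (Z \<omega>) (B i)) I)"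

definition test_functions :: "('a::euclidean_space \<Rightarrow> real) set" where
  "test_functions =
     {u \<in> borel_measurable borel. (\<forall>x. 0 \<le> u x \<and> u x \<le> 1) \<and> bounded {x. u x \<noteq> 0}}"

text \<open>The product over the points counts multiplicities. Points with \<open>u x = 0\<close> contribute the
  factor 1, and dropping them leaves a finite product.\<close>

definition apgf ::
  "'w measure \<Rightarrow> ('w \<Rightarrow> 'a::euclidean_space measure) \<Rightarrow> ('a \<Rightarrow> real) \<Rightarrow> real" where
  "apgf M \<xi> u =
     (\<integral>\<omega>. (\<Prod>x\<in>{x \<in> atoms (\<xi> \<omega>). u x \<noteq> 0}. (1 - u x) ^ nat \<lfloor>measure (\<xi> \<omega>) {x}\<rfloor>) \<partial>M)"

definition alpha :: "(nat \<Rightarrow> real) \<Rightarrow> real \<Rightarrow> real" where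
  "alpha a t = measure_pmf.expectation (Poi t) a"

definition limit_intensity :: "(nat \<Rightarrow> real) \<Rightarrow> real \<Rightarrow> ('a \<Rightarrow> real) \<Rightarrow> 'a \<Rightarrow> real" where
  "limit_intensity a \<tau> lam x = lam x * alpha a (\<tau> * lam x)"

end

theory Submission
  imports Defs
begin

text \<open>
  Conditionally on the superposition \<open>S n\<close>, points are retained independently, so the generating
  functional of the thinning at \<open>u\<close> is the expectation of the product of
  \<open>1 - u x * a (N x) / n\<close> over the points \<open>x\<close> of \<open>S n\<close>, where \<open>N x\<close> is the neighbour count
  (\<open>apgf_nbr_thinning\<close>). The number of points in the support of \<open>u\<close> is of order \<open>n\<close> and each factor
  differs from one by \<open>O(1 / n)\<close>, so the product is close to \<open>exp (- H)\<close> with \<open>H\<close> the sum of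
  \<open>u x * a (N x)\<close> divided by \<open>n\<close>. The functional converges to \<open>exp (- h)\<close> as soon as \<open>H\<close> concentrates
  at the constant \<open>h = \<integral> u x * lam x * alpha a (\<tau> * lam x) dx\<close>.

  A point of the summand \<open>X i\<close> rarely has a neighbour in \<open>X i\<close> itself, because the radii shrink and
  \<open>X i\<close> is simple. Its neighbours therefore come from the other \<open>n - 1\<close> summands, which are independent
  of \<open>X i\<close>. Hence Campbell's formula reduces the mean of \<open>H\<close> to the law of the number of neighbours
  of a fixed point \<open>x\<close>. This number is a sum of \<open>n - 1\<close> independent counts in a small ball. By the second-order
  regularity two points of one summand in the ball have probability of order \<open>1 / n\<^sup>2\<close>, so the sum
  converges to a Poisson variable with mean \<open>\<tau> * lam x\<close>, and \<open>a\<close> of it has mean \<open>alpha a (\<tau> * lam x)\<close> in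
  the limit (\<open>nbrs_limit\<close>). For the second moment of \<open>H\<close> the points of \<open>X i\<close> and \<open>X j\<close> are decoupled by
  removing both summands from all neighbour counts. At two distinct fixed points the counts are
  asymptotically independent, so the second moment is asymptotically at most \<open>h\<^sup>2\<close>
  (\<open>avg_weight_law_of_large_numbers\<close>).

  Convergence of the generating functionals at step functions is convergence of the joint generating
  functions of counts of disjoint sets, hence of the joint laws of these counts
  (\<open>poisson_limit_of_joint_pgf\<close>). This implies weak convergence in the vague topology: a vaguely open
  set is an increasing union of sets that are determined by the counts of finitely many cells of a
  countable base (\<open>pp_weak_conv_of_counts\<close>). The limiting Poisson process is constructed by placing
  Poisson numbers of independent points in disjoint annuli (\<open>poisson_process_exists\<close>).
\<close>

section \<open>The space of locally finite configurations\<close>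

lemma space_pp_space [simp]: "space (pp_space :: 'a::euclidean_space measure measure) = lf_counting"
  by (auto simp: pp_space_def space_Sup_eq_UN)

lemma measurable_emeasure_pp_space [measurable]:
  "B \<in> sets borel \<Longrightarrow> (\<lambda>\<phi>. emeasure \<phi> B) \<in> borel_measurable pp_space"
  unfolding pp_space_def
  by (auto intro!: measurable_Sup1 measurable_vimage_algebra1)

lemma lf_sets: "\<phi> \<in> lf_counting \<Longrightarrow> sets \<phi> = sets borel"
  by (auto simp: lf_counting_def)

lemma lf_space: "\<phi> \<in> lf_counting \<Longrightarrow> space \<phi> = UNIV"
  by (auto simp: lf_counting_def dest!: sets_eq_imp_space_eq)

text \<open>On bounded Borel sets the count is the mass itself; at singletons it is the exponent in \<open>apgf\<close>.\<close>

definition cnt :: "'a::euclidean_space measure \<Rightarrow> 'a set \<Rightarrow> nat" where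
  "cnt \<phi> B = nat \<lfloor>measure \<phi> B\<rfloor>"

lemma emeasure_lf_cnt:
  assumes "\<phi> \<in> lf_counting" "B \<in> sets borel" "bounded B"
  shows "emeasure \<phi> B = of_nat (cnt \<phi> B)"
proof -
  obtain k where k: "emeasure \<phi> B = of_nat k"
    using assms unfolding lf_counting_def by (blast elim: Nats_cases)
  then have "measure \<phi> B = real k" by (simp add: measure_def)
  then show ?thesis using k by (simp add: cnt_def)
qed

lemma measure_lf_cnt:
  assumes "\<phi> \<in> lf_counting" "B \<in> sets borel" "bounded B"
  shows "measure \<phi> B = real (cnt \<phi> B)"
  using emeasure_lf_cnt[OF assms] by (simp add: measure_def)

lemma measurable_nat_floor: "(\<lambda>x::real. nat \<lfloor>x\<rfloor>) \<in> measurable borel (count_space UNIV)"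
  by (rule measurable_compose[OF measurable_real_floor]) simp

lemma measurable_cnt_pp_space [measurable]:
  "B \<in> sets borel \<Longrightarrow> (\<lambda>\<phi>. cnt \<phi> B) \<in> measurable pp_space (count_space UNIV)"
  unfolding cnt_def measure_def
  by (intro measurable_compose[OF borel_measurable_enn2real measurable_nat_floor] measurable_emeasure_pp_space)

lemma emeasure_lf_SUP:
  fixes \<phi> :: "'a::euclidean_space measure"
  assumes "sets \<phi> = sets borel" "B \<in> sets borel"
  shows "emeasure \<phi> B = (SUP m::nat. emeasure \<phi> (B \<inter> cball 0 (real m)))"
proof -
  have "(SUP m::nat. emeasure \<phi> (B \<inter> cball 0 (real m))) = emeasure \<phi> (\<Union>m::nat. B \<inter> cball 0 (real m))"
  proof (rule SUP_emeasure_incseq)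
    have "B \<inter> cball 0 (real m) \<in> sets \<phi>" for m :: nat
      unfolding assms(1) by (intro sets.Int assms(2) borel_closed closed_cball)
    then show "range (\<lambda>m::nat. B \<inter> cball 0 (real m)) \<subseteq> sets \<phi>" by blast
    have "B \<inter> cball 0 (real m) \<subseteq> B \<inter> cball 0 (real n)" if "m \<le> n" for m n :: nat
      using that by (intro Int_mono subset_cball) auto
    then show "incseq (\<lambda>m::nat. B \<inter> cball 0 (real m))" unfolding incseq_def by blast
  qed
  also have "(\<Union>m::nat. B \<inter> cball 0 (real m)) = B"
  proof (intro equalityI subsetI)
    fix x assume "x \<in> B"
    moreover obtain m :: nat where "norm x \<le> real m" using real_arch_simple by blast
    ultimately show "x \<in> (\<Union>m::nat. B \<inter> cball 0 (real m))" by auto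
  qed simp
  finally show ?thesis by simp
qed

text \<open>Counts of bounded sets determine all counts by monotone limits, so only they have to be
  checked.\<close>

lemma measurable_pp_spaceI:
  fixes f :: "'b \<Rightarrow> 'a::euclidean_space measure"
  assumes "\<And>\<omega>. \<omega> \<in> space M \<Longrightarrow> f \<omega> \<in> lf_counting"
    and "\<And>B. B \<in> sets borel \<Longrightarrow> bounded B \<Longrightarrow> (\<lambda>\<omega>. emeasure (f \<omega>) B) \<in> borel_measurable M"
  shows "f \<in> measurable M pp_space"
  unfolding pp_space_def
proof (intro measurable_Sup2 measurable_vimage_algebra2)
  fix N :: "'a measure measure"
  assume "N \<in> (\<lambda>B. vimage_algebra lf_counting (\<lambda>\<phi>. emeasure \<phi> B) borel) ` sets borel"
  then obtain B :: "'a set" where B: "B \<in> sets borel"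
    and N: "N = vimage_algebra lf_counting (\<lambda>\<phi>. emeasure \<phi> B) borel" by auto
  have "(\<lambda>\<omega>. SUP m::nat. emeasure (f \<omega>) (B \<inter> cball 0 (real m))) \<in> borel_measurable M"
    using B by (intro borel_measurable_SUP assms) (auto intro: bounded_subset)
  then have "(\<lambda>\<omega>. emeasure (f \<omega>) B) \<in> borel_measurable M"
    by (rule measurable_cong[THEN iffD1, rotated]) (simp add: emeasure_lf_SUP[symmetric] B lf_sets assms(1))
  then show "f \<in> measurable M N"
    unfolding N using assms(1) by (intro measurable_vimage_algebra2) auto
qed auto

text \<open>Integration against a configuration is a measurable kernel.  Restricting it to a ball and
  dividing by one plus the mass of the ball turns it into a subprobability kernel.\<close>

lemma measurable_nn_integral_kernel:
  fixes \<kappa> :: "'l \<Rightarrow> 'a::euclidean_space measure"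
  assumes \<kappa> [measurable]: "\<kappa> \<in> measurable L pp_space"
    and f: "(\<lambda>(l, y). f l y) \<in> borel_measurable (L \<Otimes>\<^sub>M borel)"
  shows "(\<lambda>l. \<integral>\<^sup>+y. f l y \<partial>\<kappa> l) \<in> borel_measurable L"
proof -
  note f[measurable]
  define c where "c m l = emeasure (\<kappa> l) (cball 0 (real m))" for m :: nat and l
  have lf: "\<kappa> l \<in> lf_counting" if "l \<in> space L" for l
    using measurable_space[OF \<kappa> that] by simp
  have c_meas [measurable]: "c m \<in> borel_measurable L" for m
    unfolding c_def by measurable
  have c_fin: "c m l < \<infinity>" if "l \<in> space L" for m l
    using emeasure_lf_cnt[OF lf[OF that], of "cball 0 (real m)"] unfolding c_def
    by (simp add: of_nat_less_top)
  define D where "D m l = density (\<kappa> l) (\<lambda>y. indicator (cball 0 (real m)) y / (1 + c m l))" for m :: nat and l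
  have fm: "(\<lambda>y. f l y) \<in> borel_measurable borel" if "l \<in> space L" for l
    using measurable_Pair2[OF f that] by simp
  have fm': "(\<lambda>y. f l y) \<in> borel_measurable (\<kappa> l)" if "l \<in> space L" for l
    using fm[OF that] lf_sets[OF lf[OF that]] by (simp cong: measurable_cong_sets)
  have im: "indicator B \<in> borel_measurable (\<kappa> l)" if "l \<in> space L" "B \<in> sets borel" for l and B :: "'a set"
    using lf_sets[OF lf[OF that(1)]] that by (intro borel_measurable_indicator) auto
  have emD: "emeasure (D m l) B = emeasure (\<kappa> l) (B \<inter> cball 0 (real m)) / (1 + c m l)"
    if "l \<in> space L" "B \<in> sets borel" for m l B
  proof -
    have "emeasure (D m l) B = (\<integral>\<^sup>+y. indicator (cball 0 (real m)) y / (1 + c m l) * indicator B y \<partial>\<kappa> l)"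
      unfolding D_def using that lf_sets[OF lf[OF that(1)]]
      by (intro emeasure_density borel_measurable_divide_ennreal im) auto
    also have "\<dots> = (\<integral>\<^sup>+y. indicator (B \<inter> cball 0 (real m)) y / (1 + c m l) \<partial>\<kappa> l)"
      by (intro nn_integral_cong) (auto simp: indicator_def)
    also have "\<dots> = (\<integral>\<^sup>+y. indicator (B \<inter> cball 0 (real m)) y \<partial>\<kappa> l) / (1 + c m l)"
      using that by (intro nn_integral_divide im) auto
    also have "\<dots> = emeasure (\<kappa> l) (B \<inter> cball 0 (real m)) / (1 + c m l)"
      using that lf_sets[OF lf[OF that(1)]] by (subst nn_integral_indicator) auto
    finally show ?thesis .
  qed
  have D [measurable]: "D m \<in> measurable L (subprob_algebra borel)" for m
  proof (rule measurable_subprob_algebra)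
    fix l assume l: "l \<in> space L"
    show s: "sets (D m l) = sets borel" using lf_sets[OF lf[OF l]] by (simp add: D_def)
    have sp: "space (D m l) = UNIV" using lf_space[OF lf[OF l]] by (simp add: D_def)
    show "subprob_space (D m l)"
    proof
      have "c m l / (1 + c m l) \<le> 1"
        using c_fin[OF l] by (intro divide_le_posI_ennreal) (auto simp: add_pos_nonneg)
      then show "emeasure (D m l) (space (D m l)) \<le> 1"
        using emD[OF l, of UNIV] by (simp add: sp c_def)
      show "space (D m l) \<noteq> {}" by (simp add: sp)
    qed
  next
    fix B :: "'a set" assume B [measurable]: "B \<in> sets borel"
    have "(\<lambda>l. emeasure (\<kappa> l) (B \<inter> cball 0 (real m)) / (1 + c m l)) \<in> borel_measurable L"
      by measurable
    then show "(\<lambda>l. emeasure (D m l) B) \<in> borel_measurable L"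
      by (rule measurable_cong[THEN iffD1, rotated]) (simp add: emD B)
  qed
  have "(\<lambda>l. SUP m. (1 + c m l) * (\<integral>\<^sup>+y. f l y \<partial>D m l)) \<in> borel_measurable L"
    by (intro borel_measurable_SUP borel_measurable_times_ennreal borel_measurable_add
        nn_integral_measurable_subprob_algebra2[OF f D]) auto
  moreover have "(SUP m. (1 + c m l) * (\<integral>\<^sup>+y. f l y \<partial>D m l)) = (\<integral>\<^sup>+y. f l y \<partial>\<kappa> l)"
    if l: "l \<in> space L" for l
  proof -
    have "(1 + c m l) * (\<integral>\<^sup>+y. f l y \<partial>D m l) = (\<integral>\<^sup>+y. indicator (cball 0 (real m)) y * f l y \<partial>\<kappa> l)" for m
    proof -
      have "(\<integral>\<^sup>+y. f l y \<partial>D m l) = (\<integral>\<^sup>+y. indicator (cball 0 (real m)) y / (1 + c m l) * f l y \<partial>\<kappa> l)"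
        unfolding D_def using l by (intro nn_integral_density borel_measurable_divide_ennreal im fm') auto
      also have "\<dots> = (\<integral>\<^sup>+y. indicator (cball 0 (real m)) y * f l y / (1 + c m l) \<partial>\<kappa> l)"
        by (intro nn_integral_cong) (simp add: divide_ennreal_def mult_ac)
      also have "\<dots> = (\<integral>\<^sup>+y. indicator (cball 0 (real m)) y * f l y \<partial>\<kappa> l) / (1 + c m l)"
        using l by (intro nn_integral_divide borel_measurable_times_ennreal im fm') auto
      finally have e: "(\<integral>\<^sup>+y. f l y \<partial>D m l) = (\<integral>\<^sup>+y. indicator (cball 0 (real m)) y * f l y \<partial>\<kappa> l) / (1 + c m l)" .
      have "1 + c m l \<noteq> 0" "1 + c m l \<noteq> \<infinity>" using c_fin[OF l, of m] by auto
      show ?thesis unfolding e unfolding ennreal_times_divide mult.commute[of "1 + c m l"]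
        by (intro mult_divide_eq_ennreal) (use c_fin[OF l, of m] in auto)
    qed
    then have "(SUP m. (1 + c m l) * (\<integral>\<^sup>+y. f l y \<partial>D m l))
      = (SUP m::nat. \<integral>\<^sup>+y. indicator (cball 0 (real m)) y * f l y \<partial>\<kappa> l)" by simp
    also have "\<dots> = (\<integral>\<^sup>+y. (SUP m::nat. indicator (cball 0 (real m)) y * f l y) \<partial>\<kappa> l)"
    proof (rule nn_integral_monotone_convergence_SUP[symmetric])
      show "incseq (\<lambda>m::nat. (\<lambda>y. indicator (cball 0 (real m)) y * f l y))"
        by (auto simp: incseq_def le_fun_def indicator_def)
      show "(\<lambda>y. indicator (cball 0 (real m)) y * f l y) \<in> borel_measurable (\<kappa> l)" for m :: nat
        using l by (intro borel_measurable_times_ennreal im fm') auto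
    qed
    also have "\<dots> = (\<integral>\<^sup>+y. f l y \<partial>\<kappa> l)"
    proof (intro nn_integral_cong)
      fix y :: 'a
      obtain m :: nat where "norm y \<le> real m" using real_arch_simple by blast
      then show "(SUP m::nat. indicator (cball 0 (real m)) y * f l y) = f l y"
        by (intro antisym SUP_least SUP_upper2[of m]) (auto simp: indicator_def)
    qed
    finally show ?thesis .
  qed
  ultimately show ?thesis by (simp cong: measurable_cong)
qed

subsection \<open>Atoms\<close>

lemma emeasure_lf_finite: "\<phi> \<in> lf_counting \<Longrightarrow> B \<in> sets borel \<Longrightarrow> bounded B \<Longrightarrow> emeasure \<phi> B < \<infinity>"
  by (simp add: emeasure_lf_cnt of_nat_less_top)

lemma atoms_ge_1:
  assumes "\<phi> \<in> lf_counting" "x \<in> atoms \<phi>"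
  shows "1 \<le> cnt \<phi> {x}"
  using emeasure_lf_cnt[OF assms(1), of "{x}"] assms(2) by (auto simp: atoms_def Suc_le_eq)

lemma cnt_not_atom: "x \<notin> atoms \<phi> \<Longrightarrow> cnt \<phi> {x} = 0"
  by (simp add: atoms_def cnt_def measure_def)

text \<open>Every atom has mass at least one, and bounded sets have finite mass.\<close>

lemma finite_atoms_Int:
  assumes lf: "\<phi> \<in> lf_counting" and W: "bounded W"
  shows "finite (atoms \<phi> \<inter> W)"
proof (rule ccontr)
  assume inf: "infinite (atoms \<phi> \<inter> W)"
  obtain R where R: "W \<subseteq> cball 0 R" using bounded_subset_ballD[OF W, of 0] by (meson ball_subset_cball subset_trans)
  obtain F where F: "F \<subseteq> atoms \<phi> \<inter> W" "finite F" "card F = Suc (cnt \<phi> (cball 0 R))"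
    using infinite_arbitrarily_large[OF inf] by blast
  have "of_nat (card F) = (\<Sum>x\<in>F. 1::ennreal)" by simp
  also have "\<dots> \<le> (\<Sum>x\<in>F. emeasure \<phi> {x})"
  proof (intro sum_mono)
    fix x assume "x \<in> F"
    then have "1 \<le> cnt \<phi> {x}" using F(1) by (intro atoms_ge_1[OF lf]) auto
    then show "1 \<le> emeasure \<phi> {x}"
      using emeasure_lf_cnt[OF lf, of "{x}"] by (simp add: of_nat_mono[of 1, simplified])
  qed
  also have "\<dots> = emeasure \<phi> F"
    using F(2) lf_sets[OF lf] by (subst emeasure_eq_sum_singleton) auto
  also have "\<dots> \<le> emeasure \<phi> (cball 0 R)"
    using F(1) R lf_sets[OF lf] by (intro emeasure_mono) auto
  also have "\<dots> = of_nat (cnt \<phi> (cball 0 R))"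
    by (intro emeasure_lf_cnt[OF lf]) auto
  finally have "(of_nat (Suc (cnt \<phi> (cball 0 R))) :: ennreal) \<le> of_nat (cnt \<phi> (cball 0 R))"
    unfolding F(3) .
  then show False unfolding of_nat_le_iff by simp
qed

text \<open>A point without mass has a ball of mass less than one around it, and masses are
  integers, so the ball is null. By compactness all non-atoms in a ball form a null set.\<close>

lemma emeasure_diff_atoms:
  fixes W :: "'a::euclidean_space set"
  assumes lf: "\<phi> \<in> lf_counting" and W: "bounded W" "W \<in> sets borel"
  shows "emeasure \<phi> (W - atoms \<phi>) = 0"
proof -
  obtain R where R: "W \<subseteq> cball 0 R" using bounded_subset_ballD[OF W(1), of 0] by (meson ball_subset_cball subset_trans)
  define K :: "'a set" where "K = cball 0 R"
  have [measurable]: "K \<in> sets borel" by (simp add: K_def)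
  define A where "A = atoms \<phi> \<inter> K"
  have fA: "finite A" unfolding A_def K_def by (intro finite_atoms_Int[OF lf]) simp
  have sb: "sets \<phi> = sets borel" by (rule lf_sets[OF lf])
  have "\<exists>e>0. emeasure \<phi> (ball x e - A) = 0" if "x \<in> K" for x
  proof -
    define B where "B n = ball x (1 / Suc n) - A" for n
    have Bm: "B n \<in> sets borel" for n using fA unfolding B_def
      by (intro sets.Diff) (auto intro: borel_closed finite_imp_closed)
    have Bb: "bounded (B n)" for n unfolding B_def by (meson Diff_subset bounded_ball bounded_subset)
    have Bi: "(\<Inter>n. B n) = {x} - A"
    proof (intro set_eqI iffI)
      fix y assume y: "y \<in> (\<Inter>n. B n)"
      have "x = y"
      proof (rule ccontr)
        assume "x \<noteq> y"
        then obtain n where "1 / real (Suc n) < dist x y"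
          using reals_Archimedean[of "dist x y"] by (auto simp: inverse_eq_divide)
        then show False using y by (auto simp: B_def dest!: spec[of _ n])
      qed
      then show "y \<in> {x} - A" using y by (auto simp: B_def)
    qed (auto simp: B_def)
    have "(\<lambda>n. emeasure \<phi> (B n)) \<longlonglongrightarrow> emeasure \<phi> (\<Inter>n. B n)"
    proof (rule Lim_emeasure_decseq)
      have "ball x (1 / real (Suc n)) \<subseteq> ball x (1 / real (Suc m))" if "m \<le> n" for m n
        using that by (intro subset_ball divide_left_mono) auto
      then show "decseq B" unfolding decseq_def B_def by blast
      show "emeasure \<phi> (B n) \<noteq> \<infinity>" for n using emeasure_lf_finite[OF lf Bm Bb, of n] by simp
    qed (use Bm sb in auto)
    also have "emeasure \<phi> (\<Inter>n. B n) = 0"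
      unfolding Bi using that by (auto simp: A_def atoms_def insert_Diff_if)
    finally have "(\<lambda>n. emeasure \<phi> (B n)) \<longlonglongrightarrow> 0" .
    then have "eventually (\<lambda>n. emeasure \<phi> (B n) < 1) sequentially"
      by (rule order_tendstoD) simp
    then obtain n where "emeasure \<phi> (B n) < 1" by (auto simp: eventually_sequentially)
    then have "emeasure \<phi> (B n) = 0" using emeasure_lf_cnt[OF lf Bm Bb, of n]
      by (metis less_one of_nat_0 of_nat_1 of_nat_less_iff)
    then show ?thesis unfolding B_def by (intro exI[of _ "1 / Suc n"]) auto
  qed
  then obtain e where e: "\<And>x. x \<in> K \<Longrightarrow> e x > 0" "\<And>x. x \<in> K \<Longrightarrow> emeasure \<phi> (ball x (e x) - A) = 0"
    by metis
  have "compact K" by (simp add: K_def)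
  then obtain F where F: "F \<subseteq> K" "finite F" "K \<subseteq> (\<Union>x\<in>F. ball x (e x))"
    by (rule compactE_image[where f = "\<lambda>x. ball x (e x)" and C = K]) (use e(1) in auto)
  have bA: "ball x d - A \<in> sets \<phi>" for x d
    unfolding sb using fA by (intro sets.Diff) (auto intro: borel_closed finite_imp_closed)
  have "emeasure \<phi> (W - atoms \<phi>) \<le> emeasure \<phi> (\<Union>x\<in>F. ball x (e x) - A)"
    using R F bA by (intro emeasure_mono sets.finite_UN) (auto simp: A_def K_def[symmetric])
  also have "\<dots> \<le> (\<Sum>x\<in>F. emeasure \<phi> (ball x (e x) - A))"
    using F bA by (intro emeasure_subadditive_finite) auto
  also have "\<dots> = 0" using e F by (intro sum.neutral) auto
  finally show ?thesis by simp
qed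

lemma nn_integral_lf_atoms:
  fixes f :: "'a::euclidean_space \<Rightarrow> ennreal"
  assumes lf: "\<phi> \<in> lf_counting" and W: "bounded W" "W \<in> sets borel"
    and f: "f \<in> borel_measurable borel"
  shows "(\<integral>\<^sup>+x. f x * indicator W x \<partial>\<phi>) = (\<Sum>x\<in>atoms \<phi> \<inter> W. f x * of_nat (cnt \<phi> {x}))"
proof -
  have fin: "finite (atoms \<phi> \<inter> W)" by (rule finite_atoms_Int[OF lf W(1)])
  have sb: "sets \<phi> = sets borel" by (rule lf_sets[OF lf])
  have [measurable]: "f \<in> borel_measurable \<phi>" using f sb by (simp cong: measurable_cong_sets)
  have "W - atoms \<phi> = W - (atoms \<phi> \<inter> W)" by auto
  then have Wd: "W - atoms \<phi> \<in> sets \<phi>" unfolding sb using sets.Diff[OF W(2) borel_closed[OF finite_imp_closed[OF fin]]]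
    by simp
  then have "AE x in \<phi>. x \<notin> W - atoms \<phi>" using emeasure_diff_atoms[OF lf W]
    by (intro AE_not_in null_setsI Wd) auto
  then have "(\<integral>\<^sup>+x. f x * indicator W x \<partial>\<phi>) = (\<integral>\<^sup>+x. f x * indicator (atoms \<phi> \<inter> W) x \<partial>\<phi>)"
    by (intro nn_integral_cong_AE) (auto simp: indicator_def)
  also have "\<dots> = (\<Sum>x\<in>atoms \<phi> \<inter> W. f x * emeasure \<phi> {x})"
    using fin sb by (intro nn_integral_indicator_finite) auto
  also have "\<dots> = (\<Sum>x\<in>atoms \<phi> \<inter> W. f x * of_nat (cnt \<phi> {x}))"
    by (intro sum.cong refl) (simp add: emeasure_lf_cnt[OF lf])
  finally show ?thesis .
qed

lemma cnt_eq_sum_atoms: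
  assumes lf: "\<phi> \<in> lf_counting" and W: "bounded W" "W \<in> sets borel"
  shows "cnt \<phi> W = (\<Sum>x\<in>atoms \<phi> \<inter> W. cnt \<phi> {x})"
proof -
  have "of_nat (cnt \<phi> W) = (\<integral>\<^sup>+x. 1 * indicator W x \<partial>\<phi>)"
    using emeasure_lf_cnt[OF lf W(2,1)] lf_sets[OF lf] W by simp
  also have "\<dots> = (\<Sum>x\<in>atoms \<phi> \<inter> W. 1 * of_nat (cnt \<phi> {x}))"
    by (rule nn_integral_lf_atoms[OF lf W]) simp
  also have "\<dots> = of_nat (\<Sum>x\<in>atoms \<phi> \<inter> W. cnt \<phi> {x})" by simp
  finally show ?thesis unfolding of_nat_eq_iff .
qed

section \<open>Generating functions and Poisson limits of counts\<close>

lemma pmf_Poi: "0 \<le> t \<Longrightarrow> pmf (Poi t) k = t ^ k / fact k * exp (- t)"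
  by (cases "t = 0") (auto simp: Poi_def power_0_left)

lemma sums_expectation_nat_pmf:
  fixes a :: "nat \<Rightarrow> real"
  assumes "\<And>k. \<bar>a k\<bar> \<le> (c::real)"
  shows "(\<lambda>k. pmf p k * a k) sums measure_pmf.expectation p a"
proof -
  have "integrable (measure_pmf p) a"
    by (rule measure_pmf.integrable_const_bound[where B = c]) (use assms in auto)
  then have "integrable (density (count_space UNIV) (pmf p)) a"
    by (simp add: measure_pmf_eq_density)
  then have i: "integrable (count_space UNIV) (\<lambda>k. pmf p k * a k)"
    by (subst (asm) integrable_density) auto
  have "measure_pmf.expectation p a = (\<integral>k. pmf p k * a k \<partial>count_space UNIV)"
    unfolding measure_pmf_eq_density by (subst integral_density) auto
  then show ?thesis using sums_integral_count_space_nat[OF i] by simp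
qed

lemma sums_pmf_nat: "(pmf (p :: nat pmf)) sums 1"
  using sums_expectation_nat_pmf[of "\<lambda>_. 1" 1 p] by simp

lemma Poi_pgf_sums:
  assumes "0 \<le> (t::real)"
  shows "(\<lambda>k. pmf (Poi t) k * z ^ k) sums exp (- ((1 - z) * t))"
proof -
  have "(\<lambda>k. exp (- t) * ((z * t) ^ k /\<^sub>R fact k)) sums (exp (- t) * exp (z * t))"
    by (intro sums_mult exp_converges)
  also have "exp (- t) * exp (z * t) = exp (- ((1 - z) * t))"
    by (simp add: mult_exp_exp algebra_simps)
  finally show ?thesis
    by (simp add: pmf_Poi[OF assms] power_mult_distrib field_simps)
qed

text \<open>Convergence of generating functions on \<open>[0, 1]\<close> forces convergence of the coefficients: once
  the coefficients below \<open>k\<close> converge, dividing by \<open>z ^ k\<close> isolates the \<open>k\<close>-th one up to an error of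
  order \<open>z\<close>, uniformly in \<open>n\<close>.\<close>

lemma tendsto_coeff_of_tendsto_pgf:
  fixes p :: "nat \<Rightarrow> nat \<Rightarrow> real" and q :: "nat \<Rightarrow> real"
  assumes p: "\<And>n k. 0 \<le> p n k" "\<And>n. summable (p n)" "\<And>n. suminf (p n) \<le> C"
    and q: "\<And>k. 0 \<le> q k" "summable q" "suminf q \<le> C"
    and lim: "\<And>z. 0 \<le> z \<Longrightarrow> z < 1 \<Longrightarrow> (\<lambda>n. \<Sum>k. p n k * z ^ k) \<longlonglongrightarrow> (\<Sum>k. q k * z ^ k)"
  shows "(\<lambda>n. p n k) \<longlonglongrightarrow> q k"
proof (induction k rule: less_induct)
  case (less k)
  have split: "\<exists>R. 0 \<le> R \<and> R \<le> C \<and> (\<Sum>j. f j * z ^ j) = (\<Sum>j<k. f j * z ^ j) + z ^ k * (f k + z * R)"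
    if f: "\<And>j. 0 \<le> f j" "summable f" "suminf f \<le> C" and z: "0 < z" "z < 1" for f :: "nat \<Rightarrow> real" and z
  proof -
    have zle: "z ^ j \<le> 1" for j using z by (intro power_le_one) auto
    have s: "summable (\<lambda>j. f j * z ^ j)"
      by (rule summable_comparison_test'[OF f(2)]) (use f z zle in \<open>auto simp: abs_mult mult_left_le\<close>)
    have s2: "summable (\<lambda>j. f (j + Suc k) * z ^ j)"
      by (rule summable_comparison_test'[OF summable_ignore_initial_segment[OF f(2), of "Suc k"]])
        (use f z zle in \<open>auto simp: abs_mult mult_left_le\<close>)
    define R where "R = (\<Sum>j. f (j + Suc k) * z ^ j)"
    have "(\<Sum>j. f j * z ^ j) = (\<Sum>j. f (j + Suc k) * z ^ (j + Suc k)) + (\<Sum>j<Suc k. f j * z ^ j)"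
      by (rule suminf_split_initial_segment[OF s])
    also have "(\<Sum>j. f (j + Suc k) * z ^ (j + Suc k)) = z ^ Suc k * R"
      unfolding R_def by (subst suminf_mult[OF s2, symmetric]) (simp add: power_add mult_ac)
    finally have 1: "(\<Sum>j. f j * z ^ j) = (\<Sum>j<k. f j * z ^ j) + z ^ k * (f k + z * R)"
      by (simp add: algebra_simps)
    have 2: "0 \<le> R" unfolding R_def using f z s2 by (intro suminf_nonneg) auto
    have "R \<le> (\<Sum>j. f (j + Suc k))" unfolding R_def
      by (rule suminf_le[OF _ s2 summable_ignore_initial_segment[OF f(2)]])
        (use f(1) z zle in \<open>auto intro!: mult_left_le\<close>)
    also have "\<dots> \<le> suminf f"
      using suminf_split_initial_segment[OF f(2), of "Suc k"] f(1) by (simp add: sum_nonneg)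
    finally show ?thesis using 1 2 f(3) by (intro exI[of _ R]) auto
  qed
  have C: "0 \<le> C" using p suminf_nonneg[of "p 0"] order_trans by blast
  show ?case
  proof (rule LIMSEQ_I)
    fix e :: real assume e: "0 < e"
    define z where "z = min (1/2) (e / (2 * (C + 1)))"
    have z: "0 < z" "z < 1" using e C by (auto simp: z_def)
    have "z * C \<le> e / (2 * (C + 1)) * C" using C by (intro mult_right_mono) (auto simp: z_def)
    also have "\<dots> = e / 2 * (C / (C + 1))" using C by (simp add: field_simps)
    also have "\<dots> \<le> e / 2 * 1" using C e by (intro mult_left_mono) auto
    finally have zC: "z * C \<le> e / 2" by simp
    have zl: "(\<lambda>n. \<bar>(\<Sum>k. p n k * z ^ k) - (\<Sum>k. q k * z ^ k)\<bar> + \<bar>(\<Sum>j<k. p n j * z ^ j) - (\<Sum>j<k. q j * z ^ j)\<bar>) \<longlonglongrightarrow>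
       \<bar>(\<Sum>k. q k * z ^ k) - (\<Sum>k. q k * z ^ k)\<bar> + \<bar>(\<Sum>j<k. q j * z ^ j) - (\<Sum>j<k. q j * z ^ j)\<bar>"
      using less z by (intro tendsto_intros lim) auto
    have "eventually (\<lambda>n. \<bar>(\<Sum>k. p n k * z ^ k) - (\<Sum>k. q k * z ^ k)\<bar> + \<bar>(\<Sum>j<k. p n j * z ^ j) - (\<Sum>j<k. q j * z ^ j)\<bar> < z ^ k * (e / 2)) sequentially"
      by (rule order_tendstoD(2)[OF zl]) (use z e in auto)
    then have "eventually (\<lambda>n. norm (p n k - q k) < e) sequentially"
    proof eventually_elim
      case (elim n)
      obtain R where R: "0 \<le> R" "R \<le> C" "(\<Sum>j. p n j * z ^ j) = (\<Sum>j<k. p n j * z ^ j) + z ^ k * (p n k + z * R)"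
        using split[of "p n" z] p z by blast
      obtain Q where Q: "0 \<le> Q" "Q \<le> C" "(\<Sum>j. q j * z ^ j) = (\<Sum>j<k. q j * z ^ j) + z ^ k * (q k + z * Q)"
        using split[of q z] q z by blast
      have "z ^ k * (p n k - q k) = ((\<Sum>j. p n j * z ^ j) - (\<Sum>j. q j * z ^ j)) - ((\<Sum>j<k. p n j * z ^ j) - (\<Sum>j<k. q j * z ^ j)) - z ^ k * (z * (R - Q))"
        unfolding R(3) Q(3) by (simp add: algebra_simps)
      then have "\<bar>z ^ k * (p n k - q k)\<bar> < z ^ k * (e / 2) + \<bar>z ^ k * (z * (R - Q))\<bar>"
        using elim by linarith
      also have "\<bar>z ^ k * (z * (R - Q))\<bar> \<le> z ^ k * (z * C)"
        using R Q z by (auto simp: abs_mult intro!: mult_left_mono)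
      also have "\<dots> \<le> z ^ k * (e / 2)" using z zC by (intro mult_left_mono) auto
      finally have "\<bar>z ^ k * (p n k - q k)\<bar> < z ^ k * e" by (simp add: algebra_simps)
      then have "z ^ k * \<bar>p n k - q k\<bar> < z ^ k * e" using z by (simp only: abs_mult abs_of_pos zero_less_power)
      then show ?case using z by (simp only: mult_less_cancel_left_pos zero_less_power real_norm_def)
    qed
    then show "\<exists>N. \<forall>n\<ge>N. norm (p n k - q k) < e" by (simp add: eventually_sequentially)
  qed
qed

text \<open>The generating function of \<open>W\<close> under the weight \<open>V\<close> determines all weighted expectations of
  bounded functions of \<open>W\<close> in the limit: coefficients converge, no mass is lost because \<open>z = 1\<close> is
  included, and coefficientwise convergence without loss of mass is convergence in total variation.\<close>

lemma (in prob_space) poisson_limit_of_weighted_pgf: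
  fixes W :: "nat \<Rightarrow> 'a \<Rightarrow> nat" and V :: "nat \<Rightarrow> 'a \<Rightarrow> real"
  assumes W [measurable]: "\<And>n. W n \<in> measurable M (count_space UNIV)"
    and V [measurable]: "\<And>n. V n \<in> borel_measurable M"
    and VC: "\<And>n \<omega>. \<omega> \<in> space M \<Longrightarrow> 0 \<le> V n \<omega> \<and> V n \<omega> \<le> C"
    and t: "0 \<le> t"
    and lim: "\<And>z. 0 \<le> z \<Longrightarrow> z \<le> 1 \<Longrightarrow> (\<lambda>n. \<integral>\<omega>. z ^ W n \<omega> * V n \<omega> \<partial>M) \<longlonglongrightarrow> v * exp (- ((1 - z) * t))"
    and a: "\<And>k. \<bar>a k\<bar> \<le> c"
  shows "(\<lambda>n. \<integral>\<omega>. a (W n \<omega>) * V n \<omega> \<partial>M) \<longlonglongrightarrow> v * alpha a t"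
proof -
  have int: "integrable M (\<lambda>\<omega>. g (W n \<omega>) * V n \<omega>)" if g: "\<And>k. \<bar>g k\<bar> \<le> b" for g :: "nat \<Rightarrow> real" and b n
  proof (rule integrable_const_bound[of _ "b * C"])
    have "\<bar>g (W n \<omega>)\<bar> * V n \<omega> \<le> b * C" if "\<omega> \<in> space M" for \<omega>
      using VC[OF that, of n] g[of "W n \<omega>"] by (intro mult_mono) auto
    then show "AE \<omega> in M. norm (g (W n \<omega>) * V n \<omega>) \<le> b * C"
      using VC by (auto simp: abs_mult)
  qed measurable
  have ind: "integrable M (\<lambda>\<omega>. indicator {k} (W n \<omega>) * V n \<omega>)" for n k
    by (rule int[of "indicator {k}" 1]) (auto simp: indicator_def)
  define p where "p n k = (\<integral>\<omega>. indicator {k} (W n \<omega>) * V n \<omega> \<partial>M)" for n k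
  have sums: "(\<lambda>k. p n k * g k) sums (\<integral>\<omega>. g (W n \<omega>) * V n \<omega> \<partial>M)"
    if g: "\<And>k. \<bar>g k\<bar> \<le> b" for g :: "nat \<Rightarrow> real" and b n
    unfolding sums_def
  proof -
    have b: "0 \<le> b" using g[of 0] by simp
    have pt: "(\<Sum>k<K. indicator {k} (W n \<omega>) * g k) = (if W n \<omega> < K then g (W n \<omega>) else 0)" for K \<omega>
    proof -
      have "(\<Sum>k<K. indicator {k} (W n \<omega>) * g k) = (\<Sum>k<K. if k = W n \<omega> then g k else 0)"
        by (intro sum.cong) (auto simp: indicator_def)
      then show ?thesis by simp
    qed
    have "(\<lambda>K. \<integral>\<omega>. (\<Sum>k<K. indicator {k} (W n \<omega>) * g k) * V n \<omega> \<partial>M) \<longlonglongrightarrow> (\<integral>\<omega>. g (W n \<omega>) * V n \<omega> \<partial>M)"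
    proof (rule integral_dominated_convergence[where w = "\<lambda>_. b * C"])
      show "AE \<omega> in M. (\<lambda>K. (\<Sum>k<K. indicator {k} (W n \<omega>) * g k) * V n \<omega>) \<longlonglongrightarrow> g (W n \<omega>) * V n \<omega>"
      proof (intro AE_I2 tendsto_mult tendsto_const)
        fix \<omega>
        show "(\<lambda>K. \<Sum>k<K. indicator {k} (W n \<omega>) * g k) \<longlonglongrightarrow> g (W n \<omega>)"
          unfolding pt by (rule tendsto_eventually, rule eventually_mono[OF eventually_gt_at_top[of "W n \<omega>"]]) simp
      qed
      have "\<bar>(if W n \<omega> < K then g (W n \<omega>) else 0)\<bar> * V n \<omega> \<le> b * C" if "\<omega> \<in> space M" for K \<omega>
        using VC[OF that, of n] g[of "W n \<omega>"] b by (intro mult_mono) auto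
      then show "AE \<omega> in M. norm ((\<Sum>k<K. indicator {k} (W n \<omega>) * g k) * V n \<omega>) \<le> b * C" for K
        unfolding pt using VC by (auto simp: abs_mult)
      have h: "(\<lambda>\<omega>. h (W n \<omega>)) \<in> borel_measurable M" for h :: "nat \<Rightarrow> real"
        by (rule measurable_compose[OF W]) simp
      then show "(\<lambda>\<omega>. g (W n \<omega>) * V n \<omega>) \<in> borel_measurable M"
        by (intro borel_measurable_times V)
      from h show "(\<lambda>\<omega>. (\<Sum>k<K. indicator {k} (W n \<omega>) * g k) * V n \<omega>) \<in> borel_measurable M" for K
        by (intro borel_measurable_times borel_measurable_sum V)
    qed simp
    also have "(\<lambda>K. \<integral>\<omega>. (\<Sum>k<K. indicator {k} (W n \<omega>) * g k) * V n \<omega> \<partial>M) = (\<lambda>K. \<Sum>k<K. p n k * g k)"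
    proof
      fix K
      have "(\<integral>\<omega>. (\<Sum>k<K. indicator {k} (W n \<omega>) * g k) * V n \<omega> \<partial>M)
        = (\<integral>\<omega>. (\<Sum>k<K. g k * (indicator {k} (W n \<omega>) * V n \<omega>)) \<partial>M)"
        by (intro Bochner_Integration.integral_cong refl) (simp only: sum_distrib_left mult_ac)
      also have "\<dots> = (\<Sum>k<K. p n k * g k)" unfolding p_def
        by (subst Bochner_Integration.integral_sum, rule integrable_mult_right[OF ind])
          (simp add: mult.commute)
      finally show "(\<integral>\<omega>. (\<Sum>k<K. indicator {k} (W n \<omega>) * g k) * V n \<omega> \<partial>M) = (\<Sum>k<K. p n k * g k)" .
    qed
    finally show "(\<lambda>K. \<Sum>k<K. p n k * g k) \<longlonglongrightarrow> (\<integral>\<omega>. g (W n \<omega>) * V n \<omega> \<partial>M)" .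
  qed
  have p0: "0 \<le> p n k" for n k unfolding p_def using VC by (intro Bochner_Integration.integral_nonneg_AE) auto
  have p1: "p n sums (\<integral>\<omega>. V n \<omega> \<partial>M)" for n using sums[of "\<lambda>_. 1" 1 n] by simp
  have intV: "(\<integral>\<omega>. V n \<omega> \<partial>M) \<le> C" for n
  proof -
    have "(\<integral>\<omega>. V n \<omega> \<partial>M) \<le> (\<integral>\<omega>. C \<partial>M)"
      using int[of "\<lambda>_. 1" 1 n] VC by (intro integral_mono_AE) auto
    then show ?thesis by (simp add: prob_space)
  qed
  have Vv: "(\<lambda>n. \<integral>\<omega>. V n \<omega> \<partial>M) \<longlonglongrightarrow> v" using lim[of 1] by simp
  have v0: "0 \<le> v" using VC by (intro LIMSEQ_le_const[OF Vv]) (auto intro!: Bochner_Integration.integral_nonneg_AE)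
  have vC: "v \<le> C" by (intro LIMSEQ_le_const2[OF Vv]) (use intV in auto)
  define q where "q k = v * pmf (Poi t) k" for k
  have q1: "q sums v" unfolding q_def using sums_mult[OF sums_pmf_nat, of v] by simp
  have q0: "0 \<le> q k" for k using v0 by (simp add: q_def)
  have pq: "(\<lambda>n. p n k) \<longlonglongrightarrow> q k" for k
  proof (rule tendsto_coeff_of_tendsto_pgf[where C = C])
    fix z :: real assume z: "0 \<le> z" "z < 1"
    have "(\<Sum>k. p n k * z ^ k) = (\<integral>\<omega>. z ^ W n \<omega> * V n \<omega> \<partial>M)" for n
      using sums[of "\<lambda>k. z ^ k" 1 n] z by (simp add: sums_iff power_le_one)
    moreover have "(\<Sum>k. q k * z ^ k) = v * exp (- ((1 - z) * t))"
      using sums_mult[OF Poi_pgf_sums[OF t, of z], of v] by (simp add: sums_iff q_def mult.assoc)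
    ultimately show "(\<lambda>n. \<Sum>k. p n k * z ^ k) \<longlonglongrightarrow> (\<Sum>k. q k * z ^ k)"
      using lim[of z] z by simp
  qed (use p0 p1 intV q0 q1 vC in \<open>auto simp: sums_iff\<close>)
  \<comment> \<open>Scheffe's argument: \<open>\<bar>p - q\<bar> = p + q - 2 min p q\<close>, and \<open>min p q\<close> is dominated by \<open>q\<close>.\<close>
  have smin: "summable (\<lambda>k. min (p n k) (q k))" for n
  proof (rule summable_comparison_test'[OF sums_summable[OF q1], of 0])
    fix k show "norm (min (p n k) (q k)) \<le> q k" using p0[of n k] q0[of k] by simp
  qed
  have "((\<lambda>n. \<Sum>k. min (p n k) (q k)) \<longlongrightarrow> (\<Sum>k. min (q k) (q k))) sequentially"
  proof (rule tannerys_theorem[THEN conjunct2, THEN conjunct2])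
    show "((\<lambda>n. min (p n k) (q k)) \<longlongrightarrow> min (q k) (q k)) sequentially" for k
      by (intro tendsto_intros pq)
    show "\<forall>\<^sub>F (k, n) in at_top \<times>\<^sub>F sequentially. norm (min (p n k) (q k)) \<le> q k"
      using p0 q0 by (intro always_eventually) auto
  qed (use q1 in \<open>auto simp: sums_iff\<close>)
  then have lmin: "(\<lambda>n. \<Sum>k. min (p n k) (q k)) \<longlonglongrightarrow> v" using q1 by (simp add: sums_iff)
  have l1: "(\<lambda>k. \<bar>p n k - q k\<bar>) sums ((\<integral>\<omega>. V n \<omega> \<partial>M) + v - 2 * (\<Sum>k. min (p n k) (q k)))" for n
  proof -
    have "(\<lambda>k. p n k + q k - 2 * min (p n k) (q k)) sums ((\<integral>\<omega>. V n \<omega> \<partial>M) + v - 2 * (\<Sum>k. min (p n k) (q k)))"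
      by (intro sums_diff sums_add p1 q1 sums_mult summable_sums smin)
    moreover have "p n k + q k - 2 * min (p n k) (q k) = \<bar>p n k - q k\<bar>" for k by (auto simp: min_def)
    ultimately show ?thesis by simp
  qed
  have l0: "(\<lambda>n. c * ((\<integral>\<omega>. V n \<omega> \<partial>M) + v - 2 * (\<Sum>k. min (p n k) (q k)))) \<longlonglongrightarrow> c * (v + v - 2 * v)"
    by (intro tendsto_intros Vv lmin)
  have "(\<lambda>n. (\<integral>\<omega>. a (W n \<omega>) * V n \<omega> \<partial>M) - v * alpha a t) \<longlonglongrightarrow> 0"
  proof (rule Lim_null_comparison[OF always_eventually])
    show "\<forall>n. norm ((\<integral>\<omega>. a (W n \<omega>) * V n \<omega> \<partial>M) - v * alpha a t) \<le> c * ((\<integral>\<omega>. V n \<omega> \<partial>M) + v - 2 * (\<Sum>k. min (p n k) (q k)))"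
    proof
      fix n
      have s1: "(\<lambda>k. p n k * a k) sums (\<integral>\<omega>. a (W n \<omega>) * V n \<omega> \<partial>M)" by (rule sums[OF a])
      have s2: "(\<lambda>k. q k * a k) sums (v * alpha a t)"
        using sums_mult[OF sums_expectation_nat_pmf[OF a, of "Poi t"], of v] by (simp add: q_def alpha_def mult.assoc)
      have s3: "(\<lambda>k. p n k * a k - q k * a k) sums ((\<integral>\<omega>. a (W n \<omega>) * V n \<omega> \<partial>M) - v * alpha a t)"
        by (rule sums_diff[OF s1 s2])
      have b: "\<bar>p n k * a k - q k * a k\<bar> \<le> c * \<bar>p n k - q k\<bar>" for k
        using mult_right_mono[OF a[of k], of "\<bar>p n k - q k\<bar>"]
        by (metis abs_ge_zero abs_mult left_diff_distrib mult.commute)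
      have s4: "summable (\<lambda>k. \<bar>p n k * a k - q k * a k\<bar>)"
        by (rule summable_comparison_test'[OF sums_summable[OF sums_mult[OF l1, of c]]]) (use b in auto)
      have "\<bar>\<Sum>k. p n k * a k - q k * a k\<bar> \<le> (\<Sum>k. \<bar>p n k * a k - q k * a k\<bar>)"
        by (rule summable_rabs[OF s4])
      also have "\<dots> \<le> (\<Sum>k. c * \<bar>p n k - q k\<bar>)"
        by (intro suminf_le b s4 sums_summable[OF sums_mult[OF l1]])
      also have "\<dots> = c * ((\<integral>\<omega>. V n \<omega> \<partial>M) + v - 2 * (\<Sum>k. min (p n k) (q k)))"
        using sums_mult[OF l1, of c] by (simp add: sums_iff)
      finally show "norm ((\<integral>\<omega>. a (W n \<omega>) * V n \<omega> \<partial>M) - v * alpha a t) \<le> c * ((\<integral>\<omega>. V n \<omega> \<partial>M) + v - 2 * (\<Sum>k. min (p n k) (q k)))"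
        using s3 by (simp add: sums_iff)
    qed
  qed (use l0 in simp)
  then show ?thesis by (simp add: LIM_zero_iff)
qed

text \<open>Replacing the generating-function weights by arbitrary functions one coordinate at a time
  gives the joint law.\<close>

lemma (in prob_space) poisson_limit_of_joint_pgf:
  fixes W :: "nat \<Rightarrow> 'i \<Rightarrow> 'a \<Rightarrow> nat" and a :: "'i \<Rightarrow> nat \<Rightarrow> real"
  assumes I: "finite I"
    and W [measurable]: "\<And>n i. i \<in> I \<Longrightarrow> W n i \<in> measurable M (count_space UNIV)"
    and t: "\<And>i. i \<in> I \<Longrightarrow> 0 \<le> t i"
    and lim: "\<And>z. (\<And>i. i \<in> I \<Longrightarrow> 0 \<le> z i \<and> z i \<le> 1) \<Longrightarrow>
      (\<lambda>n. \<integral>\<omega>. (\<Prod>i\<in>I. z i ^ W n i \<omega>) \<partial>M) \<longlonglongrightarrow> exp (- (\<Sum>i\<in>I. (1 - z i) * t i))"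
    and a: "\<And>i k. i \<in> I \<Longrightarrow> 0 \<le> a i k \<and> a i k \<le> c"
  shows "(\<lambda>n. \<integral>\<omega>. (\<Prod>i\<in>I. a i (W n i \<omega>)) \<partial>M) \<longlonglongrightarrow> (\<Prod>i\<in>I. alpha (a i) (t i))"
proof -
  have "(\<lambda>n. \<integral>\<omega>. (\<Prod>i\<in>J. a i (W n i \<omega>)) * (\<Prod>i\<in>I-J. z i ^ W n i \<omega>) \<partial>M)
      \<longlonglongrightarrow> (\<Prod>i\<in>J. alpha (a i) (t i)) * exp (- (\<Sum>i\<in>I-J. (1 - z i) * t i))"
    if "J \<subseteq> I" "\<And>i. i \<in> I \<Longrightarrow> 0 \<le> z i \<and> z i \<le> 1" for J z
    using finite_subset[OF that(1) I] that
  proof (induction J arbitrary: z rule: finite_induct)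
    case empty
    then show ?case using lim[of z] by simp
  next
    case (insert j J)
    define V where "V n \<omega> = (\<Prod>i\<in>J. a i (W n i \<omega>)) * (\<Prod>i\<in>I-insert j J. z i ^ W n i \<omega>)" for n \<omega>
    define v where "v = (\<Prod>i\<in>J. alpha (a i) (t i)) * exp (- (\<Sum>i\<in>I-insert j J. (1 - z i) * t i))"
    have j: "j \<in> I" and JI: "J \<subseteq> I" using insert.prems by auto
    have [measurable]: "V n \<in> borel_measurable M" for n
      unfolding V_def
    proof (intro borel_measurable_times borel_measurable_prod)
      fix i assume "i \<in> J"
      then have [measurable]: "W n i \<in> measurable M (count_space UNIV)" using JI by (intro W) auto
      show "(\<lambda>\<omega>. a i (W n i \<omega>)) \<in> borel_measurable M" by measurable
    next
      fix i assume "i \<in> I - insert j J"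
      then have [measurable]: "W n i \<in> measurable M (count_space UNIV)" by (intro W) auto
      show "(\<lambda>\<omega>. z i ^ W n i \<omega>) \<in> borel_measurable M" by measurable
    qed
    have Dj: "I - J = insert j (I - insert j J)" using j insert.hyps by auto
    have "(\<lambda>n. \<integral>\<omega>. a j (W n j \<omega>) * V n \<omega> \<partial>M) \<longlonglongrightarrow> v * alpha (a j) (t j)"
    proof (rule poisson_limit_of_weighted_pgf[where C = "\<Prod>i\<in>J. c" and c = c])
      show "0 \<le> V n \<omega> \<and> V n \<omega> \<le> (\<Prod>i\<in>J. c)" for n \<omega>
      proof
        show "0 \<le> V n \<omega>" unfolding V_def using a insert.prems
          by (intro mult_nonneg_nonneg prod_nonneg zero_le_power) auto
        have "V n \<omega> \<le> (\<Prod>i\<in>J. c) * 1" unfolding V_def using a insert.prems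
          by (intro mult_mono prod_mono prod_le_1 prod_nonneg) (auto intro: power_le_one order_trans)
        then show "V n \<omega> \<le> (\<Prod>i\<in>J. c)" by simp
      qed
      show "\<bar>a j k\<bar> \<le> c" for k using a[OF j, of k] by simp
      fix w :: real assume w: "0 \<le> w" "w \<le> 1"
      have "(\<lambda>n. \<integral>\<omega>. (\<Prod>i\<in>J. a i (W n i \<omega>)) * (\<Prod>i\<in>I-J. (z(j := w)) i ^ W n i \<omega>) \<partial>M)
        \<longlonglongrightarrow> (\<Prod>i\<in>J. alpha (a i) (t i)) * exp (- (\<Sum>i\<in>I-J. (1 - (z(j := w)) i) * t i))"
        using insert.prems w by (intro insert.IH) auto
      also have "(\<Prod>i\<in>J. alpha (a i) (t i)) * exp (- (\<Sum>i\<in>I-J. (1 - (z(j := w)) i) * t i)) = v * exp (- ((1 - w) * t j))"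
        unfolding Dj v_def using I by (simp add: mult_exp_exp mult_ac algebra_simps cong: sum.cong_simp)
      moreover have "(\<Prod>i\<in>I-J. (z(j := w)) i ^ W n i \<omega>) = w ^ W n j \<omega> * (\<Prod>i\<in>I-insert j J. z i ^ W n i \<omega>)" for n \<omega>
        unfolding Dj using I by (simp cong: prod.cong_simp)
      ultimately show "(\<lambda>n. \<integral>\<omega>. w ^ W n j \<omega> * V n \<omega> \<partial>M) \<longlonglongrightarrow> v * exp (- ((1 - w) * t j))"
        by (simp add: V_def mult_ac)
    qed (use W j t in auto)
    then show ?case using insert.hyps by (simp add: V_def v_def mult_ac)
  qed
  from this[of I "\<lambda>_. 1"] show ?thesis by simp
qed

section \<open>Weak convergence from convergence of counts\<close>

subsection \<open>Cells generated by a countable base\<close>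

lemma lf_cnt_Un:
  assumes "\<phi> \<in> lf_counting" "A \<in> sets borel" "bounded A" "B \<in> sets borel" "bounded B" "A \<inter> B = {}"
  shows "cnt \<phi> (A \<union> B) = cnt \<phi> A + cnt \<phi> B"
proof -
  have "emeasure \<phi> (A \<union> B) = emeasure \<phi> A + emeasure \<phi> B"
    using assms by (intro plus_emeasure[symmetric]) (auto simp: lf_sets)
  then have "(of_nat (cnt \<phi> (A \<union> B)) :: ennreal) = of_nat (cnt \<phi> A + cnt \<phi> B)"
    using assms by (simp add: emeasure_lf_cnt)
  then show ?thesis by (simp only: of_nat_eq_iff)
qed

text \<open>The members are bounded so that the cells below are bounded and have finite counts.\<close>

definition bounded_base :: "(nat \<Rightarrow> 'a::euclidean_space set) \<Rightarrow> bool" where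
  "bounded_base B \<longleftrightarrow> (\<forall>i. open (B i) \<and> bounded (B i)) \<and>
     (\<forall>x U. open U \<longrightarrow> x \<in> U \<longrightarrow> (\<exists>i. x \<in> B i \<and> B i \<subseteq> U))"

lemma ex_bounded_base: "\<exists>B :: nat \<Rightarrow> 'a::euclidean_space set. bounded_base B"
proof -
  obtain \<B> :: "'a set set" where \<B>: "countable \<B>" "topological_basis \<B>"
    using ex_countable_basis by blast
  define \<C> where "\<C> = {b \<in> \<B>. bounded b}"
  have base: "\<exists>b\<in>\<C>. x \<in> b \<and> b \<subseteq> U" if "open U" "x \<in> U" for x and U :: "'a set"
  proof -
    have "open (U \<inter> ball x 1)" "x \<in> U \<inter> ball x 1" using that by auto
    then obtain b where "b \<in> \<B>" "x \<in> b" "b \<subseteq> U \<inter> ball x 1"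
      using topological_basisE[OF \<B>(2)] by metis
    then show ?thesis unfolding \<C>_def by (auto intro: bounded_subset[OF bounded_ball])
  qed
  have ne: "\<C> \<noteq> {}" using base[of UNIV 0] by auto
  have cnt: "countable \<C>" using \<B>(1) by (simp add: \<C>_def)
  have r: "range (from_nat_into \<C>) = \<C>" by (rule range_from_nat_into[OF ne cnt])
  show ?thesis
  proof (rule exI[of _ "from_nat_into \<C>"], unfold bounded_base_def, intro conjI allI impI)
    fix i have "from_nat_into \<C> i \<in> \<C>" using from_nat_into[OF ne] .
    then show "open (from_nat_into \<C> i)" "bounded (from_nat_into \<C> i)"
      using \<B>(2) by (auto simp: \<C>_def dest: topological_basis_open)
  next
    fix x :: 'a and U :: "'a set" assume "open U" "x \<in> U"
    then show "\<exists>i. x \<in> from_nat_into \<C> i \<and> from_nat_into \<C> i \<subseteq> U" using base[of U x] r by (metis rangeE)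
  qed
qed

text \<open>The non-empty index sets \<open>J\<close> below \<open>m\<close> give the atoms of the set algebra generated by the
  first \<open>m\<close> members of the base, apart from the unbounded one.\<close>

definition cell :: "(nat \<Rightarrow> 'a set) \<Rightarrow> nat \<Rightarrow> nat set \<Rightarrow> 'a set" where
  "cell B m J = {x. \<forall>i<m. x \<in> B i \<longleftrightarrow> i \<in> J}"

definition cell_indices :: "nat \<Rightarrow> nat set set" where
  "cell_indices m = Pow {..<m} - {{}}"

definition same_cell_counts ::
  "(nat \<Rightarrow> 'a::euclidean_space set) \<Rightarrow> nat \<Rightarrow> 'a measure \<Rightarrow> 'a measure \<Rightarrow> bool" where
  "same_cell_counts B m \<phi> \<psi> \<longleftrightarrow> (\<forall>J\<in>cell_indices m. cnt \<phi> (cell B m J) = cnt \<psi> (cell B m J))"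

lemma finite_cell_indices: "finite (cell_indices m)"
  by (simp add: cell_indices_def)

lemma mem_cell_iff: "J \<subseteq> {..<m} \<Longrightarrow> x \<in> cell B m J \<longleftrightarrow> J = {i. i < m \<and> x \<in> B i}"
  by (auto simp: cell_def)

lemma disjoint_cells: "disjoint_family_on (cell B m) (cell_indices m)"
  unfolding disjoint_family_on_def
proof (intro ballI impI, rule ccontr)
  fix J J' assume J: "J \<in> cell_indices m" "J' \<in> cell_indices m" "J \<noteq> J'"
    and "cell B m J \<inter> cell B m J' \<noteq> {}"
  then obtain x where "x \<in> cell B m J" "x \<in> cell B m J'" by auto
  with J show False using mem_cell_iff[of J m x B] mem_cell_iff[of J' m x B]
    by (auto simp: cell_indices_def)
qed

lemma cell_borel: "bounded_base B \<Longrightarrow> cell B m J \<in> sets borel"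
proof -
  assume B: "bounded_base B"
  have "cell B m J = (\<Inter>i\<in>{..<m}. if i \<in> J then B i else - B i)"
    by (auto simp: cell_def split: if_splits)
  moreover have "(if i \<in> J then B i else - B i) \<in> sets borel" for i
    using B by (auto simp: bounded_base_def)
  then have "(\<Inter>i\<in>{..<m}. if i \<in> J then B i else - B i) \<in> sets borel"
    by (cases "m = 0") (simp, intro sets.finite_INT, auto)
  ultimately show ?thesis by simp
qed

lemma cell_bounded: "bounded_base B \<Longrightarrow> J \<in> cell_indices m \<Longrightarrow> bounded (cell B m J)"
proof -
  assume B: "bounded_base B" and "J \<in> cell_indices m"
  then obtain i where "i \<in> J" "i < m" by (auto simp: cell_indices_def)
  then have "cell B m J \<subseteq> B i" by (auto simp: cell_def)
  moreover have "bounded (B i)" using B by (simp add: bounded_base_def)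
  ultimately show ?thesis using bounded_subset by blast
qed

lemma same_cell_counts_Suc:
  assumes B: "bounded_base B" and lf: "\<phi> \<in> lf_counting" "\<psi> \<in> lf_counting"
    and same: "same_cell_counts B (Suc m) \<phi> \<psi>"
  shows "same_cell_counts B m \<phi> \<psi>"
  unfolding same_cell_counts_def
proof
  fix J assume J: "J \<in> cell_indices m"
  have J': "J \<in> cell_indices (Suc m)" "insert m J \<in> cell_indices (Suc m)" "m \<notin> J"
    using J by (auto simp: cell_indices_def)
  have "cell B m J = cell B (Suc m) J \<union> cell B (Suc m) (insert m J)"
    using J'(3) by (auto simp: cell_def less_Suc_eq)
  moreover have "cell B (Suc m) J \<inter> cell B (Suc m) (insert m J) = {}"
    using J'(3) by (auto simp: cell_def)
  ultimately have "cnt \<eta> (cell B m J) = cnt \<eta> (cell B (Suc m) J) + cnt \<eta> (cell B (Suc m) (insert m J))"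
    if "\<eta> \<in> lf_counting" for \<eta>
    using that J' by (simp add: lf_cnt_Un cell_borel[OF B] cell_bounded[OF B])
  then show "cnt \<phi> (cell B m J) = cnt \<psi> (cell B m J)"
    using lf same J' by (simp add: same_cell_counts_def)
qed

lemma same_cell_counts_mono:
  assumes B: "bounded_base B" and lf: "\<phi> \<in> lf_counting" "\<psi> \<in> lf_counting"
    and "m \<le> n" and same: "same_cell_counts B n \<phi> \<psi>"
  shows "same_cell_counts B m \<phi> \<psi>"
  using \<open>m \<le> n\<close> same
  by (induction rule: inc_induct) (auto intro: same_cell_counts_Suc[OF B lf])

text \<open>On a fine enough level the test function is nearly constant on each cell that meets its
  support, so the cell counts determine its integral up to an error that is bounded by the
  oscillation times the number of points of \<open>\<phi>\<close> in a fixed ball.\<close>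

lemma integral_determined_by_cell_counts:
  fixes f :: "'a::euclidean_space \<Rightarrow> real"
  assumes B: "bounded_base B" and lf: "\<phi> \<in> lf_counting"
    and f: "continuous_on UNIV f" "compact (closure {x. f x \<noteq> 0})"
    and U: "open U" "(\<integral>x. f x \<partial>\<phi>) \<in> U"
  shows "\<exists>m. \<forall>\<psi>\<in>lf_counting. same_cell_counts B m \<phi> \<psi> \<longrightarrow> (\<integral>x. f x \<partial>\<psi>) \<in> U"
proof -
  obtain e where e: "0 < e" "ball (\<integral>x. f x \<partial>\<phi>) e \<subseteq> U" using U openE by blast
  define K where "K = closure {x. f x \<noteq> 0}"
  have K: "compact K" using f by (simp add: K_def)
  have fK: "f x = 0" if "x \<notin> K" for x using that closure_subset[of "{x. f x \<noteq> 0}"] by (auto simp: K_def)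
  obtain R where R: "K \<subseteq> ball 0 R" using bounded_subset_ballD[OF compact_imp_bounded[OF K], of 0] by auto
  define N where "N = cnt \<phi> (ball 0 R)"
  \<comment> \<open>The oscillation \<open>d\<close> on the cells enters once for each of the two configurations, times at most \<open>N\<close>
    points.\<close>
  define d where "d = e / (2 * (real N + 1))"
  have d: "0 < d" using e by (simp add: d_def)
  have "\<exists>i. x \<in> B i \<and> B i \<subseteq> ball 0 R \<inter> {y. \<bar>f y - f x\<bar> < d / 2}" if "x \<in> K" for x
  proof -
    have "open {y. \<bar>f y - f x\<bar> < d / 2}"
      using f(1) by (intro open_Collect_less continuous_intros)
    then have "open (ball 0 R \<inter> {y. \<bar>f y - f x\<bar> < d / 2})" by (intro open_Int) auto
    moreover have "x \<in> ball 0 R \<inter> {y. \<bar>f y - f x\<bar> < d / 2}" using that R d by auto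
    ultimately show ?thesis using B unfolding bounded_base_def by blast
  qed
  then have "\<forall>x\<in>K. \<exists>i. x \<in> B i \<and> B i \<subseteq> ball 0 R \<inter> {y. \<bar>f y - f x\<bar> < d / 2}" by blast
  from bchoice[OF this] obtain i
    where i': "\<forall>x\<in>K. x \<in> B (i x) \<and> B (i x) \<subseteq> ball 0 R \<inter> {y. \<bar>f y - f x\<bar> < d / 2}" by blast
  have i: "x \<in> B (i x)" "y \<in> B (i x) \<Longrightarrow> y \<in> ball 0 R \<and> \<bar>f y - f x\<bar> < d / 2" if "x \<in> K" for x y
    using bspec[OF i' that] by blast+
  obtain F where F: "F \<subseteq> K" "finite F" "K \<subseteq> (\<Union>x\<in>F. B (i x))"
    by (rule compactE_image[OF K, of K "\<lambda>x. B (i x)"]) (use B i(1) in \<open>auto simp: bounded_base_def\<close>)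
  obtain m where m: "i ` F \<subseteq> {..<m}" using finite_nat_bounded[of "i ` F"] F(2) by blast
  define \<J> where "\<J> = {J \<in> Pow {..<m}. cell B m J \<inter> K \<noteq> {}}"
  have fJ: "finite \<J>" by (simp add: \<J>_def)
  have "\<exists>p. p \<in> cell B m J \<inter> K" if "J \<in> \<J>" for J using that by (auto simp: \<J>_def)
  then obtain p where p: "\<And>J. J \<in> \<J> \<Longrightarrow> p J \<in> cell B m J \<inter> K" by metis
  have cellJ: "J \<in> cell_indices m \<and> (\<forall>y\<in>cell B m J. y \<in> ball 0 R \<and> \<bar>f y - f (p J)\<bar> < d)" if J: "J \<in> \<J>" for J
  proof -
    obtain x where x: "x \<in> F" "p J \<in> B (i x)" using p[OF J] F by auto
    have im: "i x < m" using x m by auto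
    have xK: "x \<in> K" using x F by auto
    have iJ: "i x \<in> J" using p[OF J] x im by (auto simp: cell_def)
    have "y \<in> ball 0 R \<and> \<bar>f y - f (p J)\<bar> < d" if "y \<in> cell B m J" for y
    proof -
      have "y \<in> B (i x)" using that im iJ by (auto simp: cell_def)
      from i(2)[OF xK this] i(2)[OF xK x(2)] show ?thesis by (auto simp: abs_if split: if_splits)
    qed
    then show ?thesis using iJ J by (auto simp: cell_indices_def \<J>_def)
  qed
  define s where "s c x = (\<Sum>J\<in>\<J>. c J * indicator (cell B m J) x)" for c :: "nat set \<Rightarrow> real" and x
  have s_eq: "s c x = (if {i. i < m \<and> x \<in> B i} \<in> \<J> then c {i. i < m \<and> x \<in> B i} else 0)" for c x
  proof -
    have "s c x = (\<Sum>J\<in>\<J>. if J = {i. i < m \<and> x \<in> B i} then c J else 0)"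
      unfolding s_def by (intro sum.cong) (auto simp: indicator_def \<J>_def mem_cell_iff)
    then show ?thesis using fJ by simp
  qed
  have int_s: "integrable \<eta> (s c)" "(\<integral>x. s c x \<partial>\<eta>) = (\<Sum>J\<in>\<J>. c J * real (cnt \<eta> (cell B m J)))"
    if lfc: "\<eta> \<in> lf_counting" for \<eta> c
  proof -
    have i1: "integrable \<eta> (indicator (cell B m J) :: 'a \<Rightarrow> real)" if "J \<in> \<J>" for J
      using cellJ[OF that] cell_borel[OF B] cell_bounded[OF B] lf_sets[OF lfc]
      by (intro integrable_real_indicator) (auto intro!: emeasure_lf_finite[OF lfc, simplified])
    then show "integrable \<eta> (s c)" unfolding s_def by (intro Bochner_Integration.integrable_sum integrable_mult_right) auto
    have "(\<integral>x. s c x \<partial>\<eta>) = (\<Sum>J\<in>\<J>. c J * measure \<eta> (cell B m J))"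
      unfolding s_def using i1 lf_space[OF lfc] by (subst Bochner_Integration.integral_sum) auto
    also have "\<dots> = (\<Sum>J\<in>\<J>. c J * real (cnt \<eta> (cell B m J)))"
      using cellJ cell_borel[OF B] cell_bounded[OF B] by (intro sum.cong refl) (auto simp: measure_lf_cnt[OF lfc])
    finally show "(\<integral>x. s c x \<partial>\<eta>) = (\<Sum>J\<in>\<J>. c J * real (cnt \<eta> (cell B m J)))" .
  qed
  define g where "g = s (\<lambda>J. f (p J))"
  define h where "h = s (\<lambda>J. 1)"
  have fg: "\<bar>f x - g x\<bar> \<le> d * h x" for x
  proof (cases "{i. i < m \<and> x \<in> B i} \<in> \<J>")
    case True
    have "x \<in> cell B m {i. i < m \<and> x \<in> B i}" by (auto simp: cell_def)
    then show ?thesis using cellJ[OF True] True by (auto simp: g_def h_def s_eq)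
  next
    case False
    have "x \<in> cell B m {i. i < m \<and> x \<in> B i}" by (auto simp: cell_def)
    then have "x \<notin> K" using False by (auto simp: \<J>_def)
    then show ?thesis using False by (simp add: g_def h_def s_eq fK)
  qed
  have close: "\<bar>(\<integral>x. f x \<partial>\<eta>) - (\<integral>x. g x \<partial>\<eta>)\<bar> \<le> d * (\<integral>x. h x \<partial>\<eta>)" if lfc: "\<eta> \<in> lf_counting" for \<eta>
  proof -
    have fm: "f \<in> borel_measurable \<eta>" using borel_measurable_continuous_onI[OF f(1)] lf_sets[OF lfc]
      by (simp cong: measurable_cong_sets)
    have ig: "integrable \<eta> g" "integrable \<eta> h" unfolding g_def h_def by (auto intro: int_s[OF lfc])
    have ifg: "integrable \<eta> (\<lambda>x. f x - g x)"
      by (rule Bochner_Integration.integrable_bound[OF integrable_mult_right[OF ig(2), of d]])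
        (use fm ig fg in \<open>auto intro!: borel_measurable_diff order_trans[OF fg]\<close>)
    have if': "integrable \<eta> f" using Bochner_Integration.integrable_add[OF ifg ig(1)] by simp
    have "\<bar>(\<integral>x. f x \<partial>\<eta>) - (\<integral>x. g x \<partial>\<eta>)\<bar> = \<bar>\<integral>x. f x - g x \<partial>\<eta>\<bar>" using if' ig by simp
    also have "\<dots> \<le> (\<integral>x. \<bar>f x - g x\<bar> \<partial>\<eta>)" by (rule integral_abs_bound)
    also have "\<dots> \<le> (\<integral>x. d * h x \<partial>\<eta>)" using ifg ig fg by (intro integral_mono) auto
    finally show ?thesis by simp
  qed
  have hN: "(\<integral>x. h x \<partial>\<phi>) \<le> real N"
  proof -
    have "(\<integral>x. h x \<partial>\<phi>) \<le> (\<integral>x. indicator (ball 0 R) x \<partial>\<phi>)"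
    proof (rule integral_mono)
      show "integrable \<phi> h" unfolding h_def by (rule int_s[OF lf])
      show "integrable \<phi> (indicator (ball 0 R) :: 'a \<Rightarrow> real)"
        using lf_sets[OF lf] emeasure_lf_finite[OF lf, of "ball 0 R"] by (intro integrable_real_indicator) auto
      fix x
      have xc: "x \<in> cell B m {i. i < m \<and> x \<in> B i}" by (auto simp: cell_def)
      have "x \<in> ball 0 R" if "{i. i < m \<and> x \<in> B i} \<in> \<J>"
        using bspec[OF conjunct2[OF cellJ[OF that]] xc] ..
      then show "h x \<le> indicator (ball 0 R) x"
        by (auto simp: h_def s_eq)
    qed
    also have "\<dots> = real N" using lf_space[OF lf] by (simp add: N_def measure_lf_cnt[OF lf])
    finally show ?thesis .
  qed
  show ?thesis
  proof (intro exI[of _ m] ballI impI)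
    fix \<psi> assume lf': "\<psi> \<in> lf_counting" and same: "same_cell_counts B m \<phi> \<psi>"
    have eq: "(\<integral>x. s c x \<partial>\<psi>) = (\<integral>x. s c x \<partial>\<phi>)" for c
      using same cellJ unfolding int_s(2)[OF lf] int_s(2)[OF lf'] same_cell_counts_def
      by (intro sum.cong) auto
    have "\<bar>(\<integral>x. f x \<partial>\<psi>) - (\<integral>x. f x \<partial>\<phi>)\<bar> \<le> 2 * (d * (\<integral>x. h x \<partial>\<phi>))"
      using close[OF lf] close[OF lf'] unfolding g_def h_def eq by linarith
    also have "\<dots> \<le> 2 * (d * real N)" using d hN by (intro mult_left_mono) auto
    also have "\<dots> < e" using e by (simp add: d_def field_simps)
    finally show "(\<integral>x. f x \<partial>\<psi>) \<in> U" using e by (auto simp: dist_real_def subset_eq abs_minus_commute)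
  qed
qed

lemma topspace_vague: "topspace vague_topology = (lf_counting :: 'a::euclidean_space measure set)"
proof -
  have "\<exists>f U. {\<phi> \<in> lf_counting. (\<integral>x. f x \<partial>\<phi>) \<in> U} = (lf_counting :: 'a measure set)
    \<and> continuous_on UNIV f \<and> compact (closure {x. f x \<noteq> 0}) \<and> open (U :: real set)"
    by (rule exI[of _ "\<lambda>_. 0"], rule exI[of _ UNIV]) auto
  then show ?thesis unfolding vague_topology_def topology_generated_by_topspace by blast
qed

text \<open>The sub-basic open sets are covered by the preceding lemma. For a finite intersection the finer of
  the two levels works, because finer cell counts determine coarser ones.\<close>

lemma vague_open_determined_by_cell_counts:
  assumes B: "bounded_base B" and G: "openin vague_topology G" and \<phi>: "\<phi> \<in> G"
  shows "\<exists>m. \<forall>\<psi>\<in>lf_counting. same_cell_counts B m \<phi> \<psi> \<longrightarrow> \<psi> \<in> G"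
proof -
  have lf: "\<phi> \<in> lf_counting" using openin_subset[OF G] \<phi> by (auto simp: topspace_vague)
  have "generate_topology_on
     {{\<phi> \<in> lf_counting. (\<integral>x. f x \<partial>\<phi>) \<in> U} | (f :: 'a \<Rightarrow> real) U.
        continuous_on UNIV f \<and> compact (closure {x. f x \<noteq> 0}) \<and> open U} G"
    using G unfolding vague_topology_def openin_topology_generated_by_iff .
  then show ?thesis using \<phi>
  proof (induction rule: generate_topology_on.induct)
    case (Int a b)
    obtain m1 m2 where "\<forall>\<psi>\<in>lf_counting. same_cell_counts B m1 \<phi> \<psi> \<longrightarrow> \<psi> \<in> a"
      "\<forall>\<psi>\<in>lf_counting. same_cell_counts B m2 \<phi> \<psi> \<longrightarrow> \<psi> \<in> b" using Int by blast
    then show ?case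
      by (meson IntI same_cell_counts_mono[OF B lf] max.cobounded1 max.cobounded2)
  next
    case (Basis s)
    then obtain f :: "'a \<Rightarrow> real" and U where "s = {\<phi> \<in> lf_counting. (\<integral>x. f x \<partial>\<phi>) \<in> U}"
      "continuous_on UNIV f" "compact (closure {x. f x \<noteq> 0})" "open U" by auto
    then show ?case using integral_determined_by_cell_counts[OF B lf, of f U] Basis by auto
  next
    case (UN K)
    then show ?case by (meson UnionE UnionI)
  qed auto
qed

subsection \<open>Open sets and the portmanteau argument\<close>

definition cell_counts :: "(nat \<Rightarrow> 'a::euclidean_space set) \<Rightarrow> nat \<Rightarrow> 'a measure \<Rightarrow> nat set \<Rightarrow> nat" where
  "cell_counts B m \<phi> = (\<lambda>J\<in>cell_indices m. cnt \<phi> (cell B m J))"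

lemma cell_counts_eq_iff: "cell_counts B m \<phi> = cell_counts B m \<psi> \<longleftrightarrow> same_cell_counts B m \<phi> \<psi>"
  unfolding cell_counts_def same_cell_counts_def by (auto simp: fun_eq_iff restrict_def)

lemma countable_cell_counts: "countable (range (cell_counts B m))"
proof (rule countable_subset)
  show "range (cell_counts B m) \<subseteq> (\<Pi>\<^sub>E J\<in>cell_indices m. UNIV)"
    by (auto simp: cell_counts_def)
  show "countable (\<Pi>\<^sub>E J\<in>cell_indices m. (UNIV :: nat set))"
    by (intro countable_PiE finite_cell_indices) auto
qed

lemma sets_cell_counts:
  assumes B: "bounded_base B"
  shows "{\<phi> \<in> lf_counting. cell_counts B m \<phi> = v} \<in> sets pp_space"
proof (cases "v \<in> extensional (cell_indices m)")
  case True
  have eq: "{\<phi> \<in> lf_counting. cell_counts B m \<phi> = v}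
    = {\<phi> \<in> space pp_space. \<forall>J\<in>cell_indices m. cnt \<phi> (cell B m J) = v J}"
    using True by (auto simp: cell_counts_def fun_eq_iff extensional_def restrict_def)
  have [measurable]: "finite (cell_indices m)" by (rule finite_cell_indices)
  have "Measurable.pred pp_space (\<lambda>\<phi>. cnt \<phi> (cell B m J) = v J)" for J
    using measurable_compose[OF measurable_cnt_pp_space[OF cell_borel[OF B]], of "\<lambda>k. k = v J" "count_space UNIV"]
    by simp
  then show ?thesis unfolding eq
    by (intro sets.sets_Collect_finite_All finite_cell_indices) (simp add: pred_def)
next
  case False
  then have "{\<phi> \<in> lf_counting. cell_counts B m \<phi> = v} = {}"
    by (auto simp: cell_counts_def)
  then show ?thesis by (metis sets.empty_sets)
qed

text \<open>An open set is the increasing union of the sets that are determined by cell counts, each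
  of which is a countable union of cylinder sets. Hence open sets are measurable, and since finite
  unions of cylinder sets have convergent probabilities, these bound the probabilities of an open
  set asymptotically from below.\<close>

definition level_interior :: "(nat \<Rightarrow> 'a::euclidean_space set) \<Rightarrow> 'a measure set \<Rightarrow> nat \<Rightarrow> 'a measure set" where
  "level_interior B G m = {\<phi> \<in> lf_counting. \<forall>\<psi>\<in>lf_counting. same_cell_counts B m \<phi> \<psi> \<longrightarrow> \<psi> \<in> G}"

lemma level_interior_cylinders:
  "level_interior B G m = (\<Union>v\<in>cell_counts B m ` level_interior B G m. {\<phi> \<in> lf_counting. cell_counts B m \<phi> = v})"
proof (intro equalityI subsetI)
  fix \<psi> assume "\<psi> \<in> (\<Union>v\<in>cell_counts B m ` level_interior B G m. {\<phi> \<in> lf_counting. cell_counts B m \<phi> = v})"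
  then obtain \<phi> where "\<phi> \<in> level_interior B G m" "\<psi> \<in> lf_counting" "cell_counts B m \<psi> = cell_counts B m \<phi>" by auto
  then show "\<psi> \<in> level_interior B G m"
    unfolding level_interior_def cell_counts_eq_iff same_cell_counts_def by simp
qed (auto simp: level_interior_def)

lemma sets_level_interior:
  assumes B: "bounded_base B"
  shows "level_interior B G m \<in> sets pp_space"
  by (subst level_interior_cylinders, intro sets.countable_UN'' countable_subset[OF _ countable_cell_counts])
    (auto intro!: sets_cell_counts[OF B])

lemma level_interior_Union:
  assumes B: "bounded_base B" and G: "openin vague_topology G"
  shows "(\<Union>m. level_interior B G m) = G"
proof (intro equalityI subsetI)
  fix \<phi> assume "\<phi> \<in> (\<Union>m. level_interior B G m)"
  then obtain m where "\<phi> \<in> level_interior B G m" by auto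
  then show "\<phi> \<in> G" unfolding level_interior_def by (auto simp: same_cell_counts_def)
next
  fix \<phi> assume \<phi>: "\<phi> \<in> G"
  then have "\<phi> \<in> lf_counting" using openin_subset[OF G] by (auto simp: topspace_vague)
  then show "\<phi> \<in> (\<Union>m. level_interior B G m)"
    using vague_open_determined_by_cell_counts[OF B G \<phi>] by (auto simp: level_interior_def)
qed

lemma level_interior_incseq: "bounded_base B \<Longrightarrow> incseq (level_interior B G)"
  unfolding incseq_def level_interior_def using same_cell_counts_mono by blast

lemma vague_open_measurable:
  assumes "openin vague_topology (G :: 'a::euclidean_space measure set)"
  shows "G \<in> sets pp_space"
proof -
  obtain B :: "nat \<Rightarrow> 'a set" where B: "bounded_base B" using ex_bounded_base by blast
  show ?thesis
    by (subst level_interior_Union[OF B assms, symmetric]) (auto intro: sets_level_interior[OF B])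
qed

text \<open>One half of the portmanteau theorem. Finitely many cylinder sets inside \<open>G\<close> already carry more
  than \<open>c\<close> of the mass under \<open>Q\<close>, and their probabilities converge.\<close>

lemma vague_open_liminf:
  fixes P :: "nat \<Rightarrow> 'a::euclidean_space measure measure"
  assumes P: "\<And>n. prob_space (P n)" "\<And>n. sets (P n) = sets pp_space"
    and Q: "prob_space Q" "sets Q = sets pp_space"
    and lim: "\<And>(I :: nat set set) C v. finite I \<Longrightarrow> disjoint_family_on C I \<Longrightarrow>
      (\<And>i. i \<in> I \<Longrightarrow> C i \<in> sets borel \<and> bounded (C i)) \<Longrightarrow>
      (\<lambda>n. measure (P n) {\<phi> \<in> lf_counting. \<forall>i\<in>I. cnt \<phi> (C i) = v i})
        \<longlonglongrightarrow> measure Q {\<phi> \<in> lf_counting. \<forall>i\<in>I. cnt \<phi> (C i) = v i}"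
    and G: "openin vague_topology G" and c: "c < measure Q G"
  shows "eventually (\<lambda>n. c < measure (P n) G) sequentially"
proof -
  obtain B :: "nat \<Rightarrow> 'a set" where B: "bounded_base B" using ex_bounded_base by blast
  interpret Q: prob_space Q by fact
  have "(\<lambda>m. measure Q (level_interior B G m)) \<longlonglongrightarrow> measure Q (\<Union>m. level_interior B G m)"
    by (rule Q.finite_Lim_measure_incseq[OF _ level_interior_incseq[OF B]])
      (auto simp: Q sets_level_interior[OF B])
  then have "(\<lambda>m. measure Q (level_interior B G m)) \<longlonglongrightarrow> measure Q G"
    by (simp add: level_interior_Union[OF B G])
  from order_tendstoD(1)[OF this c] obtain m where m: "c < measure Q (level_interior B G m)"
    by (auto simp: eventually_sequentially)
  define A where "A = cell_counts B m ` level_interior B G m"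
  define E where "E v = {\<phi> \<in> lf_counting. cell_counts B m \<phi> = v}" for v
  have E: "E v \<in> sets pp_space" for v unfolding E_def by (rule sets_cell_counts[OF B])
  have AE: "level_interior B G m = (\<Union>v\<in>A. E v)"
    unfolding A_def E_def by (rule level_interior_cylinders)
  have "\<exists>F. finite F \<and> F \<subseteq> A \<and> c < measure Q (\<Union>v\<in>F. E v)"
  proof (cases "A = {}")
    case True
    then show ?thesis using m AE by (intro exI[of _ "{}"]) auto
  next
    case False
    have cA: "countable A" unfolding A_def by (rule countable_subset[OF _ countable_cell_counts]) auto
    define e where "e = from_nat_into A"
    have e: "range e = A" unfolding e_def by (rule range_from_nat_into[OF False cA])
    have "(\<lambda>K. measure Q (\<Union>v\<in>e ` {..<K}. E v)) \<longlonglongrightarrow> measure Q (\<Union>K. \<Union>v\<in>e ` {..<K}. E v)"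
    proof (rule Q.finite_Lim_measure_incseq)
      show "incseq (\<lambda>K. \<Union>v\<in>e ` {..<K}. E v)"
        by (intro incseq_SucI UN_mono image_mono) auto
      show "range (\<lambda>K. \<Union>v\<in>e ` {..<K}. E v) \<subseteq> sets Q" using E by (auto simp: Q)
    qed
    also have "(\<Union>K. \<Union>v\<in>e ` {..<K}. E v) = level_interior B G m"
      unfolding AE e[symmetric] by auto
    finally have "(\<lambda>K. measure Q (\<Union>v\<in>e ` {..<K}. E v)) \<longlonglongrightarrow> measure Q (level_interior B G m)" .
    from order_tendstoD(1)[OF this m] obtain K where "c < measure Q (\<Union>v\<in>e ` {..<K}. E v)"
      by (auto simp: eventually_sequentially)
    then show ?thesis using e by (intro exI[of _ "e ` {..<K}"]) auto
  qed
  then obtain F where F: "finite F" "F \<subseteq> A" "c < measure Q (\<Union>v\<in>F. E v)" by blast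
  have sumE: "measure R (\<Union>v\<in>F. E v) = (\<Sum>v\<in>F. measure R (E v))" if "prob_space R" "sets R = sets pp_space" for R
  proof -
    interpret R: prob_space R by fact
    show ?thesis
      by (rule R.finite_measure_finite_Union) (use F E that in \<open>auto simp: disjoint_family_on_def E_def\<close>)
  qed
  have "(\<lambda>n. measure (P n) (E v)) \<longlonglongrightarrow> measure Q (E v)" if "v \<in> F" for v
  proof -
    have ext: "v \<in> extensional (cell_indices m)" using that F by (auto simp: A_def cell_counts_def)
    have eq: "E v = {\<phi> \<in> lf_counting. \<forall>J\<in>cell_indices m. cnt \<phi> (cell B m J) = v J}"
      unfolding E_def using ext by (auto simp: cell_counts_def fun_eq_iff extensional_def restrict_def)
    show ?thesis unfolding eq
      by (rule lim[OF finite_cell_indices disjoint_cells]) (auto simp: cell_borel[OF B] cell_bounded[OF B])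
  qed
  then have "(\<lambda>n. measure (P n) (\<Union>v\<in>F. E v)) \<longlonglongrightarrow> measure Q (\<Union>v\<in>F. E v)"
    unfolding sumE[OF P] sumE[OF Q] by (intro tendsto_sum)
  from order_tendstoD(1)[OF this F(3)] show ?thesis
  proof eventually_elim
    case (elim n)
    interpret P: prob_space "P n" by (rule P)
    have "(\<Union>v\<in>F. E v) \<subseteq> G" using F(2) AE level_interior_Union[OF B G] by blast
    then have "measure (P n) (\<Union>v\<in>F. E v) \<le> measure (P n) G"
      using vague_open_measurable[OF G] by (intro P.finite_measure_mono) (auto simp: P)
    then show ?case using elim by simp
  qed
qed

lemma vague_continuous_measurable:
  fixes F :: "'a::euclidean_space measure \<Rightarrow> real"
  assumes "continuous_map vague_topology euclideanreal F"
  shows "F \<in> borel_measurable pp_space"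
proof (rule borel_measurableI)
  fix U :: "real set" assume "open U"
  then have "openin vague_topology {\<phi> \<in> topspace vague_topology. F \<phi> \<in> U}"
    by (intro openin_continuous_map_preimage[OF assms]) auto
  from vague_open_measurable[OF this] show "F -` U \<inter> space pp_space \<in> sets pp_space"
    by (simp add: topspace_vague vimage_def Int_def conj_commute)
qed

text \<open>The other half, pushed forward to the real line: the lower bounds for the open rays \<open>F < x\<close> and
  \<open>F > x\<close> give convergence of the distribution functions of \<open>F\<close> at continuity points.\<close>

lemma integral_tendsto_of_open_liminf:
  fixes P :: "nat \<Rightarrow> 'b measure"
  assumes P: "\<And>n. prob_space (P n)" "\<And>n. sets (P n) = sets S"
    and Q: "prob_space Q" "sets Q = sets S"
    and F [measurable]: "F \<in> borel_measurable S" and bdd: "\<And>x. x \<in> space S \<Longrightarrow> \<bar>F x\<bar> \<le> (b::real)"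
    and lim: "\<And>U c. open U \<Longrightarrow> c < measure Q {x \<in> space S. F x \<in> U} \<Longrightarrow>
      eventually (\<lambda>n. c < measure (P n) {x \<in> space S. F x \<in> U}) sequentially"
  shows "(\<lambda>n. \<integral>x. F x \<partial>P n) \<longlonglongrightarrow> (\<integral>x. F x \<partial>Q)"
proof -
  have FP [measurable]: "F \<in> borel_measurable (P n)" for n using F P(2)[of n] by (simp cong: measurable_cong_sets)
  have FQ [measurable]: "F \<in> borel_measurable Q" using F Q(2) by (simp cong: measurable_cong_sets)
  have spP: "space (P n) = space S" for n using P(2) by (rule sets_eq_imp_space_eq)
  have spQ: "space Q = space S" using Q(2) by (rule sets_eq_imp_space_eq)
  have rdP: "real_distribution (distr (P n) borel F)" for n
    using prob_space.real_distribution_distr[OF P(1) FP] .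
  have rdQ: "real_distribution (distr Q borel F)" using prob_space.real_distribution_distr[OF Q(1) FQ] .
  interpret Q: prob_space Q by fact
  interpret dQ: real_distribution "distr Q borel F" by fact
  have wc: "weak_conv_m (\<lambda>n. distr (P n) borel F) (distr Q borel F)"
    unfolding weak_conv_m_def weak_conv_def
  proof (intro allI impI)
    fix x assume "isCont (cdf (distr Q borel F)) x"
    then have "measure (distr Q borel F) {x} = 0" by (simp add: dQ.isCont_cdf)
    then have null: "measure Q {y \<in> space S. F y = x} = 0"
      by (simp add: measure_distr vimage_def Int_def conj_commute spQ)
    have cdfQ: "cdf (distr Q borel F) x = measure Q {y \<in> space S. F y \<le> x}"
      unfolding cdf_def by (simp add: measure_distr vimage_def Int_def conj_commute spQ)
    have cdfP: "cdf (distr (P n) borel F) x = measure (P n) {y \<in> space S. F y \<le> x}" for n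
      unfolding cdf_def by (simp add: measure_distr vimage_def Int_def conj_commute spP)
    have setS: "{y \<in> space S. F y \<le> x} \<in> sets S" "{y \<in> space S. F y < x} \<in> sets S" "{y \<in> space S. F y = x} \<in> sets S"
      by measurable
    have "measure Q {y \<in> space S. F y \<le> x} = measure Q ({y \<in> space S. F y < x} \<union> {y \<in> space S. F y = x})"
      by (rule arg_cong[where f = "measure Q"]) auto
    also have "\<dots> = measure Q {y \<in> space S. F y < x} + measure Q {y \<in> space S. F y = x}"
      using setS Q(2) by (intro Q.finite_measure_Union) auto
    finally have le_lt: "measure Q {y \<in> space S. F y \<le> x} = measure Q {y \<in> space S. F y < x}"
      using null by simp
    have compl: "measure R {y \<in> space S. F y > x} = 1 - measure R {y \<in> space S. F y \<le> x}"
      if "prob_space R" "sets R = sets S" for R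
    proof -
      interpret R: prob_space R by fact
      have "space R - {y \<in> space S. F y \<le> x} = {y \<in> space S. F y > x}"
        using sets_eq_imp_space_eq[OF that(2)] by auto
      then show ?thesis using R.prob_compl[of "{y \<in> space S. F y \<le> x}"] setS that(2) by simp
    qed
    show "(\<lambda>n. cdf (distr (P n) borel F) x) \<longlonglongrightarrow> cdf (distr Q borel F) x"
      unfolding cdfP cdfQ
    proof (rule order_tendstoI)
      fix c assume "c < measure Q {y \<in> space S. F y \<le> x}"
      then have "c < measure Q {y \<in> space S. F y \<in> {..<x}}" by (simp add: le_lt)
      from lim[OF open_lessThan this]
      show "eventually (\<lambda>n. c < measure (P n) {y \<in> space S. F y \<le> x}) sequentially"
      proof eventually_elim
        case (elim n)
        interpret P: prob_space "P n" by (rule P)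
        have "measure (P n) {y \<in> space S. F y \<in> {..<x}} \<le> measure (P n) {y \<in> space S. F y \<le> x}"
          using setS P(2) by (intro P.finite_measure_mono) auto
        then show ?case using elim by simp
      qed
    next
      fix c assume "measure Q {y \<in> space S. F y \<le> x} < c"
      then have "1 - c < measure Q {y \<in> space S. F y \<in> {x<..}}" using compl[OF Q] by simp
      from lim[OF open_greaterThan this]
      show "eventually (\<lambda>n. measure (P n) {y \<in> space S. F y \<le> x} < c) sequentially"
        by eventually_elim (use compl[OF P] in simp)
    qed
  qed
  define k where "k y = max (- b) (min b y)" for y :: real
  have kF: "k (F x) = F x" if "x \<in> space S" for x using bdd[OF that] by (auto simp: k_def)
  have kc: "continuous_on UNIV k" unfolding k_def by (intro continuous_intros)
  have km [measurable]: "k \<in> borel_measurable borel" using kc by (rule borel_measurable_continuous_onI)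
  have "(\<lambda>n. \<integral>y. k y \<partial>distr (P n) borel F) \<longlonglongrightarrow> (\<integral>y. k y \<partial>distr Q borel F)"
  proof (rule weak_conv_imp_integral_bdd_continuous_conv[OF _ rdQ wc])
    show "\<And>n. real_distribution (distr (P n) borel F)" by (rule rdP)
    show "isCont k x" for x using kc by (simp add: continuous_on_eq_continuous_at)
    show "norm (k x) \<le> \<bar>b\<bar>" for x by (auto simp: k_def)
  qed
  moreover have "(\<integral>y. k y \<partial>distr (P n) borel F) = (\<integral>x. F x \<partial>P n)" for n
    by (subst integral_distr[OF FP km], intro Bochner_Integration.integral_cong) (auto simp: kF spP)
  moreover have "(\<integral>y. k y \<partial>distr Q borel F) = (\<integral>x. F x \<partial>Q)"
    by (subst integral_distr[OF FQ km], intro Bochner_Integration.integral_cong) (auto simp: kF spQ)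
  ultimately show ?thesis by simp
qed

text \<open>The vague topology has enough sets that are described by counts of disjoint bounded Borel sets,
  so convergence of the joint probabilities of such counts implies weak convergence.\<close>

lemma pp_weak_conv_of_counts:
  fixes Y :: "nat \<Rightarrow> 'w \<Rightarrow> 'a::euclidean_space measure"
  assumes M: "prob_space M" and Y: "\<And>n. n \<ge> n0 \<Longrightarrow> Y n \<in> measurable M pp_space"
    and Q: "prob_space Q" and Z: "Z \<in> measurable Q pp_space"
    and lim: "\<And>(I :: nat set) C v. finite I \<Longrightarrow> disjoint_family_on C I \<Longrightarrow>
      (\<And>i. i \<in> I \<Longrightarrow> C i \<in> sets borel \<and> bounded (C i)) \<Longrightarrow>
      (\<lambda>n. measure M {\<omega> \<in> space M. \<forall>i\<in>I. cnt (Y n \<omega>) (C i) = v i})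
        \<longlonglongrightarrow> measure Q {\<omega> \<in> space Q. \<forall>i\<in>I. cnt (Z \<omega>) (C i) = v i}"
  shows "pp_weak_conv M Y Q Z"
  unfolding pp_weak_conv_def
proof (intro allI impI)
  fix F :: "'a measure \<Rightarrow> real"
  assume F: "continuous_map vague_topology euclideanreal F \<and> bounded (F ` lf_counting)"
  obtain b where b: "\<And>\<phi>. \<phi> \<in> lf_counting \<Longrightarrow> \<bar>F \<phi>\<bar> \<le> b"
    using F by (auto simp: bounded_iff)
  have Fm: "F \<in> borel_measurable pp_space" using F by (auto intro: vague_continuous_measurable)
  define P where "P n = distr M pp_space (Y (n + n0))" for n
  define R where "R = distr Q pp_space Z"
  have Y': "Y (n + n0) \<in> measurable M pp_space" for n by (rule Y) simp
  have Pp: "prob_space (P n)" for n unfolding P_def by (rule prob_space.prob_space_distr[OF M Y'])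
  have Rp: "prob_space R" unfolding R_def by (rule prob_space.prob_space_distr[OF Q Z])
  have cyl: "measure (distr M' pp_space Y') {\<phi> \<in> lf_counting. \<forall>i\<in>I. cnt \<phi> (C i) = v i}
      = measure M' {\<omega> \<in> space M'. \<forall>i\<in>I. cnt (Y' \<omega>) (C i) = v i}"
    if "finite I" "\<And>i. i \<in> I \<Longrightarrow> C i \<in> sets borel \<and> bounded (C i)" "Y' \<in> measurable M' pp_space"
    for M' :: "'z measure" and Y' :: "'z \<Rightarrow> 'a measure" and I :: "nat set set" and C :: "nat set \<Rightarrow> 'a set" and v
  proof -
    have "{\<phi> \<in> space pp_space. cnt \<phi> (C i) = v i} \<in> sets pp_space" if "i \<in> I" for i
      using measurable_sets[OF measurable_cnt_pp_space, of "C i" "{v i}"] that \<open>\<And>i. i \<in> I \<Longrightarrow> C i \<in> sets borel \<and> bounded (C i)\<close>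
      by (simp add: vimage_def Int_def conj_commute)
    then have "{\<phi> \<in> space pp_space. \<forall>i\<in>I. cnt \<phi> (C i) = v i} \<in> sets pp_space"
      using that(1) by (intro sets.sets_Collect_finite_All) auto
    then show ?thesis using measurable_space[OF that(3)]
      by (subst measure_distr[OF that(3)]) (auto intro!: arg_cong[where f = "measure M'"])
  qed
  have limPR: "(\<lambda>n. measure (P n) {\<phi> \<in> lf_counting. \<forall>i\<in>I. cnt \<phi> (C i) = v i})
        \<longlonglongrightarrow> measure R {\<phi> \<in> lf_counting. \<forall>i\<in>I. cnt \<phi> (C i) = v i}"
    if "finite I" "disjoint_family_on C I" "\<And>i. i \<in> I \<Longrightarrow> C i \<in> sets borel \<and> bounded (C i)"
    for I :: "nat set set" and C v
  proof -
    obtain b where b: "bij_betw b {0..<card I} I" using ex_bij_betw_nat_finite[OF \<open>finite I\<close>] by blast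
    have bI: "b k \<in> I" if "k \<in> {0..<card I}" for k using b that by (auto simp: bij_betw_def)
    have all: "(\<forall>i\<in>I. q i) \<longleftrightarrow> (\<forall>k\<in>{0..<card I}. q (b k))" for q
    proof -
      have "b ` {0..<card I} = I" using b by (simp add: bij_betw_def)
      moreover have "(\<forall>i\<in>b ` {0..<card I}. q i) \<longleftrightarrow> (\<forall>k\<in>{0..<card I}. q (b k))" by blast
      ultimately show ?thesis by simp
    qed
    have dis: "disjoint_family_on (\<lambda>k. C (b k)) {0..<card I}"
      using that(2) b bI unfolding disjoint_family_on_def bij_betw_def inj_on_def by metis
    have "(\<lambda>n. measure M {\<omega> \<in> space M. \<forall>k\<in>{0..<card I}. cnt (Y (n + n0) \<omega>) (C (b k)) = v (b k)})
        \<longlonglongrightarrow> measure Q {\<omega> \<in> space Q. \<forall>k\<in>{0..<card I}. cnt (Z \<omega>) (C (b k)) = v (b k)}"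
      by (rule LIMSEQ_ignore_initial_segment[OF lim[OF _ dis]]) (use that(3) bI in auto)
    then have "(\<lambda>n. measure M {\<omega> \<in> space M. \<forall>i\<in>I. cnt (Y (n + n0) \<omega>) (C i) = v i})
        \<longlonglongrightarrow> measure Q {\<omega> \<in> space Q. \<forall>i\<in>I. cnt (Z \<omega>) (C i) = v i}"
      unfolding all .
    then show ?thesis
      unfolding P_def R_def by (simp add: cyl[OF that(1) that(3) Y'] cyl[OF that(1) that(3) Z])
  qed
  have "(\<lambda>n. \<integral>\<phi>. F \<phi> \<partial>P n) \<longlonglongrightarrow> (\<integral>\<phi>. F \<phi> \<partial>R)"
  proof (rule integral_tendsto_of_open_liminf[OF Pp _ Rp _ Fm])
    fix U :: "real set" and c
    assume U: "open U" and c: "c < measure R {x \<in> space pp_space. F x \<in> U}"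
    have op: "openin vague_topology {\<phi> \<in> space pp_space. F \<phi> \<in> U}"
      using openin_continuous_map_preimage[OF conjunct1[OF F], of U] U by (simp add: topspace_vague)
    show "eventually (\<lambda>n. c < measure (P n) {x \<in> space pp_space. F x \<in> U}) sequentially"
      by (rule vague_open_liminf[OF Pp _ Rp _ limPR op c]) (auto simp: P_def R_def)
  qed (use b in \<open>auto simp: P_def R_def\<close>)
  then have "(\<lambda>n. \<integral>\<omega>. F (Y (n + n0) \<omega>) \<partial>M) \<longlonglongrightarrow> (\<integral>\<omega>. F (Z \<omega>) \<partial>Q)"
    unfolding P_def R_def by (simp add: integral_distr[OF Y' Fm] integral_distr[OF Z Fm])
  then show "(\<lambda>n. \<integral>\<omega>. F (Y n \<omega>) \<partial>M) \<longlonglongrightarrow> (\<integral>\<omega>. F (Z \<omega>) \<partial>Q)"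
    by (rule LIMSEQ_offset)
qed

section \<open>The generating functional of a configuration\<close>

text \<open>The integrand of \<open>apgf\<close>.\<close>

definition gfun :: "('a::euclidean_space \<Rightarrow> real) \<Rightarrow> 'a measure \<Rightarrow> real" where
  "gfun u \<phi> = (\<Prod>x\<in>{x \<in> atoms \<phi>. u x \<noteq> 0}. (1 - u x) ^ cnt \<phi> {x})"

lemma apgf_eq_gfun: "apgf M \<xi> u = (\<integral>\<omega>. gfun u (\<xi> \<omega>) \<partial>M)"
  by (simp add: apgf_def gfun_def cnt_def)

lemma gfun_eq_prod_Int:
  assumes "\<phi> \<in> lf_counting" "bounded W" "{x. u x \<noteq> 0} \<subseteq> W"
  shows "gfun u \<phi> = (\<Prod>x\<in>atoms \<phi> \<inter> W. (1 - u x) ^ cnt \<phi> {x})"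
  unfolding gfun_def
  by (rule prod.mono_neutral_left) (use assms finite_atoms_Int in auto)

lemma gfun_bounds: "u \<in> test_functions \<Longrightarrow> 0 \<le> gfun u \<phi> \<and> gfun u \<phi> \<le> 1"
  unfolding gfun_def test_functions_def
  by (auto intro!: prod_nonneg prod_le_1 power_le_one)

text \<open>The logarithm turns the product into an integral against the configuration, which is measurable
  in it. A point with \<open>u x = 1\<close> kills the product and accordingly has infinite weight.\<close>

lemma measurable_gfun:
  fixes u :: "'a::euclidean_space \<Rightarrow> real"
  assumes u: "u \<in> test_functions"
  shows "gfun u \<in> borel_measurable pp_space"
proof -
  obtain R where R: "{x. u x \<noteq> 0} \<subseteq> cball 0 R"
    using u bounded_subset_ballD[of "{x. u x \<noteq> 0}" 0] ball_subset_cball unfolding test_functions_def by blast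
  have um [measurable]: "u \<in> borel_measurable borel" and u01: "\<And>x. 0 \<le> u x \<and> u x \<le> 1"
    using u by (auto simp: test_functions_def)
  define g where "g x = (if u x = 1 then \<infinity> else ennreal (- ln (1 - u x)))" for x
  have gm [measurable]: "g \<in> borel_measurable borel" unfolding g_def by measurable
  define E where "E \<phi> = (\<integral>\<^sup>+x. g x * indicator (cball 0 R) x \<partial>\<phi>)" for \<phi> :: "'a measure"
  have "(\<lambda>(\<phi> :: 'a measure, x). g x * indicator (cball 0 R) x) \<in> borel_measurable (pp_space \<Otimes>\<^sub>M borel)"
    unfolding split_beta'
    by (rule measurable_compose[OF measurable_snd]) (intro borel_measurable_times_ennreal gm borel_measurable_indicator, simp)
  then have Em [measurable]: "E \<in> borel_measurable pp_space"
    unfolding E_def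
    by (rule measurable_nn_integral_kernel[where \<kappa> = "\<lambda>\<phi>. \<phi>", OF measurable_ident_sets[OF refl]])
  have "gfun u \<phi> = (if E \<phi> = \<infinity> then 0 else exp (- enn2real (E \<phi>)))" if lf: "\<phi> \<in> lf_counting" for \<phi>
  proof -
    define A where "A = atoms \<phi> \<inter> cball 0 R"
    have fA: "finite A" unfolding A_def by (rule finite_atoms_Int[OF lf]) simp
    have Eeq: "E \<phi> = (\<Sum>x\<in>A. g x * of_nat (cnt \<phi> {x}))"
      unfolding E_def A_def by (rule nn_integral_lf_atoms[OF lf]) auto
    have geq: "gfun u \<phi> = (\<Prod>x\<in>A. (1 - u x) ^ cnt \<phi> {x})"
      unfolding A_def by (rule gfun_eq_prod_Int[OF lf _ R]) simp
    have pos: "1 \<le> cnt \<phi> {x}" if "x \<in> A" for x using that unfolding A_def by (intro atoms_ge_1[OF lf]) simp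
    show ?thesis
    proof (cases "\<exists>x\<in>A. u x = 1")
      case True
      then obtain x where x: "x \<in> A" "u x = 1" by auto
      have "g x * of_nat (cnt \<phi> {x}) = \<infinity>" using pos[OF x(1)] x(2)
        by (simp add: g_def ennreal_top_mult)
      then have "E \<phi> = \<infinity>" unfolding Eeq using x(1) fA
        by (metis (no_types, lifting) ennreal_add_eq_top infinity_ennreal_def sum.remove)
      moreover have "gfun u \<phi> = 0" unfolding geq using x pos[OF x(1)] fA
        by (intro prod_zero) (auto intro!: bexI[of _ x])
      ultimately show ?thesis by simp
    next
      case False
      have lt1: "u x < 1" if "x \<in> A" for x using False that u01[of x] by fastforce
      have ln0: "0 \<le> - ln (1 - u x)" if "x \<in> A" for x using lt1[OF that] u01[of x] by simp
      have "E \<phi> = (\<Sum>x\<in>A. ennreal (- ln (1 - u x) * real (cnt \<phi> {x})))"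
        unfolding Eeq
      proof (intro sum.cong refl)
        fix x assume x: "x \<in> A"
        then have "g x = ennreal (- ln (1 - u x))" using False by (auto simp: g_def)
        then show "g x * of_nat (cnt \<phi> {x}) = ennreal (- ln (1 - u x) * real (cnt \<phi> {x}))"
          by (simp only: ennreal_mult[OF ln0[OF x] of_nat_0_le_iff] ennreal_of_nat_eq_real_of_nat)
      qed
      also have "\<dots> = ennreal (\<Sum>x\<in>A. - ln (1 - u x) * real (cnt \<phi> {x}))"
        using ln0 by (intro sum_ennreal mult_nonneg_nonneg) auto
      finally have E: "E \<phi> = ennreal (\<Sum>x\<in>A. - ln (1 - u x) * real (cnt \<phi> {x}))" .
      have "0 \<le> (\<Sum>x\<in>A. - ln (1 - u x) * real (cnt \<phi> {x}))"
        using ln0 by (intro sum_nonneg mult_nonneg_nonneg) auto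
      then have "exp (- enn2real (E \<phi>)) = exp (\<Sum>x\<in>A. real (cnt \<phi> {x}) * ln (1 - u x))"
        unfolding E by (simp add: sum_negf mult.commute)
      also have "\<dots> = (\<Prod>x\<in>A. (1 - u x) ^ cnt \<phi> {x})"
        unfolding exp_sum[OF fA] using lt1 by (intro prod.cong refl) (simp add: exp_of_nat_mult)
      finally show ?thesis using geq E by simp
    qed
  qed
  moreover have "(\<lambda>\<phi>. if E \<phi> = \<infinity> then 0 else exp (- enn2real (E \<phi>))) \<in> borel_measurable pp_space"
    by measurable
  ultimately show ?thesis
    by (subst measurable_cong[where g = "\<lambda>\<phi>. if E \<phi> = \<infinity> then 0 else exp (- enn2real (E \<phi>))"]) simp_all
qed

text \<open>With this \<open>u\<close> a point of \<open>C i\<close> contributes the factor \<open>1 - u x = z i\<close> to the generating functional,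
  which becomes the joint generating function of the counts.\<close>

definition step_fun :: "'i set \<Rightarrow> ('i \<Rightarrow> 'a set) \<Rightarrow> ('i \<Rightarrow> real) \<Rightarrow> 'a \<Rightarrow> real" where
  "step_fun I C z x = (\<Sum>i\<in>I. (1 - z i) * indicator (C i) x)"

lemma step_fun_eq:
  assumes "finite I" "disjoint_family_on C I" "i \<in> I" "x \<in> C i"
  shows "step_fun I C z x = 1 - z i"
proof -
  have "(1 - z j) * indicator (C j) x = (if j = i then 1 - z i else 0)" if "j \<in> I" for j
    using assms that by (auto simp: disjoint_family_on_def indicator_def)
  then show ?thesis using assms by (simp add: step_fun_def)
qed

lemma step_fun_outside: "x \<notin> (\<Union>i\<in>I. C i) \<Longrightarrow> step_fun I C z x = 0"
  by (auto simp: step_fun_def intro!: sum.neutral)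

lemma step_fun_support: "{x. step_fun I C z x \<noteq> 0} \<subseteq> (\<Union>i\<in>I. C i)"
proof
  fix x assume "x \<in> {x. step_fun I C z x \<noteq> 0}"
  then have "step_fun I C z x \<noteq> 0" by simp
  then show "x \<in> (\<Union>i\<in>I. C i)" by (rule contrapos_np) (rule step_fun_outside)
qed

lemma step_fun_test:
  fixes C :: "'i \<Rightarrow> 'a::euclidean_space set"
  assumes "finite I" "disjoint_family_on C I" "\<And>i. i \<in> I \<Longrightarrow> C i \<in> sets borel \<and> bounded (C i)"
    "\<And>i. i \<in> I \<Longrightarrow> 0 \<le> z i \<and> z i \<le> (1::real)"
  shows "step_fun I C z \<in> test_functions"
proof -
  have "step_fun I C z \<in> borel_measurable borel"
    unfolding step_fun_def using assms
    by (intro borel_measurable_sum borel_measurable_times borel_measurable_indicator) auto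
  moreover have "0 \<le> step_fun I C z x \<and> step_fun I C z x \<le> 1" for x
  proof (cases "x \<in> (\<Union>i\<in>I. C i)")
    case True
    then show ?thesis using step_fun_eq[OF assms(1,2)] assms(4) by fastforce
  qed (simp add: step_fun_outside)
  moreover have "bounded {x. step_fun I C z x \<noteq> 0}"
  proof (rule bounded_subset)
    show "bounded (\<Union>i\<in>I. C i)" using assms by auto
    show "{x. step_fun I C z x \<noteq> 0} \<subseteq> (\<Union>i\<in>I. C i)" by (rule step_fun_support)
  qed
  ultimately show ?thesis by (simp add: test_functions_def)
qed

lemma gfun_step_fun:
  assumes lf: "\<phi> \<in> lf_counting" and I: "finite I" "disjoint_family_on C I"
    and C: "\<And>i. i \<in> I \<Longrightarrow> C i \<in> sets borel \<and> bounded (C i)"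
  shows "gfun (step_fun I C z) \<phi> = (\<Prod>i\<in>I. z i ^ cnt \<phi> (C i))"
proof -
  have "gfun (step_fun I C z) \<phi> = (\<Prod>x\<in>atoms \<phi> \<inter> (\<Union>i\<in>I. C i). (1 - step_fun I C z x) ^ cnt \<phi> {x})"
  proof (rule gfun_eq_prod_Int[OF lf])
    show "bounded (\<Union>i\<in>I. C i)" using I C by auto
    show "{x. step_fun I C z x \<noteq> 0} \<subseteq> (\<Union>i\<in>I. C i)" by (rule step_fun_support)
  qed
  also have "atoms \<phi> \<inter> (\<Union>i\<in>I. C i) = (\<Union>i\<in>I. atoms \<phi> \<inter> C i)" by auto
  also have "(\<Prod>x\<in>(\<Union>i\<in>I. atoms \<phi> \<inter> C i). (1 - step_fun I C z x) ^ cnt \<phi> {x})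
    = (\<Prod>i\<in>I. \<Prod>x\<in>atoms \<phi> \<inter> C i. (1 - step_fun I C z x) ^ cnt \<phi> {x})"
    using I C finite_atoms_Int[OF lf] by (intro prod.UNION_disjoint) (auto simp: disjoint_family_on_def)
  also have "\<dots> = (\<Prod>i\<in>I. \<Prod>x\<in>atoms \<phi> \<inter> C i. z i ^ cnt \<phi> {x})"
    by (intro prod.cong refl) (simp add: step_fun_eq[OF I])
  also have "\<dots> = (\<Prod>i\<in>I. z i ^ cnt \<phi> (C i))"
  proof (intro prod.cong refl)
    fix i assume "i \<in> I"
    then have "cnt \<phi> (C i) = (\<Sum>x\<in>atoms \<phi> \<inter> C i. cnt \<phi> {x})"
      using C by (intro cnt_eq_sum_atoms[OF lf]) auto
    then show "(\<Prod>x\<in>atoms \<phi> \<inter> C i. z i ^ cnt \<phi> {x}) = z i ^ cnt \<phi> (C i)"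
      by (simp only: power_sum)
  qed
  finally show ?thesis .
qed

section \<open>Existence of Poisson processes\<close>

text \<open>The joint generating functions of independent Poisson counts with intensity measure \<open>\<Lambda>\<close>.\<close>

definition poisson_pgf :: "'a::euclidean_space measure measure \<Rightarrow> 'a measure \<Rightarrow> bool" where
  "poisson_pgf Q \<Lambda> \<longleftrightarrow> (\<forall>(I :: nat set) C z. finite I \<longrightarrow> disjoint_family_on C I \<longrightarrow>
     (\<forall>i\<in>I. C i \<in> sets borel \<and> bounded (C i)) \<longrightarrow> (\<forall>i\<in>I. 0 \<le> z i \<and> z i \<le> 1) \<longrightarrow>
     (\<integral>\<phi>. (\<Prod>i\<in>I. z i ^ cnt \<phi> (C i)) \<partial>Q) = exp (- (\<Sum>i\<in>I. (1 - z i) * measure \<Lambda> (C i))))"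

text \<open>This is the limit theorem for joint generating functions applied to a constant sequence.\<close>

lemma integral_prod_counts_of_poisson_pgf:
  fixes I :: "nat set"
  assumes Q: "prob_space Q" "sets Q = sets pp_space" and pgf: "poisson_pgf Q \<Lambda>"
    and I: "finite I" "disjoint_family_on C I" "\<And>i. i \<in> I \<Longrightarrow> C i \<in> sets borel \<and> bounded (C i)"
    and a: "\<And>i k. i \<in> I \<Longrightarrow> 0 \<le> a i k \<and> a i k \<le> (1::real)"
  shows "(\<integral>\<phi>. (\<Prod>i\<in>I. a i (cnt \<phi> (C i))) \<partial>Q) = (\<Prod>i\<in>I. alpha (a i) (measure \<Lambda> (C i)))"
proof -
  interpret prob_space Q by fact
  have "(\<lambda>n::nat. \<integral>\<phi>. (\<Prod>i\<in>I. a i (cnt \<phi> (C i))) \<partial>Q) \<longlonglongrightarrow> (\<Prod>i\<in>I. alpha (a i) (measure \<Lambda> (C i)))"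
  proof (rule poisson_limit_of_joint_pgf[OF I(1), where W = "\<lambda>n i \<phi>. cnt \<phi> (C i)" and c = 1])
    show "(\<lambda>\<phi>. cnt \<phi> (C i)) \<in> measurable Q (count_space UNIV)" if "i \<in> I" for i
      using measurable_cnt_pp_space[of "C i"] I(3)[OF that] by (simp add: measurable_cong_sets[OF Q(2) refl])
    fix z :: "nat \<Rightarrow> real" assume "\<And>i. i \<in> I \<Longrightarrow> 0 \<le> z i \<and> z i \<le> 1"
    then show "(\<lambda>n::nat. \<integral>\<phi>. (\<Prod>i\<in>I. z i ^ cnt \<phi> (C i)) \<partial>Q) \<longlonglongrightarrow> exp (- (\<Sum>i\<in>I. (1 - z i) * measure \<Lambda> (C i)))"
      using pgf I unfolding poisson_pgf_def by simp
  qed (use a in auto)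
  then show ?thesis by (simp add: LIMSEQ_const_iff)
qed

text \<open>With indicators as the bounded functions of the counts, joint probabilities of the counts are
  products of Poisson probabilities.\<close>

lemma poisson_process_of_pgf:
  fixes \<Lambda> :: "'a::euclidean_space measure"
  assumes Q: "prob_space Q" "sets Q = sets pp_space" and pgf: "poisson_pgf Q \<Lambda>"
  shows "poisson_process Q (\<lambda>\<phi>. \<phi>) \<Lambda>"
proof -
  interpret prob_space Q by fact
  have spQ: "space Q = lf_counting" using sets_eq_imp_space_eq[OF Q(2)] by simp
  have emm: "(\<lambda>\<phi>. emeasure \<phi> B) \<in> borel_measurable Q" if "B \<in> sets borel" for B :: "'a set"
    using measurable_emeasure_pp_space[OF that] by (simp add: measurable_cong_sets[OF Q(2) refl])
  have ind: "measure Q {\<phi> \<in> space Q. \<forall>i\<in>I. cnt \<phi> (C i) \<in> S i} = (\<Prod>i\<in>I. alpha (indicator (S i)) (measure \<Lambda> (C i)))"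
    if I: "finite I" "disjoint_family_on C I" "\<And>i. i \<in> I \<Longrightarrow> C i \<in> sets borel \<and> bounded (C i)"
    for I :: "nat set" and C S
  proof -
    have cm: "(\<lambda>\<phi>. cnt \<phi> (C i)) \<in> measurable Q (count_space UNIV)" if "i \<in> I" for i
      using measurable_cnt_pp_space[of "C i"] I(3)[OF that] by (simp add: measurable_cong_sets[OF Q(2) refl])
    have "{\<phi> \<in> space Q. cnt \<phi> (C i) \<in> S i} \<in> sets Q" if "i \<in> I" for i
      using measurable_sets[OF cm[OF that], of "S i"] by (simp add: vimage_def Int_def conj_commute)
    then have ms: "{\<phi> \<in> space Q. \<forall>i\<in>I. cnt \<phi> (C i) \<in> S i} \<in> sets Q"
      using I(1) by (intro sets.sets_Collect_finite_All) auto
    have "(\<Prod>i\<in>I. alpha (indicator (S i)) (measure \<Lambda> (C i))) = (\<integral>\<phi>. (\<Prod>i\<in>I. indicator (S i) (cnt \<phi> (C i))) \<partial>Q)"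
      by (rule integral_prod_counts_of_poisson_pgf[OF Q pgf I, symmetric]) (auto simp: indicator_def)
    also have "\<dots> = (\<integral>\<phi>. indicator {\<phi> \<in> space Q. \<forall>i\<in>I. cnt \<phi> (C i) \<in> S i} \<phi> \<partial>Q)"
      using I(1) by (intro Bochner_Integration.integral_cong refl) (auto simp: indicator_def prod_zero_iff)
    also have "\<dots> = measure Q {\<phi> \<in> space Q. \<forall>i\<in>I. cnt \<phi> (C i) \<in> S i}" using ms by simp
    finally show ?thesis ..
  qed
  have one: "measure Q {\<phi> \<in> space Q. cnt \<phi> B \<in> S} = alpha (indicator S) (measure \<Lambda> B)"
    if "B \<in> sets borel" "bounded B" for B S
    using ind[of "{0}" "\<lambda>_. B" "\<lambda>_. S"] that by (simp add: disjoint_family_on_def)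
  show ?thesis
    unfolding poisson_process_def point_process_def
  proof (intro conjI ballI allI impI)
    show "prob_space Q" by fact
    show "(\<lambda>\<phi>. \<phi>) \<in> measurable Q pp_space" using Q(2) by (simp add: measurable_ident_sets)
  next
    fix B :: "'a set" and k assume B: "B \<in> sets borel" "bounded B"
    have "{\<phi> \<in> space Q. emeasure \<phi> B = of_nat k} = {\<phi> \<in> space Q. cnt \<phi> B \<in> {k}}"
      using emeasure_lf_cnt[OF _ B] by (auto simp: spQ)
    then show "measure Q {\<phi> \<in> space Q. emeasure \<phi> B = of_nat k} = pmf (Poi (measure \<Lambda> B)) k"
      using one[OF B, of "{k}"] by (simp add: alpha_def measure_pmf_single)
  next
    fix I :: "nat set" and B :: "nat \<Rightarrow> 'a set"
    assume I: "finite I" "disjoint_family_on B I" "\<forall>i\<in>I. B i \<in> sets borel \<and> bounded (B i)"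
    show "indep_vars (\<lambda>_. borel) (\<lambda>i \<phi>. emeasure \<phi> (B i)) I"
      unfolding indep_vars_def2
    proof (intro conjI ballI)
      show "(\<lambda>\<phi>. emeasure \<phi> (B i)) \<in> borel_measurable Q" if "i \<in> I" for i
        using emm I(3) that by auto
      show "indep_sets (\<lambda>i. {(\<lambda>\<phi>. emeasure \<phi> (B i)) -` A \<inter> space Q |A. A \<in> sets borel}) I"
        unfolding indep_sets_def
      proof (intro conjI ballI allI impI)
        show "{(\<lambda>\<phi>. emeasure \<phi> (B i)) -` A \<inter> space Q |A. A \<in> sets borel} \<subseteq> events" if "i \<in> I" for i
          using measurable_sets[OF emm] I(3) that by auto
        fix J A assume J: "J \<subseteq> I" "J \<noteq> {}" "finite J"
          and A: "A \<in> Pi J (\<lambda>i. {(\<lambda>\<phi>. emeasure \<phi> (B i)) -` A \<inter> space Q |A. A \<in> sets borel})"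
        have "\<forall>j\<in>J. \<exists>T. A j = (\<lambda>\<phi>. emeasure \<phi> (B j)) -` T \<inter> space Q" using A by blast
        from bchoice[OF this] obtain T where T: "\<And>j. j \<in> J \<Longrightarrow> A j = (\<lambda>\<phi>. emeasure \<phi> (B j)) -` T j \<inter> space Q" by blast
        define S where "S j = {k. of_nat k \<in> T j}" for j
        have AS: "A j = {\<phi> \<in> space Q. cnt \<phi> (B j) \<in> S j}" if "j \<in> J" for j
          using T[OF that] emeasure_lf_cnt[of _ "B j"] I(3) J(1) that by (auto simp: spQ S_def)
        have "prob (\<Inter>j\<in>J. A j) = prob {\<phi> \<in> space Q. \<forall>i\<in>J. cnt \<phi> (B i) \<in> S i}"
          using AS J(2) by (intro arg_cong[where f = prob]) auto
        also have "\<dots> = (\<Prod>i\<in>J. alpha (indicator (S i)) (measure \<Lambda> (B i)))"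
          using I J by (intro ind) (auto simp: disjoint_family_on_def)
        also have "\<dots> = (\<Prod>j\<in>J. prob (A j))"
          using AS one I(3) J(1) by (intro prod.cong refl) auto
        finally show "prob (\<Inter>j\<in>J. A j) = (\<Prod>j\<in>J. prob (A j))" .
      qed
    qed
  qed
qed

lemma (in product_prob_space) nn_integral_PiM_prod_coordinates:
  assumes F: "finite F" "F \<subseteq> I" and g: "\<And>i. i \<in> F \<Longrightarrow> g i \<in> borel_measurable (M i)"
  shows "(\<integral>\<^sup>+\<omega>. (\<Prod>i\<in>F. g i (\<omega> i)) \<partial>PiM I M) = (\<Prod>i\<in>F. \<integral>\<^sup>+x. g i x \<partial>M i)"
proof -
  have m: "(\<lambda>\<omega>. \<Prod>i\<in>F. g i (\<omega> i)) \<in> borel_measurable (PiM F M)"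
    by (intro borel_measurable_prod_ennreal measurable_compose[OF measurable_component_singleton _] g)
  have "(\<integral>\<^sup>+\<omega>. (\<Prod>i\<in>F. g i (\<omega> i)) \<partial>PiM I M) = (\<integral>\<^sup>+\<omega>. (\<Prod>i\<in>F. g i (restrict \<omega> F i)) \<partial>PiM I M)"
    by (intro nn_integral_cong prod.cong) auto
  also have "\<dots> = (\<integral>\<^sup>+\<omega>. (\<Prod>i\<in>F. g i (\<omega> i)) \<partial>distr (PiM I M) (PiM F M) (\<lambda>\<omega>. restrict \<omega> F))"
    using m by (intro nn_integral_distr[symmetric] measurable_restrict_subset[OF F(2)]) simp
  also have "\<dots> = (\<integral>\<^sup>+\<omega>. (\<Prod>i\<in>F. g i (\<omega> i)) \<partial>PiM F M)"
    by (simp add: distr_PiM_restrict_finite[OF F])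
  also have "\<dots> = (\<Prod>i\<in>F. \<integral>\<^sup>+x. g i x \<partial>M i)"
    by (rule product_nn_integral_prod[OF F(1) g])
  finally show ?thesis .
qed

text \<open>On each annulus a Poisson number of independent points is drawn from the normalized
  intensity. Annuli make the union locally finite for every outcome, not only almost surely.\<close>

definition annulus :: "nat \<Rightarrow> 'a::euclidean_space set" where
  "annulus j = {x. real j \<le> norm x \<and> norm x < real (Suc j)}"

definition annulus_law :: "'a::euclidean_space measure \<Rightarrow> nat \<Rightarrow> 'a measure" where
  "annulus_law \<Lambda> j = (if emeasure \<Lambda> (annulus j) = 0 then return borel 0 else uniform_measure \<Lambda> (annulus j))"

definition annulus_sample :: "'a::euclidean_space measure \<Rightarrow> nat \<Rightarrow> (nat \<times> (nat \<Rightarrow> 'a)) measure" where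
  "annulus_sample \<Lambda> j =
     measure_pmf (Poi (measure \<Lambda> (annulus j))) \<Otimes>\<^sub>M PiM UNIV (\<lambda>_::nat. annulus_law \<Lambda> j)"

definition sample_config :: "(nat \<Rightarrow> nat \<times> (nat \<Rightarrow> 'a::euclidean_space)) \<Rightarrow> 'a measure" where
  "sample_config \<omega> = distr (count_space {(j, i). i < fst (\<omega> j) \<and> snd (\<omega> j) i \<in> annulus j}) borel
     (\<lambda>(j, i). snd (\<omega> j) i)"

definition annulus_count :: "nat \<Rightarrow> 'a::euclidean_space set \<Rightarrow> nat \<times> (nat \<Rightarrow> 'a) \<Rightarrow> nat" where
  "annulus_count j B \<eta> = (\<Sum>i<fst \<eta>. if snd \<eta> i \<in> annulus j \<inter> B then 1 else 0)"

lemma annulus_borel [measurable]: "annulus j \<in> sets borel"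
  unfolding annulus_def by measurable

lemma annulus_bounded: "bounded (annulus j)"
  by (rule bounded_subset[of "cball 0 (real (Suc j))"]) (auto simp: annulus_def)

lemma emeasure_sample_config:
  fixes B :: "'a::euclidean_space set"
  assumes B: "B \<in> sets borel" "B \<subseteq> ball 0 (real m)"
  shows "emeasure (sample_config \<omega>) B = of_nat (\<Sum>j<m. annulus_count j B (\<omega> j))"
proof -
  define S where "S = {(j, i). i < fst (\<omega> j) \<and> snd (\<omega> j) i \<in> annulus j}"
  define T where "T = (SIGMA j:{..<m}. {i. i < fst (\<omega> j) \<and> snd (\<omega> j) i \<in> annulus j \<inter> B})"
  have "(\<lambda>(j, i). snd (\<omega> j) i) -` B \<inter> S = T"
  proof (intro equalityI subsetI)
    fix p assume "p \<in> (\<lambda>(j, i). snd (\<omega> j) i) -` B \<inter> S"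
    then obtain j i where p: "p = (j, i)" "i < fst (\<omega> j)" "snd (\<omega> j) i \<in> annulus j" "snd (\<omega> j) i \<in> B"
      by (auto simp: S_def)
    then have "real j < real m" using B(2) by (auto simp: annulus_def intro: le_less_trans)
    then show "p \<in> T" using p by (auto simp: T_def)
  qed (auto simp: S_def T_def)
  then have "emeasure (sample_config \<omega>) B = emeasure (count_space S) T"
    unfolding sample_config_def S_def[symmetric]
    by (subst emeasure_distr) (auto simp: B)
  also have "\<dots> = of_nat (card T)"
    by (subst emeasure_count_space) (auto simp: T_def S_def intro!: finite_SigmaI)
  also have "card T = (\<Sum>j<m. card {i. i < fst (\<omega> j) \<and> snd (\<omega> j) i \<in> annulus j \<inter> B})"
    unfolding T_def by (rule card_SigmaI) auto
  also have "\<dots> = (\<Sum>j<m. annulus_count j B (\<omega> j))"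
    unfolding annulus_count_def by (intro sum.cong refl, subst sum.If_cases) (auto simp: Int_def conj_commute lessThan_def)
  finally show ?thesis .
qed

lemma sample_config_lf: "sample_config \<omega> \<in> lf_counting"
proof -
  have "emeasure (sample_config \<omega>) B \<in> \<nat>" if B: "B \<in> sets borel" "bounded B" for B
  proof -
    obtain r where "B \<subseteq> ball 0 r" using bounded_subset_ballD[OF B(2), of 0] by auto
    moreover obtain m :: nat where "r \<le> real m" using real_arch_simple by blast
    ultimately have "B \<subseteq> ball 0 (real m)" using subset_ball by blast
    from emeasure_sample_config[OF B(1) this] show ?thesis by (simp only: of_nat_in_Nats)
  qed
  then show ?thesis by (simp add: lf_counting_def sample_config_def)
qed

lemma measurable_annulus_count:
  fixes B :: "'a::euclidean_space set"
  assumes B [measurable]: "B \<in> sets borel" and sets: "sets \<nu> = sets borel"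
  shows "annulus_count j B \<in> measurable (measure_pmf p \<Otimes>\<^sub>M PiM UNIV (\<lambda>_::nat. \<nu>)) (count_space UNIV)"
  unfolding annulus_count_def
proof (rule measurable_compose_countable[where g = fst])
  let ?M = "measure_pmf p \<Otimes>\<^sub>M PiM UNIV (\<lambda>_::nat. \<nu>)"
  fix k :: nat
  have "(\<lambda>\<eta>. snd \<eta> i) \<in> measurable ?M borel" for i
  proof -
    have "(\<lambda>x. x i) \<in> measurable (PiM UNIV (\<lambda>_::nat. \<nu>)) \<nu>" by (rule measurable_component_singleton) simp
    then have "(\<lambda>x. x i) \<in> measurable (PiM UNIV (\<lambda>_::nat. \<nu>)) borel"
      by (simp add: measurable_cong_sets[OF refl sets])
    from measurable_compose[OF measurable_snd this] show ?thesis .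
  qed
  then have [measurable]: "Measurable.pred ?M (\<lambda>\<eta>. snd \<eta> i \<in> annulus j \<inter> B)" for i
    by (rule measurable_compose) (simp add: pred_def)
  have r: "(\<lambda>\<eta>. \<Sum>i<k. if snd \<eta> i \<in> annulus j \<inter> B then 1 else 0 :: real) \<in> borel_measurable ?M"
    by measurable
  have "(\<Sum>i<k. if snd \<eta> i \<in> annulus j \<inter> B then 1 else 0) = nat \<lfloor>\<Sum>i<k. if snd \<eta> i \<in> annulus j \<inter> B then 1 else 0 :: real\<rfloor>"
    for \<eta> :: "nat \<times> (nat \<Rightarrow> 'a)"
  proof -
    have "(\<Sum>i<k. if snd \<eta> i \<in> annulus j \<inter> B then 1 else 0 :: real) = real (\<Sum>i<k. if snd \<eta> i \<in> annulus j \<inter> B then 1 else 0)"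
      unfolding of_nat_sum by (intro sum.cong) auto
    then show ?thesis by (simp only: floor_of_nat nat_int)
  qed
  then have eq: "(\<lambda>\<eta> :: nat \<times> (nat \<Rightarrow> 'a). \<Sum>i<k. if snd \<eta> i \<in> annulus j \<inter> B then 1 else 0)
      = (\<lambda>\<eta>. nat \<lfloor>\<Sum>i<k. if snd \<eta> i \<in> annulus j \<inter> B then 1 else 0 :: real\<rfloor>)"
    by (rule ext)
  show "(\<lambda>\<eta>. \<Sum>i<k. if snd \<eta> i \<in> annulus j \<inter> B then 1 else 0 :: nat) \<in> measurable ?M (count_space UNIV)"
    unfolding eq by (rule measurable_compose[OF r measurable_nat_floor])
next
  have "fst \<in> measurable (measure_pmf p \<Otimes>\<^sub>M PiM UNIV (\<lambda>_::nat. \<nu>)) (measure_pmf p)" by (rule measurable_fst)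
  then show "fst \<in> measurable (measure_pmf p \<Otimes>\<^sub>M PiM UNIV (\<lambda>_::nat. \<nu>)) (count_space UNIV)"
    by (simp add: measurable_cong_sets[OF refl sets_measure_pmf_count_space])
qed

lemma nn_integral_Poi_power:
  assumes "0 \<le> t" "0 \<le> s" "s \<le> (1::real)"
  shows "(\<integral>\<^sup>+k. ennreal s ^ k \<partial>measure_pmf (Poi t)) = ennreal (exp (- ((1 - s) * t)))"
proof -
  have "(\<integral>\<^sup>+k. ennreal s ^ k \<partial>measure_pmf (Poi t)) = (\<integral>\<^sup>+k. ennreal (s ^ k) \<partial>measure_pmf (Poi t))"
    using assms by (simp add: ennreal_power)
  also have "\<dots> = ennreal (measure_pmf.expectation (Poi t) (\<lambda>k. s ^ k))"
    using assms by (intro nn_integral_eq_integral measure_pmf.integrable_const_bound[where B = 1]) (auto simp: power_le_one)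
  also have "measure_pmf.expectation (Poi t) (\<lambda>k. s ^ k) = exp (- ((1 - s) * t))"
    using sums_unique2[OF sums_expectation_nat_pmf[of "\<lambda>k. s ^ k" 1 "Poi t"] Poi_pgf_sums[OF assms(1), of s]] assms
    by (simp add: power_le_one)
  finally show ?thesis .
qed

context
  fixes \<Lambda> :: "'a::euclidean_space measure"
  assumes sets_L: "sets \<Lambda> = sets borel"
    and fin_L: "\<And>B. B \<in> sets borel \<Longrightarrow> bounded B \<Longrightarrow> emeasure \<Lambda> B < \<infinity>"
begin

lemma annulus_law_prob: "prob_space (annulus_law \<Lambda> j)"
proof (cases "emeasure \<Lambda> (annulus j) = 0")
  case False
  then show ?thesis using fin_L[OF annulus_borel annulus_bounded, of j]
    by (auto simp: annulus_law_def intro!: prob_space_uniform_measure)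
qed (simp add: annulus_law_def prob_space_return)

lemma annulus_law_sets: "sets (annulus_law \<Lambda> j) = sets borel"
  by (simp add: annulus_law_def sets_L)

lemma annulus_sample_prob: "prob_space (annulus_sample \<Lambda> j)"
  unfolding annulus_sample_def
  by (intro prob_space_pair measure_pmf.prob_space_axioms prob_space_PiM annulus_law_prob)

lemma annulus_law_scaled:
  assumes "B \<in> sets borel"
  shows "measure \<Lambda> (annulus j) * measure (annulus_law \<Lambda> j) (annulus j \<inter> B) = measure \<Lambda> (annulus j \<inter> B)"
proof (cases "emeasure \<Lambda> (annulus j) = 0")
  case True
  have "emeasure \<Lambda> (annulus j \<inter> B) \<le> emeasure \<Lambda> (annulus j)"
    by (intro emeasure_mono) (auto simp: sets_L)
  then show ?thesis using True by (simp add: measure_def)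
next
  case False
  have "measure \<Lambda> (annulus j) \<noteq> 0" using False fin_L[OF annulus_borel annulus_bounded, of j]
    by (simp add: measure_def enn2real_eq_0_iff)
  then show ?thesis using False fin_L[OF annulus_borel annulus_bounded, of j] assms
    by (simp add: annulus_law_def measure_uniform_measure sets_L Int_absorb1 Int_assoc[symmetric])
qed

text \<open>Conditionally on the number of points the weights of the points are independent, so the
  Poisson generating function is evaluated at the mean weight of a single point.\<close>

lemma annulus_sample_pgf:
  fixes I :: "nat set"
  assumes I: "finite I" "disjoint_family_on C I" "\<And>i. i \<in> I \<Longrightarrow> C i \<in> sets borel \<and> bounded (C i)"
    and z: "\<And>i. i \<in> I \<Longrightarrow> 0 \<le> z i \<and> z i \<le> (1::real)"
  shows "(\<integral>\<^sup>+\<eta>. ennreal (\<Prod>i\<in>I. z i ^ annulus_count j (C i) \<eta>) \<partial>annulus_sample \<Lambda> j)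
    = ennreal (exp (- (\<Sum>i\<in>I. (1 - z i) * measure \<Lambda> (annulus j \<inter> C i))))"
proof -
  define t where "t = measure \<Lambda> (annulus j)"
  define \<nu> where "\<nu> = annulus_law \<Lambda> j"
  interpret \<nu>: prob_space \<nu> unfolding \<nu>_def by (rule annulus_law_prob)
  have s\<nu>: "sets \<nu> = sets borel" unfolding \<nu>_def by (rule annulus_law_sets)
  interpret P: product_prob_space "\<lambda>_::nat. \<nu>" UNIV by unfold_locales
  have sf: "sigma_finite_measure (PiM UNIV (\<lambda>_::nat. \<nu>))"
    by (intro prob_space_imp_sigma_finite prob_space_PiM \<nu>.prob_space_axioms)
  define f where "f y = 1 - step_fun I (\<lambda>i. annulus j \<inter> C i) z y" for y
  have I': "disjoint_family_on (\<lambda>i. annulus j \<inter> C i) I"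
    using I(2) by (auto simp: disjoint_family_on_def)
  have st: "step_fun I (\<lambda>i. annulus j \<inter> C i) z \<in> test_functions"
    using I z by (intro step_fun_test[OF I(1) I']) (auto intro: bounded_subset)
  then have fm: "f \<in> borel_measurable borel" and f01: "\<And>y. 0 \<le> f y \<and> f y \<le> 1"
    unfolding f_def test_functions_def by auto
  have fm\<nu>: "f \<in> borel_measurable \<nu>" using fm by (simp add: measurable_cong_sets[OF s\<nu> refl])
  have fprod: "(\<Prod>i\<in>I. z i ^ (if y \<in> annulus j \<inter> C i then 1 else 0)) = f y" for y
  proof (cases "y \<in> (\<Union>i\<in>I. annulus j \<inter> C i)")
    case True
    then obtain k where k: "k \<in> I" "y \<in> annulus j \<inter> C k" by auto
    have "(\<Prod>i\<in>I. z i ^ (if y \<in> annulus j \<inter> C i then 1 else 0)) = (\<Prod>i\<in>I. if i = k then z i else 1)"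
      using k I' by (intro prod.cong refl) (auto simp: disjoint_family_on_def)
    also have "\<dots> = z k" using I(1) k(1) by simp
    also have "\<dots> = f y" unfolding f_def using step_fun_eq[OF I(1) I' k] by simp
    finally show ?thesis .
  next
    case False
    then have "f y = 1" by (simp only: f_def step_fun_outside[OF False])
    then show ?thesis using False by (auto intro!: prod.neutral)
  qed
  have prodf: "(\<Prod>i\<in>I. z i ^ annulus_count j (C i) \<eta>) = (\<Prod>l<fst \<eta>. f (snd \<eta> l))" for \<eta>
  proof -
    have "(\<Prod>i\<in>I. z i ^ annulus_count j (C i) \<eta>)
      = (\<Prod>i\<in>I. \<Prod>l<fst \<eta>. z i ^ (if snd \<eta> l \<in> annulus j \<inter> C i then 1 else 0))"
      by (simp only: annulus_count_def power_sum)
    also have "\<dots> = (\<Prod>l<fst \<eta>. \<Prod>i\<in>I. z i ^ (if snd \<eta> l \<in> annulus j \<inter> C i then 1 else 0))"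
      by (rule prod.swap)
    finally show ?thesis by (simp only: fprod)
  qed
  have int_f: "(\<integral>y. f y \<partial>\<nu>) = 1 - (\<Sum>i\<in>I. (1 - z i) * measure \<nu> (annulus j \<inter> C i))"
  proof -
    have m: "annulus j \<inter> C i \<in> sets \<nu>" if "i \<in> I" for i using I(3)[OF that] by (auto simp: s\<nu>)
    have i: "integrable \<nu> (indicator (annulus j \<inter> C i) :: 'a \<Rightarrow> real)" if "i \<in> I" for i
      using m[OF that] by (intro integrable_real_indicator \<nu>.emeasure_finite[THEN less_top[THEN iffD1]]) (auto simp: less_top[symmetric])
    have "(\<integral>y. step_fun I (\<lambda>i. annulus j \<inter> C i) z y \<partial>\<nu>) = (\<Sum>i\<in>I. (1 - z i) * measure \<nu> (annulus j \<inter> C i))"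
      unfolding step_fun_def using i m by (subst Bochner_Integration.integral_sum) (auto intro!: sum.cong)
    moreover have "integrable \<nu> (step_fun I (\<lambda>i. annulus j \<inter> C i) z)"
      unfolding step_fun_def using i by (intro Bochner_Integration.integrable_sum integrable_mult_right)
    ultimately show ?thesis unfolding f_def by (simp add: \<nu>.prob_space)
  qed
  define s where "s = (\<integral>y. f y \<partial>\<nu>)"
  have intf: "integrable \<nu> f" using fm\<nu> f01 by (intro \<nu>.integrable_const_bound[where B = 1]) auto
  have s01: "0 \<le> s" "s \<le> 1"
  proof -
    show "0 \<le> s" unfolding s_def using f01 by (intro Bochner_Integration.integral_nonneg) auto
    have "s \<le> (\<integral>y. 1 \<partial>\<nu>)" unfolding s_def using f01 intf by (intro integral_mono) auto
    then show "s \<le> 1" by (simp add: \<nu>.prob_space)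
  qed
  have nnf: "(\<integral>\<^sup>+y. ennreal (f y) \<partial>\<nu>) = ennreal s"
    unfolding s_def using f01 intf by (intro nn_integral_eq_integral) auto
  have meas: "(\<lambda>\<eta>. ennreal (\<Prod>i\<in>I. z i ^ annulus_count j (C i) \<eta>)) \<in> borel_measurable (measure_pmf (Poi t) \<Otimes>\<^sub>M PiM UNIV (\<lambda>_::nat. \<nu>))"
  proof (intro measurable_compose[OF _ measurable_ennreal] borel_measurable_prod)
    fix i assume "i \<in> I"
    then have "annulus_count j (C i) \<in> measurable (measure_pmf (Poi t) \<Otimes>\<^sub>M PiM UNIV (\<lambda>_::nat. \<nu>)) (count_space UNIV)"
      using I(3) s\<nu> by (intro measurable_annulus_count) auto
    then show "(\<lambda>\<eta>. z i ^ annulus_count j (C i) \<eta>) \<in> borel_measurable (measure_pmf (Poi t) \<Otimes>\<^sub>M PiM UNIV (\<lambda>_::nat. \<nu>))"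
      by (rule measurable_compose) simp
  qed
  have "(\<integral>\<^sup>+\<eta>. ennreal (\<Prod>i\<in>I. z i ^ annulus_count j (C i) \<eta>) \<partial>annulus_sample \<Lambda> j)
    = (\<integral>\<^sup>+k. \<integral>\<^sup>+x. ennreal (\<Prod>i\<in>I. z i ^ annulus_count j (C i) (k, x)) \<partial>PiM UNIV (\<lambda>_::nat. \<nu>) \<partial>measure_pmf (Poi t))"
    unfolding annulus_sample_def t_def[symmetric] \<nu>_def[symmetric]
    by (rule sigma_finite_measure.nn_integral_fst[OF sf meas, symmetric])
  also have "\<dots> = (\<integral>\<^sup>+k. ennreal s ^ k \<partial>measure_pmf (Poi t))"
  proof (intro nn_integral_cong)
    fix k
    have "(\<integral>\<^sup>+x. ennreal (\<Prod>i\<in>I. z i ^ annulus_count j (C i) (k, x)) \<partial>PiM UNIV (\<lambda>_::nat. \<nu>))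
      = (\<integral>\<^sup>+x. (\<Prod>l<k. ennreal (f (x l))) \<partial>PiM UNIV (\<lambda>_::nat. \<nu>))"
      unfolding prodf using f01 by (simp add: prod_ennreal)
    also have "\<dots> = (\<Prod>l<k. \<integral>\<^sup>+y. ennreal (f y) \<partial>\<nu>)"
      using fm\<nu> by (intro P.nn_integral_PiM_prod_coordinates[of _ "\<lambda>_ y. ennreal (f y)"]) auto
    finally show "(\<integral>\<^sup>+x. ennreal (\<Prod>i\<in>I. z i ^ annulus_count j (C i) (k, x)) \<partial>PiM UNIV (\<lambda>_::nat. \<nu>)) = ennreal s ^ k"
      by (simp add: nnf)
  qed
  also have "\<dots> = ennreal (exp (- ((1 - s) * t)))"
    using s01 by (intro nn_integral_Poi_power) (auto simp: t_def)
  also have "(1 - s) * t = (\<Sum>i\<in>I. (1 - z i) * (t * measure \<nu> (annulus j \<inter> C i)))"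
    unfolding s_def int_f by (simp add: sum_distrib_left sum_distrib_right mult_ac)
  also have "\<dots> = (\<Sum>i\<in>I. (1 - z i) * measure \<Lambda> (annulus j \<inter> C i))"
    using I(3) unfolding t_def \<nu>_def by (intro sum.cong refl) (simp add: annulus_law_scaled)
  finally show ?thesis .
qed

text \<open>Bounded sets meet finitely many annuli, so their generating functions are finite products over
  independent annuli and the exponents add up.\<close>

theorem poisson_process_exists: "\<exists>Q. prob_space Q \<and> sets Q = sets pp_space \<and> poisson_pgf Q \<Lambda>"
proof -
  interpret P: product_prob_space "annulus_sample \<Lambda>" UNIV
    by (intro product_prob_spaceI annulus_sample_prob)
  define \<Omega> where "\<Omega> = PiM UNIV (annulus_sample \<Lambda>)"
  have cm: "(\<lambda>\<omega>. annulus_count j B (\<omega> j)) \<in> measurable \<Omega> (count_space UNIV)" if "B \<in> sets borel" for j B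
    unfolding \<Omega>_def
    by (rule measurable_compose[OF measurable_component_singleton])
      (auto simp: annulus_sample_def intro!: measurable_annulus_count that annulus_law_sets)
  have in_ball: "\<exists>m. B \<subseteq> ball 0 (real m)" if "bounded B" for B :: "'a set"
  proof -
    obtain r where "B \<subseteq> ball 0 r" using bounded_subset_ballD[OF \<open>bounded B\<close>, of 0] by auto
    moreover obtain m :: nat where "r \<le> real m" using real_arch_simple by blast
    ultimately show ?thesis using subset_ball by blast
  qed
  have sc: "sample_config \<in> measurable \<Omega> pp_space"
  proof (rule measurable_pp_spaceI[OF sample_config_lf])
    fix B :: "'a set" assume B: "B \<in> sets borel" "bounded B"
    obtain m where "B \<subseteq> ball 0 (real m)" using in_ball[OF B(2)] by auto
    then have "(\<lambda>\<omega>. emeasure (sample_config \<omega>) B) = (\<lambda>\<omega>. \<Sum>j<m. of_nat (annulus_count j B (\<omega> j)))"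
      using emeasure_sample_config[OF B(1)] by auto
    moreover have "(\<lambda>\<omega>. of_nat (annulus_count j B (\<omega> j)) :: ennreal) \<in> borel_measurable \<Omega>" for j
      by (rule measurable_compose[OF cm[OF B(1)]]) simp
    ultimately show "(\<lambda>\<omega>. emeasure (sample_config \<omega>) B) \<in> borel_measurable \<Omega>" by simp
  qed
  have \<Omega>p: "prob_space \<Omega>" unfolding \<Omega>_def by (rule P.prob_space_axioms)
  define Q where "Q = distr \<Omega> pp_space sample_config"
  have Qp: "prob_space Q" unfolding Q_def by (rule prob_space.prob_space_distr[OF \<Omega>p sc])
  have "(\<integral>\<phi>. (\<Prod>i\<in>I. z i ^ cnt \<phi> (C i)) \<partial>Q) = exp (- (\<Sum>i\<in>I. (1 - z i) * measure \<Lambda> (C i)))"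
    if I: "finite I" "disjoint_family_on C I" "\<forall>i\<in>I. C i \<in> sets borel \<and> bounded (C i)"
      and z: "\<forall>i\<in>I. 0 \<le> z i \<and> z i \<le> (1::real)" for I :: "nat set" and C z
  proof -
    have "bounded (\<Union>i\<in>I. C i)" using I by auto
    then obtain m where m: "(\<Union>i\<in>I. C i) \<subseteq> ball 0 (real m)" using in_ball by blast
    have cnt_eq: "cnt (sample_config \<omega>) (C i) = (\<Sum>j<m. annulus_count j (C i) (\<omega> j))" if "i \<in> I" for i \<omega>
    proof -
      have "(of_nat (cnt (sample_config \<omega>) (C i)) :: ennreal) = of_nat (\<Sum>j<m. annulus_count j (C i) (\<omega> j))"
        using I(3) m that emeasure_sample_config[of "C i" m \<omega>] emeasure_lf_cnt[OF sample_config_lf, of "C i" \<omega>]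
        by (simp add: UN_subset_iff)
      then show ?thesis by (simp only: of_nat_eq_iff)
    qed
    have "(\<lambda>\<phi>. \<Prod>i\<in>I. z i ^ cnt \<phi> (C i)) \<in> borel_measurable pp_space"
      using I(3) by (intro borel_measurable_prod measurable_compose[OF measurable_cnt_pp_space]) auto
    then have "(\<integral>\<phi>. (\<Prod>i\<in>I. z i ^ cnt \<phi> (C i)) \<partial>Q) = (\<integral>\<omega>. (\<Prod>i\<in>I. z i ^ cnt (sample_config \<omega>) (C i)) \<partial>\<Omega>)"
      unfolding Q_def by (rule integral_distr[OF sc])
    also have "\<dots> = (\<integral>\<omega>. (\<Prod>j<m. \<Prod>i\<in>I. z i ^ annulus_count j (C i) (\<omega> j)) \<partial>\<Omega>)"
      by (simp add: cnt_eq power_sum prod.swap[of _ _ I] cong: prod.cong)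
    also have "\<dots> = enn2real (\<integral>\<^sup>+\<omega>. (\<Prod>j<m. ennreal (\<Prod>i\<in>I. z i ^ annulus_count j (C i) (\<omega> j))) \<partial>\<Omega>)"
    proof -
      have nn: "0 \<le> (\<Prod>i\<in>I. z i ^ annulus_count j (C i) (\<omega> j))" for j \<omega>
        using z by (intro prod_nonneg) auto
      have "(\<lambda>\<omega>. \<Prod>j<m. \<Prod>i\<in>I. z i ^ annulus_count j (C i) (\<omega> j)) \<in> borel_measurable \<Omega>"
        using I(3) by (intro borel_measurable_prod measurable_compose[OF cm]) auto
      moreover have "0 \<le> (\<Prod>j<m. \<Prod>i\<in>I. z i ^ annulus_count j (C i) (\<omega> j))" for \<omega>
        by (intro prod_nonneg nn)
      ultimately show ?thesis using nn
        by (subst integral_eq_nn_integral) (auto simp: prod_ennreal)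
    qed
    also have "(\<integral>\<^sup>+\<omega>. (\<Prod>j<m. ennreal (\<Prod>i\<in>I. z i ^ annulus_count j (C i) (\<omega> j))) \<partial>\<Omega>)
      = (\<Prod>j<m. \<integral>\<^sup>+\<eta>. ennreal (\<Prod>i\<in>I. z i ^ annulus_count j (C i) \<eta>) \<partial>annulus_sample \<Lambda> j)"
      unfolding \<Omega>_def
    proof (rule P.nn_integral_PiM_prod_coordinates)
      fix j assume "j \<in> {..<m}"
      show "(\<lambda>\<eta>. ennreal (\<Prod>i\<in>I. z i ^ annulus_count j (C i) \<eta>)) \<in> borel_measurable (annulus_sample \<Lambda> j)"
      proof (intro measurable_compose[OF _ measurable_ennreal] borel_measurable_prod)
        fix i assume "i \<in> I"
        then have "annulus_count j (C i) \<in> measurable (annulus_sample \<Lambda> j) (count_space UNIV)"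
          unfolding annulus_sample_def using I(3) by (intro measurable_annulus_count annulus_law_sets) auto
        then show "(\<lambda>\<eta>. z i ^ annulus_count j (C i) \<eta>) \<in> borel_measurable (annulus_sample \<Lambda> j)"
          by (rule measurable_compose) simp
      qed
    qed auto
    also have "\<dots> = (\<Prod>j<m. ennreal (exp (- (\<Sum>i\<in>I. (1 - z i) * measure \<Lambda> (annulus j \<inter> C i)))))"
      using I z by (intro prod.cong refl annulus_sample_pgf) auto
    also have "\<dots> = ennreal (exp (\<Sum>j<m. - (\<Sum>i\<in>I. (1 - z i) * measure \<Lambda> (annulus j \<inter> C i))))"
      by (simp add: prod_ennreal exp_sum)
    also have "(\<Sum>j<m. - (\<Sum>i\<in>I. (1 - z i) * measure \<Lambda> (annulus j \<inter> C i)))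
      = - (\<Sum>i\<in>I. (1 - z i) * (\<Sum>j<m. measure \<Lambda> (annulus j \<inter> C i)))"
      by (simp add: sum_negf sum_distrib_left sum.swap[of _ _ I])
    also have "(\<Sum>i\<in>I. (1 - z i) * (\<Sum>j<m. measure \<Lambda> (annulus j \<inter> C i))) = (\<Sum>i\<in>I. (1 - z i) * measure \<Lambda> (C i))"
    proof (intro sum.cong refl arg_cong2[where f = "(*)"])
      fix i assume i: "i \<in> I"
      have "measure \<Lambda> (\<Union>j\<in>{..<m}. annulus j \<inter> C i) = (\<Sum>j<m. measure \<Lambda> (annulus j \<inter> C i))"
      proof (rule measure_finite_Union)
        show "disjoint_family_on (\<lambda>j. annulus j \<inter> C i) {..<m}"
          unfolding disjoint_family_on_def annulus_def by auto
        show "emeasure \<Lambda> (annulus j \<inter> C i) \<noteq> \<infinity>" for j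
          using fin_L[of "annulus j \<inter> C i"] I(3) i bounded_subset[OF annulus_bounded[of j], of "annulus j \<inter> C i"]
          by auto
      qed (use I(3) i in \<open>auto simp: sets_L\<close>)
      moreover have "(\<Union>j\<in>{..<m}. annulus j \<inter> C i) = C i"
      proof (intro equalityI subsetI)
        fix x assume x: "x \<in> C i"
        then have "norm x < real m" using m i by auto
        moreover have "real (nat \<lfloor>norm x\<rfloor>) \<le> norm x" by (intro of_nat_floor) simp
        ultimately have "nat \<lfloor>norm x\<rfloor> < m" by linarith
        moreover have "x \<in> annulus (nat \<lfloor>norm x\<rfloor>)" unfolding annulus_def using norm_ge_zero[of x] by auto linarith
        ultimately show "x \<in> (\<Union>j\<in>{..<m}. annulus j \<inter> C i)" using x by auto
      qed auto
      ultimately show "(\<Sum>j<m. measure \<Lambda> (annulus j \<inter> C i)) = measure \<Lambda> (C i)" by simp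
    qed
    finally show ?thesis by simp
  qed
  then have "poisson_pgf Q \<Lambda>" unfolding poisson_pgf_def by blast
  then show ?thesis using Qp by (intro exI[of _ Q]) (auto simp: Q_def)
qed

end

section \<open>Generating functional of a thinning\<close>

text \<open>The integral of an arbitrary function is a supremum over simple minorants; countably many of them
  attain it, and their pointwise supremum is measurable.\<close>

lemma nn_integral_attained_from_below:
  fixes f :: "'a \<Rightarrow> ennreal"
  shows "\<exists>g\<in>borel_measurable M. (\<forall>x. g x \<le> f x) \<and> (\<integral>\<^sup>+x. g x \<partial>M) = (\<integral>\<^sup>+x. f x \<partial>M)"
proof -
  define A where "A = {g. simple_function M g \<and> g \<le> f}"
  have ne: "A \<noteq> {}" by (auto simp: A_def le_fun_def intro!: exI[of _ "\<lambda>_. 0"])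
  have "integral\<^sup>S M ` A \<noteq> {}" using ne by simp
  from ennreal_Sup_countable_SUP[OF this] obtain s
    where s: "range s \<subseteq> integral\<^sup>S M ` A" "Sup (integral\<^sup>S M ` A) = (SUP k::nat. s k)" by blast
  have "\<forall>k. \<exists>g. g \<in> A \<and> integral\<^sup>S M g = s k"
  proof
    fix k
    have "s k \<in> integral\<^sup>S M ` A" using s(1) by (rule subsetD) (rule rangeI)
    then show "\<exists>g. g \<in> A \<and> integral\<^sup>S M g = s k" by (elim imageE) (rule exI, rule conjI, assumption, rule sym)
  qed
  from choice[OF this] obtain G where G: "\<And>k. G k \<in> A" "\<And>k. integral\<^sup>S M (G k) = s k" by blast
  define g where "g x = (SUP k::nat. G k x)" for x
  have sG: "simple_function M (G k)" for k using G by (simp add: A_def)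
  have gm: "g \<in> borel_measurable M" unfolding g_def using sG by (intro borel_measurable_SUP borel_measurable_simple_function) auto
  have gf: "g x \<le> f x" for x unfolding g_def using G(1) by (intro SUP_least) (auto simp: A_def le_fun_def)
  have "(\<integral>\<^sup>+x. f x \<partial>M) = (SUP k. s k)"
    unfolding nn_integral_def A_def[symmetric] using s(2) by simp
  also have "\<dots> \<le> (\<integral>\<^sup>+x. g x \<partial>M)"
  proof (rule SUP_least)
    fix k
    have "s k = (\<integral>\<^sup>+x. G k x \<partial>M)" using nn_integral_eq_simple_integral[OF sG] G(2) by simp
    also have "\<dots> \<le> (\<integral>\<^sup>+x. g x \<partial>M)" by (intro nn_integral_mono) (auto simp: g_def intro: SUP_upper)
    finally show "s k \<le> (\<integral>\<^sup>+x. g x \<partial>M)" .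
  qed
  finally have "(\<integral>\<^sup>+x. f x \<partial>M) \<le> (\<integral>\<^sup>+x. g x \<partial>M)" .
  moreover have "(\<integral>\<^sup>+x. g x \<partial>M) \<le> (\<integral>\<^sup>+x. f x \<partial>M)" using gf by (intro nn_integral_mono)
  ultimately show ?thesis using gm gf by (intro bexI[of _ g]) auto
qed

text \<open>The kernel need not be measurable in \<open>\<omega>\<close>, so its integral is a priori only a lower integral. Applying the disintegration to a set and to its complement shows that lower and
  upper integral agree, hence the kernel is measurable up to a null set.\<close>

lemma (in prob_space) disintegration_nn_integral:
  fixes \<kappa> :: "'a \<Rightarrow> 'b measure"
  assumes Y [measurable]: "Y \<in> measurable M N"
    and \<kappa>: "\<And>\<omega>. \<omega> \<in> space M \<Longrightarrow> prob_space (\<kappa> \<omega>)" "\<And>\<omega>. \<omega> \<in> space M \<Longrightarrow> sets (\<kappa> \<omega>) = sets N"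
    and dis: "\<And>B. B \<in> sets N \<Longrightarrow> emeasure M {\<omega> \<in> space M. Y \<omega> \<in> B} = (\<integral>\<^sup>+\<omega>. emeasure (\<kappa> \<omega>) B \<partial>M)"
    and G: "G \<in> borel_measurable N"
  shows "\<exists>h\<in>borel_measurable M. (AE \<omega> in M. (\<integral>\<^sup>+y. G y \<partial>\<kappa> \<omega>) = h \<omega>) \<and> (\<integral>\<^sup>+\<omega>. h \<omega> \<partial>M) = (\<integral>\<^sup>+\<omega>. G (Y \<omega>) \<partial>M)"
  using G
proof (induction rule: borel_measurable_induct)
  case (cong f g)
  have e1: "(\<integral>\<^sup>+y. f y \<partial>\<kappa> \<omega>) = (\<integral>\<^sup>+y. g y \<partial>\<kappa> \<omega>)" if "\<omega> \<in> space M" for \<omega>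
    using cong(3) sets_eq_imp_space_eq[OF \<kappa>(2)[OF that]] by (intro nn_integral_cong) auto
  have e2: "(\<integral>\<^sup>+\<omega>. f (Y \<omega>) \<partial>M) = (\<integral>\<^sup>+\<omega>. g (Y \<omega>) \<partial>M)"
    using cong(3) measurable_space[OF Y] by (intro nn_integral_cong) auto
  obtain h where h: "h\<in>borel_measurable M" "AE \<omega> in M. (\<integral>\<^sup>+y. g y \<partial>\<kappa> \<omega>) = h \<omega>" "(\<integral>\<^sup>+\<omega>. h \<omega> \<partial>M) = (\<integral>\<^sup>+\<omega>. g (Y \<omega>) \<partial>M)"
    using cong(4) by blast
  have "AE \<omega> in M. (\<integral>\<^sup>+y. f y \<partial>\<kappa> \<omega>) = h \<omega>"
    using h(2) AE_space by eventually_elim (simp add: e1)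
  then show ?case using h e2 by (intro bexI[of _ h] conjI) simp_all
next
  case (set B)
  have "emeasure M {\<omega> \<in> space M. Y \<omega> \<in> B} = (\<integral>\<^sup>+\<omega>. emeasure (\<kappa> \<omega>) B \<partial>M)" by (rule dis[OF set])
  then obtain g1 where g1 [measurable]: "g1 \<in> borel_measurable M" "\<And>\<omega>. g1 \<omega> \<le> emeasure (\<kappa> \<omega>) B"
    "(\<integral>\<^sup>+\<omega>. g1 \<omega> \<partial>M) = emeasure M {\<omega> \<in> space M. Y \<omega> \<in> B}"
    using nn_integral_attained_from_below[of M "\<lambda>\<omega>. emeasure (\<kappa> \<omega>) B"] by auto
  define B' where "B' = space N - B"
  have B': "B' \<in> sets N" using set by (auto simp: B'_def)
  have "emeasure M {\<omega> \<in> space M. Y \<omega> \<in> B'} = (\<integral>\<^sup>+\<omega>. emeasure (\<kappa> \<omega>) B' \<partial>M)" by (rule dis[OF B'])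
  then obtain g2 where g2 [measurable]: "g2 \<in> borel_measurable M" "\<And>\<omega>. g2 \<omega> \<le> emeasure (\<kappa> \<omega>) B'"
    "(\<integral>\<^sup>+\<omega>. g2 \<omega> \<partial>M) = emeasure M {\<omega> \<in> space M. Y \<omega> \<in> B'}"
    using nn_integral_attained_from_below[of M "\<lambda>\<omega>. emeasure (\<kappa> \<omega>) B'"] by auto
  have sum1: "emeasure (\<kappa> \<omega>) B + emeasure (\<kappa> \<omega>) B' = 1" if "\<omega> \<in> space M" for \<omega>
  proof -
    have sp: "space (\<kappa> \<omega>) = space N" by (rule sets_eq_imp_space_eq[OF \<kappa>(2)[OF that]])
    have "emeasure (\<kappa> \<omega>) B + emeasure (\<kappa> \<omega>) B' = emeasure (\<kappa> \<omega>) (B \<union> B')"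
      using set B' \<kappa>(2)[OF that] by (intro plus_emeasure) (auto simp: B'_def)
    also have "B \<union> B' = space (\<kappa> \<omega>)" using sets.sets_into_space[OF set] by (auto simp: B'_def sp)
    finally show ?thesis using prob_space.emeasure_space_1[OF \<kappa>(1)[OF that]] by simp
  qed
  have "(\<integral>\<^sup>+\<omega>. (g1 \<omega> + g2 \<omega>) \<partial>M) = emeasure M {\<omega> \<in> space M. Y \<omega> \<in> B} + emeasure M {\<omega> \<in> space M. Y \<omega> \<in> B'}"
    by (simp add: nn_integral_add g1(3) g2(3))
  also have "\<dots> = emeasure M ({\<omega> \<in> space M. Y \<omega> \<in> B} \<union> {\<omega> \<in> space M. Y \<omega> \<in> B'})"
    using set B' by (intro plus_emeasure) (auto simp: B'_def)
  also have "{\<omega> \<in> space M. Y \<omega> \<in> B} \<union> {\<omega> \<in> space M. Y \<omega> \<in> B'} = space M"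
    using measurable_space[OF Y] by (auto simp: B'_def)
  finally have tot: "(\<integral>\<^sup>+\<omega>. (g1 \<omega> + g2 \<omega>) \<partial>M) = 1" by (simp add: emeasure_space_1)
  have le1: "g1 \<omega> + g2 \<omega> \<le> 1" if "\<omega> \<in> space M" for \<omega>
    using add_mono[OF g1(2)[of \<omega>] g2(2)[of \<omega>]] sum1[OF that] by simp
  have "(\<integral>\<^sup>+\<omega>. (1 - (g1 \<omega> + g2 \<omega>)) \<partial>M) = (\<integral>\<^sup>+\<omega>. 1 \<partial>M) - (\<integral>\<^sup>+\<omega>. (g1 \<omega> + g2 \<omega>) \<partial>M)"
    using le1 tot by (intro nn_integral_diff) auto
  then have "(\<integral>\<^sup>+\<omega>. (1 - (g1 \<omega> + g2 \<omega>)) \<partial>M) = 0" by (simp add: tot emeasure_space_1)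
  then have ae: "AE \<omega> in M. 1 - (g1 \<omega> + g2 \<omega>) = 0" by (subst (asm) nn_integral_0_iff_AE) auto
  have "AE \<omega> in M. (\<integral>\<^sup>+y. indicator B y \<partial>\<kappa> \<omega>) = g1 \<omega>"
    using ae AE_space
  proof eventually_elim
    case (elim \<omega>)
    have eq1: "g1 \<omega> + g2 \<omega> = 1" using le1[OF elim(2)] ennreal_minus_eq_0[OF elim(1)] by (rule antisym)
    have "emeasure (\<kappa> \<omega>) B + g2 \<omega> \<le> emeasure (\<kappa> \<omega>) B + emeasure (\<kappa> \<omega>) B'" by (intro add_left_mono g2(2))
    also have "\<dots> = g1 \<omega> + g2 \<omega>" using sum1 eq1 elim by simp
    finally have "emeasure (\<kappa> \<omega>) B + g2 \<omega> \<le> g1 \<omega> + g2 \<omega>" .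
    moreover have "g2 \<omega> \<noteq> \<infinity>" using eq1 by auto
    ultimately have "emeasure (\<kappa> \<omega>) B \<le> g1 \<omega>" by (simp add: ennreal_add_left_cancel_le add.commute)
    then have "emeasure (\<kappa> \<omega>) B = g1 \<omega>" using g1(2)[of \<omega>] by simp
    then show ?case using set \<kappa>(2)[of \<omega>] elim by simp
  qed
  moreover have "(\<integral>\<^sup>+\<omega>. indicator B (Y \<omega>) \<partial>M) = emeasure M {\<omega> \<in> space M. Y \<omega> \<in> B}"
  proof -
    have "(\<integral>\<^sup>+\<omega>. indicator B (Y \<omega>) \<partial>M) = (\<integral>\<^sup>+\<omega>. indicator {\<omega> \<in> space M. Y \<omega> \<in> B} \<omega> \<partial>M)"
      by (intro nn_integral_cong) (auto simp: indicator_def)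
    also have "\<dots> = emeasure M {\<omega> \<in> space M. Y \<omega> \<in> B}"
      using measurable_sets[OF Y set] by (intro nn_integral_indicator) (simp add: vimage_def Int_def conj_commute)
    finally show ?thesis .
  qed
  ultimately show ?case using g1 by (intro bexI[of _ g1]) auto
next
  case (mult f c)
  obtain h where h: "h\<in>borel_measurable M" "AE \<omega> in M. (\<integral>\<^sup>+y. f y \<partial>\<kappa> \<omega>) = h \<omega>" "(\<integral>\<^sup>+\<omega>. h \<omega> \<partial>M) = (\<integral>\<^sup>+\<omega>. f (Y \<omega>) \<partial>M)"
    using mult by blast
  have "AE \<omega> in M. (\<integral>\<^sup>+y. c * f y \<partial>\<kappa> \<omega>) = c * h \<omega>"
    using h(2) AE_space by eventually_elim
      (subst nn_integral_cmult, auto simp: measurable_cong_sets[OF \<kappa>(2) refl] mult)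
  then show ?case using h mult(2)
    by (intro bexI[of _ "\<lambda>\<omega>. c * h \<omega>"]) (auto simp: nn_integral_cmult measurable_compose[OF Y])
next
  case (add f g)
  obtain h where h: "h\<in>borel_measurable M" "AE \<omega> in M. (\<integral>\<^sup>+y. f y \<partial>\<kappa> \<omega>) = h \<omega>" "(\<integral>\<^sup>+\<omega>. h \<omega> \<partial>M) = (\<integral>\<^sup>+\<omega>. f (Y \<omega>) \<partial>M)"
    using add by blast
  obtain k where k: "k\<in>borel_measurable M" "AE \<omega> in M. (\<integral>\<^sup>+y. g y \<partial>\<kappa> \<omega>) = k \<omega>" "(\<integral>\<^sup>+\<omega>. k \<omega> \<partial>M) = (\<integral>\<^sup>+\<omega>. g (Y \<omega>) \<partial>M)"
    using add by blast
  have "AE \<omega> in M. (\<integral>\<^sup>+y. (g y + f y) \<partial>\<kappa> \<omega>) = k \<omega> + h \<omega>"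
    using h(2) k(2) AE_space by eventually_elim
      (subst nn_integral_add, auto simp: measurable_cong_sets[OF \<kappa>(2) refl] add)
  then show ?case using h k add
    by (intro bexI[of _ "\<lambda>\<omega>. k \<omega> + h \<omega>"]) (auto simp: nn_integral_add measurable_compose[OF Y])
next
  case (seq U)
  have "\<forall>i. \<exists>h. h\<in>borel_measurable M \<and> (AE \<omega> in M. (\<integral>\<^sup>+y. U i y \<partial>\<kappa> \<omega>) = h \<omega>) \<and> (\<integral>\<^sup>+\<omega>. h \<omega> \<partial>M) = (\<integral>\<^sup>+\<omega>. U i (Y \<omega>) \<partial>M)"
    using seq by blast
  from choice[OF this] obtain h where h: "\<And>i. h i\<in>borel_measurable M"
    "\<And>i. AE \<omega> in M. (\<integral>\<^sup>+y. U i y \<partial>\<kappa> \<omega>) = h i \<omega>" "\<And>i. (\<integral>\<^sup>+\<omega>. h i \<omega> \<partial>M) = (\<integral>\<^sup>+\<omega>. U i (Y \<omega>) \<partial>M)" by blast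
  have all: "AE \<omega> in M. \<forall>i. (\<integral>\<^sup>+y. U i y \<partial>\<kappa> \<omega>) = h i \<omega>" using h(2) by (simp add: AE_all_countable)
  have inc: "AE \<omega> in M. h i \<omega> \<le> h (Suc i) \<omega>" for i
    using all
  proof eventually_elim
    case (elim \<omega>)
    have "(\<integral>\<^sup>+y. U i y \<partial>\<kappa> \<omega>) \<le> (\<integral>\<^sup>+y. U (Suc i) y \<partial>\<kappa> \<omega>)"
      using seq(3) by (intro nn_integral_mono) (auto simp: incseq_Suc_iff le_fun_def)
    then show ?case using elim by simp
  qed
  have "AE \<omega> in M. (\<integral>\<^sup>+y. (SUP i. U i) y \<partial>\<kappa> \<omega>) = (SUP i. h i \<omega>)"
    using all AE_space
  proof eventually_elim
    case (elim \<omega>)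
    have "(\<integral>\<^sup>+y. (SUP i. U i y) \<partial>\<kappa> \<omega>) = (SUP i. \<integral>\<^sup>+y. U i y \<partial>\<kappa> \<omega>)"
      using seq elim by (intro nn_integral_monotone_convergence_SUP) (auto simp: measurable_cong_sets[OF \<kappa>(2) refl])
    then show ?case using elim by (simp add: image_comp)
  qed
  moreover have "(\<integral>\<^sup>+\<omega>. (SUP i. h i \<omega>) \<partial>M) = (\<integral>\<^sup>+\<omega>. (SUP i. U i) (Y \<omega>) \<partial>M)"
  proof -
    have "(\<integral>\<^sup>+\<omega>. (SUP i. h i \<omega>) \<partial>M) = (SUP i. \<integral>\<^sup>+\<omega>. h i \<omega> \<partial>M)"
      using h inc by (intro nn_integral_monotone_convergence_SUP_AE) auto
    also have "\<dots> = (SUP i. \<integral>\<^sup>+\<omega>. U i (Y \<omega>) \<partial>M)" using h by simp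
    also have "\<dots> = (\<integral>\<^sup>+\<omega>. (SUP i. U i (Y \<omega>)) \<partial>M)"
      using seq by (intro nn_integral_monotone_convergence_SUP[symmetric])
        (auto simp: incseq_def le_fun_def measurable_compose[OF Y])
    finally show ?thesis by (simp add: image_comp)
  qed
  ultimately show ?case using h by (intro bexI[of _ "\<lambda>\<omega>. SUP i. h i \<omega>"]) auto
qed

lemma emeasure_counting_measure_on:
  assumes "B \<in> sets borel" "finite (A \<inter> B)"
  shows "emeasure (counting_measure_on A) B = of_nat (card (A \<inter> B))"
  using assms by (simp add: counting_measure_on_def emeasure_distr Int_commute emeasure_count_space)

definition locally_finite_set :: "'a::euclidean_space set \<Rightarrow> bool" where
  "locally_finite_set A \<longleftrightarrow> (\<forall>W. bounded W \<longrightarrow> finite (A \<inter> W))"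

lemma locally_finite_subset: "locally_finite_set A \<Longrightarrow> A' \<subseteq> A \<Longrightarrow> locally_finite_set A'"
  unfolding locally_finite_set_def by (meson Int_mono finite_subset order_refl)

lemma counting_measure_on_lf:
  assumes "locally_finite_set A"
  shows "counting_measure_on A \<in> lf_counting"
proof -
  have "sets (counting_measure_on A) = sets borel" by (simp add: counting_measure_on_def)
  then show ?thesis using assms emeasure_counting_measure_on[of _ A]
    by (simp add: lf_counting_def locally_finite_set_def)
qed

lemma emeasure_counting_measure_on_singleton:
  "emeasure (counting_measure_on A) {x} = (if x \<in> A then 1 else 0)"
  using emeasure_counting_measure_on[of "{x}" A] by (cases "x \<in> A") auto

lemma atoms_counting_measure_on: "atoms (counting_measure_on A) = A"
  by (simp add: atoms_def emeasure_counting_measure_on_singleton)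

lemma cnt_counting_measure_on_singleton: "x \<in> A \<Longrightarrow> cnt (counting_measure_on A) {x} = 1"
  by (simp add: cnt_def measure_def emeasure_counting_measure_on_singleton)

lemma thinned_configuration_measurable:
  fixes A :: "'a::euclidean_space set"
  assumes A: "locally_finite_set A"
  shows "(\<lambda>b. counting_measure_on {x \<in> A. b x}) \<in> measurable (PiM A (\<lambda>x. measure_pmf (p x))) pp_space"
proof (rule measurable_pp_spaceI)
  have lfs: "locally_finite_set {x \<in> A. b x}" for b
    by (rule locally_finite_subset[OF A]) auto
  show "counting_measure_on {x \<in> A. b x} \<in> lf_counting" for b
    by (rule counting_measure_on_lf[OF lfs])
  fix B :: "'a set" assume B: "B \<in> sets borel" "bounded B"
  have fin: "finite (A \<inter> B)" using A B by (auto simp: locally_finite_set_def)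
  have "emeasure (counting_measure_on {x \<in> A. b x}) B = (\<Sum>x\<in>A \<inter> B. of_bool (b x))" for b
  proof -
    have "{x \<in> A. b x} \<inter> B = {x \<in> A \<inter> B. b x}" by auto
    then have "emeasure (counting_measure_on {x \<in> A. b x}) B = of_nat (card {x \<in> A \<inter> B. b x})"
      using fin B by (subst emeasure_counting_measure_on) (auto intro: finite_subset[of _ "A \<inter> B"])
    also have "card {x \<in> A \<inter> B. b x} = (\<Sum>x\<in>A \<inter> B. of_bool (b x))"
      using fin by (simp add: of_bool_def sum.If_cases Int_def)
    finally show ?thesis by simp
  qed
  moreover have "(\<lambda>b. \<Sum>x\<in>A \<inter> B. of_bool (b x) :: ennreal) \<in> borel_measurable (PiM A (\<lambda>x. measure_pmf (p x)))"
  proof (intro borel_measurable_sum)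
    fix x assume "x \<in> A \<inter> B"
    then show "(\<lambda>b. of_bool (b x) :: ennreal) \<in> borel_measurable (PiM A (\<lambda>x. measure_pmf (p x)))"
      by (intro measurable_compose[OF measurable_component_singleton, of x A]) auto
  qed
  ultimately show "(\<lambda>b. emeasure (counting_measure_on {x \<in> A. b x}) B) \<in> borel_measurable (PiM A (\<lambda>x. measure_pmf (p x)))"
    by simp
qed

lemma thin_law_prob:
  assumes "locally_finite_set A"
  shows "prob_space (thin_law q r A)" "sets (thin_law q r A) = sets pp_space"
  unfolding thin_law_def
  by (auto intro!: prob_space.prob_space_distr prob_space_PiM thinned_configuration_measurable[OF assms] measure_pmf.prob_space_axioms)

text \<open>Independent retention turns the expected product into the product of the single-point
  expectations \<open>q (1 - u) + (1 - q) = 1 - q u\<close>.\<close>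

lemma nn_integral_gfun_thin_law:
  fixes A :: "'a::euclidean_space set"
  assumes A: "locally_finite_set A" and q: "\<And>k. 0 \<le> q k \<and> q k \<le> 1" and u: "u \<in> test_functions"
    and W: "bounded W" "{x. u x \<noteq> 0} \<subseteq> W"
  shows "(\<integral>\<^sup>+\<psi>. ennreal (gfun u \<psi>) \<partial>thin_law q r A) = ennreal (\<Prod>x\<in>A \<inter> W. 1 - q (nbr_count r x A) * u x)"
proof -
  define p where "p x = bernoulli_pmf (q (nbr_count r x A))" for x
  interpret P: product_prob_space "\<lambda>x. measure_pmf (p x)" A
    by (intro product_prob_spaceI measure_pmf.prob_space_axioms)
  have u01: "\<And>x. 0 \<le> u x \<and> u x \<le> 1" using u by (auto simp: test_functions_def)
  have fin: "finite (A \<inter> W)" using A W by (auto simp: locally_finite_set_def)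
  have lfs: "locally_finite_set {x \<in> A. b x}" for b
    by (rule locally_finite_subset[OF A]) auto
  have gf: "gfun u (counting_measure_on {x \<in> A. b x}) = (\<Prod>x\<in>A \<inter> W. if b x then 1 - u x else 1)" for b
  proof -
    have "gfun u (counting_measure_on {x \<in> A. b x}) = (\<Prod>x\<in>{x \<in> A. b x} \<inter> W. (1 - u x) ^ cnt (counting_measure_on {x \<in> A. b x}) {x})"
      using gfun_eq_prod_Int[OF counting_measure_on_lf[OF lfs] W(1), of u b] W(2) by (simp add: atoms_counting_measure_on)
    also have "\<dots> = (\<Prod>x\<in>{x \<in> A. b x} \<inter> W. 1 - u x)"
      by (intro prod.cong refl) (simp add: cnt_counting_measure_on_singleton)
    also have "{x \<in> A. b x} \<inter> W = {x \<in> A \<inter> W. b x}" by auto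
    also have "(\<Prod>x\<in>{x \<in> A \<inter> W. b x}. 1 - u x) = (\<Prod>x\<in>A \<inter> W. if b x then 1 - u x else 1)"
      using fin by (rule prod.inter_filter)
    finally show ?thesis .
  qed
  have gm: "(\<lambda>\<psi>. ennreal (gfun u \<psi>)) \<in> borel_measurable pp_space"
    by (intro measurable_compose[OF measurable_gfun[OF u]]) simp
  have "(\<integral>\<^sup>+\<psi>. ennreal (gfun u \<psi>) \<partial>thin_law q r A)
    = (\<integral>\<^sup>+b. ennreal (gfun u (counting_measure_on {x \<in> A. b x})) \<partial>PiM A (\<lambda>x. measure_pmf (p x)))"
    unfolding thin_law_def p_def[symmetric] using gm
    by (intro nn_integral_distr thinned_configuration_measurable[OF A]) simp
  also have "\<dots> = (\<integral>\<^sup>+b. (\<Prod>x\<in>A \<inter> W. ennreal (if b x then 1 - u x else 1)) \<partial>PiM A (\<lambda>x. measure_pmf (p x)))"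
    unfolding gf using u01 by (intro nn_integral_cong prod_ennreal[symmetric]) auto
  also have "\<dots> = (\<Prod>x\<in>A \<inter> W. \<integral>\<^sup>+b. ennreal (if b then 1 - u x else 1) \<partial>measure_pmf (p x))"
    by (rule P.nn_integral_PiM_prod_coordinates[OF fin, of "\<lambda>x b. ennreal (if b then 1 - u x else 1)"]) auto
  also have "\<dots> = (\<Prod>x\<in>A \<inter> W. ennreal (1 - q (nbr_count r x A) * u x))"
  proof (intro prod.cong refl)
    fix x
    have "(\<integral>\<^sup>+b. ennreal (if b then 1 - u x else 1) \<partial>measure_pmf (p x))
      = ennreal (1 - u x) * ennreal (q (nbr_count r x A)) + ennreal (1 - q (nbr_count r x A))"
      unfolding p_def using q by (subst nn_integral_bernoulli_pmf) auto
    also have "\<dots> = ennreal ((1 - u x) * q (nbr_count r x A) + (1 - q (nbr_count r x A)))"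
      using q u01 by (simp add: ennreal_mult ennreal_plus)
    finally show "(\<integral>\<^sup>+b. ennreal (if b then 1 - u x else 1) \<partial>measure_pmf (p x)) = ennreal (1 - q (nbr_count r x A) * u x)"
      by (simp add: algebra_simps)
  qed
  also have "\<dots> = ennreal (\<Prod>x\<in>A \<inter> W. 1 - q (nbr_count r x A) * u x)"
    using q u01 by (intro prod_ennreal) (simp add: mult_le_one)
  finally show ?thesis .
qed

lemma locally_finite_atoms: "\<phi> \<in> lf_counting \<Longrightarrow> locally_finite_set (atoms \<phi>)"
  by (simp add: locally_finite_set_def finite_atoms_Int)

text \<open>The product on the right is known to be measurable in \<open>\<omega>\<close> only up to a null set, hence the
  measurable version \<open>h\<close>.\<close>

lemma (in prob_space) apgf_nbr_thinning:
  fixes S :: "'a \<Rightarrow> 'b::euclidean_space measure"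
  assumes thin: "nbr_thinning M q r S Y" and S: "\<And>\<omega>. \<omega> \<in> space M \<Longrightarrow> S \<omega> \<in> lf_counting"
    and Sm: "S \<in> measurable M pp_space"
    and q: "\<And>k. 0 \<le> q k \<and> q k \<le> 1" and u: "u \<in> test_functions"
    and W: "bounded W" "{x. u x \<noteq> 0} \<subseteq> W"
  shows "\<exists>h\<in>borel_measurable M. (AE \<omega> in M. h \<omega> = (\<Prod>x\<in>atoms (S \<omega>) \<inter> W. 1 - q (nbr_count r x (atoms (S \<omega>))) * u x))
    \<and> apgf M Y u = (\<integral>\<omega>. h \<omega> \<partial>M)"
proof -
  define \<kappa> where "\<kappa> \<omega> = thin_law q r (atoms (S \<omega>))" for \<omega>
  have Y: "Y \<in> measurable M pp_space" using thin by (simp add: nbr_thinning_def)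
  have u01: "\<And>x. 0 \<le> u x \<and> u x \<le> 1" using u by (auto simp: test_functions_def)
  have dis: "emeasure M {\<omega> \<in> space M. Y \<omega> \<in> B} = (\<integral>\<^sup>+\<omega>. emeasure (\<kappa> \<omega>) B \<partial>M)" if "B \<in> sets pp_space" for B
  proof -
    have "emeasure M {\<omega> \<in> space M. S \<omega> \<in> space pp_space \<and> Y \<omega> \<in> B} = (\<integral>\<^sup>+\<omega>. indicator (space pp_space) (S \<omega>) * emeasure (\<kappa> \<omega>) B \<partial>M)"
      using thin that unfolding nbr_thinning_def \<kappa>_def by blast
    also have "\<dots> = (\<integral>\<^sup>+\<omega>. emeasure (\<kappa> \<omega>) B \<partial>M)" using S by (intro nn_integral_cong) simp
    also have "{\<omega> \<in> space M. S \<omega> \<in> space pp_space \<and> Y \<omega> \<in> B} = {\<omega> \<in> space M. Y \<omega> \<in> B}" using S by auto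
    finally show ?thesis .
  qed
  have gm: "(\<lambda>\<psi>. ennreal (gfun u \<psi>)) \<in> borel_measurable pp_space"
    by (intro measurable_compose[OF measurable_gfun[OF u]]) simp
  obtain h where h: "h \<in> borel_measurable M" "AE \<omega> in M. (\<integral>\<^sup>+\<psi>. ennreal (gfun u \<psi>) \<partial>\<kappa> \<omega>) = h \<omega>"
    "(\<integral>\<^sup>+\<omega>. h \<omega> \<partial>M) = (\<integral>\<^sup>+\<omega>. ennreal (gfun u (Y \<omega>)) \<partial>M)"
    using disintegration_nn_integral[OF Y _ _ dis gm] thin_law_prob[OF locally_finite_atoms[OF S]] unfolding \<kappa>_def by blast
  have pos: "0 \<le> (\<Prod>x\<in>atoms (S \<omega>) \<inter> W. 1 - q (nbr_count r x (atoms (S \<omega>))) * u x)" for \<omega>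
    using q u01 by (intro prod_nonneg) (simp add: mult_le_one)
  have he: "AE \<omega> in M. h \<omega> = ennreal (\<Prod>x\<in>atoms (S \<omega>) \<inter> W. 1 - q (nbr_count r x (atoms (S \<omega>))) * u x)"
    using h(2) AE_space
  proof eventually_elim
    case (elim \<omega>)
    then show ?case
      using nn_integral_gfun_thin_law[OF locally_finite_atoms[OF S[OF elim(2)]] q u W] by (simp add: \<kappa>_def)
  qed
  have "AE \<omega> in M. enn2real (h \<omega>) = (\<Prod>x\<in>atoms (S \<omega>) \<inter> W. 1 - q (nbr_count r x (atoms (S \<omega>))) * u x)"
    using he by eventually_elim (simp add: pos)
  moreover have "apgf M Y u = (\<integral>\<omega>. enn2real (h \<omega>) \<partial>M)"
  proof -
    have "apgf M Y u = enn2real (\<integral>\<^sup>+\<omega>. ennreal (gfun u (Y \<omega>)) \<partial>M)"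
      unfolding apgf_eq_gfun using gfun_bounds[OF u]
      by (intro integral_eq_nn_integral measurable_compose[OF Y measurable_gfun[OF u]]) auto
    also have "\<dots> = enn2real (\<integral>\<^sup>+\<omega>. ennreal (enn2real (h \<omega>)) \<partial>M)"
    proof -
      have "AE \<omega> in M. h \<omega> = ennreal (enn2real (h \<omega>))" using he by eventually_elim (simp add: pos)
      then show ?thesis unfolding h(3)[symmetric] by (intro arg_cong[where f = enn2real] nn_integral_cong_AE)
    qed
    also have "\<dots> = (\<integral>\<omega>. enn2real (h \<omega>) \<partial>M)"
      using h(1) by (intro integral_eq_nn_integral[symmetric]) auto
    finally show ?thesis .
  qed
  ultimately show ?thesis using h(1) by (intro bexI[of _ "\<lambda>\<omega>. enn2real (h \<omega>)"]) auto
qed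

section \<open>The law of a single summand\<close>

lemma measurable_emeasure_cball:
  assumes \<kappa>: "\<kappa> \<in> measurable L pp_space" and x [measurable]: "x \<in> borel_measurable L"
  shows "(\<lambda>l. emeasure (\<kappa> l) (cball (x l) r)) \<in> borel_measurable L"
proof -
  have "(\<lambda>p. dist (x (fst p)) (snd p)) \<in> borel_measurable (L \<Otimes>\<^sub>M borel)" by measurable
  then have "(\<lambda>p. indicator {..r} (dist (x (fst p)) (snd p)) :: ennreal) \<in> borel_measurable (L \<Otimes>\<^sub>M borel)"
    by (rule measurable_compose) simp
  moreover have "indicator {..r} (dist (x (fst p)) (snd p)) = (indicator (cball (x (fst p)) r) (snd p) :: ennreal)" for p
    by (simp add: indicator_def)
  ultimately have "(\<lambda>(l, y). indicator (cball (x l) r) y :: ennreal) \<in> borel_measurable (L \<Otimes>\<^sub>M borel)"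
    by (simp add: split_beta')
  from measurable_nn_integral_kernel[OF \<kappa> this]
  have m: "(\<lambda>l. \<integral>\<^sup>+y. indicator (cball (x l) r) y \<partial>\<kappa> l) \<in> borel_measurable L" .
  have "(\<integral>\<^sup>+y. indicator (cball (x l) r) y \<partial>\<kappa> l) = emeasure (\<kappa> l) (cball (x l) r)" if "l \<in> space L" for l
    using lf_sets[of "\<kappa> l"] measurable_space[OF \<kappa> that] by (intro nn_integral_indicator) simp
  then show ?thesis using m by (subst measurable_cong[where g = "\<lambda>l. \<integral>\<^sup>+y. indicator (cball (x l) r) y \<partial>\<kappa> l"]) simp_all
qed

lemma measurable_cnt_cball:
  assumes "\<kappa> \<in> measurable L pp_space" "x \<in> borel_measurable L"
  shows "(\<lambda>l. cnt (\<kappa> l) (cball (x l) r)) \<in> measurable L (count_space UNIV)"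
  unfolding cnt_def measure_def
  by (rule measurable_compose[OF borel_measurable_enn2real[OF measurable_emeasure_cball[OF assms]] measurable_nat_floor])

definition simple_config :: "'a::euclidean_space measure \<Rightarrow> bool" where
  "simple_config \<phi> \<longleftrightarrow> (\<forall>x. cnt \<phi> {x} \<le> 1)"

lemma simple_config_atom: "\<phi> \<in> lf_counting \<Longrightarrow> simple_config \<phi> \<Longrightarrow> x \<in> atoms \<phi> \<Longrightarrow> cnt \<phi> {x} = 1"
  using atoms_ge_1 unfolding simple_config_def by (metis le_antisym)

lemma cnt_simple_config:
  assumes "\<phi> \<in> lf_counting" "simple_config \<phi>" "bounded W" "W \<in> sets borel"
  shows "cnt \<phi> W = card (atoms \<phi> \<inter> W)"
  using cnt_eq_sum_atoms[OF assms(1,3,4)] simple_config_atom[OF assms(1,2)] by simp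

text \<open>Simplicity is a statement about uncountably many points. Integrating the indicator of a
  multiple point against the configuration itself makes it a measurable event.\<close>

lemma sets_simple_config: "{\<phi> \<in> lf_counting. simple_config (\<phi> :: 'a::euclidean_space measure)} \<in> sets pp_space"
proof -
  define Z where "Z m \<phi> = (\<integral>\<^sup>+y. of_bool (2 \<le> cnt \<phi> (cball y 0)) * indicator (cball 0 (real m)) y \<partial>\<phi>)"
    for m :: nat and \<phi> :: "'a measure"
  have "(\<lambda>p. cnt (fst p) (cball (snd p) 0)) \<in> measurable (pp_space \<Otimes>\<^sub>M (borel :: 'a measure)) (count_space UNIV)"
    by (rule measurable_cnt_cball) measurable
  then have "(\<lambda>p. of_bool (2 \<le> cnt (fst p) (cball (snd p) 0)) :: ennreal) \<in> borel_measurable (pp_space \<Otimes>\<^sub>M (borel :: 'a measure))"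
    by (rule measurable_compose) simp
  moreover have "(\<lambda>p. indicator (cball 0 (real m)) (snd p) :: ennreal) \<in> borel_measurable (pp_space \<Otimes>\<^sub>M (borel :: 'a measure))" for m :: nat
    by (rule measurable_compose[OF measurable_snd], intro borel_measurable_indicator) simp
  ultimately have "Z m \<in> borel_measurable pp_space" for m
    unfolding Z_def
    by (intro measurable_nn_integral_kernel[where \<kappa> = "\<lambda>\<phi>. \<phi>", OF measurable_ident_sets[OF refl]],
        unfold split_beta', intro borel_measurable_times_ennreal)
  then have "Z m -` {0} \<inter> space pp_space \<in> sets pp_space" for m by (rule measurable_sets) simp
  then have "(\<Inter>m\<in>UNIV. Z m -` {0} \<inter> space pp_space) \<in> sets pp_space" by (intro sets.countable_INT') auto
  moreover have "(\<Inter>m\<in>UNIV. Z m -` {0} \<inter> space pp_space) = {\<phi> \<in> lf_counting. simple_config \<phi>}"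
  proof -
    have "(\<forall>m. Z m \<phi> = 0) \<longleftrightarrow> simple_config \<phi>" if lf: "\<phi> \<in> lf_counting" for \<phi>
    proof -
      have "(\<lambda>y. of_bool (2 \<le> cnt \<phi> (cball y 0)) :: ennreal) \<in> borel_measurable borel"
        by (rule measurable_compose[OF measurable_cnt_cball[of "\<lambda>_. \<phi>" borel "\<lambda>y. y" 0]]) (auto simp: lf)
      from nn_integral_lf_atoms[OF lf bounded_cball _ this]
      have Z: "Z m \<phi> = (\<Sum>x\<in>atoms \<phi> \<inter> cball 0 (real m). of_bool (2 \<le> cnt \<phi> {x}) * of_nat (cnt \<phi> {x}))" for m
        unfolding Z_def by simp
      have fin: "finite (atoms \<phi> \<inter> cball 0 (real m))" for m by (rule finite_atoms_Int[OF lf bounded_cball])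
      have "(\<forall>m. Z m \<phi> = 0) \<longleftrightarrow> (\<forall>m::nat. \<forall>x\<in>atoms \<phi> \<inter> cball 0 (real m). \<not> 2 \<le> cnt \<phi> {x})"
        unfolding Z using fin by (auto simp: sum_eq_0_iff)
      also have "\<dots> \<longleftrightarrow> (\<forall>x\<in>atoms \<phi>. \<not> 2 \<le> cnt \<phi> {x})"
      proof -
        have "\<exists>m::nat. x \<in> cball 0 (real m)" for x :: 'a using real_arch_simple[of "norm x"] by simp
        then show ?thesis by blast
      qed
      also have "\<dots> \<longleftrightarrow> simple_config \<phi>"
        unfolding simple_config_def using cnt_not_atom[of _ \<phi>] by (metis le0 not_less_eq_eq numeral_2_eq_2 One_nat_def)
      finally show ?thesis .
    qed
    then show ?thesis by auto
  qed
  ultimately show ?thesis by simp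
qed

text \<open>The two terms of the second moment bound come from pairs of distinct points and from the diagonal.\<close>

locale simple_point_law =
  fixes P0 :: "'a::euclidean_space measure measure" and lam :: "'a \<Rightarrow> real"
  assumes prob_P0: "prob_space P0" and sets_P0 [measurable_cong]: "sets P0 = sets pp_space"
    and lam_cont: "continuous_on UNIV lam" and lam_nonneg: "\<And>x. 0 \<le> lam x"
    and AE_simple: "AE \<phi> in P0. simple_config \<phi>"
    and intensity: "\<And>B. B \<in> sets borel \<Longrightarrow> (\<integral>\<^sup>+\<phi>. emeasure \<phi> B \<partial>P0) = (\<integral>\<^sup>+x\<in>B. ennreal (lam x) \<partial>lborel)"
    and second_moment: "\<And>R. \<exists>C\<ge>0. \<forall>B1\<in>sets borel. \<forall>B2\<in>sets borel. B1 \<subseteq> cball 0 R \<longrightarrow> B2 \<subseteq> cball 0 R \<longrightarrow>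
      (\<integral>\<^sup>+\<phi>. emeasure \<phi> B1 * emeasure \<phi> B2 \<partial>P0)
        \<le> ennreal C * emeasure lborel B1 * emeasure lborel B2 + (\<integral>\<^sup>+x\<in>B1 \<inter> B2. ennreal (lam x) \<partial>lborel)"

text \<open>For a simple configuration the product of two counts is the number of pairs of distinct points
  plus the count of the intersection; the first has a bounded density by second-order regularity.\<close>

lemma simple_point_lawI:
  fixes X0 :: "'v \<Rightarrow> 'a::euclidean_space measure"
  assumes X0: "point_process N X0" and simple: "simple_pp N X0"
    and lam: "continuous_on UNIV lam" "\<And>x. 0 \<le> lam x" and int: "has_intensity N X0 lam"
    and second: "second_order_regular N X0"
  shows "simple_point_law (distr N pp_space X0) lam"
proof (rule simple_point_law.intro)
  have N: "prob_space N" and Xm [measurable]: "X0 \<in> measurable N pp_space" using X0 by (auto simp: point_process_def)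
  have lf: "X0 \<omega> \<in> lf_counting" if "\<omega> \<in> space N" for \<omega> using measurable_space[OF Xm that] by simp
  have simpN: "AE \<omega> in N. simple_config (X0 \<omega>)"
    using simple AE_space unfolding simple_pp_def
  proof eventually_elim
    case (elim \<omega>)
    have "cnt (X0 \<omega>) {x} \<le> 1" for x
    proof -
      have "emeasure (X0 \<omega>) {x} \<le> 1" using elim(1) by blast
      then have "(of_nat (cnt (X0 \<omega>) {x}) :: ennreal) \<le> of_nat 1"
        by (simp only: emeasure_lf_cnt[OF lf[OF elim(2)] borel_singleton[OF sets.empty_sets] bounded_insert[THEN iffD2, OF bounded_empty]] of_nat_1)
      then show ?thesis by (simp only: of_nat_le_iff)
    qed
    then show ?case by (simp add: simple_config_def)
  qed
  show "prob_space (distr N pp_space X0)" by (rule prob_space.prob_space_distr[OF N Xm])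
  show "AE \<phi> in distr N pp_space X0. simple_config \<phi>"
    using simpN by (subst AE_distr_iff[OF Xm]) (use sets_simple_config in auto)
  show "(\<integral>\<^sup>+\<phi>. emeasure \<phi> B \<partial>distr N pp_space X0) = (\<integral>\<^sup>+x\<in>B. ennreal (lam x) \<partial>lborel)" if "B \<in> sets borel" for B
    using int that by (subst nn_integral_distr[OF Xm]) (auto simp: has_intensity_def)
  fix R :: real
  from second[unfolded second_order_regular_def] obtain \<rho> :: "'a \<Rightarrow> 'a \<Rightarrow> real"
    where "(\<lambda>(x, y). \<rho> x y) \<in> borel_measurable (borel \<Otimes>\<^sub>M borel)" and "\<forall>x y. 0 \<le> \<rho> x y"
    and \<rho>: "\<forall>B1\<in>sets borel. \<forall>B2\<in>sets borel. bounded B1 \<longrightarrow> bounded B2 \<longrightarrow>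
           (\<integral>\<^sup>+\<omega>. (\<integral>\<^sup>+(x, y). indicator B1 x * indicator B2 y
               \<partial>count_space {(x, y). x \<in> atoms (X0 \<omega>) \<and> y \<in> atoms (X0 \<omega>) \<and> x \<noteq> y}) \<partial>N)
           = (\<integral>\<^sup>+x\<in>B1. (\<integral>\<^sup>+y\<in>B2. ennreal (\<rho> x y) \<partial>lborel) \<partial>lborel)"
    and \<rho>b: "\<forall>K. compact K \<longrightarrow> bdd_above {\<rho> x y | x y. x \<in> K \<and> y \<in> K \<and> x \<noteq> y}"
    by (elim exE conjE)
  obtain C0 where C0: "\<And>x y. x \<in> cball 0 R \<Longrightarrow> y \<in> cball 0 R \<Longrightarrow> x \<noteq> y \<Longrightarrow> \<rho> x y \<le> C0"
    using \<rho>b[rule_format, OF compact_cball[of 0 R]] unfolding bdd_above_def by blast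
  define C where "C = max C0 0"
  have C: "0 \<le> C" and \<rho>C: "\<And>x y. x \<in> cball 0 R \<Longrightarrow> y \<in> cball 0 R \<Longrightarrow> x \<noteq> y \<Longrightarrow> \<rho> x y \<le> C"
    using C0 by (auto simp: C_def intro: max.coboundedI1)
  have main: "(\<integral>\<^sup>+\<phi>. emeasure \<phi> B1 * emeasure \<phi> B2 \<partial>distr N pp_space X0)
        \<le> ennreal C * emeasure lborel B1 * emeasure lborel B2 + (\<integral>\<^sup>+x\<in>B1 \<inter> B2. ennreal (lam x) \<partial>lborel)"
    if B: "B1 \<in> sets borel" "B2 \<in> sets borel" "B1 \<subseteq> cball 0 R" "B2 \<subseteq> cball 0 R" for B1 B2
  proof -
    have bd: "bounded B1" "bounded B2" using B by (auto intro: bounded_subset[OF bounded_cball])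
    define D where "D \<omega> = {(x, y). x \<in> atoms (X0 \<omega>) \<and> y \<in> atoms (X0 \<omega>) \<and> x \<noteq> y}" for \<omega>
    define J where "J \<omega> = (\<integral>\<^sup>+(x, y). indicator B1 x * indicator B2 y \<partial>count_space (D \<omega>) :: ennreal)" for \<omega>
    have pt: "AE \<omega> in N. emeasure (X0 \<omega>) B1 * emeasure (X0 \<omega>) B2 = J \<omega> + emeasure (X0 \<omega>) (B1 \<inter> B2)"
      using simpN AE_space
    proof eventually_elim
      case (elim \<omega>)
      note l = lf[OF elim(2)]
      define A1 where "A1 = atoms (X0 \<omega>) \<inter> B1"
      define A2 where "A2 = atoms (X0 \<omega>) \<inter> B2"
      have fin: "finite A1" "finite A2" unfolding A1_def A2_def by (auto intro: finite_atoms_Int[OF l] bd)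
      have c1: "emeasure (X0 \<omega>) B1 = of_nat (card A1)" "emeasure (X0 \<omega>) B2 = of_nat (card A2)"
        "emeasure (X0 \<omega>) (B1 \<inter> B2) = of_nat (card (A1 \<inter> A2))"
        using emeasure_lf_cnt[OF l] cnt_simple_config[OF l elim(1)] B bd bounded_Int[of B1 B2]
        by (auto simp: A1_def A2_def Int_ac)
      have "J \<omega> = (\<integral>\<^sup>+p. indicator (D \<omega> \<inter> (A1 \<times> A2)) p \<partial>count_space (D \<omega>))"
        unfolding J_def by (intro nn_integral_cong) (auto simp: D_def A1_def A2_def indicator_def)
      also have "\<dots> = emeasure (count_space (D \<omega>)) (D \<omega> \<inter> (A1 \<times> A2))"
        by (intro nn_integral_indicator) auto
      also have "\<dots> = of_nat (card (D \<omega> \<inter> (A1 \<times> A2)))"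
        using fin by (subst emeasure_count_space) auto
      finally have J: "J \<omega> = of_nat (card (D \<omega> \<inter> (A1 \<times> A2)))" .
      have "A1 \<times> A2 = (D \<omega> \<inter> (A1 \<times> A2)) \<union> (\<lambda>x. (x, x)) ` (A1 \<inter> A2)"
        by (auto simp: D_def A1_def A2_def)
      then have "card (A1 \<times> A2) = card (D \<omega> \<inter> (A1 \<times> A2)) + card ((\<lambda>x. (x, x)) ` (A1 \<inter> A2))"
        using fin by (subst card_Un_disjoint[symmetric]) (auto simp: D_def)
      also have "card ((\<lambda>x. (x, x)) ` (A1 \<inter> A2)) = card (A1 \<inter> A2)" by (rule card_image) (auto simp: inj_on_def)
      finally have "card A1 * card A2 = card (D \<omega> \<inter> (A1 \<times> A2)) + card (A1 \<inter> A2)" by (simp add: card_cartesian_product)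
      then show ?case unfolding c1 J by (metis of_nat_add of_nat_mult)
    qed
    have Bm: "B1 \<inter> B2 \<in> sets borel" using B by auto
    have "(\<integral>\<^sup>+\<phi>. emeasure \<phi> B1 * emeasure \<phi> B2 \<partial>distr N pp_space X0) = (\<integral>\<^sup>+\<omega>. emeasure (X0 \<omega>) B1 * emeasure (X0 \<omega>) B2 \<partial>N)"
      using B by (subst nn_integral_distr[OF Xm]) (auto intro!: borel_measurable_times_ennreal)
    \<comment> \<open>\<open>J\<close> need not be measurable; it agrees almost everywhere with a measurable difference.\<close>
    also have "\<dots> = (\<integral>\<^sup>+\<omega>. (emeasure (X0 \<omega>) B1 * emeasure (X0 \<omega>) B2 - emeasure (X0 \<omega>) (B1 \<inter> B2)) + emeasure (X0 \<omega>) (B1 \<inter> B2) \<partial>N)"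
    proof (rule nn_integral_cong_AE)
      show "AE \<omega> in N. emeasure (X0 \<omega>) B1 * emeasure (X0 \<omega>) B2
        = (emeasure (X0 \<omega>) B1 * emeasure (X0 \<omega>) B2 - emeasure (X0 \<omega>) (B1 \<inter> B2)) + emeasure (X0 \<omega>) (B1 \<inter> B2)"
        using pt by eventually_elim (rule diff_add_cancel_ennreal[symmetric], simp)
    qed
    also have "\<dots> = (\<integral>\<^sup>+\<omega>. (emeasure (X0 \<omega>) B1 * emeasure (X0 \<omega>) B2 - emeasure (X0 \<omega>) (B1 \<inter> B2)) \<partial>N) + (\<integral>\<^sup>+\<omega>. emeasure (X0 \<omega>) (B1 \<inter> B2) \<partial>N)"
      using B Bm by (intro nn_integral_add borel_measurable_minus_ennreal borel_measurable_times_ennreal measurable_compose[OF Xm] measurable_emeasure_pp_space)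
    also have "(\<integral>\<^sup>+\<omega>. (emeasure (X0 \<omega>) B1 * emeasure (X0 \<omega>) B2 - emeasure (X0 \<omega>) (B1 \<inter> B2)) \<partial>N) = (\<integral>\<^sup>+\<omega>. J \<omega> \<partial>N)"
    proof (rule nn_integral_cong_AE)
      show "AE \<omega> in N. emeasure (X0 \<omega>) B1 * emeasure (X0 \<omega>) B2 - emeasure (X0 \<omega>) (B1 \<inter> B2) = J \<omega>"
        using pt AE_space
      proof eventually_elim
        case (elim \<omega>)
        have "emeasure (X0 \<omega>) (B1 \<inter> B2) < \<infinity>"
          using emeasure_lf_finite[OF lf[OF elim(2)] Bm] bd by (simp add: bounded_Int)
        then show ?case unfolding elim(1) by (simp add: ennreal_add_diff_cancel_right)
      qed
    qed
    also have "(\<integral>\<^sup>+\<omega>. J \<omega> \<partial>N) = (\<integral>\<^sup>+x\<in>B1. (\<integral>\<^sup>+y\<in>B2. ennreal (\<rho> x y) \<partial>lborel) \<partial>lborel)"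
      unfolding J_def D_def by (rule \<rho>[rule_format, OF B(1,2) bd])
    also have "(\<integral>\<^sup>+\<omega>. emeasure (X0 \<omega>) (B1 \<inter> B2) \<partial>N) = (\<integral>\<^sup>+x\<in>B1 \<inter> B2. ennreal (lam x) \<partial>lborel)"
      using int Bm by (simp add: has_intensity_def)
    also have "(\<integral>\<^sup>+x\<in>B1. (\<integral>\<^sup>+y\<in>B2. ennreal (\<rho> x y) \<partial>lborel) \<partial>lborel) \<le> (\<integral>\<^sup>+x\<in>B1. ennreal C * emeasure lborel B2 \<partial>lborel)"
    proof (intro nn_integral_mono)
      fix x :: 'a
      have "(\<integral>\<^sup>+y\<in>B2. ennreal (\<rho> x y) \<partial>lborel) \<le> ennreal C * emeasure lborel B2" if "x \<in> B1"
      proof -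
        have "AE y in lborel. y \<noteq> x" by (rule AE_lborel_singleton)
        then have "AE y in lborel. ennreal (\<rho> x y) * indicator B2 y \<le> ennreal C * indicator B2 y"
        proof eventually_elim
          case (elim y)
          have "\<rho> x y \<le> C" if "y \<in> B2"
            using \<open>x \<in> B1\<close> that B(3,4) elim by (intro \<rho>C) auto
          then show ?case by (auto simp: indicator_def intro!: ennreal_leI)
        qed
        then have "(\<integral>\<^sup>+y\<in>B2. ennreal (\<rho> x y) \<partial>lborel) \<le> (\<integral>\<^sup>+y\<in>B2. ennreal C \<partial>lborel)" by (rule nn_integral_mono_AE)
        also have "\<dots> = ennreal C * emeasure lborel B2" using B by (simp add: nn_integral_cmult_indicator)
        finally show ?thesis .
      qed
      then show "(\<integral>\<^sup>+y\<in>B2. ennreal (\<rho> x y) \<partial>lborel) * indicator B1 x \<le> ennreal C * emeasure lborel B2 * indicator B1 x"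
        by (auto simp: indicator_def)
    qed
    also have "(\<integral>\<^sup>+x\<in>B1. ennreal C * emeasure lborel B2 \<partial>lborel) = ennreal C * emeasure lborel B1 * emeasure lborel B2"
      using B by (subst nn_integral_cmult_indicator) (auto simp: mult_ac)
    finally show ?thesis by (simp add: add_mono)
  qed
  show "\<exists>C\<ge>0. \<forall>B1\<in>sets borel. \<forall>B2\<in>sets borel. B1 \<subseteq> cball 0 R \<longrightarrow> B2 \<subseteq> cball 0 R \<longrightarrow>
      (\<integral>\<^sup>+\<phi>. emeasure \<phi> B1 * emeasure \<phi> B2 \<partial>distr N pp_space X0)
        \<le> ennreal C * emeasure lborel B1 * emeasure lborel B2 + (\<integral>\<^sup>+x\<in>B1 \<inter> B2. ennreal (lam x) \<partial>lborel)"
    using C main by blast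
qed (use lam in auto)

context simple_point_law
begin

lemma space_P0: "space P0 = lf_counting"
  using sets_eq_imp_space_eq[OF sets_P0] by simp

lemma lam_measurable [measurable]: "lam \<in> borel_measurable borel"
  using borel_measurable_continuous_onI[OF lam_cont] .

lemma lam_bounded: "\<exists>L\<ge>0. \<forall>x\<in>cball 0 R. lam x \<le> L"
proof -
  have "compact (lam ` cball 0 R)"
    by (rule compact_continuous_image[OF continuous_on_subset[OF lam_cont] compact_cball]) simp
  from compact_imp_bounded[OF this] obtain L where "\<forall>y\<in>lam ` cball 0 R. norm y \<le> L"
    unfolding bounded_iff ..
  then show ?thesis by (intro exI[of _ "max L 0"]) (auto simp: abs_le_iff intro: max.coboundedI1)
qed

lemma measurable_config: "\<phi> \<in> lf_counting \<Longrightarrow> f \<in> borel_measurable borel \<Longrightarrow> f \<in> borel_measurable \<phi>"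
  by (simp add: measurable_cong_sets[OF lf_sets refl])

text \<open>Campbell's formula: both sides are monotone and linear in \<open>f\<close> and agree on indicators, where they are
  the two expressions for the intensity.\<close>

lemma campbell:
  assumes "f \<in> borel_measurable borel"
  shows "(\<integral>\<^sup>+\<phi>. (\<integral>\<^sup>+x. f x \<partial>\<phi>) \<partial>P0) = (\<integral>\<^sup>+x. f x * ennreal (lam x) \<partial>lborel)"
  using assms
proof (induction rule: borel_measurable_induct)
  case (cong f g)
  then have "f = g" by auto
  then show ?case using cong by simp
next
  case (set B)
  have "(\<integral>\<^sup>+\<phi>. (\<integral>\<^sup>+x. indicator B x \<partial>\<phi>) \<partial>P0) = (\<integral>\<^sup>+\<phi>. emeasure \<phi> B \<partial>P0)"
    using set lf_sets by (intro nn_integral_cong nn_integral_indicator) (auto simp: space_P0)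
  also have "\<dots> = (\<integral>\<^sup>+x\<in>B. ennreal (lam x) \<partial>lborel)" by (rule intensity[OF set])
  finally show ?case by (simp add: mult.commute)
next
  case (mult f c)
  have "(\<integral>\<^sup>+\<phi>. (\<integral>\<^sup>+x. c * f x \<partial>\<phi>) \<partial>P0) = (\<integral>\<^sup>+\<phi>. c * (\<integral>\<^sup>+x. f x \<partial>\<phi>) \<partial>P0)"
    using mult lf_sets by (intro nn_integral_cong nn_integral_cmult) (auto simp: space_P0 intro: measurable_config)
  also have "\<dots> = c * (\<integral>\<^sup>+\<phi>. (\<integral>\<^sup>+x. f x \<partial>\<phi>) \<partial>P0)"
  proof (rule nn_integral_cmult)
    have "(\<lambda>(\<phi>, x). f x) \<in> borel_measurable (P0 \<Otimes>\<^sub>M borel)"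
      unfolding split_beta' by (rule measurable_compose[OF measurable_snd mult(2)])
    then show "(\<lambda>\<phi>. \<integral>\<^sup>+x. f x \<partial>\<phi>) \<in> borel_measurable P0"
      by (intro measurable_nn_integral_kernel[where \<kappa> = "\<lambda>\<phi>. \<phi>"] measurable_ident_sets sets_P0)
  qed
  also have "\<dots> = (\<integral>\<^sup>+x. c * f x * ennreal (lam x) \<partial>lborel)"
    unfolding mult.IH using mult(2) by (subst nn_integral_cmult[symmetric]) (auto simp: mult.assoc)
  finally show ?case .
next
  case (add f g)
  have k: "(\<lambda>\<phi>. \<integral>\<^sup>+x. f x \<partial>\<phi>) \<in> borel_measurable P0" if "f \<in> borel_measurable borel" for f :: "'a \<Rightarrow> ennreal"
  proof -
    have "(\<lambda>(\<phi>, x). f x) \<in> borel_measurable (P0 \<Otimes>\<^sub>M borel)"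
      unfolding split_beta' by (rule measurable_compose[OF measurable_snd that])
    then show ?thesis by (intro measurable_nn_integral_kernel[where \<kappa> = "\<lambda>\<phi>. \<phi>"] measurable_ident_sets sets_P0)
  qed
  have "(\<integral>\<^sup>+\<phi>. (\<integral>\<^sup>+x. g x + f x \<partial>\<phi>) \<partial>P0) = (\<integral>\<^sup>+\<phi>. (\<integral>\<^sup>+x. g x \<partial>\<phi>) + (\<integral>\<^sup>+x. f x \<partial>\<phi>) \<partial>P0)"
    using add lf_sets by (intro nn_integral_cong nn_integral_add) (auto simp: space_P0 intro: measurable_config)
  also have "\<dots> = (\<integral>\<^sup>+x. g x * ennreal (lam x) \<partial>lborel) + (\<integral>\<^sup>+x. f x * ennreal (lam x) \<partial>lborel)"
    using k add by (subst nn_integral_add) auto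
  also have "\<dots> = (\<integral>\<^sup>+x. (g x + f x) * ennreal (lam x) \<partial>lborel)"
    using add by (subst nn_integral_add[symmetric]) (auto simp: distrib_right)
  finally show ?case .
next
  case (seq U)
  have k: "(\<lambda>\<phi>. \<integral>\<^sup>+x. U i x \<partial>\<phi>) \<in> borel_measurable P0" for i
  proof -
    have "(\<lambda>(\<phi>, x). U i x) \<in> borel_measurable (P0 \<Otimes>\<^sub>M borel)"
      unfolding split_beta' by (rule measurable_compose[OF measurable_snd seq(1)])
    then show ?thesis by (intro measurable_nn_integral_kernel[where \<kappa> = "\<lambda>\<phi>. \<phi>"] measurable_ident_sets sets_P0)
  qed
  have "(\<integral>\<^sup>+\<phi>. (\<integral>\<^sup>+x. (SUP i. U i x) \<partial>\<phi>) \<partial>P0) = (\<integral>\<^sup>+\<phi>. (SUP i. \<integral>\<^sup>+x. U i x \<partial>\<phi>) \<partial>P0)"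
    using seq lf_sets by (intro nn_integral_cong nn_integral_monotone_convergence_SUP) (auto simp: space_P0 intro: measurable_config)
  also have "\<dots> = (SUP i. \<integral>\<^sup>+\<phi>. (\<integral>\<^sup>+x. U i x \<partial>\<phi>) \<partial>P0)"
    using k seq(3) by (intro nn_integral_monotone_convergence_SUP) (auto simp: incseq_def le_fun_def intro!: nn_integral_mono)
  also have "\<dots> = (SUP i. \<integral>\<^sup>+x. U i x * ennreal (lam x) \<partial>lborel)" using seq by simp
  also have "\<dots> = (\<integral>\<^sup>+x. (SUP i. U i x * ennreal (lam x)) \<partial>lborel)"
    using seq by (intro nn_integral_monotone_convergence_SUP[symmetric]) (auto simp: incseq_def le_fun_def intro!: mult_right_mono)
  also have "\<dots> = (\<integral>\<^sup>+x. (SUP i. U i x) * ennreal (lam x) \<partial>lborel)"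
    by (simp add: SUP_mult_right_ennreal)
  finally show ?case by (simp add: image_comp)
qed

text \<open>Campbell's formula for a function that also depends on independent information; the points
  of the configuration then see this information as if it were fixed.\<close>

lemma campbell_indep:
  assumes M: "prob_space M" and Xm: "Xi \<in> measurable M pp_space" and Vm: "V \<in> measurable M L"
    and pd: "distr M pp_space Xi \<Otimes>\<^sub>M distr M L V = distr M (pp_space \<Otimes>\<^sub>M L) (\<lambda>\<omega>. (Xi \<omega>, V \<omega>))"
    and law: "distr M pp_space Xi = P0"
    and f: "(\<lambda>(x, l). f x l) \<in> borel_measurable (borel \<Otimes>\<^sub>M L)"
  shows "(\<integral>\<^sup>+\<omega>. (\<integral>\<^sup>+x. f x (V \<omega>) \<partial>Xi \<omega>) \<partial>M) = (\<integral>\<^sup>+x. ennreal (lam x) * (\<integral>\<^sup>+\<omega>. f x (V \<omega>) \<partial>M) \<partial>lborel)"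
proof -
  interpret M: prob_space M by fact
  note f [measurable]
  define DV where "DV = distr M L V"
  have sD: "sets DV = sets L" by (simp add: DV_def)
  interpret DV: prob_space DV unfolding DV_def by (rule M.prob_space_distr[OF Vm])
  interpret P0: prob_space P0 by (rule prob_P0)
  interpret PD: pair_sigma_finite P0 DV ..
  interpret LD: pair_sigma_finite lborel DV ..
  define g where "g p = (\<integral>\<^sup>+x. f x (snd p) \<partial>fst p)" for p
  have "(\<lambda>q. f (snd q) (snd (fst q))) \<in> borel_measurable ((pp_space \<Otimes>\<^sub>M L) \<Otimes>\<^sub>M borel)"
    using measurable_compose[OF measurable_Pair[OF measurable_snd measurable_compose[OF measurable_fst measurable_snd]] f]
    by simp
  then have gm: "g \<in> borel_measurable (pp_space \<Otimes>\<^sub>M L)"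
    unfolding g_def by (intro measurable_nn_integral_kernel[where \<kappa> = fst] measurable_fst) (simp add: split_beta')
  have gm': "g \<in> borel_measurable (P0 \<Otimes>\<^sub>M DV)"
    using gm by (simp add: measurable_cong_sets[OF sets_pair_measure_cong[OF sets_P0 sD] refl])
  have fm: "(\<lambda>x. f x l) \<in> borel_measurable borel" if "l \<in> space L" for l
    using measurable_Pair1[OF f that] by simp
  have fV: "(\<lambda>l. f x l) \<in> borel_measurable L" for x
    using measurable_Pair2[OF f, of x] by simp
  have "(\<integral>\<^sup>+\<omega>. (\<integral>\<^sup>+x. f x (V \<omega>) \<partial>Xi \<omega>) \<partial>M) = (\<integral>\<^sup>+\<omega>. g (Xi \<omega>, V \<omega>) \<partial>M)" by (simp add: g_def)
  also have "\<dots> = (\<integral>\<^sup>+p. g p \<partial>distr M (pp_space \<Otimes>\<^sub>M L) (\<lambda>\<omega>. (Xi \<omega>, V \<omega>)))"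
    using gm Xm Vm by (intro nn_integral_distr[symmetric] measurable_Pair) auto
  also have "\<dots> = (\<integral>\<^sup>+p. g p \<partial>(P0 \<Otimes>\<^sub>M DV))" by (simp add: pd[symmetric] law DV_def)
  also have "\<dots> = (\<integral>\<^sup>+l. (\<integral>\<^sup>+\<phi>. g (\<phi>, l) \<partial>P0) \<partial>DV)" by (rule PD.nn_integral_snd[OF gm', symmetric])
  also have "\<dots> = (\<integral>\<^sup>+l. (\<integral>\<^sup>+x. f x l * ennreal (lam x) \<partial>lborel) \<partial>DV)"
    using sets_eq_imp_space_eq[OF sD] by (intro nn_integral_cong) (simp add: g_def campbell[OF fm])
  also have "\<dots> = (\<integral>\<^sup>+x. (\<integral>\<^sup>+l. f x l * ennreal (lam x) \<partial>DV) \<partial>lborel)"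
  proof (rule LD.Fubini')
    have s: "sets (lborel \<Otimes>\<^sub>M DV) = sets (borel \<Otimes>\<^sub>M L)" by (rule sets_pair_measure_cong) (simp_all add: sD)
    have "(\<lambda>(x, l). f x l * ennreal (lam x)) \<in> borel_measurable (borel \<Otimes>\<^sub>M L)" by measurable
    then show "(\<lambda>(x, l). f x l * ennreal (lam x)) \<in> borel_measurable (lborel \<Otimes>\<^sub>M DV)"
      unfolding measurable_cong_sets[OF s refl] .
  qed
  also have "\<dots> = (\<integral>\<^sup>+x. ennreal (lam x) * (\<integral>\<^sup>+\<omega>. f x (V \<omega>) \<partial>M) \<partial>lborel)"
  proof (intro nn_integral_cong)
    fix x
    have "(\<integral>\<^sup>+l. f x l * ennreal (lam x) \<partial>DV) = (\<integral>\<^sup>+\<omega>. f x (V \<omega>) * ennreal (lam x) \<partial>M)"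
      unfolding DV_def using fV by (intro nn_integral_distr Vm borel_measurable_times_ennreal) auto
    also have "\<dots> = (\<integral>\<^sup>+\<omega>. f x (V \<omega>) \<partial>M) * ennreal (lam x)"
      using fV by (intro nn_integral_multc measurable_compose[OF Vm])
    finally show "(\<integral>\<^sup>+l. f x l * ennreal (lam x) \<partial>DV) = ennreal (lam x) * (\<integral>\<^sup>+\<omega>. f x (V \<omega>) \<partial>M)"
      by (simp add: mult.commute)
  qed
  finally show ?thesis .
qed

subsection \<open>Moments of counts\<close>

lemma cnt_measurable_P0 [measurable]: "B \<in> sets borel \<Longrightarrow> (\<lambda>\<phi>. cnt \<phi> B) \<in> measurable P0 (count_space UNIV)"
  using measurable_cnt_pp_space by (simp add: measurable_cong_sets[OF sets_P0 refl])

lemma emeasure_P0_cnt: "\<phi> \<in> space P0 \<Longrightarrow> B \<in> sets borel \<Longrightarrow> bounded B \<Longrightarrow> emeasure \<phi> B = ennreal (real (cnt \<phi> B))"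
  by (simp add: space_P0 emeasure_lf_cnt ennreal_of_nat_eq_real_of_nat)

text \<open>The excess of the second moment over the mean is the expected number of ordered pairs of points.
  It is of the order of the squared volume, which makes two points in a small set negligible.\<close>

lemma moment_bounds:
  "\<exists>C\<ge>0. \<exists>L\<ge>0. \<forall>B\<in>sets borel. B \<subseteq> cball 0 R \<longrightarrow>
     integrable P0 (\<lambda>\<phi>. real (cnt \<phi> B)) \<and> integrable P0 (\<lambda>\<phi>. (real (cnt \<phi> B))\<^sup>2) \<and>
     (\<integral>\<phi>. real (cnt \<phi> B) \<partial>P0) \<le> L * measure lborel B \<and>
     ennreal (\<integral>\<phi>. real (cnt \<phi> B) \<partial>P0) = (\<integral>\<^sup>+x\<in>B. ennreal (lam x) \<partial>lborel) \<and>
     (\<integral>\<phi>. (real (cnt \<phi> B))\<^sup>2 \<partial>P0) \<le> C * (measure lborel B)\<^sup>2 + (\<integral>\<phi>. real (cnt \<phi> B) \<partial>P0)"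
proof -
  from second_moment[of R] obtain C where C: "0 \<le> C" and C2: "\<forall>B1\<in>sets borel. \<forall>B2\<in>sets borel.
      B1 \<subseteq> cball 0 R \<longrightarrow> B2 \<subseteq> cball 0 R \<longrightarrow> (\<integral>\<^sup>+\<phi>. emeasure \<phi> B1 * emeasure \<phi> B2 \<partial>P0)
        \<le> ennreal C * emeasure lborel B1 * emeasure lborel B2 + (\<integral>\<^sup>+x\<in>B1 \<inter> B2. ennreal (lam x) \<partial>lborel)"
    by (elim exE conjE)
  obtain L where L: "0 \<le> L" "\<And>x. x \<in> cball 0 R \<Longrightarrow> lam x \<le> L" using lam_bounded[of R] by blast
  have main: "integrable P0 (\<lambda>\<phi>. real (cnt \<phi> B)) \<and> integrable P0 (\<lambda>\<phi>. (real (cnt \<phi> B))\<^sup>2) \<and>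
     (\<integral>\<phi>. real (cnt \<phi> B) \<partial>P0) \<le> L * measure lborel B \<and>
     ennreal (\<integral>\<phi>. real (cnt \<phi> B) \<partial>P0) = (\<integral>\<^sup>+x\<in>B. ennreal (lam x) \<partial>lborel) \<and>
     (\<integral>\<phi>. (real (cnt \<phi> B))\<^sup>2 \<partial>P0) \<le> C * (measure lborel B)\<^sup>2 + (\<integral>\<phi>. real (cnt \<phi> B) \<partial>P0)"
    if B: "B \<in> sets borel" "B \<subseteq> cball 0 R" for B
  proof -
    have bd: "bounded B" using B(2) bounded_cball bounded_subset by blast
    have rm: "(\<lambda>\<phi>. real (cnt \<phi> B)) \<in> borel_measurable P0"
      by (rule measurable_compose[OF cnt_measurable_P0[OF B(1)]]) simp
    have fin: "emeasure lborel B < \<infinity>"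
      using emeasure_bounded_finite[OF bd] by simp
    have eB: "emeasure lborel B = ennreal (measure lborel B)" using fin by (simp add: emeasure_eq_ennreal_measure)
    have n1: "(\<integral>\<^sup>+\<phi>. ennreal (real (cnt \<phi> B)) \<partial>P0) = (\<integral>\<^sup>+x\<in>B. ennreal (lam x) \<partial>lborel)"
      using intensity[OF B(1)] emeasure_P0_cnt[OF _ B(1) bd] by (simp cong: nn_integral_cong)
    have "(\<integral>\<^sup>+x\<in>B. ennreal (lam x) \<partial>lborel) \<le> (\<integral>\<^sup>+x\<in>B. ennreal L \<partial>lborel)"
      using B(2) L by (intro nn_integral_mono) (auto simp: indicator_def intro!: ennreal_leI)
    also have "\<dots> = ennreal (L * measure lborel B)"
      using B(1) L by (simp add: nn_integral_cmult_indicator eB ennreal_mult)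
    finally have n1b: "(\<integral>\<^sup>+x\<in>B. ennreal (lam x) \<partial>lborel) \<le> ennreal (L * measure lborel B)" .
    have i1: "integrable P0 (\<lambda>\<phi>. real (cnt \<phi> B))"
      using rm n1 n1b by (intro integrableI_nonneg) (auto simp: le_less_trans[OF _ ennreal_less_top])
    have e1: "ennreal (\<integral>\<phi>. real (cnt \<phi> B) \<partial>P0) = (\<integral>\<^sup>+x\<in>B. ennreal (lam x) \<partial>lborel)"
      using nn_integral_eq_integral[OF i1] n1 by simp
    have b1: "(\<integral>\<phi>. real (cnt \<phi> B) \<partial>P0) \<le> L * measure lborel B"
      using n1b L unfolding e1[symmetric] by (subst (asm) ennreal_le_iff) auto
    have n2: "(\<integral>\<^sup>+\<phi>. ennreal ((real (cnt \<phi> B))\<^sup>2) \<partial>P0) \<le> ennreal (C * (measure lborel B)\<^sup>2 + (\<integral>\<phi>. real (cnt \<phi> B) \<partial>P0))"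
    proof -
      have "(\<integral>\<^sup>+\<phi>. ennreal ((real (cnt \<phi> B))\<^sup>2) \<partial>P0) = (\<integral>\<^sup>+\<phi>. emeasure \<phi> B * emeasure \<phi> B \<partial>P0)"
        using emeasure_P0_cnt[OF _ B(1) bd] by (intro nn_integral_cong) (simp add: power2_eq_square ennreal_mult)
      also have "\<dots> \<le> ennreal C * emeasure lborel B * emeasure lborel B + (\<integral>\<^sup>+x\<in>B \<inter> B. ennreal (lam x) \<partial>lborel)"
        using C2 B by blast
      also have "\<dots> = ennreal (C * (measure lborel B)\<^sup>2) + ennreal (\<integral>\<phi>. real (cnt \<phi> B) \<partial>P0)"
        using C by (simp add: e1 eB power2_eq_square ennreal_mult mult.assoc)
      also have "\<dots> = ennreal (C * (measure lborel B)\<^sup>2 + (\<integral>\<phi>. real (cnt \<phi> B) \<partial>P0))"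
        using C by (intro ennreal_plus[symmetric]) (auto intro!: Bochner_Integration.integral_nonneg)
      finally show ?thesis .
    qed
    have i2: "integrable P0 (\<lambda>\<phi>. (real (cnt \<phi> B))\<^sup>2)"
      using rm n2 by (intro integrableI_nonneg borel_measurable_power) (auto simp: le_less_trans[OF _ ennreal_less_top])
    have e2: "(\<integral>\<^sup>+\<phi>. ennreal ((real (cnt \<phi> B))\<^sup>2) \<partial>P0) = ennreal (\<integral>\<phi>. (real (cnt \<phi> B))\<^sup>2 \<partial>P0)"
      by (rule nn_integral_eq_integral[OF i2]) simp
    have "0 \<le> C * (measure lborel B)\<^sup>2 + (\<integral>\<phi>. real (cnt \<phi> B) \<partial>P0)"
      using C by (intro add_nonneg_nonneg mult_nonneg_nonneg Bochner_Integration.integral_nonneg) auto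
    from n2[unfolded e2 ennreal_le_iff[OF this]]
    have "(\<integral>\<phi>. (real (cnt \<phi> B))\<^sup>2 \<partial>P0) \<le> C * (measure lborel B)\<^sup>2 + (\<integral>\<phi>. real (cnt \<phi> B) \<partial>P0)" .
    then show ?thesis using i1 i2 e1 b1 by blast
  qed
  show ?thesis
    by (rule exI[of _ C], rule conjI[OF C], rule exI[of _ L], rule conjI[OF L(1)], intro ballI impI)
      (rule main)
qed

end

subsection \<open>Counts in shrinking balls\<close>

lemma lf_cnt_UN:
  assumes lf: "\<phi> \<in> lf_counting" and P: "finite P" "disjoint_family_on C P"
    "\<And>x. x \<in> P \<Longrightarrow> C x \<in> sets borel" "\<And>x. x \<in> P \<Longrightarrow> bounded (C x)"
  shows "cnt \<phi> (\<Union>x\<in>P. C x) = (\<Sum>x\<in>P. cnt \<phi> (C x))"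
proof -
  have "emeasure \<phi> (\<Union>x\<in>P. C x) = (\<Sum>x\<in>P. emeasure \<phi> (C x))"
    using P lf_sets[OF lf] by (intro sum_emeasure[symmetric]) auto
  also have "\<dots> = of_nat (\<Sum>x\<in>P. cnt \<phi> (C x))"
    using P by (simp add: emeasure_lf_cnt[OF lf])
  finally have "(of_nat (cnt \<phi> (\<Union>x\<in>P. C x)) :: ennreal) = of_nat (\<Sum>x\<in>P. cnt \<phi> (C x))"
    using P by (subst emeasure_lf_cnt[OF lf, symmetric]) auto
  then show ?thesis by (simp only: of_nat_eq_iff)
qed

text \<open>The first-order expansion of the product is exact unless there are at least two points, and
  then the number of ordered pairs dominates everything.\<close>

lemma prod_power_expansion:
  fixes z :: "'a \<Rightarrow> real" and c :: "'a \<Rightarrow> nat"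
  assumes P: "finite P" and z: "\<And>x. x \<in> P \<Longrightarrow> 0 \<le> z x \<and> z x \<le> 1"
  shows "\<bar>(\<Prod>x\<in>P. z x ^ c x) - 1 + (\<Sum>x\<in>P. (1 - z x) * real (c x))\<bar> \<le> (real (\<Sum>x\<in>P. c x))\<^sup>2 - real (\<Sum>x\<in>P. c x)"
proof -
  define m where "m = (\<Sum>x\<in>P. c x)"
  consider "m = 0" | "m = 1" | "m \<ge> 2" by linarith
  then show ?thesis
  proof cases
    case 1
    then have "\<forall>x\<in>P. c x = 0" using P by (simp add: m_def)
    then show ?thesis by simp
  next
    case 2
    then have "\<exists>x\<in>P. c x = 1 \<and> (\<forall>y\<in>P. x \<noteq> y \<longrightarrow> c y = 0)" using sum_eq_1_iff[OF P, of c] by (simp add: m_def)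
    then obtain x where x: "x \<in> P" "c x = 1" "\<And>y. y \<in> P \<Longrightarrow> x \<noteq> y \<Longrightarrow> c y = 0" by blast
    have "(\<Prod>y\<in>P. z y ^ c y) = (\<Prod>y\<in>P. if y = x then z x else 1)"
      using x by (intro prod.cong refl) auto
    moreover have "(\<Sum>y\<in>P. (1 - z y) * real (c y)) = (\<Sum>y\<in>P. if y = x then 1 - z x else 0)"
      using x by (intro sum.cong refl) auto
    ultimately show ?thesis using P x(1) 2 by (simp add: m_def)
  next
    case 3
    have "0 \<le> (\<Prod>x\<in>P. z x ^ c x)" using z by (intro prod_nonneg) auto
    moreover have "(\<Prod>x\<in>P. z x ^ c x) \<le> 1" using z by (intro prod_le_1) (auto intro: power_le_one)
    moreover have "0 \<le> (\<Sum>x\<in>P. (1 - z x) * real (c x))" using z by (intro sum_nonneg) auto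
    moreover have "(\<Sum>x\<in>P. (1 - z x) * real (c x)) \<le> (\<Sum>x\<in>P. 1 * real (c x))"
      using z by (intro sum_mono mult_right_mono) auto
    moreover have "1 \<le> real m" using 3 by simp
    ultimately have "\<bar>(\<Prod>x\<in>P. z x ^ c x) - 1 + (\<Sum>x\<in>P. (1 - z x) * real (c x))\<bar> \<le> real m"
      unfolding m_def of_nat_sum mult_1 by linarith
    also have "real m \<le> (real m)\<^sup>2 - real m"
      using mult_left_mono[of 2 "real m" "real m"] 3 by (simp add: power2_eq_square)
    finally show ?thesis unfolding m_def .
  qed
qed

text \<open>Powers of numbers in the unit interval satisfy \<open>\<bar>x ^ n - y ^ n\<bar> \<le> n * \<bar>x - y\<bar>\<close>, which compares \<open>\<psi> n\<close>
  with \<open>exp (- s / n)\<close>. Replacing \<open>n\<close> by \<open>k n\<close> changes the power by at most two factors tending to one.\<close>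

lemma power_tendsto_exp:
  fixes \<psi> :: "nat \<Rightarrow> real"
  assumes \<psi>: "\<And>n. 0 \<le> \<psi> n \<and> \<psi> n \<le> 1" and lim: "(\<lambda>n. real n * (1 - \<psi> n)) \<longlonglongrightarrow> s"
    and k: "\<And>n. k n \<le> n" "\<And>n. n \<le> k n + 2"
  shows "(\<lambda>n. \<psi> n ^ k n) \<longlonglongrightarrow> exp (- s)"
proof -
  have s0: "0 \<le> s" by (rule LIMSEQ_le_const[OF lim]) (use \<psi> in auto)
  have "(\<lambda>n. real n * (1 - \<psi> n) * inverse (real n)) \<longlonglongrightarrow> s * 0"
    by (intro tendsto_mult lim LIMSEQ_inverse_real_of_nat_add[of 0, simplified] tendsto_inverse_0_at_top filterlim_real_sequentially)
  from this[unfolded mult_zero_right] have "(\<lambda>n. 1 - \<psi> n) \<longlonglongrightarrow> 0"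
    by (rule Lim_transform_eventually[OF _ eventually_mono[OF eventually_gt_at_top[of 0]]]) (simp_all add: field_simps)
  from tendsto_diff[OF tendsto_const[of 1] this] have \<psi>1: "\<psi> \<longlonglongrightarrow> 1" by simp
  have e1: "(\<lambda>n. real n * (1 - exp (- s / real n))) \<longlonglongrightarrow> s"
  proof (cases "s = 0")
    case False
    have "((\<lambda>h. (exp (0 + h) - exp 0) / h) \<longlongrightarrow> exp 0) (at (0::real))"
      using DERIV_exp[of "0::real"] by (simp add: DERIV_def)
    moreover have "filterlim (\<lambda>n. - s / real n) (at 0) sequentially"
      unfolding filterlim_at
    proof (intro conjI)
      show "(\<lambda>n. - s / real n) \<longlonglongrightarrow> 0"
        by (rule tendsto_divide_0[OF tendsto_const filterlim_at_top_imp_at_infinity[OF filterlim_real_sequentially]])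
      show "eventually (\<lambda>n. - s / real n \<in> UNIV \<and> - s / real n \<noteq> 0) sequentially"
        using eventually_gt_at_top[of 0] by eventually_elim (use False in auto)
    qed
    ultimately have "(\<lambda>n. (exp (0 + - s / real n) - exp 0) / (- s / real n)) \<longlonglongrightarrow> exp 0"
      by (rule filterlim_compose)
    then have "(\<lambda>n. s * ((exp (0 + - s / real n) - exp 0) / (- s / real n))) \<longlonglongrightarrow> s * exp 0"
      by (intro tendsto_mult tendsto_const)
    then show ?thesis using False
      by (rule_tac Lim_transform_eventually[OF _ eventually_mono[OF eventually_gt_at_top[of 0]]]) (auto simp: field_simps)
  qed simp
  have d0: "(\<lambda>n. \<psi> n ^ n - exp (- s / real n) ^ n) \<longlonglongrightarrow> 0"
  proof (rule Lim_null_comparison[OF always_eventually])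
    show "\<forall>n. norm (\<psi> n ^ n - exp (- s / real n) ^ n) \<le> \<bar>real n * (1 - \<psi> n) - real n * (1 - exp (- s / real n))\<bar>"
    proof
      fix n
      have "norm (\<psi> n ^ n - exp (- s / real n) ^ n) \<le> real n * norm (\<psi> n - exp (- s / real n))"
        using \<psi> s0 by (intro norm_power_diff) (auto simp: divide_nonpos_nonneg)
      also have "\<dots> = \<bar>real n * (\<psi> n - exp (- s / real n))\<bar>" by (simp add: abs_mult)
      finally show "norm (\<psi> n ^ n - exp (- s / real n) ^ n) \<le> \<bar>real n * (1 - \<psi> n) - real n * (1 - exp (- s / real n))\<bar>"
        by (simp add: algebra_simps abs_minus_commute)
    qed
    have "(\<lambda>n. \<bar>real n * (1 - \<psi> n) - real n * (1 - exp (- s / real n))\<bar>) \<longlonglongrightarrow> \<bar>s - s\<bar>"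
      by (intro tendsto_intros lim e1)
    then show "(\<lambda>n. \<bar>real n * (1 - \<psi> n) - real n * (1 - exp (- s / real n))\<bar>) \<longlonglongrightarrow> 0" by simp
  qed
  have d1: "(\<lambda>n. exp (- s / real n) ^ n) \<longlonglongrightarrow> exp (- s)"
    by (rule tendsto_eventually, rule eventually_mono[OF eventually_gt_at_top[of 0]])
      (simp add: exp_of_nat_mult[symmetric])
  from tendsto_add[OF d0 d1] have nn: "(\<lambda>n. \<psi> n ^ n) \<longlonglongrightarrow> exp (- s)" by simp
  have "(\<lambda>n. \<psi> n ^ k n - \<psi> n ^ n) \<longlonglongrightarrow> 0"
  proof (rule Lim_null_comparison[OF always_eventually])
    show "\<forall>n. norm (\<psi> n ^ k n - \<psi> n ^ n) \<le> 1 - \<psi> n ^ 2"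
    proof
      fix n
      have "\<psi> n ^ n = \<psi> n ^ k n * \<psi> n ^ (n - k n)" using k(1)[of n] by (simp add: power_add[symmetric])
      then have eq: "\<psi> n ^ k n - \<psi> n ^ n = \<psi> n ^ k n * (1 - \<psi> n ^ (n - k n))" by (simp add: algebra_simps)
      have le: "\<psi> n ^ 2 \<le> \<psi> n ^ (n - k n)" using \<psi>[of n] k(2)[of n] by (intro power_decreasing) auto
      have "\<psi> n ^ k n * (1 - \<psi> n ^ (n - k n)) \<le> 1 * (1 - \<psi> n ^ 2)"
        using \<psi>[of n] le by (intro mult_mono) (auto intro: power_le_one)
      moreover have "0 \<le> \<psi> n ^ k n * (1 - \<psi> n ^ (n - k n))"
        using \<psi>[of n] by (intro mult_nonneg_nonneg) (auto intro: power_le_one)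
      ultimately show "norm (\<psi> n ^ k n - \<psi> n ^ n) \<le> 1 - \<psi> n ^ 2" unfolding eq by simp
    qed
    have "(\<lambda>n. 1 - \<psi> n ^ 2) \<longlonglongrightarrow> 1 - 1 ^ 2" by (intro tendsto_intros \<psi>1)
    then show "(\<lambda>n. 1 - \<psi> n ^ 2) \<longlonglongrightarrow> 0" by simp
  qed
  then have "(\<lambda>n. \<psi> n ^ n - \<psi> n ^ k n) \<longlonglongrightarrow> 0" using tendsto_minus by fastforce
  from tendsto_diff[OF nn this] show ?thesis by simp
qed

text \<open>A ball of radius \<open>r n\<close> around \<open>x\<close> has volume of order \<open>\<tau> / n\<close>, so that the \<open>n\<close> summands
  together put about \<open>\<tau> * lam x\<close> points into it.\<close>

locale critical_radii = simple_point_law P0 lam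
  for P0 :: "'a::euclidean_space measure measure" and lam +
  fixes r :: "nat \<Rightarrow> real" and \<tau> :: real
  assumes r_pos: "\<And>n. 1 \<le> n \<Longrightarrow> 0 < r n" and r_lim: "r \<longlonglongrightarrow> 0" and \<tau>_nonneg: "0 \<le> \<tau>"
    and critical: "(\<lambda>n. real n * measure lborel (cball (0::'a) 1) * r n ^ DIM('a)) \<longlonglongrightarrow> \<tau>"
begin

definition vol :: "nat \<Rightarrow> real" where
  "vol n = measure lborel (cball (0::'a) 1) * r n ^ DIM('a)"

lemma measure_cball_r: "1 \<le> n \<Longrightarrow> measure lborel (cball (x::'a) (r n)) = vol n"
  using r_pos[of n] content_cball[of "r n" x] content_cball[of 1 "0::'a"] by (simp add: vol_def)

lemma vol_pos: "1 \<le> n \<Longrightarrow> 0 < vol n"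
  using r_pos[of n] content_cball_pos[of 1 "0::'a"] by (simp add: vol_def)

lemma n_vol_lim: "(\<lambda>n. real n * vol n) \<longlonglongrightarrow> \<tau>"
  using critical by (simp add: vol_def mult.assoc)

lemma vol_lim: "vol \<longlonglongrightarrow> 0"
proof -
  have "(\<lambda>n. measure lborel (cball (0::'a) 1) * r n ^ DIM('a)) \<longlonglongrightarrow> measure lborel (cball (0::'a) 1) * 0 ^ DIM('a)"
    by (intro tendsto_intros r_lim)
  moreover have "measure lborel (cball (0::'a) 1) * 0 ^ DIM('a) = 0" by simp
  ultimately show ?thesis unfolding vol_def[abs_def] by (simp only:)
qed

text \<open>By continuity \<open>lam\<close> is nearly constant on the shrinking ball, so the mean count per unit of volume
  tends to \<open>lam x\<close>.\<close>

lemma mean_count_limit: "(\<lambda>n. real n * (\<integral>\<phi>. real (cnt \<phi> (cball x (r n))) \<partial>P0)) \<longlonglongrightarrow> \<tau> * lam x"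
proof -
  define mean where "mean n = (\<integral>\<phi>. real (cnt \<phi> (cball x (r n))) \<partial>P0)" for n
  have "(\<lambda>n. mean n / vol n) \<longlonglongrightarrow> lam x"
  proof (rule LIMSEQ_I)
    fix e :: real assume e: "0 < e"
    have "isCont lam x" using lam_cont by (simp add: continuous_on_eq_continuous_at)
    then obtain d where d: "0 < d" "\<And>y. dist y x < d \<Longrightarrow> dist (lam y) (lam x) < e / 2"
      unfolding continuous_at_eps_delta using e by (meson half_gt_zero)
    have "eventually (\<lambda>n. r n < min d 1) sequentially" by (rule order_tendstoD(2)[OF r_lim]) (use d in auto)
    then have "eventually (\<lambda>n. norm (mean n / vol n - lam x) < e) sequentially"
      using eventually_ge_at_top[of 1]
    proof eventually_elim
      case (elim n)
      define B where "B = cball x (r n)"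
      have rn: "0 < r n" by (rule r_pos[OF elim(2)])
      have Bs: "B \<in> sets borel" by (simp add: B_def)
      have BR: "B \<subseteq> cball 0 (norm x + 1)"
      proof
        fix y assume "y \<in> B"
        then have "dist x y \<le> 1" using elim by (auto simp: B_def)
        then show "y \<in> cball 0 (norm x + 1)" using norm_triangle_sub[of y x] by (simp add: dist_norm norm_minus_commute)
      qed
      have mB: "measure lborel B = vol n" unfolding B_def by (rule measure_cball_r[OF elim(2)])
      have eB: "emeasure lborel B = ennreal (vol n)"
        unfolding mB[symmetric] B_def by (intro emeasure_eq_ennreal_measure) (use emeasure_lborel_cball_finite[of x "r n"] in auto)
      have em: "ennreal (mean n) = (\<integral>\<^sup>+y\<in>B. ennreal (lam y) \<partial>lborel)"
        using moment_bounds[of "norm x + 1"] Bs BR unfolding mean_def B_def[symmetric] by blast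
      have m0: "0 \<le> mean n" unfolding mean_def by (intro Bochner_Integration.integral_nonneg) simp
      have v: "0 < vol n" by (rule vol_pos[OF elim(2)])
      have near: "\<bar>lam y - lam x\<bar> \<le> e / 2" if "y \<in> B" for y
        using d(2)[of y] that elim rn by (auto simp: B_def dist_real_def dist_commute)
      have near': "ennreal (lam y) * indicator B y \<le> ennreal (lam x + e / 2) * indicator B y"
        "ennreal (lam x - e / 2) * indicator B y \<le> ennreal (lam y) * indicator B y" for y
      proof -
        have "lam y \<le> lam x + e / 2" "lam x - e / 2 \<le> lam y" if "y \<in> B"
          using near[OF that] by linarith+
        then show "ennreal (lam y) * indicator B y \<le> ennreal (lam x + e / 2) * indicator B y"
          "ennreal (lam x - e / 2) * indicator B y \<le> ennreal (lam y) * indicator B y"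
          by (auto simp: indicator_def intro!: ennreal_leI)
      qed
      have "(\<integral>\<^sup>+y\<in>B. ennreal (lam y) \<partial>lborel) \<le> (\<integral>\<^sup>+y\<in>B. ennreal (lam x + e / 2) \<partial>lborel)"
        by (intro nn_integral_mono near')
      also have "\<dots> = ennreal ((lam x + e / 2) * vol n)"
        using Bs lam_nonneg[of x] e v by (simp add: nn_integral_cmult_indicator eB ennreal_mult)
      finally have up: "mean n \<le> (lam x + e / 2) * vol n"
        using lam_nonneg[of x] e v unfolding em[symmetric] by (subst (asm) ennreal_le_iff) auto
      have lo: "(lam x - e / 2) * vol n \<le> mean n"
      proof (cases "0 \<le> lam x - e / 2")
        case True
        have "ennreal ((lam x - e / 2) * vol n) = (\<integral>\<^sup>+y\<in>B. ennreal (lam x - e / 2) \<partial>lborel)"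
          using Bs True v by (simp add: nn_integral_cmult_indicator eB ennreal_mult)
        also have "\<dots> \<le> (\<integral>\<^sup>+y\<in>B. ennreal (lam y) \<partial>lborel)"
          by (intro nn_integral_mono near')
        finally show ?thesis unfolding em[symmetric] using m0 by (subst (asm) ennreal_le_iff) auto
      next
        case False
        then have "(lam x - e / 2) * vol n \<le> 0" using v by (simp add: mult_nonpos_nonneg)
        then show ?thesis using m0 by linarith
      qed
      have "lam x - e / 2 \<le> mean n / vol n" "mean n / vol n \<le> lam x + e / 2"
        using up lo v by (simp_all add: field_simps)
      then show ?case using e unfolding real_norm_def abs_less_iff by linarith
    qed
    then show "\<exists>N. \<forall>n\<ge>N. norm (mean n / vol n - lam x) < e" by (simp add: eventually_sequentially)
  qed
  from tendsto_mult[OF n_vol_lim this]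
  have l: "(\<lambda>n. real n * vol n * (mean n / vol n)) \<longlonglongrightarrow> \<tau> * lam x" .
  have "eventually (\<lambda>n. real n * vol n * (mean n / vol n) = real n * mean n) sequentially"
    using eventually_ge_at_top[of 1]
  proof eventually_elim
    case (elim n)
    then show ?case using vol_pos[OF elim] by simp
  qed
  from Lim_transform_eventually[OF l this] show ?thesis unfolding mean_def .
qed

definition ball_pgf :: "'a set \<Rightarrow> ('a \<Rightarrow> real) \<Rightarrow> nat \<Rightarrow> real" where
  "ball_pgf P z n = (\<integral>\<phi>. (\<Prod>x\<in>P. z x ^ cnt \<phi> (cball x (r n))) \<partial>P0)"

lemma ball_prod_measurable [measurable]:
  "(\<lambda>\<phi>. \<Prod>x\<in>P. z x ^ cnt \<phi> (cball x \<rho>) :: real) \<in> borel_measurable pp_space"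
  by (intro borel_measurable_prod measurable_compose[OF measurable_cnt_pp_space]) auto

lemma ball_pgf_bounds:
  assumes "\<And>x. x \<in> P \<Longrightarrow> 0 \<le> z x \<and> z x \<le> 1"
  shows "0 \<le> ball_pgf P z n \<and> ball_pgf P z n \<le> 1"
    and "integrable P0 (\<lambda>\<phi>. \<Prod>x\<in>P. z x ^ cnt \<phi> (cball x (r n)))"
proof -
  interpret P0: prob_space P0 by (rule prob_P0)
  have b: "0 \<le> (\<Prod>x\<in>P. z x ^ c x)" "(\<Prod>x\<in>P. z x ^ c x) \<le> 1" for c :: "'a \<Rightarrow> nat"
    using assms by (auto intro!: prod_nonneg prod_le_1 power_le_one)
  show i: "integrable P0 (\<lambda>\<phi>. \<Prod>x\<in>P. z x ^ cnt \<phi> (cball x (r n)))"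
    using b by (intro P0.integrable_const_bound[where B = 1]) auto
  have "ball_pgf P z n \<le> (\<integral>\<phi>. 1 \<partial>P0)" unfolding ball_pgf_def using b i by (intro integral_mono) auto
  then show "0 \<le> ball_pgf P z n \<and> ball_pgf P z n \<le> 1"
    unfolding ball_pgf_def using b by (auto simp: P0.prob_space intro!: Bochner_Integration.integral_nonneg)
qed

text \<open>Because two points of the same summand in the small balls have probability of order the
  squared volume, only the mean matters at scale \<open>1 / n\<close>.\<close>

lemma ball_pgf_limit:
  assumes P: "finite P" and z: "\<And>x. x \<in> P \<Longrightarrow> 0 \<le> z x \<and> z x \<le> 1"
  shows "(\<lambda>n. real n * (1 - ball_pgf P z n)) \<longlonglongrightarrow> (\<Sum>x\<in>P. (1 - z x) * (\<tau> * lam x))"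
proof -
  define mean where "mean x n = (\<integral>\<phi>. real (cnt \<phi> (cball x (r n))) \<partial>P0)" for x n
  have l1: "(\<lambda>n. \<Sum>x\<in>P. (1 - z x) * (real n * mean x n)) \<longlonglongrightarrow> (\<Sum>x\<in>P. (1 - z x) * (\<tau> * lam x))"
    unfolding mean_def by (intro tendsto_intros mean_count_limit)
  obtain R0 where R0: "P \<subseteq> ball 0 R0" using bounded_subset_ballD[OF finite_imp_bounded[OF P], of 0] by auto
  define R where "R = R0 + 1"
  obtain C where C: "0 \<le> C" and mb: "\<And>B. B \<in> sets borel \<Longrightarrow> B \<subseteq> cball 0 R \<Longrightarrow>
     integrable P0 (\<lambda>\<phi>. real (cnt \<phi> B)) \<and> integrable P0 (\<lambda>\<phi>. (real (cnt \<phi> B))\<^sup>2) \<and>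
     (\<integral>\<phi>. (real (cnt \<phi> B))\<^sup>2 \<partial>P0) \<le> C * (measure lborel B)\<^sup>2 + (\<integral>\<phi>. real (cnt \<phi> B) \<partial>P0)"
    using moment_bounds[of R] by blast
  have "\<exists>d>0. \<forall>x\<in>P. \<forall>y\<in>P. x \<noteq> y \<longrightarrow> d \<le> dist x y"
  proof (intro exI[of _ "Min (insert 1 ((\<lambda>(x, y). dist x y) ` {p \<in> P \<times> P. fst p \<noteq> snd p}))"] conjI ballI impI)
    have fin: "finite (insert 1 ((\<lambda>(x, y). dist x y) ` {p \<in> P \<times> P. fst p \<noteq> snd p}))" using P by auto
    show "0 < Min (insert 1 ((\<lambda>(x, y). dist x y) ` {p \<in> P \<times> P. fst p \<noteq> snd p}))"
      using fin by (subst Min_gr_iff) auto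
    fix x y assume "x \<in> P" "y \<in> P" "x \<noteq> y"
    then show "Min (insert 1 ((\<lambda>(x, y). dist x y) ` {p \<in> P \<times> P. fst p \<noteq> snd p})) \<le> dist x y"
      using fin by (intro Min_le) (auto intro!: rev_image_eqI[of "(x, y)"])
  qed
  then obtain d where d: "0 < d" "\<And>x y. x \<in> P \<Longrightarrow> y \<in> P \<Longrightarrow> x \<noteq> y \<Longrightarrow> d \<le> dist x y" by blast
  have "eventually (\<lambda>n. r n < min (d / 2) 1) sequentially" by (rule order_tendstoD(2)[OF r_lim]) (use d in auto)
  then have ev: "eventually (\<lambda>n. norm (real n * (1 - ball_pgf P z n) - (\<Sum>x\<in>P. (1 - z x) * (real n * mean x n)))
      \<le> C * (real (card P))\<^sup>2 * (real n * vol n) * vol n) sequentially"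
    using eventually_ge_at_top[of 1]
  proof eventually_elim
    case (elim n)
    define U where "U = (\<Union>x\<in>P. cball x (r n))"
    have sub: "cball x (r n) \<subseteq> cball 0 R" if "x \<in> P" for x
    proof
      fix y assume "y \<in> cball x (r n)"
      then have "norm (y - x) \<le> 1" using elim by (simp add: dist_norm norm_minus_commute)
      moreover have "norm x < R0" using R0 that by auto
      ultimately show "y \<in> cball 0 R" using norm_triangle_sub[of y x] by (simp add: R_def)
    qed
    have disj: "disjoint_family_on (\<lambda>x. cball x (r n)) P"
      unfolding disjoint_family_on_def
    proof (intro ballI impI, rule ccontr)
      fix x y assume xy: "x \<in> P" "y \<in> P" "x \<noteq> y" and "cball x (r n) \<inter> cball y (r n) \<noteq> {}"
      then obtain w where "dist x w \<le> r n" "dist y w \<le> r n" by auto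
      then have "dist x y \<le> 2 * r n" using dist_triangle2[of x y w] by linarith
      then show False using d(2)[OF xy] elim by linarith
    qed
    have Us: "U \<in> sets borel" "U \<subseteq> cball 0 R" unfolding U_def using P sub by (auto intro!: sets.finite_UN)
    note mU = mb[OF Us]
    have vU: "measure lborel U = real (card P) * vol n"
    proof -
      have "measure lborel U = (\<Sum>x\<in>P. measure lborel (cball x (r n)))"
        unfolding U_def using P disj
        by (intro measure_finite_Union) (use emeasure_lborel_cball_finite[of _ "r n"] in \<open>auto simp: less_top\<close>)
      then show ?thesis by (simp add: measure_cball_r[OF elim(2)])
    qed
    have cU: "cnt \<phi> U = (\<Sum>x\<in>P. cnt \<phi> (cball x (r n)))" if "\<phi> \<in> space P0" for \<phi>
      unfolding U_def using that P disj by (intro lf_cnt_UN) (auto simp: space_P0)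
    have ip: "integrable P0 (\<lambda>\<phi>. \<Prod>x\<in>P. z x ^ cnt \<phi> (cball x (r n)))" by (rule ball_pgf_bounds(2)[OF z])
    have im: "integrable P0 (\<lambda>\<phi>. real (cnt \<phi> (cball x (r n))))" if "x \<in> P" for x
      using mb[OF _ sub[OF that]] by simp
    interpret P0: prob_space P0 by (rule prob_P0)
    have isum: "integrable P0 (\<lambda>\<phi>. \<Sum>x\<in>P. (1 - z x) * real (cnt \<phi> (cball x (r n))))"
      using im by (intro Bochner_Integration.integrable_sum integrable_mult_right) auto
    have ia: "integrable P0 (\<lambda>\<phi>. (\<Prod>x\<in>P. z x ^ cnt \<phi> (cball x (r n))) - 1 + (\<Sum>x\<in>P. (1 - z x) * real (cnt \<phi> (cball x (r n)))))"
      using ip isum by (intro Bochner_Integration.integrable_add Bochner_Integration.integrable_diff) auto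
    define E where "E \<phi> = (\<Prod>x\<in>P. z x ^ cnt \<phi> (cball x (r n))) - 1 + (\<Sum>x\<in>P. (1 - z x) * real (cnt \<phi> (cball x (r n))))"
      for \<phi> :: "'a measure"
    have eq: "ball_pgf P z n - 1 + (\<Sum>x\<in>P. (1 - z x) * mean x n) = (\<integral>\<phi>. E \<phi> \<partial>P0)"
      unfolding E_def ball_pgf_def mean_def using ip isum im by (simp add: P0.prob_space)
    have "\<bar>ball_pgf P z n - 1 + (\<Sum>x\<in>P. (1 - z x) * mean x n)\<bar> \<le> (\<integral>\<phi>. \<bar>E \<phi>\<bar> \<partial>P0)"
      unfolding eq by (rule integral_abs_bound)
    also have "\<dots> \<le> (\<integral>\<phi>. (real (cnt \<phi> U))\<^sup>2 - real (cnt \<phi> U) \<partial>P0)"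
      using ia mU cU prod_power_expansion[OF P z] unfolding E_def by (intro integral_mono) auto
    also have "\<dots> = (\<integral>\<phi>. (real (cnt \<phi> U))\<^sup>2 \<partial>P0) - (\<integral>\<phi>. real (cnt \<phi> U) \<partial>P0)"
      using mU by simp
    also have "\<dots> \<le> C * (real (card P) * vol n)\<^sup>2" using mU unfolding vU by simp
    finally have "real n * \<bar>ball_pgf P z n - 1 + (\<Sum>x\<in>P. (1 - z x) * mean x n)\<bar> \<le> real n * (C * (real (card P) * vol n)\<^sup>2)"
      by (intro mult_left_mono) auto
    moreover have "real n * (1 - ball_pgf P z n) - (\<Sum>x\<in>P. (1 - z x) * (real n * mean x n))
      = - (real n * (ball_pgf P z n - 1 + (\<Sum>x\<in>P. (1 - z x) * mean x n)))"
      by (simp add: sum_distrib_left algebra_simps)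
    ultimately show ?case by (simp add: abs_mult power2_eq_square mult_ac)
  qed
  have "(\<lambda>n. C * (real (card P))\<^sup>2 * (real n * vol n) * vol n) \<longlonglongrightarrow> C * (real (card P))\<^sup>2 * \<tau> * 0"
    by (intro tendsto_intros n_vol_lim vol_lim)
  then have "(\<lambda>n. real n * (1 - ball_pgf P z n) - (\<Sum>x\<in>P. (1 - z x) * (real n * mean x n))) \<longlonglongrightarrow> 0"
    by (intro Lim_null_comparison[OF ev]) simp
  from tendsto_add[OF this l1] show ?thesis by simp
qed

end

section \<open>Neighbour counts in the superposition\<close>

lemma measurable_sum_nat:
  assumes "\<And>i. i \<in> I \<Longrightarrow> f i \<in> measurable M (count_space UNIV)"
  shows "(\<lambda>x. \<Sum>i\<in>I. f i x :: nat) \<in> measurable M (count_space UNIV)"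
proof -
  have "(\<lambda>x. real (f i x)) \<in> borel_measurable M" if "i \<in> I" for i
    by (rule measurable_compose[OF assms[OF that]]) simp
  then have "(\<lambda>x. \<Sum>i\<in>I. real (f i x)) \<in> borel_measurable M"
    by (rule borel_measurable_sum)
  from measurable_compose[OF this measurable_nat_floor]
  have "(\<lambda>x. nat \<lfloor>\<Sum>i\<in>I. real (f i x)\<rfloor>) \<in> measurable M (count_space UNIV)" .
  moreover have "nat \<lfloor>\<Sum>i\<in>I. real (f i x)\<rfloor> = (\<Sum>i\<in>I. f i x)" for x
    by (simp only: of_nat_sum[symmetric] floor_of_nat nat_int)
  ultimately show ?thesis by simp
qed

locale superposed_sample = critical_radii P0 lam r \<tau> + prob_space M
  for P0 :: "'a::euclidean_space measure measure" and lam r \<tau> and M :: "'w measure" +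
  fixes X :: "nat \<Rightarrow> 'w \<Rightarrow> 'a measure"
  assumes indep: "indep_vars (\<lambda>_. pp_space) X {1..}"
    and law: "\<And>i. 1 \<le> i \<Longrightarrow> distr M pp_space (X i) = P0"
begin

definition nbrs :: "nat set \<Rightarrow> nat \<Rightarrow> 'a \<Rightarrow> 'w \<Rightarrow> nat" where
  "nbrs I n x \<omega> = (\<Sum>l\<in>I. cnt (X l \<omega>) (cball x (r n)))"

text \<open>The neighbour count as a function of the vector of summands. In this form it can be used as the
  independent information in Campbell's formula.\<close>

definition nbrs_of :: "nat set \<Rightarrow> nat \<Rightarrow> 'a \<Rightarrow> (nat \<Rightarrow> 'a measure) \<Rightarrow> nat" where
  "nbrs_of I n x v = (\<Sum>l\<in>I. cnt (v l) (cball x (r n)))"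

lemma X_measurable: "1 \<le> i \<Longrightarrow> X i \<in> measurable M pp_space"
  using indep unfolding indep_vars_def by auto

lemma X_lf: "1 \<le> i \<Longrightarrow> \<omega> \<in> space M \<Longrightarrow> X i \<omega> \<in> lf_counting"
  using measurable_space[OF X_measurable, of i \<omega>] by simp

lemma nn_integral_X:
  assumes "1 \<le> i" "g \<in> borel_measurable pp_space"
  shows "(\<integral>\<^sup>+\<omega>. g (X i \<omega>) \<partial>M) = (\<integral>\<^sup>+\<phi>. g \<phi> \<partial>P0)"
  using nn_integral_distr[OF X_measurable[OF assms(1)], of g] assms law by simp

lemma AE_X: "1 \<le> i \<Longrightarrow> AE \<omega> in M. simple_config (X i \<omega>)"
proof -
  assume i: "1 \<le> i"
  have "AE \<phi> in distr M pp_space (X i). simple_config \<phi>" unfolding law[OF i] by (rule AE_simple)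
  then show ?thesis
    by (subst (asm) AE_distr_iff[OF X_measurable[OF i]]) (simp_all add: sets_simple_config)
qed

lemma rest_measurable: "J \<subseteq> {1..} \<Longrightarrow> (\<lambda>\<omega>. \<lambda>l\<in>J. X l \<omega>) \<in> measurable M (PiM J (\<lambda>_. pp_space))"
  by (intro measurable_restrict X_measurable) auto

lemma joint_law_X_rest:
  assumes "1 \<le> i" "J \<subseteq> {1..}" "i \<notin> J"
  shows "distr M pp_space (X i) \<Otimes>\<^sub>M distr M (PiM J (\<lambda>_. pp_space)) (\<lambda>\<omega>. \<lambda>l\<in>J. X l \<omega>)
    = distr M (pp_space \<Otimes>\<^sub>M PiM J (\<lambda>_. pp_space)) (\<lambda>\<omega>. (X i \<omega>, \<lambda>l\<in>J. X l \<omega>))"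
proof -
  let ?A = "PiM {i} (\<lambda>_. pp_space :: 'a measure measure)" and ?B = "PiM J (\<lambda>_. pp_space :: 'a measure measure)"
  let ?Xi = "\<lambda>\<omega>. \<lambda>l\<in>{i}. X l \<omega>" and ?XJ = "\<lambda>\<omega>. \<lambda>l\<in>J. X l \<omega>"
  have Xi: "?Xi \<in> measurable M ?A" and XJ: "?XJ \<in> measurable M ?B"
    using assms by (intro rest_measurable; auto)+
  have "indep_var ?A ?Xi ?B ?XJ"
    using assms by (intro indep_var_restrict[OF indep]) auto
  then have pd: "distr M ?A ?Xi \<Otimes>\<^sub>M distr M ?B ?XJ = distr M (?A \<Otimes>\<^sub>M ?B) (\<lambda>\<omega>. (?Xi \<omega>, ?XJ \<omega>))"
    unfolding indep_var_distribution_eq by blast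
  have ev: "(\<lambda>v. v i) \<in> measurable ?A pp_space" by (rule measurable_component_singleton) simp
  have "distr M pp_space (X i) \<Otimes>\<^sub>M distr M ?B ?XJ
    = distr (distr M ?A ?Xi) pp_space (\<lambda>v. v i) \<Otimes>\<^sub>M distr (distr M ?B ?XJ) ?B (\<lambda>v. v)"
    by (simp add: distr_distr[OF ev Xi] distr_distr[OF measurable_ident_sets[OF refl] XJ] comp_def)
  also have "\<dots> = distr (distr M ?A ?Xi \<Otimes>\<^sub>M distr M ?B ?XJ) (pp_space \<Otimes>\<^sub>M ?B) (\<lambda>(v, w). (v i, w))"
  proof (rule pair_measure_distr)
    have "distr (distr M ?B ?XJ) ?B (\<lambda>v. v) = distr M ?B ?XJ"
      by (simp add: distr_distr[OF measurable_ident_sets[OF refl] XJ] comp_def)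
    then show "sigma_finite_measure (distr (distr M ?B ?XJ) ?B (\<lambda>v. v))"
      using prob_space_distr[OF XJ] prob_space_imp_sigma_finite by metis
  qed (use ev in auto)
  also have "\<dots> = distr M (pp_space \<Otimes>\<^sub>M ?B) (\<lambda>\<omega>. (X i \<omega>, ?XJ \<omega>))"
  proof -
    have "(\<lambda>p. (fst p i, snd p)) \<in> measurable (?A \<Otimes>\<^sub>M ?B) (pp_space \<Otimes>\<^sub>M ?B)"
      by (intro measurable_Pair measurable_compose[OF measurable_fst ev] measurable_snd)
    then show ?thesis unfolding pd split_beta'
      by (subst distr_distr) (auto simp: comp_def intro!: measurable_Pair Xi XJ)
  qed
  finally show ?thesis .
qed

lemma nbrs_of_restrict: "I \<subseteq> J \<Longrightarrow> nbrs_of I n x (\<lambda>l\<in>J. X l \<omega>) = nbrs I n x \<omega>"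
  unfolding nbrs_of_def nbrs_def by (intro sum.cong) auto

lemma measurable_nbrs_of:
  assumes "I \<subseteq> J" and g: "g \<in> borel_measurable L" and v: "v \<in> measurable L (PiM J (\<lambda>_. pp_space))"
  shows "(\<lambda>l. nbrs_of I n (g l) (v l)) \<in> measurable L (count_space UNIV)"
  unfolding nbrs_of_def
proof (intro measurable_sum_nat measurable_cnt_cball g)
  fix i assume "i \<in> I"
  then show "(\<lambda>l. v l i) \<in> measurable L pp_space"
    using assms by (intro measurable_compose[OF v measurable_component_singleton]) auto
qed

lemma measurable_nbrs:
  assumes "I \<subseteq> {1..}" and g: "g \<in> borel_measurable L" and v: "v \<in> measurable L M"
  shows "(\<lambda>l. nbrs I n (g l) (v l)) \<in> measurable L (count_space UNIV)"
  unfolding nbrs_def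
proof (intro measurable_sum_nat measurable_cnt_cball g)
  fix i assume "i \<in> I"
  then show "(\<lambda>l. X i (v l)) \<in> measurable L pp_space"
    using assms by (intro measurable_compose[OF v X_measurable]) auto
qed

lemma nbrs_pgf:
  assumes I: "finite I" "I \<subseteq> {1..}" and z: "\<And>x. x \<in> P \<Longrightarrow> 0 \<le> z x \<and> z x \<le> 1"
  shows "(\<integral>\<omega>. (\<Prod>x\<in>P. z x ^ nbrs I n x \<omega>) \<partial>M) = ball_pgf P z n ^ card I"
proof -
  define g where "g \<phi> = (\<Prod>x\<in>P. z x ^ cnt \<phi> (cball x (r n)))" for \<phi> :: "'a measure"
  have gm: "g \<in> borel_measurable pp_space" unfolding g_def by (rule ball_prod_measurable)
  have iv: "indep_vars (\<lambda>_. borel) (\<lambda>l \<omega>. g (X l \<omega>)) I"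
    using gm by (intro indep_vars_compose2[OF indep_vars_subset[OF indep I(2)]])
  have int: "(\<integral>\<omega>. g (X l \<omega>) \<partial>M) = ball_pgf P z n" if "l \<in> I" for l
  proof -
    have l: "1 \<le> l" using that I by auto
    have "ball_pgf P z n = (\<integral>\<phi>. g \<phi> \<partial>distr M pp_space (X l))"
      unfolding law[OF l] by (simp add: ball_pgf_def g_def[abs_def])
    then show ?thesis using integral_distr[OF X_measurable[OF l] gm] by simp
  qed
  have "(\<integral>\<omega>. (\<Prod>x\<in>P. z x ^ nbrs I n x \<omega>) \<partial>M) = (\<integral>\<omega>. (\<Prod>l\<in>I. g (X l \<omega>)) \<partial>M)"
    unfolding nbrs_def g_def power_sum by (subst prod.swap) simp
  also have "\<dots> = (\<Prod>l\<in>I. \<integral>\<omega>. g (X l \<omega>) \<partial>M)"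
  proof (rule indep_vars_lebesgue_integral[OF I(1) iv])
    fix l assume "l \<in> I"
    then have l: "1 \<le> l" using I by auto
    have "integrable (distr M pp_space (X l)) g" using ball_pgf_bounds(2)[OF z] law[OF l] by (simp add: g_def[abs_def])
    then show "integrable M (\<lambda>\<omega>. g (X l \<omega>))" by (subst (asm) integrable_distr_eq[OF X_measurable[OF l] gm])
  qed
  also have "\<dots> = ball_pgf P z n ^ card I" using int by simp
  finally show ?thesis .
qed

text \<open>At finitely many fixed points the neighbour counts become independent Poisson variables. Each
  summand contributes one factor to their generating function; the at most two factors that are
  missing in \<open>I n\<close> tend to one.\<close>

lemma nbrs_limit:
  assumes P: "finite P" and I: "\<And>n. I n \<subseteq> {1..n}" "\<And>n. n \<le> card (I n) + 2"
    and a: "\<And>k. 0 \<le> a k \<and> a k \<le> c"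
  shows "(\<lambda>n. \<integral>\<omega>. (\<Prod>x\<in>P. a (nbrs (I n) n x \<omega>)) \<partial>M) \<longlonglongrightarrow> (\<Prod>x\<in>P. alpha a (\<tau> * lam x))"
proof (rule poisson_limit_of_joint_pgf[OF P, where c = c])
  show "nbrs (I n) n x \<in> measurable M (count_space UNIV)" for n x
  proof -
    have "I n \<subseteq> {1..}" by (rule order_trans[OF I(1)]) auto
    from measurable_nbrs[OF this, of "\<lambda>_. x" M "\<lambda>\<omega>. \<omega>" n] show ?thesis by simp
  qed
  show "0 \<le> \<tau> * lam x" for x using \<tau>_nonneg lam_nonneg[of x] by simp
  fix z :: "'a \<Rightarrow> real" assume z: "\<And>x. x \<in> P \<Longrightarrow> 0 \<le> z x \<and> z x \<le> 1"
  have cI: "card (I n) \<le> n" for n using card_mono[OF _ I(1)[of n]] by simp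
  have "(\<lambda>n. ball_pgf P z n ^ card (I n)) \<longlonglongrightarrow> exp (- (\<Sum>x\<in>P. (1 - z x) * (\<tau> * lam x)))"
    using z by (intro power_tendsto_exp ball_pgf_bounds(1) ball_pgf_limit[OF P] cI I(2)) auto
  moreover have "(\<integral>\<omega>. (\<Prod>x\<in>P. z x ^ nbrs (I n) n x \<omega>) \<partial>M) = ball_pgf P z n ^ card (I n)" for n
    using I(1)[of n] z by (intro nbrs_pgf) (auto intro: finite_subset)
  ultimately show "(\<lambda>n. \<integral>\<omega>. (\<Prod>x\<in>P. z x ^ nbrs (I n) n x \<omega>) \<partial>M) \<longlonglongrightarrow> exp (- (\<Sum>x\<in>P. (1 - z x) * (\<tau> * lam x)))"
    by simp
qed (use a in auto)

end

locale retention_setting = superposed_sample P0 lam r \<tau> M X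
  for P0 :: "'a::euclidean_space measure measure" and lam r \<tau> and M :: "'w measure" and X +
  fixes a :: "nat \<Rightarrow> real" and c :: real and u :: "'a \<Rightarrow> real" and R :: real
  assumes a_bounds: "\<And>k. 0 \<le> a k \<and> a k \<le> c"
    and u_meas [measurable]: "u \<in> borel_measurable borel" and u_bounds: "\<And>x. 0 \<le> u x \<and> u x \<le> 1"
    and u_supp: "\<And>x. x \<notin> cball 0 R \<Longrightarrow> u x = 0"
begin

abbreviation W :: "'a set" where "W \<equiv> cball 0 R"

definition weight :: "nat set \<Rightarrow> nat \<Rightarrow> 'a \<Rightarrow> 'w \<Rightarrow> ennreal" where
  "weight I n x \<omega> = ennreal (u x * a (nbrs I n x \<omega>))"

text \<open>The neighbours are counted in the summands \<open>I\<close> alone. For \<open>i \<notin> I\<close> the weights are then independent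
  of the points of \<open>X i\<close> to which they are attached.\<close>

definition weight_sum :: "nat \<Rightarrow> nat set \<Rightarrow> nat \<Rightarrow> 'w \<Rightarrow> ennreal" where
  "weight_sum n I i \<omega> = (\<integral>\<^sup>+x. weight I n x \<omega> \<partial>X i \<omega>)"

lemma c_nonneg: "0 \<le> c" using a_bounds[of 0] by simp

lemma weight_le: "weight I n x \<omega> \<le> ennreal c * indicator W x"
proof (cases "x \<in> W")
  case True
  have "u x * a (nbrs I n x \<omega>) \<le> 1 * c" using u_bounds a_bounds c_nonneg by (intro mult_mono) auto
  then show ?thesis using True by (simp add: weight_def ennreal_leI)
next
  case False
  then have "u x = 0" by (rule u_supp)
  then show ?thesis by (simp add: weight_def)
qed

lemma weight_measurable:
  assumes "I \<subseteq> {1..}" "g \<in> borel_measurable L" "v \<in> measurable L M"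
  shows "(\<lambda>l. weight I n (g l) (v l)) \<in> borel_measurable L"
proof -
  have "(\<lambda>l. a (nbrs I n (g l) (v l))) \<in> borel_measurable L"
    by (rule measurable_compose[OF measurable_nbrs[OF assms]]) simp
  moreover have "(\<lambda>l. u (g l)) \<in> borel_measurable L" using assms(2) by measurable
  ultimately show ?thesis unfolding weight_def
    by (intro measurable_compose[OF borel_measurable_times measurable_ennreal])
qed

lemma weight_sum_measurable:
  assumes "I \<subseteq> {1..}" "1 \<le> i"
  shows "weight_sum n I i \<in> borel_measurable M"
  unfolding weight_sum_def
  by (intro measurable_nn_integral_kernel X_measurable assms)
    (simp add: split_beta' weight_measurable[OF assms(1) measurable_snd measurable_fst])

lemma weight_sum_le:
  assumes "1 \<le> i" "\<omega> \<in> space M"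
  shows "weight_sum n I i \<omega> \<le> ennreal c * emeasure (X i \<omega>) W"
proof -
  have "weight_sum n I i \<omega> \<le> (\<integral>\<^sup>+x. ennreal c * indicator W x \<partial>X i \<omega>)"
    unfolding weight_sum_def by (intro nn_integral_mono weight_le)
  also have "\<dots> = ennreal c * emeasure (X i \<omega>) W"
    using lf_sets[OF X_lf[OF assms]] by (intro nn_integral_cmult_indicator) simp
  finally show ?thesis .
qed

definition mean_weight :: "nat \<Rightarrow> nat set \<Rightarrow> ennreal" where
  "mean_weight n I = (\<integral>\<^sup>+x. ennreal (lam x) * (\<integral>\<^sup>+\<omega>. weight I n x \<omega> \<partial>M) \<partial>lborel)"

definition mean_weight_pair :: "nat \<Rightarrow> nat set \<Rightarrow> ennreal" where
  "mean_weight_pair n I = (\<integral>\<^sup>+x. ennreal (lam x) * (\<integral>\<^sup>+y. ennreal (lam y) * (\<integral>\<^sup>+\<omega>. weight I n x \<omega> * weight I n y \<omega> \<partial>M) \<partial>lborel) \<partial>lborel)"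

definition weight_of :: "nat set \<Rightarrow> nat \<Rightarrow> 'a \<Rightarrow> (nat \<Rightarrow> 'a measure) \<Rightarrow> ennreal" where
  "weight_of I n x v = ennreal (u x * a (nbrs_of I n x v))"

lemma weight_of_restrict: "I \<subseteq> J \<Longrightarrow> weight_of I n x (\<lambda>l\<in>J. X l \<omega>) = weight I n x \<omega>"
  by (simp add: weight_of_def weight_def nbrs_of_restrict)

lemma weight_of_measurable:
  assumes "I \<subseteq> J" "g \<in> borel_measurable L" "v \<in> measurable L (PiM J (\<lambda>_. pp_space))"
  shows "(\<lambda>l. weight_of I n (g l) (v l)) \<in> borel_measurable L"
proof -
  have "(\<lambda>l. a (nbrs_of I n (g l) (v l))) \<in> borel_measurable L"
    by (rule measurable_compose[OF measurable_nbrs_of[OF assms]]) simp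
  moreover have "(\<lambda>l. u (g l)) \<in> borel_measurable L" using assms(2) by measurable
  ultimately show ?thesis unfolding weight_of_def
    by (intro measurable_compose[OF borel_measurable_times measurable_ennreal])
qed

text \<open>The weights are computed from summands independent of \<open>X i\<close>, so Campbell's formula replaces the
  points of \<open>X i\<close> by fixed points.\<close>

lemma expectation_weight_sum:
  assumes I: "I \<subseteq> {1..}" "i \<notin> I" "1 \<le> i"
  shows "(\<integral>\<^sup>+\<omega>. weight_sum n I i \<omega> \<partial>M) = mean_weight n I"
proof -
  have "(\<lambda>(x, v). weight_of I n x v) \<in> borel_measurable (borel \<Otimes>\<^sub>M PiM I (\<lambda>_. pp_space))"
    unfolding split_beta' by (rule weight_of_measurable[OF order_refl measurable_fst measurable_snd])
  from campbell_indep[OF prob_space_axioms X_measurable[OF I(3)] rest_measurable[OF I(1)] joint_law_X_rest[OF I(3,1,2)] law[OF I(3)] this]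
  show ?thesis by (simp add: weight_sum_def mean_weight_def weight_of_restrict)
qed

text \<open>Campbell's formula is applied twice, first to the points of \<open>X i\<close> given the summands in \<open>insert j I\<close>,
  then to those of \<open>X j\<close> given the summands in \<open>I\<close>.\<close>

lemma expectation_weight_sum_product:
  assumes I: "I \<subseteq> {1..}" "i \<notin> I" "j \<notin> I" "i \<noteq> j" "1 \<le> i" "1 \<le> j"
  shows "(\<integral>\<^sup>+\<omega>. weight_sum n I i \<omega> * weight_sum n I j \<omega> \<partial>M) = mean_weight_pair n I"
proof -
  define J where "J = insert j I"
  have J: "J \<subseteq> {1..}" "i \<notin> J" "I \<subseteq> J" "j \<in> J" using I by (auto simp: J_def)
  define f where "f x v = (\<integral>\<^sup>+y. weight_of I n x v * weight_of I n y v \<partial>v j)" for x v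
  let ?L = "borel \<Otimes>\<^sub>M PiM J (\<lambda>_. pp_space :: 'a measure measure)"
  have "(\<lambda>p. \<integral>\<^sup>+y. weight_of I n (fst p) (snd p) * weight_of I n y (snd p) \<partial>snd p j) \<in> borel_measurable ?L"
  proof (rule measurable_nn_integral_kernel)
    show "(\<lambda>p. snd p j) \<in> measurable ?L pp_space"
      by (rule measurable_compose[OF measurable_snd measurable_component_singleton]) (rule J(4))
    show "(\<lambda>(p, y). weight_of I n (fst p) (snd p) * weight_of I n y (snd p)) \<in> borel_measurable (?L \<Otimes>\<^sub>M borel)"
      unfolding split_beta'
      by (intro borel_measurable_times_ennreal weight_of_measurable[OF J(3)] measurable_snd
          measurable_compose[OF measurable_fst measurable_fst] measurable_compose[OF measurable_fst measurable_snd])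
  qed
  then have fm: "(\<lambda>(x, v). f x v) \<in> borel_measurable ?L" by (simp add: f_def split_beta')
  have wX: "(\<lambda>y. weight I n y \<omega>) \<in> borel_measurable (X k \<omega>)" if "\<omega> \<in> space M" "1 \<le> k" for k \<omega>
  proof -
    have "(\<lambda>y. weight I n y \<omega>) \<in> borel_measurable borel"
      using weight_measurable[OF I(1), of "\<lambda>y. y" borel "\<lambda>_. \<omega>"] that by simp
    then show ?thesis by (rule measurable_config[OF X_lf[OF that(2,1)]])
  qed
  have fX: "f x (\<lambda>l\<in>J. X l \<omega>) = (\<integral>\<^sup>+y. weight I n x \<omega> * weight I n y \<omega> \<partial>X j \<omega>)" for x \<omega>
    using J by (simp add: f_def weight_of_restrict)
  have "(\<integral>\<^sup>+\<omega>. weight_sum n I i \<omega> * weight_sum n I j \<omega> \<partial>M) = (\<integral>\<^sup>+\<omega>. (\<integral>\<^sup>+x. f x (\<lambda>l\<in>J. X l \<omega>) \<partial>X i \<omega>) \<partial>M)"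
  proof (rule nn_integral_cong)
    fix \<omega> assume \<omega>: "\<omega> \<in> space M"
    have "weight_sum n I i \<omega> * weight_sum n I j \<omega> = (\<integral>\<^sup>+x. weight I n x \<omega> * weight_sum n I j \<omega> \<partial>X i \<omega>)"
      unfolding weight_sum_def[of n I i] by (rule nn_integral_multc[symmetric, OF wX[OF \<omega> I(5)]])
    also have "\<dots> = (\<integral>\<^sup>+x. f x (\<lambda>l\<in>J. X l \<omega>) \<partial>X i \<omega>)"
      unfolding fX weight_sum_def by (intro nn_integral_cong nn_integral_cmult[symmetric] wX[OF \<omega> I(6)])
    finally show "weight_sum n I i \<omega> * weight_sum n I j \<omega> = (\<integral>\<^sup>+x. f x (\<lambda>l\<in>J. X l \<omega>) \<partial>X i \<omega>)" .
  qed
  also have "\<dots> = (\<integral>\<^sup>+x. ennreal (lam x) * (\<integral>\<^sup>+\<omega>. f x (\<lambda>l\<in>J. X l \<omega>) \<partial>M) \<partial>lborel)"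
    by (rule campbell_indep[OF prob_space_axioms X_measurable[OF I(5)] rest_measurable[OF J(1)] joint_law_X_rest[OF I(5) J(1,2)] law[OF I(5)] fm])
  also have "\<dots> = mean_weight_pair n I"
    unfolding mean_weight_pair_def
  proof (intro nn_integral_cong arg_cong2[where f = "(*)"] refl)
    fix x :: 'a
    have "(\<lambda>(y, v). weight_of I n x v * weight_of I n y v) \<in> borel_measurable (borel \<Otimes>\<^sub>M PiM I (\<lambda>_. pp_space))"
      unfolding split_beta'
      by (intro borel_measurable_times_ennreal weight_of_measurable[OF order_refl] measurable_fst measurable_snd) simp
    from campbell_indep[OF prob_space_axioms X_measurable[OF I(6)] rest_measurable[OF I(1)] joint_law_X_rest[OF I(6,1,3)] law[OF I(6)] this]
    show "(\<integral>\<^sup>+\<omega>. f x (\<lambda>l\<in>J. X l \<omega>) \<partial>M) = (\<integral>\<^sup>+y. ennreal (lam y) * (\<integral>\<^sup>+\<omega>. weight I n x \<omega> * weight I n y \<omega> \<partial>M) \<partial>lborel)"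
      unfolding fX by (simp add: weight_of_restrict)
  qed
  finally show ?thesis .
qed

end

section \<open>A law of large numbers for the retention weights\<close>

lemma alpha_sums:
  assumes "\<And>k. \<bar>a k\<bar> \<le> c" "0 \<le> t"
  shows "(\<lambda>k. t ^ k / fact k * exp (- t) * a k) sums alpha a t"
  using sums_expectation_nat_pmf[of a c "Poi t"] assms pmf_Poi[OF assms(2)] by (simp add: alpha_def)

lemma alpha_measurable:
  fixes g :: "'b \<Rightarrow> real"
  assumes a: "\<And>k. \<bar>a k\<bar> \<le> c" and g [measurable]: "g \<in> borel_measurable N" and g0: "\<And>x. 0 \<le> g x"
  shows "(\<lambda>x. alpha a (g x)) \<in> borel_measurable N"
proof -
  have "alpha a (g x) = (\<Sum>k. g x ^ k / fact k * exp (- g x) * a k)" for x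
    using alpha_sums[OF a g0] by (simp add: sums_iff)
  then show ?thesis by simp
qed

lemma alpha_bounds:
  assumes "\<And>k. 0 \<le> a k \<and> a k \<le> c"
  shows "0 \<le> alpha a t \<and> alpha a t \<le> c"
proof -
  have i: "integrable (measure_pmf (Poi t)) a"
    using assms by (intro measure_pmf.integrable_const_bound[where B = c]) auto
  have "alpha a t \<le> measure_pmf.expectation (Poi t) (\<lambda>_. c)"
    unfolding alpha_def using i assms by (intro integral_mono) auto
  then show ?thesis using assms by (auto simp: alpha_def intro!: Bochner_Integration.integral_nonneg)
qed

text \<open>A sequence of worst choices \<open>p n \<in> A n\<close> converges too.\<close>

lemma eventually_uniform_of_sequences:
  fixes f :: "nat \<Rightarrow> 'b \<Rightarrow> real"
  assumes ne: "\<And>n. A n \<noteq> {}" and lim: "\<And>p. (\<And>n. p n \<in> A n) \<Longrightarrow> (\<lambda>n. f n (p n)) \<longlonglongrightarrow> L" and e: "0 < e"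
  shows "eventually (\<lambda>n. \<forall>I\<in>A n. \<bar>f n I - L\<bar> < e) sequentially"
proof -
  have "\<forall>n. \<exists>I. I \<in> A n \<and> ((\<exists>J\<in>A n. \<not> \<bar>f n J - L\<bar> < e) \<longrightarrow> \<not> \<bar>f n I - L\<bar> < e)"
    using ne by blast
  from choice[OF this] obtain p where p: "\<And>n. p n \<in> A n"
    "\<And>n. (\<exists>J\<in>A n. \<not> \<bar>f n J - L\<bar> < e) \<longrightarrow> \<not> \<bar>f n (p n) - L\<bar> < e" by blast
  have "eventually (\<lambda>n. dist (f n (p n)) L < e) sequentially" by (rule tendstoD[OF lim[OF p(1)] e])
  then show ?thesis
  proof eventually_elim
    case (elim n)
    then show ?case using p(2)[of n] by (auto simp: dist_real_def)
  qed
qed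

lemma cball_mass_measurable:
  assumes "\<phi> \<in> lf_counting"
  shows "(\<lambda>x. emeasure \<phi> (cball x \<rho>)) \<in> borel_measurable borel"
  by (rule measurable_emeasure_cball[where \<kappa> = "\<lambda>_. \<phi>" and x = "\<lambda>x. x"]) (use assms in auto)

context retention_setting
begin

lemma alpha_lam_measurable [measurable]: "(\<lambda>x. alpha a (\<tau> * lam x)) \<in> borel_measurable borel"
proof (rule alpha_measurable)
  show "\<bar>a k\<bar> \<le> c" for k using a_bounds[of k] by simp
  show "0 \<le> \<tau> * lam x" for x using \<tau>_nonneg lam_nonneg by simp
qed measurable

definition limit_weight :: "'a \<Rightarrow> ennreal" where
  "limit_weight x = ennreal (u x * alpha a (\<tau> * lam x))"

definition limit_mean :: ennreal where
  "limit_mean = (\<integral>\<^sup>+x. ennreal (lam x) * limit_weight x \<partial>lborel)"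

text \<open>An integrable bound for \<open>lam x\<close> times the mean weight at \<open>x\<close>, uniform in \<open>n\<close> and \<open>I\<close>.\<close>

definition dominating :: "'a \<Rightarrow> ennreal" where
  "dominating x = ennreal (lam x) * (ennreal c * indicator W x)"

lemma limit_weight_measurable [measurable]: "limit_weight \<in> borel_measurable borel"
  unfolding limit_weight_def[abs_def] by measurable

lemma W_borel [measurable]: "W \<in> sets borel"
  by simp

lemma dominating_measurable [measurable]: "dominating \<in> borel_measurable borel"
  unfolding dominating_def[abs_def] by (intro borel_measurable_times_ennreal borel_measurable_indicator) auto

lemma dominating_finite: "(\<integral>\<^sup>+x. dominating x \<partial>lborel) < \<infinity>"
proof -
  obtain L where L: "0 \<le> L" "\<And>x. x \<in> W \<Longrightarrow> lam x \<le> L" using lam_bounded[of R] by blast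
  have "(\<integral>\<^sup>+x. dominating x \<partial>lborel) \<le> (\<integral>\<^sup>+x. ennreal (L * c) * indicator W x \<partial>lborel)"
  proof (intro nn_integral_mono)
    fix x
    show "dominating x \<le> ennreal (L * c) * indicator W x"
      using L c_nonneg lam_nonneg[of x]
      by (auto simp: dominating_def indicator_def ennreal_mult[symmetric] intro!: ennreal_leI mult_right_mono)
  qed
  also have "\<dots> = ennreal (L * c) * emeasure lborel W" by (rule nn_integral_cmult_indicator) simp
  also have "\<dots> < \<infinity>" using emeasure_lborel_cball_finite[of "0::'a" R] by (simp add: ennreal_mult_less_top)
  finally show ?thesis .
qed

lemma limit_weight_le: "limit_weight x \<le> ennreal c * indicator W x"
proof (cases "x \<in> W")
  case True
  have "u x * alpha a (\<tau> * lam x) \<le> 1 * c"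
    using u_bounds[of x] alpha_bounds[OF a_bounds, where t = "\<tau> * lam x"] by (intro mult_mono) auto
  then show ?thesis using True by (simp add: limit_weight_def ennreal_leI)
qed (simp add: limit_weight_def u_supp)

lemma limit_mean_finite: "limit_mean < \<infinity>"
proof -
  have "limit_mean \<le> (\<integral>\<^sup>+x. dominating x \<partial>lborel)"
    unfolding limit_mean_def dominating_def by (intro nn_integral_mono mult_left_mono limit_weight_le) simp
  then show ?thesis using dominating_finite by simp
qed

lemma expected_weight_le: "(\<integral>\<^sup>+\<omega>. weight I n x \<omega> \<partial>M) \<le> ennreal c * indicator W x"
proof -
  have "(\<integral>\<^sup>+\<omega>. weight I n x \<omega> \<partial>M) \<le> (\<integral>\<^sup>+\<omega>. ennreal c * indicator W x \<partial>M)"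
    by (intro nn_integral_mono weight_le)
  then show ?thesis by (simp add: emeasure_space_1)
qed

text \<open>Index sets that miss at most two summands: decoupling a pair of points removes the summands that
  contain them.\<close>

definition admissible :: "nat \<Rightarrow> nat set set" where
  "admissible n = {I. I \<subseteq> {1..n} \<and> n \<le> card I + 2}"

lemma admissible_subset: "I \<in> admissible n \<Longrightarrow> I \<subseteq> {1..}"
  by (auto simp: admissible_def)

lemma expected_weight_limit:
  assumes I: "\<And>n. I n \<in> admissible n"
  shows "(\<lambda>n. \<integral>\<^sup>+\<omega>. weight (I n) n x \<omega> \<partial>M) \<longlonglongrightarrow> limit_weight x"
proof -
  have "(\<integral>\<^sup>+\<omega>. weight (I n) n x \<omega> \<partial>M) = ennreal (u x * (\<integral>\<omega>. a (nbrs (I n) n x \<omega>) \<partial>M))" for n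
  proof -
    have m: "(\<lambda>\<omega>. a (nbrs (I n) n x \<omega>)) \<in> borel_measurable M"
      by (rule measurable_compose[OF measurable_nbrs[OF admissible_subset[OF I], of "\<lambda>_. x" M "\<lambda>\<omega>. \<omega>"]]) auto
    have "integrable M (\<lambda>\<omega>. a (nbrs (I n) n x \<omega>))"
      using m a_bounds by (intro integrable_const_bound[where B = c]) auto
    then have "(\<integral>\<^sup>+\<omega>. ennreal (u x * a (nbrs (I n) n x \<omega>)) \<partial>M) = ennreal (\<integral>\<omega>. u x * a (nbrs (I n) n x \<omega>) \<partial>M)"
      using u_bounds a_bounds by (intro nn_integral_eq_integral) auto
    then show ?thesis by (simp add: weight_def)
  qed
  moreover have "(\<lambda>n. \<integral>\<omega>. (\<Prod>y\<in>{x}. a (nbrs (I n) n y \<omega>)) \<partial>M) \<longlonglongrightarrow> (\<Prod>y\<in>{x}. alpha a (\<tau> * lam y))"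
    using I a_bounds by (intro nbrs_limit) (auto simp: admissible_def)
  then have "(\<lambda>n. ennreal (u x * (\<integral>\<omega>. a (nbrs (I n) n x \<omega>) \<partial>M))) \<longlonglongrightarrow> ennreal (u x * alpha a (\<tau> * lam x))"
    by (intro tendsto_ennrealI tendsto_mult tendsto_const) simp
  ultimately show ?thesis by (simp add: limit_weight_def)
qed

text \<open>Two distinct points have disjoint balls eventually, so their neighbour counts decouple in the limit.\<close>

lemma expected_weight_pair_limit:
  assumes I: "\<And>n. I n \<in> admissible n" and xy: "x \<noteq> y"
  shows "(\<lambda>n. \<integral>\<^sup>+\<omega>. weight (I n) n x \<omega> * weight (I n) n y \<omega> \<partial>M) \<longlonglongrightarrow> limit_weight x * limit_weight y"
proof -
  have "(\<integral>\<^sup>+\<omega>. weight (I n) n x \<omega> * weight (I n) n y \<omega> \<partial>M)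
    = ennreal (u x * u y * (\<integral>\<omega>. a (nbrs (I n) n x \<omega>) * a (nbrs (I n) n y \<omega>) \<partial>M))" for n
  proof -
    have m: "(\<lambda>\<omega>. a (nbrs (I n) n x \<omega>)) \<in> borel_measurable M" for x
      by (rule measurable_compose[OF measurable_nbrs[OF admissible_subset[OF I], of "\<lambda>_. x" M "\<lambda>\<omega>. \<omega>"]]) auto
    have "integrable M (\<lambda>\<omega>. a (nbrs (I n) n x \<omega>) * a (nbrs (I n) n y \<omega>))"
      using m a_bounds c_nonneg
      by (intro integrable_const_bound[where B = "c * c"]) (auto simp: abs_mult intro!: mult_mono AE_I2)
    then have "(\<integral>\<^sup>+\<omega>. ennreal (u x * u y * (a (nbrs (I n) n x \<omega>) * a (nbrs (I n) n y \<omega>))) \<partial>M)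
      = ennreal (\<integral>\<omega>. u x * u y * (a (nbrs (I n) n x \<omega>) * a (nbrs (I n) n y \<omega>)) \<partial>M)"
      using u_bounds a_bounds by (intro nn_integral_eq_integral integrable_mult_right) auto
    moreover have "weight (I n) n x \<omega> * weight (I n) n y \<omega> = ennreal (u x * u y * (a (nbrs (I n) n x \<omega>) * a (nbrs (I n) n y \<omega>)))" for \<omega>
      using u_bounds a_bounds by (simp add: weight_def ennreal_mult[symmetric] mult_ac)
    ultimately show ?thesis by simp
  qed
  moreover have "(\<lambda>n. \<integral>\<omega>. (\<Prod>w\<in>{x, y}. a (nbrs (I n) n w \<omega>)) \<partial>M) \<longlonglongrightarrow> (\<Prod>w\<in>{x, y}. alpha a (\<tau> * lam w))"
    using I a_bounds by (intro nbrs_limit) (auto simp: admissible_def)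
  then have "(\<lambda>n. \<integral>\<omega>. a (nbrs (I n) n x \<omega>) * a (nbrs (I n) n y \<omega>) \<partial>M) \<longlonglongrightarrow> alpha a (\<tau> * lam x) * alpha a (\<tau> * lam y)"
    using xy by simp
  then have "(\<lambda>n. ennreal (u x * u y * (\<integral>\<omega>. a (nbrs (I n) n x \<omega>) * a (nbrs (I n) n y \<omega>) \<partial>M)))
      \<longlonglongrightarrow> ennreal (u x * u y * (alpha a (\<tau> * lam x) * alpha a (\<tau> * lam y)))"
    by (intro tendsto_ennrealI tendsto_mult tendsto_const)
  moreover have "ennreal (u x * u y * (alpha a (\<tau> * lam x) * alpha a (\<tau> * lam y))) = limit_weight x * limit_weight y"
    using u_bounds alpha_bounds[OF a_bounds] by (simp add: limit_weight_def ennreal_mult[symmetric] mult_ac)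
  ultimately show ?thesis by simp
qed

lemma expected_weight_measurable:
  assumes "I \<subseteq> {1..}"
  shows "(\<lambda>x. \<integral>\<^sup>+\<omega>. weight I n x \<omega> \<partial>M) \<in> borel_measurable borel"
proof -
  have "(\<lambda>(x, \<omega>). weight I n x \<omega>) \<in> borel_measurable (borel \<Otimes>\<^sub>M M)"
    unfolding split_beta' by (rule weight_measurable[OF assms measurable_fst measurable_snd])
  then show ?thesis by (rule borel_measurable_nn_integral)
qed

lemma expected_weight_pair_measurable:
  assumes "I \<subseteq> {1..}"
  shows "(\<lambda>p. \<integral>\<^sup>+\<omega>. weight I n (fst p) \<omega> * weight I n (snd p) \<omega> \<partial>M) \<in> borel_measurable (borel \<Otimes>\<^sub>M borel)"
proof -
  have "(\<lambda>(p, \<omega>). weight I n (fst p) \<omega> * weight I n (snd p) \<omega>) \<in> borel_measurable ((borel \<Otimes>\<^sub>M borel) \<Otimes>\<^sub>M M)"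
    unfolding split_beta'
    by (intro borel_measurable_times_ennreal weight_measurable[OF assms] measurable_snd
        measurable_compose[OF measurable_fst measurable_fst] measurable_compose[OF measurable_fst measurable_snd])
  then show ?thesis by (rule borel_measurable_nn_integral)
qed

lemma mean_weight_limit:
  assumes I: "\<And>n. I n \<in> admissible n"
  shows "(\<lambda>n. mean_weight n (I n)) \<longlonglongrightarrow> limit_mean"
  unfolding mean_weight_def limit_mean_def
proof (rule nn_integral_dominated_convergence[where w = dominating])
  show "(\<lambda>x. ennreal (lam x) * (\<integral>\<^sup>+\<omega>. weight (I n) n x \<omega> \<partial>M)) \<in> borel_measurable lborel" for n
    using expected_weight_measurable[OF admissible_subset[OF I]] by simp
  show "AE x in lborel. ennreal (lam x) * (\<integral>\<^sup>+\<omega>. weight (I n) n x \<omega> \<partial>M) \<le> dominating x" for n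
    unfolding dominating_def by (intro AE_I2 mult_left_mono expected_weight_le) simp
  show "AE x in lborel. (\<lambda>n. ennreal (lam x) * (\<integral>\<^sup>+\<omega>. weight (I n) n x \<omega> \<partial>M)) \<longlonglongrightarrow> ennreal (lam x) * limit_weight x"
    by (intro AE_I2 ennreal_tendsto_cmult expected_weight_limit I) simp
qed (use dominating_finite in auto)

text \<open>Dominated convergence in both variables; the diagonal, where the weights stay dependent, is null.\<close>

lemma mean_weight_pair_limit:
  assumes I: "\<And>n. I n \<in> admissible n"
  shows "(\<lambda>n. mean_weight_pair n (I n)) \<longlonglongrightarrow> limit_mean * limit_mean"
proof -
  define e where "e n x y = (\<integral>\<^sup>+\<omega>. weight (I n) n x \<omega> * weight (I n) n y \<omega> \<partial>M)" for n x y
  have em: "(\<lambda>p. e n (fst p) (snd p)) \<in> borel_measurable (borel \<Otimes>\<^sub>M borel)" for n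
    unfolding e_def by (rule expected_weight_pair_measurable[OF admissible_subset[OF I]])
  have emy: "(\<lambda>y. e n x y) \<in> borel_measurable borel" for n x
    using measurable_Pair2[OF em, of x n] by simp
  have ele: "e n x y \<le> ennreal c * indicator W x * (ennreal c * indicator W y)" for n x y
  proof -
    have "e n x y \<le> (\<integral>\<^sup>+\<omega>. ennreal c * indicator W x * (ennreal c * indicator W y) \<partial>M)"
      unfolding e_def by (intro nn_integral_mono mult_mono weight_le) auto
    then show ?thesis by (simp add: emeasure_space_1)
  qed
  define m where "m n x = (\<integral>\<^sup>+y. ennreal (lam y) * e n x y \<partial>lborel)" for n x
  have mm: "m n \<in> borel_measurable borel" for n
  proof -
    have "(\<lambda>(x, y). ennreal (lam y) * e n x y) \<in> borel_measurable (borel \<Otimes>\<^sub>M borel)"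
      unfolding split_beta'
      by (intro borel_measurable_times_ennreal em measurable_compose[OF measurable_snd]) measurable
    then have "(\<lambda>(x, y). ennreal (lam y) * e n x y) \<in> borel_measurable (borel \<Otimes>\<^sub>M lborel)"
      by (simp add: measurable_cong_sets[OF sets_pair_measure_cong[OF refl sets_lborel] refl])
    then show ?thesis unfolding m_def[abs_def] by (rule lborel.borel_measurable_nn_integral)
  qed
  have mlim: "(\<lambda>n. m n x) \<longlonglongrightarrow> limit_weight x * limit_mean" for x
  proof -
    have "(\<lambda>n. m n x) \<longlonglongrightarrow> (\<integral>\<^sup>+y. ennreal (lam y) * (limit_weight x * limit_weight y) \<partial>lborel)"
      unfolding m_def
    proof (rule nn_integral_dominated_convergence[where w = "\<lambda>y. ennreal c * dominating y"])
      show "AE y in lborel. ennreal (lam y) * e n x y \<le> ennreal c * dominating y" for n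
      proof (intro AE_I2)
        fix y
        have "ennreal (lam y) * e n x y \<le> ennreal (lam y) * (ennreal c * 1 * (ennreal c * indicator W y))"
          by (intro mult_left_mono order_trans[OF ele] mult_right_mono) (auto simp: indicator_def)
        then show "ennreal (lam y) * e n x y \<le> ennreal c * dominating y" by (simp add: dominating_def mult_ac)
      qed
      show "(\<integral>\<^sup>+y. ennreal c * dominating y \<partial>lborel) < \<infinity>"
        using dominating_finite by (simp add: nn_integral_cmult ennreal_mult_less_top)
      have "AE y in lborel. y \<noteq> x" by (rule AE_lborel_singleton)
      then show "AE y in lborel. (\<lambda>n. ennreal (lam y) * e n x y) \<longlonglongrightarrow> ennreal (lam y) * (limit_weight x * limit_weight y)"
      proof eventually_elim
        case (elim y)
        then show ?case unfolding e_def by (intro ennreal_tendsto_cmult expected_weight_pair_limit I) auto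
      qed
    qed (use emy in auto)
    also have "(\<integral>\<^sup>+y. ennreal (lam y) * (limit_weight x * limit_weight y) \<partial>lborel)
      = (\<integral>\<^sup>+y. limit_weight x * (ennreal (lam y) * limit_weight y) \<partial>lborel)" by (simp add: mult_ac)
    also have "\<dots> = limit_weight x * limit_mean" unfolding limit_mean_def by (rule nn_integral_cmult) simp
    finally show ?thesis .
  qed
  have mle: "m n x \<le> ennreal c * indicator W x * (\<integral>\<^sup>+y. dominating y \<partial>lborel)" for n x
  proof -
    have "m n x \<le> (\<integral>\<^sup>+y. ennreal c * indicator W x * dominating y \<partial>lborel)"
      unfolding m_def
    proof (intro nn_integral_mono)
      fix y
      have "ennreal (lam y) * e n x y \<le> ennreal (lam y) * (ennreal c * indicator W x * (ennreal c * indicator W y))"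
        by (intro mult_left_mono ele) simp
      then show "ennreal (lam y) * e n x y \<le> ennreal c * indicator W x * dominating y" by (simp add: dominating_def mult_ac)
    qed
    also have "\<dots> = ennreal c * indicator W x * (\<integral>\<^sup>+y. dominating y \<partial>lborel)" by (rule nn_integral_cmult) simp
    finally show ?thesis .
  qed
  have "(\<lambda>n. \<integral>\<^sup>+x. ennreal (lam x) * m n x \<partial>lborel) \<longlonglongrightarrow> (\<integral>\<^sup>+x. ennreal (lam x) * (limit_weight x * limit_mean) \<partial>lborel)"
  proof (rule nn_integral_dominated_convergence[where w = "\<lambda>x. dominating x * (\<integral>\<^sup>+y. dominating y \<partial>lborel)"])
    show "AE x in lborel. ennreal (lam x) * m n x \<le> dominating x * (\<integral>\<^sup>+y. dominating y \<partial>lborel)" for n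
    proof (intro AE_I2)
      fix x
      have "ennreal (lam x) * m n x \<le> ennreal (lam x) * (ennreal c * indicator W x * (\<integral>\<^sup>+y. dominating y \<partial>lborel))"
        by (intro mult_left_mono mle) simp
      then show "ennreal (lam x) * m n x \<le> dominating x * (\<integral>\<^sup>+y. dominating y \<partial>lborel)"
        by (simp add: dominating_def mult_ac)
    qed
    show "(\<integral>\<^sup>+x. dominating x * (\<integral>\<^sup>+y. dominating y \<partial>lborel) \<partial>lborel) < \<infinity>"
      using dominating_finite by (simp add: nn_integral_multc ennreal_mult_less_top)
    show "AE x in lborel. (\<lambda>n. ennreal (lam x) * m n x) \<longlonglongrightarrow> ennreal (lam x) * (limit_weight x * limit_mean)"
      by (intro AE_I2 ennreal_tendsto_cmult mlim) simp
  qed (use mm in auto)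
  also have "(\<integral>\<^sup>+x. ennreal (lam x) * (limit_weight x * limit_mean) \<partial>lborel) = (\<integral>\<^sup>+x. ennreal (lam x) * limit_weight x * limit_mean \<partial>lborel)"
    by (simp add: mult_ac)
  also have "\<dots> = limit_mean * limit_mean"
    unfolding limit_mean_def by (rule nn_integral_multc) simp
  finally show ?thesis unfolding m_def e_def mean_weight_pair_def .
qed

text \<open>Dropping \<open>X j\<close> from the neighbour counts changes the weight of a point by at most \<open>c\<close>, and only
  if \<open>X j\<close> has a point in its ball; this is the resulting bound for the points of \<open>X i\<close>.\<close>

definition drop_error :: "nat \<Rightarrow> nat \<Rightarrow> nat \<Rightarrow> 'w \<Rightarrow> ennreal" where
  "drop_error n i j \<omega> = (\<integral>\<^sup>+x. ennreal c * indicator W x * emeasure (X j \<omega>) (cball x (r n)) \<partial>X i \<omega>)"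

lemma drop_error_measurable:
  assumes "1 \<le> i" "1 \<le> j"
  shows "drop_error n i j \<in> borel_measurable M"
  unfolding drop_error_def
proof (intro measurable_nn_integral_kernel X_measurable assms, unfold split_beta', intro borel_measurable_times_ennreal)
  show "(\<lambda>p. emeasure (X j (fst p)) (cball (snd p) (r n))) \<in> borel_measurable (M \<Otimes>\<^sub>M borel)"
    by (intro measurable_emeasure_cball measurable_compose[OF measurable_fst X_measurable] assms measurable_snd)
  show "(\<lambda>p. indicator W (snd p) :: ennreal) \<in> borel_measurable (M \<Otimes>\<^sub>M borel)"
    by (rule measurable_compose[OF measurable_snd], intro borel_measurable_indicator) simp
qed simp

lemma weight_sum_le_drop:
  assumes I: "finite I" "I \<subseteq> {1..}" "j \<in> I" and i: "1 \<le> i" and \<omega>: "\<omega> \<in> space M"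
  shows "weight_sum n I i \<omega> \<le> weight_sum n (I - {j}) i \<omega> + drop_error n i j \<omega>"
proof -
  have j: "1 \<le> j" using I by auto
  have pt: "weight I n x \<omega> \<le> weight (I - {j}) n x \<omega> + ennreal c * indicator W x * emeasure (X j \<omega>) (cball x (r n))" for x
  proof (cases "cnt (X j \<omega>) (cball x (r n)) = 0")
    case True
    then have "nbrs I n x \<omega> = nbrs (I - {j}) n x \<omega>"
      unfolding nbrs_def using sum.remove[OF I(1,3), of "\<lambda>l. cnt (X l \<omega>) (cball x (r n))"] by simp
    then show ?thesis by (simp add: weight_def)
  next
    case False
    then have "(1::ennreal) \<le> of_nat (cnt (X j \<omega>) (cball x (r n)))" by simp
    also have "\<dots> = emeasure (X j \<omega>) (cball x (r n))" by (rule emeasure_lf_cnt[symmetric, OF X_lf[OF j \<omega>]]) auto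
    finally have "ennreal c * indicator W x * 1 \<le> ennreal c * indicator W x * emeasure (X j \<omega>) (cball x (r n))"
      by (intro mult_left_mono) auto
    moreover have "weight I n x \<omega> \<le> ennreal c * indicator W x * 1" using weight_le[of I n x \<omega>] by simp
    ultimately have "weight I n x \<omega> \<le> ennreal c * indicator W x * emeasure (X j \<omega>) (cball x (r n))"
      by (rule order_trans[rotated])
    then show ?thesis by (simp add: add_increasing)
  qed
  have m1: "(\<lambda>x. weight (I - {j}) n x \<omega>) \<in> borel_measurable (X i \<omega>)"
    using weight_measurable[of "I - {j}" "\<lambda>y. y" borel "\<lambda>_. \<omega>"] I \<omega>
    by (intro measurable_config[OF X_lf[OF i \<omega>]]) auto
  have m2: "(\<lambda>x. ennreal c * indicator W x * emeasure (X j \<omega>) (cball x (r n))) \<in> borel_measurable (X i \<omega>)"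
    by (intro measurable_config[OF X_lf[OF i \<omega>]] borel_measurable_times_ennreal borel_measurable_indicator
        cball_mass_measurable[OF X_lf[OF j \<omega>]]) auto
  have "weight_sum n I i \<omega> \<le> (\<integral>\<^sup>+x. weight (I - {j}) n x \<omega> + ennreal c * indicator W x * emeasure (X j \<omega>) (cball x (r n)) \<partial>X i \<omega>)"
    unfolding weight_sum_def by (intro nn_integral_mono pt)
  also have "\<dots> = weight_sum n (I - {j}) i \<omega> + drop_error n i j \<omega>"
    unfolding weight_sum_def drop_error_def by (rule nn_integral_add[OF m1 m2])
  finally show ?thesis .
qed

text \<open>The ball around a point of \<open>X i\<close> contains a point of \<open>X j\<close> with probability of the order of its
  volume. The count of \<open>X j\<close> in the window is controlled simultaneously by the second moment bound.\<close>

lemma expectation_drop_error: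
  "\<exists>\<kappa>\<ge>0. eventually (\<lambda>n. \<forall>i\<ge>1. \<forall>j\<ge>1. i \<noteq> j \<longrightarrow>
     (\<integral>\<^sup>+\<omega>. drop_error n i j \<omega> * emeasure (X j \<omega>) W \<partial>M) \<le> ennreal (\<kappa> * vol n)) sequentially"
proof -
  from second_moment[of "\<bar>R\<bar> + 1"] obtain C where C: "0 \<le> C" and C2: "\<forall>B1\<in>sets borel. \<forall>B2\<in>sets borel.
      B1 \<subseteq> cball 0 (\<bar>R\<bar> + 1) \<longrightarrow> B2 \<subseteq> cball 0 (\<bar>R\<bar> + 1) \<longrightarrow> (\<integral>\<^sup>+\<phi>. emeasure \<phi> B1 * emeasure \<phi> B2 \<partial>P0)
        \<le> ennreal C * emeasure lborel B1 * emeasure lborel B2 + (\<integral>\<^sup>+x\<in>B1 \<inter> B2. ennreal (lam x) \<partial>lborel)"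
    by (elim exE conjE)
  obtain L where L: "0 \<le> L" "\<And>x. x \<in> cball 0 (\<bar>R\<bar> + 1) \<Longrightarrow> lam x \<le> L" using lam_bounded[of "\<bar>R\<bar> + 1"] by blast
  define V where "V = measure lborel W"
  have VW: "emeasure lborel W = ennreal V" unfolding V_def
    using emeasure_lborel_cball_finite[of "0::'a" R] by (intro emeasure_eq_ennreal_measure) auto
  define q where "q = enn2real (\<integral>\<^sup>+x. dominating x \<partial>lborel)"
  have q: "(\<integral>\<^sup>+x. dominating x \<partial>lborel) = ennreal q" using dominating_finite by (simp add: q_def)
  define \<kappa> where "\<kappa> = q * (C * V + L)"
  have nn: "0 \<le> q" "0 \<le> V" by (auto simp: q_def V_def)
  have \<kappa>: "0 \<le> \<kappa>" using C L nn by (simp add: \<kappa>_def)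
  have "eventually (\<lambda>n. r n < 1) sequentially" by (rule order_tendstoD(2)[OF r_lim]) simp
  then have "eventually (\<lambda>n. \<forall>i\<ge>1. \<forall>j\<ge>1. i \<noteq> j \<longrightarrow>
     (\<integral>\<^sup>+\<omega>. drop_error n i j \<omega> * emeasure (X j \<omega>) W \<partial>M) \<le> ennreal (\<kappa> * vol n)) sequentially"
    using eventually_ge_at_top[of 1]
  proof eventually_elim
    case (elim n)
    show ?case
    proof (intro allI impI)
      fix i j :: nat assume ij: "1 \<le> i" "1 \<le> j" "i \<noteq> j"
      have v: "0 < vol n" by (rule vol_pos[OF elim(2)])
      define f where "f x w = ennreal c * indicator W x * emeasure (w j) (cball x (r n)) * emeasure (w j) W" for x and w :: "nat \<Rightarrow> 'a measure"
      have proj: "(\<lambda>p. snd p j) \<in> measurable ((borel :: 'a measure) \<Otimes>\<^sub>M PiM {j} (\<lambda>_. pp_space)) (pp_space :: 'a measure measure)"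
        by (rule measurable_compose[OF measurable_snd measurable_component_singleton]) simp
      have fm: "(\<lambda>(x, w). f x w) \<in> borel_measurable (borel \<Otimes>\<^sub>M PiM {j} (\<lambda>_. pp_space :: 'a measure measure))"
        unfolding f_def split_beta'
      proof (intro borel_measurable_times_ennreal)
        show "(\<lambda>p. emeasure (snd p j) (cball (fst p) (r n))) \<in> borel_measurable ((borel :: 'a measure) \<Otimes>\<^sub>M PiM {j} (\<lambda>_. pp_space :: 'a measure measure))"
          by (rule measurable_emeasure_cball[OF proj measurable_fst])
        show "(\<lambda>p. emeasure (snd p j) W) \<in> borel_measurable ((borel :: 'a measure) \<Otimes>\<^sub>M PiM {j} (\<lambda>_. pp_space :: 'a measure measure))"
          by (rule measurable_compose[OF proj measurable_emeasure_pp_space]) simp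
        show "(\<lambda>p. indicator W (fst p) :: ennreal) \<in> borel_measurable (borel \<Otimes>\<^sub>M PiM {j} (\<lambda>_. pp_space :: 'a measure measure))"
          by (rule measurable_compose[OF measurable_fst], intro borel_measurable_indicator) simp
      qed simp
      have "(\<integral>\<^sup>+\<omega>. drop_error n i j \<omega> * emeasure (X j \<omega>) W \<partial>M) = (\<integral>\<^sup>+\<omega>. (\<integral>\<^sup>+x. f x (\<lambda>l\<in>{j}. X l \<omega>) \<partial>X i \<omega>) \<partial>M)"
      proof (rule nn_integral_cong)
        fix \<omega> assume \<omega>: "\<omega> \<in> space M"
        have m2: "(\<lambda>x. ennreal c * indicator W x * emeasure (X j \<omega>) (cball x (r n))) \<in> borel_measurable (X i \<omega>)"
          by (intro measurable_config[OF X_lf[OF ij(1) \<omega>]] borel_measurable_times_ennreal borel_measurable_indicator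
              cball_mass_measurable[OF X_lf[OF ij(2) \<omega>]]) auto
        show "drop_error n i j \<omega> * emeasure (X j \<omega>) W = (\<integral>\<^sup>+x. f x (\<lambda>l\<in>{j}. X l \<omega>) \<partial>X i \<omega>)"
          unfolding drop_error_def f_def by (simp add: nn_integral_multc[OF m2])
      qed
      also have "\<dots> = (\<integral>\<^sup>+x. ennreal (lam x) * (\<integral>\<^sup>+\<omega>. f x (\<lambda>l\<in>{j}. X l \<omega>) \<partial>M) \<partial>lborel)"
        using ij by (intro campbell_indep[OF prob_space_axioms X_measurable rest_measurable joint_law_X_rest law fm]) auto
      also have "\<dots> \<le> (\<integral>\<^sup>+x. dominating x * ennreal ((C * V + L) * vol n) \<partial>lborel)"
      proof (intro nn_integral_mono)
        fix x :: 'a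
        have bound: "(\<integral>\<^sup>+\<phi>. emeasure \<phi> (cball x (r n)) * emeasure \<phi> W \<partial>P0) \<le> ennreal ((C * V + L) * vol n)" if x: "x \<in> W"
        proof -
          define B where "B = cball x (r n)"
          have B: "B \<in> sets borel" "W \<subseteq> cball 0 (\<bar>R\<bar> + 1)" by (auto simp: B_def)
          have BR: "B \<subseteq> cball 0 (\<bar>R\<bar> + 1)"
          proof
            fix y assume "y \<in> B"
            then have "norm (y - x) \<le> 1" using elim by (simp add: B_def dist_norm norm_minus_commute)
            moreover have "norm x \<le> \<bar>R\<bar>" using x by auto
            ultimately show "y \<in> cball 0 (\<bar>R\<bar> + 1)" using norm_triangle_sub[of y x] by simp
          qed
          have eB: "emeasure lborel B = ennreal (vol n)"
            unfolding measure_cball_r[OF elim(2), of x, symmetric] B_def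
            by (intro emeasure_eq_ennreal_measure) (use emeasure_lborel_cball_finite[of x "r n"] in auto)
          have "(\<integral>\<^sup>+y\<in>B \<inter> W. ennreal (lam y) \<partial>lborel) \<le> (\<integral>\<^sup>+y. ennreal L * indicator B y \<partial>lborel)"
          proof (intro nn_integral_mono)
            fix y show "ennreal (lam y) * indicator (B \<inter> W) y \<le> ennreal L * indicator B y"
              using L(2)[of y] BR by (auto simp: indicator_def intro!: ennreal_leI)
          qed
          also have "\<dots> = ennreal (L * vol n)"
            using L v B(1) by (subst nn_integral_cmult_indicator) (auto simp: eB ennreal_mult)
          finally have l: "(\<integral>\<^sup>+y\<in>B \<inter> W. ennreal (lam y) \<partial>lborel) \<le> ennreal (L * vol n)" .
          have "(\<integral>\<^sup>+\<phi>. emeasure \<phi> B * emeasure \<phi> W \<partial>P0)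
            \<le> ennreal C * emeasure lborel B * emeasure lborel W + (\<integral>\<^sup>+y\<in>B \<inter> W. ennreal (lam y) \<partial>lborel)"
            using C2 B BR W_borel by blast
          also have "\<dots> \<le> ennreal (C * vol n * V) + ennreal (L * vol n)"
            using C v nn l by (intro add_mono) (simp_all add: eB VW ennreal_mult)
          also have "\<dots> = ennreal ((C * V + L) * vol n)"
            using C L v nn by (subst ennreal_plus[symmetric]) (auto simp: algebra_simps)
          finally show ?thesis by (simp add: B_def)
        qed
        have "(\<integral>\<^sup>+\<omega>. f x (\<lambda>l\<in>{j}. X l \<omega>) \<partial>M) = ennreal c * indicator W x * (\<integral>\<^sup>+\<phi>. emeasure \<phi> (cball x (r n)) * emeasure \<phi> W \<partial>P0)"
        proof -
          have gm: "(\<lambda>\<phi>. emeasure \<phi> (cball x (r n)) * emeasure \<phi> W) \<in> borel_measurable pp_space"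
            by (intro borel_measurable_times_ennreal measurable_emeasure_pp_space) auto
          have "(\<integral>\<^sup>+\<omega>. f x (\<lambda>l\<in>{j}. X l \<omega>) \<partial>M) = (\<integral>\<^sup>+\<omega>. ennreal c * indicator W x * (emeasure (X j \<omega>) (cball x (r n)) * emeasure (X j \<omega>) W) \<partial>M)"
            by (simp add: f_def mult.assoc)
          also have "\<dots> = ennreal c * indicator W x * (\<integral>\<^sup>+\<omega>. emeasure (X j \<omega>) (cball x (r n)) * emeasure (X j \<omega>) W \<partial>M)"
            by (rule nn_integral_cmult[OF measurable_compose[OF X_measurable[OF ij(2)] gm]])
          finally show ?thesis unfolding nn_integral_X[OF ij(2) gm] .
        qed
        also have "\<dots> \<le> ennreal c * indicator W x * ennreal ((C * V + L) * vol n)"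
          using bound by (cases "x \<in> W") (auto intro!: mult_left_mono)
        finally show "ennreal (lam x) * (\<integral>\<^sup>+\<omega>. f x (\<lambda>l\<in>{j}. X l \<omega>) \<partial>M) \<le> dominating x * ennreal ((C * V + L) * vol n)"
          unfolding dominating_def by (simp add: mult_left_mono mult.assoc)
      qed
      also have "\<dots> = ennreal q * ennreal ((C * V + L) * vol n)" by (simp add: nn_integral_multc q)
      also have "\<dots> = ennreal (\<kappa> * vol n)"
        using nn C L v by (subst ennreal_mult[symmetric]) (auto simp: \<kappa>_def mult_ac)
      finally show "(\<integral>\<^sup>+\<omega>. drop_error n i j \<omega> * emeasure (X j \<omega>) W \<partial>M) \<le> ennreal (\<kappa> * vol n)" .
    qed
  qed
  then show ?thesis using \<kappa> by blast
qed

text \<open>The points of each summand carry the weights that result from the other \<open>n - 1\<close> summands.\<close>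

definition avg_weight :: "nat \<Rightarrow> 'w \<Rightarrow> ennreal" where
  "avg_weight n \<omega> = (\<Sum>i\<in>{1..n}. weight_sum n ({1..n} - {i}) i \<omega>) / of_nat n"

lemma others_admissible:
  shows "i \<in> {1..n} \<Longrightarrow> {1..n} - {i} \<in> admissible n"
    and "i \<in> {1..n} \<Longrightarrow> j \<in> {1..n} \<Longrightarrow> {1..n} - {i} - {j} \<in> admissible n"
  by (auto simp: admissible_def card_Diff_subset_Int card_Diff_singleton_if)

lemma admissible_nonempty: "admissible n \<noteq> {}"
  by (auto simp: admissible_def intro!: exI[of _ "{1..n}"])

definition limit_mean_r :: real where "limit_mean_r = enn2real limit_mean"

lemma limit_mean_eq: "limit_mean = ennreal limit_mean_r"
  using limit_mean_finite by (simp add: limit_mean_r_def)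

lemma mean_weight_finite: "mean_weight n I < \<infinity>"
proof -
  have "mean_weight n I \<le> (\<integral>\<^sup>+x. dominating x \<partial>lborel)"
    unfolding mean_weight_def dominating_def by (intro nn_integral_mono mult_left_mono expected_weight_le) simp
  then show ?thesis using dominating_finite by simp
qed

lemma mean_weight_pair_finite: "mean_weight_pair n I < \<infinity>"
proof -
  have le: "weight I n x \<omega> * weight I n y \<omega> \<le> ennreal c * indicator W x * (ennreal c * indicator W y)" for x y \<omega>
    by (intro mult_mono weight_le) auto
  have "mean_weight_pair n I \<le> (\<integral>\<^sup>+x. ennreal (lam x) * (\<integral>\<^sup>+y. ennreal (lam y) * (\<integral>\<^sup>+\<omega>. ennreal c * indicator W x * (ennreal c * indicator W y) \<partial>M) \<partial>lborel) \<partial>lborel)"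
    unfolding mean_weight_pair_def by (intro nn_integral_mono mult_left_mono le) auto
  also have "\<dots> = (\<integral>\<^sup>+x. (\<integral>\<^sup>+y. dominating x * dominating y \<partial>lborel) \<partial>lborel)"
  proof (intro nn_integral_cong)
    fix x
    have "ennreal (lam x) * (\<integral>\<^sup>+y. ennreal (lam y) * (\<integral>\<^sup>+\<omega>. ennreal c * indicator W x * (ennreal c * indicator W y) \<partial>M) \<partial>lborel)
      = ennreal (lam x) * (\<integral>\<^sup>+y. ennreal c * indicator W x * dominating y \<partial>lborel)"
      by (simp add: emeasure_space_1 dominating_def mult_ac)
    also have "\<dots> = (\<integral>\<^sup>+y. dominating x * dominating y \<partial>lborel)"
      by (simp add: nn_integral_cmult) (simp add: dominating_def mult_ac)
    finally show "ennreal (lam x) * (\<integral>\<^sup>+y. ennreal (lam y) * (\<integral>\<^sup>+\<omega>. ennreal c * indicator W x * (ennreal c * indicator W y) \<partial>M) \<partial>lborel)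
      = (\<integral>\<^sup>+y. dominating x * dominating y \<partial>lborel)" .
  qed
  also have "\<dots> = (\<integral>\<^sup>+x. dominating x \<partial>lborel) * (\<integral>\<^sup>+y. dominating y \<partial>lborel)"
    by (simp add: nn_integral_cmult nn_integral_multc)
  also have "\<dots> < \<infinity>" using dominating_finite by (simp add: ennreal_mult_less_top)
  finally show ?thesis .
qed

lemma mean_weight_uniform:
  assumes "0 < e"
  shows "eventually (\<lambda>n. \<forall>I\<in>admissible n. \<bar>enn2real (mean_weight n I) - limit_mean_r\<bar> < e) sequentially"
proof (rule eventually_uniform_of_sequences[OF admissible_nonempty _ assms])
  fix p assume "\<And>n. p n \<in> admissible n"
  then show "(\<lambda>n. enn2real (mean_weight n (p n))) \<longlonglongrightarrow> limit_mean_r"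
    using mean_weight_limit limit_mean_finite unfolding limit_mean_r_def
    by (intro tendsto_enn2real) auto
qed

lemma mean_weight_pair_uniform:
  assumes "0 < e"
  shows "eventually (\<lambda>n. \<forall>I\<in>admissible n. \<bar>enn2real (mean_weight_pair n I) - limit_mean_r\<^sup>2\<bar> < e) sequentially"
proof (rule eventually_uniform_of_sequences[OF admissible_nonempty _ assms])
  fix p assume p: "\<And>n. p n \<in> admissible n"
  have eq: "limit_mean * limit_mean = ennreal (limit_mean_r\<^sup>2)"
    unfolding limit_mean_eq power2_eq_square by (rule ennreal_mult[symmetric]) (simp_all add: limit_mean_r_def)
  show "(\<lambda>n. enn2real (mean_weight_pair n (p n))) \<longlonglongrightarrow> limit_mean_r\<^sup>2"
    by (rule tendsto_enn2real[OF mean_weight_pair_limit[OF p, unfolded eq]]) simp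
qed

lemma second_moment_W: "\<exists>Q\<ge>0. \<forall>i\<ge>1. (\<integral>\<^sup>+\<omega>. (ennreal c * emeasure (X i \<omega>) W) * (ennreal c * emeasure (X i \<omega>) W) \<partial>M) \<le> ennreal Q"
proof -
  from second_moment[of R] obtain C where C: "0 \<le> C" and C2: "\<forall>B1\<in>sets borel. \<forall>B2\<in>sets borel.
      B1 \<subseteq> cball 0 R \<longrightarrow> B2 \<subseteq> cball 0 R \<longrightarrow> (\<integral>\<^sup>+\<phi>. emeasure \<phi> B1 * emeasure \<phi> B2 \<partial>P0)
        \<le> ennreal C * emeasure lborel B1 * emeasure lborel B2 + (\<integral>\<^sup>+x\<in>B1 \<inter> B2. ennreal (lam x) \<partial>lborel)"
    by (elim exE conjE)
  obtain L where L: "0 \<le> L" "\<And>x. x \<in> W \<Longrightarrow> lam x \<le> L" using lam_bounded[of R] by blast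
  have fin: "emeasure lborel W < \<infinity>" by (rule emeasure_lborel_cball_finite)
  define q where "q = ennreal c * ennreal c * (ennreal C * emeasure lborel W * emeasure lborel W + ennreal L * emeasure lborel W)"
  have qf: "q < \<infinity>" using fin by (simp add: q_def ennreal_mult_less_top)
  have "(\<integral>\<^sup>+\<omega>. (ennreal c * emeasure (X i \<omega>) W) * (ennreal c * emeasure (X i \<omega>) W) \<partial>M) \<le> ennreal (enn2real q)" if i: "1 \<le> i" for i
  proof -
    have gm: "(\<lambda>\<phi>. emeasure \<phi> W * emeasure \<phi> W) \<in> borel_measurable pp_space"
      by (intro borel_measurable_times_ennreal measurable_emeasure_pp_space) auto
    have "(\<integral>\<^sup>+\<omega>. (ennreal c * emeasure (X i \<omega>) W) * (ennreal c * emeasure (X i \<omega>) W) \<partial>M)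
      = (\<integral>\<^sup>+\<omega>. ennreal c * ennreal c * (emeasure (X i \<omega>) W * emeasure (X i \<omega>) W) \<partial>M)"
      by (simp add: mult_ac)
    also have "\<dots> = ennreal c * ennreal c * (\<integral>\<^sup>+\<omega>. emeasure (X i \<omega>) W * emeasure (X i \<omega>) W \<partial>M)"
      by (rule nn_integral_cmult[OF measurable_compose[OF X_measurable[OF i] gm]])
    also have "(\<integral>\<^sup>+\<omega>. emeasure (X i \<omega>) W * emeasure (X i \<omega>) W \<partial>M) = (\<integral>\<^sup>+\<phi>. emeasure \<phi> W * emeasure \<phi> W \<partial>P0)"
      by (rule nn_integral_X[OF i gm])
    also have "\<dots> \<le> ennreal C * emeasure lborel W * emeasure lborel W + (\<integral>\<^sup>+x\<in>W \<inter> W. ennreal (lam x) \<partial>lborel)"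
      using C2 W_borel by blast
    also have "(\<integral>\<^sup>+x\<in>W \<inter> W. ennreal (lam x) \<partial>lborel) \<le> (\<integral>\<^sup>+x. ennreal L * indicator W x \<partial>lborel)"
      using L by (intro nn_integral_mono) (auto simp: indicator_def intro!: ennreal_leI)
    also have "\<dots> = ennreal L * emeasure lborel W" by (rule nn_integral_cmult_indicator) simp
    finally show ?thesis using qf by (simp add: q_def mult_left_mono)
  qed
  then show ?thesis by (intro exI[of _ "enn2real q"]) auto
qed

text \<open>The points of \<open>X i\<close> see \<open>X j\<close> and conversely. Dropping both summands from all neighbour counts
  makes the product accessible to Campbell's formula, at the price of the drop errors.\<close>

lemma expectation_weight_sum_product_le:
  assumes ij: "i \<in> {1..n}" "j \<in> {1..n}" "i \<noteq> j"
    and \<kappa>: "\<And>i j. 1 \<le> i \<Longrightarrow> 1 \<le> j \<Longrightarrow> i \<noteq> j \<Longrightarrow> (\<integral>\<^sup>+\<omega>. drop_error n i j \<omega> * emeasure (X j \<omega>) W \<partial>M) \<le> e"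
  shows "(\<integral>\<^sup>+\<omega>. weight_sum n ({1..n} - {i}) i \<omega> * weight_sum n ({1..n} - {j}) j \<omega> \<partial>M)
    \<le> mean_weight_pair n ({1..n} - {i} - {j}) + (ennreal c * e + ennreal c * e)"
proof -
  define I where "I = {1..n} - {i} - {j}"
  have I: "I \<subseteq> {1..}" "i \<notin> I" "j \<notin> I" by (auto simp: I_def)
  have i1: "1 \<le> i" "1 \<le> j" using ij by auto
  have eqi: "{1..n} - {i} - {j} = I" "{1..n} - {j} - {i} = I" by (auto simp: I_def)
  have Tm: "weight_sum n I i \<in> borel_measurable M" "weight_sum n I j \<in> borel_measurable M"
    by (intro weight_sum_measurable I i1)+
  have Dm: "drop_error n i j \<in> borel_measurable M" "drop_error n j i \<in> borel_measurable M" by (intro drop_error_measurable i1)+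
  have Xm: "(\<lambda>\<omega>. emeasure (X k \<omega>) W) \<in> borel_measurable M" if "1 \<le> k" for k
    by (rule measurable_compose[OF X_measurable[OF that] measurable_emeasure_pp_space]) simp
  have "(\<integral>\<^sup>+\<omega>. weight_sum n ({1..n} - {i}) i \<omega> * weight_sum n ({1..n} - {j}) j \<omega> \<partial>M)
    \<le> (\<integral>\<^sup>+\<omega>. weight_sum n I i \<omega> * weight_sum n I j \<omega> + (ennreal c * (drop_error n i j \<omega> * emeasure (X j \<omega>) W) + ennreal c * (drop_error n j i \<omega> * emeasure (X i \<omega>) W)) \<partial>M)"
  proof (intro nn_integral_mono)
    fix \<omega> assume \<omega>: "\<omega> \<in> space M"
    have s: "finite ({1..n} - {k})" "{1..n} - {k} \<subseteq> {1..}" for k by auto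
    have mem: "j \<in> {1..n} - {i}" "i \<in> {1..n} - {j}" using ij by auto
    have a: "weight_sum n ({1..n} - {i}) i \<omega> \<le> weight_sum n I i \<omega> + drop_error n i j \<omega>"
      using weight_sum_le_drop[OF s mem(1) i1(1) \<omega>, of n] unfolding eqi .
    have b: "weight_sum n ({1..n} - {j}) j \<omega> \<le> weight_sum n I j \<omega> + drop_error n j i \<omega>"
      using weight_sum_le_drop[OF s mem(2) i1(2) \<omega>, of n] unfolding eqi .
    have c1: "weight_sum n ({1..n} - {j}) j \<omega> \<le> ennreal c * emeasure (X j \<omega>) W" by (rule weight_sum_le[OF i1(2) \<omega>])
    have c2: "weight_sum n I i \<omega> \<le> ennreal c * emeasure (X i \<omega>) W" by (rule weight_sum_le[OF i1(1) \<omega>])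
    have "weight_sum n ({1..n} - {i}) i \<omega> * weight_sum n ({1..n} - {j}) j \<omega> \<le> (weight_sum n I i \<omega> + drop_error n i j \<omega>) * weight_sum n ({1..n} - {j}) j \<omega>"
      by (intro mult_right_mono a) simp
    also have "\<dots> = weight_sum n I i \<omega> * weight_sum n ({1..n} - {j}) j \<omega> + drop_error n i j \<omega> * weight_sum n ({1..n} - {j}) j \<omega>" by (simp add: distrib_right)
    also have "\<dots> \<le> weight_sum n I i \<omega> * (weight_sum n I j \<omega> + drop_error n j i \<omega>) + drop_error n i j \<omega> * (ennreal c * emeasure (X j \<omega>) W)"
      by (intro add_mono mult_left_mono b c1) auto
    also have "\<dots> = weight_sum n I i \<omega> * weight_sum n I j \<omega> + weight_sum n I i \<omega> * drop_error n j i \<omega> + drop_error n i j \<omega> * (ennreal c * emeasure (X j \<omega>) W)"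
      by (simp add: distrib_left)
    also have "\<dots> \<le> weight_sum n I i \<omega> * weight_sum n I j \<omega> + (ennreal c * emeasure (X i \<omega>) W) * drop_error n j i \<omega> + drop_error n i j \<omega> * (ennreal c * emeasure (X j \<omega>) W)"
      by (intro add_mono mult_right_mono c2) auto
    finally show "weight_sum n ({1..n} - {i}) i \<omega> * weight_sum n ({1..n} - {j}) j \<omega> \<le> weight_sum n I i \<omega> * weight_sum n I j \<omega> + (ennreal c * (drop_error n i j \<omega> * emeasure (X j \<omega>) W) + ennreal c * (drop_error n j i \<omega> * emeasure (X i \<omega>) W))"
      by (simp add: ac_simps)
  qed
  also have "\<dots> = (\<integral>\<^sup>+\<omega>. weight_sum n I i \<omega> * weight_sum n I j \<omega> \<partial>M) + (ennreal c * (\<integral>\<^sup>+\<omega>. drop_error n i j \<omega> * emeasure (X j \<omega>) W \<partial>M) + ennreal c * (\<integral>\<^sup>+\<omega>. drop_error n j i \<omega> * emeasure (X i \<omega>) W \<partial>M))"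
    using Tm Dm Xm[OF i1(1)] Xm[OF i1(2)] by (simp add: nn_integral_add nn_integral_cmult)
  also have "\<dots> \<le> mean_weight_pair n I + (ennreal c * e + ennreal c * e)"
    unfolding expectation_weight_sum_product[OF I ij(3) i1] using ij i1 by (intro add_mono mult_left_mono \<kappa>) auto
  finally show ?thesis by (simp add: I_def)
qed

lemma avg_weight_measurable: "avg_weight n \<in> borel_measurable M"
  unfolding avg_weight_def[abs_def]
  by (intro borel_measurable_divide_ennreal borel_measurable_sum weight_sum_measurable) auto

lemma avg_weight_finite: "1 \<le> n \<Longrightarrow> \<omega> \<in> space M \<Longrightarrow> avg_weight n \<omega> < \<infinity>"
proof -
  assume n: "1 \<le> n" and \<omega>: "\<omega> \<in> space M"
  have "weight_sum n ({1..n} - {i}) i \<omega> < \<infinity>" if "i \<in> {1..n}" for i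
  proof -
    have i: "1 \<le> i" using that by auto
    have "ennreal c * emeasure (X i \<omega>) W < \<infinity>"
      using emeasure_lf_finite[OF X_lf[OF i \<omega>] W_borel bounded_cball] by (simp add: ennreal_mult_less_top)
    then show ?thesis using weight_sum_le[OF i \<omega>, of n "{1..n} - {i}"] by (rule le_less_trans[rotated])
  qed
  then have "(\<Sum>i\<in>{1..n}. weight_sum n ({1..n} - {i}) i \<omega>) < \<infinity>" by simp
  then obtain s where "(\<Sum>i\<in>{1..n}. weight_sum n ({1..n} - {i}) i \<omega>) = ennreal s" "0 \<le> s"
    by (cases "\<Sum>i\<in>{1..n}. weight_sum n ({1..n} - {i}) i \<omega>") auto
  then show ?thesis using n unfolding avg_weight_def by (simp add: ennreal_of_nat_eq_real_of_nat divide_ennreal)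
qed

lemma avg_weight_mean:
  assumes n: "1 \<le> n"
  shows "(\<integral>\<^sup>+\<omega>. avg_weight n \<omega> \<partial>M) = ennreal ((\<Sum>i\<in>{1..n}. enn2real (mean_weight n ({1..n} - {i}))) / real n)"
proof -
  have "(\<integral>\<^sup>+\<omega>. avg_weight n \<omega> \<partial>M) = (\<integral>\<^sup>+\<omega>. (\<Sum>i\<in>{1..n}. weight_sum n ({1..n} - {i}) i \<omega>) \<partial>M) / of_nat n"
    unfolding avg_weight_def by (intro nn_integral_divide borel_measurable_sum weight_sum_measurable) auto
  also have "(\<integral>\<^sup>+\<omega>. (\<Sum>i\<in>{1..n}. weight_sum n ({1..n} - {i}) i \<omega>) \<partial>M) = (\<Sum>i\<in>{1..n}. \<integral>\<^sup>+\<omega>. weight_sum n ({1..n} - {i}) i \<omega> \<partial>M)"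
    by (intro nn_integral_sum weight_sum_measurable) auto
  also have "\<dots> = (\<Sum>i\<in>{1..n}. ennreal (enn2real (mean_weight n ({1..n} - {i}))))"
    using mean_weight_finite by (intro sum.cong refl) (subst expectation_weight_sum, auto)
  also have "\<dots> = ennreal (\<Sum>i\<in>{1..n}. enn2real (mean_weight n ({1..n} - {i})))"
    by (intro sum_ennreal) simp
  also have "\<dots> / of_nat n = ennreal ((\<Sum>i\<in>{1..n}. enn2real (mean_weight n ({1..n} - {i}))) / real n)"
    using n by (simp add: ennreal_of_nat_eq_real_of_nat divide_ennreal sum_nonneg)
  finally show ?thesis .
qed

text \<open>Among the \<open>n * n\<close> pairs the diagonal ones contribute only \<open>Q / n\<close> after division by \<open>n * n\<close>.\<close>

lemma avg_weight_second_moment: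
  assumes n: "1 \<le> n" and Q: "0 \<le> Q" "\<And>i. 1 \<le> i \<Longrightarrow> (\<integral>\<^sup>+\<omega>. (ennreal c * emeasure (X i \<omega>) W) * (ennreal c * emeasure (X i \<omega>) W) \<partial>M) \<le> ennreal Q"
    and e: "0 \<le> e" "\<And>i j. 1 \<le> i \<Longrightarrow> 1 \<le> j \<Longrightarrow> i \<noteq> j \<Longrightarrow> (\<integral>\<^sup>+\<omega>. drop_error n i j \<omega> * emeasure (X j \<omega>) W \<partial>M) \<le> ennreal e"
    and B: "0 \<le> B" "\<And>I. I \<in> admissible n \<Longrightarrow> enn2real (mean_weight_pair n I) \<le> B"
  shows "(\<integral>\<^sup>+\<omega>. avg_weight n \<omega> * avg_weight n \<omega> \<partial>M) \<le> ennreal (Q / real n + (B + 2 * c * e))"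
proof -
  define t where "t i \<omega> = weight_sum n ({1..n} - {i}) i \<omega>" for i \<omega>
  have tm: "t i \<in> borel_measurable M" if "i \<in> {1..n}" for i
    unfolding t_def[abs_def] using that by (intro weight_sum_measurable) auto
  have pair: "(\<integral>\<^sup>+\<omega>. t i \<omega> * t j \<omega> \<partial>M) \<le> ennreal (if i = j then Q else B + 2 * c * e)" if ij: "i \<in> {1..n}" "j \<in> {1..n}" for i j
  proof (cases "i = j")
    case True
    have i: "1 \<le> i" using ij by auto
    have "(\<integral>\<^sup>+\<omega>. t i \<omega> * t j \<omega> \<partial>M) \<le> (\<integral>\<^sup>+\<omega>. (ennreal c * emeasure (X i \<omega>) W) * (ennreal c * emeasure (X i \<omega>) W) \<partial>M)"
      unfolding t_def True[symmetric] by (intro nn_integral_mono mult_mono weight_sum_le[OF i]) auto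
    also have "\<dots> \<le> ennreal Q" by (rule Q(2)[OF i])
    finally show ?thesis using True by simp
  next
    case False
    have "(\<integral>\<^sup>+\<omega>. t i \<omega> * t j \<omega> \<partial>M) \<le> mean_weight_pair n ({1..n} - {i} - {j}) + (ennreal c * ennreal e + ennreal c * ennreal e)"
      unfolding t_def by (rule expectation_weight_sum_product_le[OF ij False e(2)])
    also have "mean_weight_pair n ({1..n} - {i} - {j}) \<le> ennreal B"
      using B(2)[OF others_admissible(2)[OF ij]] mean_weight_pair_finite[of n "{1..n} - {i} - {j}"]
      by (metis ennreal_enn2real ennreal_leI infinity_ennreal_def)
    also have "ennreal B + (ennreal c * ennreal e + ennreal c * ennreal e) = ennreal (B + 2 * c * e)"
      using B(1) c_nonneg e(1) by (simp add: ennreal_mult[symmetric] ennreal_plus[symmetric] del: ennreal_plus)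
    finally show ?thesis using False by (simp add: add_right_mono)
  qed
  have "(\<integral>\<^sup>+\<omega>. avg_weight n \<omega> * avg_weight n \<omega> \<partial>M) = (\<integral>\<^sup>+\<omega>. (\<Sum>i\<in>{1..n}. \<Sum>j\<in>{1..n}. t i \<omega> * t j \<omega>) * (inverse (of_nat n) * inverse (of_nat n)) \<partial>M)"
    unfolding avg_weight_def t_def by (intro nn_integral_cong) (simp add: sum_product divide_ennreal_def mult_ac)
  also have "\<dots> = (\<integral>\<^sup>+\<omega>. (\<Sum>i\<in>{1..n}. \<Sum>j\<in>{1..n}. t i \<omega> * t j \<omega>) \<partial>M) * (inverse (of_nat n) * inverse (of_nat n))"
    by (intro nn_integral_multc borel_measurable_sum borel_measurable_times_ennreal tm)
  also have "(\<integral>\<^sup>+\<omega>. (\<Sum>i\<in>{1..n}. \<Sum>j\<in>{1..n}. t i \<omega> * t j \<omega>) \<partial>M) = (\<Sum>i\<in>{1..n}. \<integral>\<^sup>+\<omega>. (\<Sum>j\<in>{1..n}. t i \<omega> * t j \<omega>) \<partial>M)"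
    by (intro nn_integral_sum borel_measurable_sum borel_measurable_times_ennreal tm)
  also have "\<dots> = (\<Sum>i\<in>{1..n}. \<Sum>j\<in>{1..n}. \<integral>\<^sup>+\<omega>. t i \<omega> * t j \<omega> \<partial>M)"
    by (intro sum.cong refl nn_integral_sum borel_measurable_times_ennreal tm)
  also have "\<dots> \<le> (\<Sum>i\<in>{1..n}. \<Sum>j\<in>{1..n}. ennreal (if i = j then Q else B + 2 * c * e))"
    by (intro sum_mono pair)
  also have "\<dots> = ennreal (\<Sum>i\<in>{1..n}. \<Sum>j\<in>{1..n}. if i = j then Q else B + 2 * c * e)"
    using Q(1) B(1) c_nonneg e(1) by (simp add: sum_ennreal sum_nonneg)
  also have "(\<Sum>i\<in>{1..n}. \<Sum>j\<in>{1..n}. if i = j then Q else B + 2 * c * e) \<le> (\<Sum>i\<in>{1..n}. \<Sum>j\<in>{1..n}. (if i = j then Q else 0) + (B + 2 * c * e))"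
    using Q(1) B(1) c_nonneg e(1) by (intro sum_mono) auto
  also have "\<dots> = real n * Q + real n * real n * (B + 2 * c * e)"
    by (simp add: sum.distrib distrib_left mult.assoc)
  also have "ennreal (real n * Q + real n * real n * (B + 2 * c * e)) * (inverse (of_nat n) * inverse (of_nat n))
    = ennreal (Q / real n + (B + 2 * c * e))"
  proof -
    have "inverse (of_nat n) = ennreal (inverse (real n))"
      using n by (simp add: ennreal_of_nat_eq_real_of_nat inverse_ennreal)
    then have "ennreal (real n * Q + real n * real n * (B + 2 * c * e)) * (inverse (of_nat n) * inverse (of_nat n))
      = ennreal ((real n * Q + real n * real n * (B + 2 * c * e)) * (inverse (real n) * inverse (real n)))"
      using Q(1) B(1) c_nonneg e(1) by (simp add: ennreal_mult[symmetric] del: ennreal_plus)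
    also have "(real n * Q + real n * real n * (B + 2 * c * e)) * (inverse (real n) * inverse (real n)) = Q / real n + (B + 2 * c * e)"
    proof -
      have "(N * Q + N * N * E) * (inverse N * inverse N) = Q / N + E" if "N \<noteq> 0" for N E :: real
        using that by (simp add: field_simps)
      then show ?thesis using n by simp
    qed
    finally show ?thesis .
  qed
  finally show ?thesis by (simp add: mult_right_mono ennreal_leI)
qed

text \<open>The means of the averages tend to \<open>limit_mean_r\<close> and their second moments are asymptotically at
  most its square, so the averages converge in mean square and hence in mean.\<close>

lemma avg_weight_law_of_large_numbers:
  "(\<lambda>n. \<integral>\<omega>. \<bar>enn2real (avg_weight n \<omega>) - limit_mean_r\<bar> \<partial>M) \<longlonglongrightarrow> 0"
proof (rule LIMSEQ_I)
  fix d0 :: real assume d0: "0 < d0"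
  define h where "h = limit_mean_r"
  have h0: "0 \<le> h" by (simp add: h_def limit_mean_r_def)
  define d where "d = d0 / 4"
  have d: "0 < d" using d0 by (simp add: d_def)
  have d2: "0 < d\<^sup>2 / 2" using d by simp
  obtain Q where Q: "0 \<le> Q" "\<And>i. 1 \<le> i \<Longrightarrow> (\<integral>\<^sup>+\<omega>. (ennreal c * emeasure (X i \<omega>) W) * (ennreal c * emeasure (X i \<omega>) W) \<partial>M) \<le> ennreal Q"
    using second_moment_W by blast
  obtain \<kappa> where \<kappa>: "0 \<le> \<kappa>" and ev\<kappa>: "eventually (\<lambda>n. \<forall>i\<ge>1. \<forall>j\<ge>1. i \<noteq> j \<longrightarrow>
     (\<integral>\<^sup>+\<omega>. drop_error n i j \<omega> * emeasure (X j \<omega>) W \<partial>M) \<le> ennreal (\<kappa> * vol n)) sequentially"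
    using expectation_drop_error by blast
  \<comment> \<open>An error \<open>e\<close> in the mean enters the variance as \<open>2 * h * e \<le> d\<^sup>2\<close>.\<close>
  define e where "e = d\<^sup>2 / (2 * (h + 1))"
  have e: "0 < e" using d h0 by (simp add: e_def)
  have "(\<lambda>n. Q * inverse (real n) + 2 * c * (\<kappa> * vol n)) \<longlonglongrightarrow> Q * 0 + 2 * c * (\<kappa> * 0)"
    by (intro tendsto_intros vol_lim lim_inverse_n)
  then have "eventually (\<lambda>n. Q * inverse (real n) + 2 * c * (\<kappa> * vol n) < d\<^sup>2 / 2) sequentially"
    by (rule order_tendstoD(2)) (use d in simp)
  then have "eventually (\<lambda>n. norm ((\<integral>\<omega>. \<bar>enn2real (avg_weight n \<omega>) - limit_mean_r\<bar> \<partial>M) - 0) < d0) sequentially"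
    using eventually_ge_at_top[of 1] ev\<kappa> mean_weight_uniform[OF e] mean_weight_pair_uniform[OF d2]
  proof eventually_elim
    case (elim n)
    have n: "1 \<le> n" by (rule elim(2))
    have v: "0 < vol n" by (rule vol_pos[OF n])
    define H where "H \<omega> = enn2real (avg_weight n \<omega>)" for \<omega>
    have Hm: "H \<in> borel_measurable M" unfolding H_def[abs_def] by (intro borel_measurable_enn2real avg_weight_measurable)
    have He: "ennreal (H \<omega>) = avg_weight n \<omega>" if "\<omega> \<in> space M" for \<omega> using avg_weight_finite[OF n that] by (simp add: H_def)
    have H0: "0 \<le> H \<omega>" for \<omega> by (simp add: H_def)
    define m where "m = (\<Sum>i\<in>{1..n}. enn2real (mean_weight n ({1..n} - {i}))) / real n"
    have m0: "0 \<le> m" unfolding m_def by (intro divide_nonneg_nonneg sum_nonneg) auto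
    have nH: "(\<integral>\<^sup>+\<omega>. ennreal (H \<omega>) \<partial>M) = ennreal m"
      using avg_weight_mean[OF n] He unfolding m_def by (simp cong: nn_integral_cong)
    have iH: "integrable M H" using Hm nH H0 by (intro integrableI_nonneg) auto
    have EH: "(\<integral>\<omega>. H \<omega> \<partial>M) = m" using nH nn_integral_eq_integral[OF iH] H0 m0
      by (simp add: ennreal_inj Bochner_Integration.integral_nonneg)
    have "\<bar>m - h\<bar> \<le> e"
    proof -
      have "m - h = (\<Sum>i\<in>{1..n}. enn2real (mean_weight n ({1..n} - {i})) - h) / real n"
        using n by (simp add: m_def sum_subtractf diff_divide_distrib)
      moreover have "\<bar>\<Sum>i\<in>{1..n}. enn2real (mean_weight n ({1..n} - {i})) - h\<bar> \<le> (\<Sum>i\<in>{1..n}. e)"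
        using elim(4) others_admissible(1)[of _ n] unfolding h_def
        by (intro order_trans[OF sum_abs] sum_mono less_imp_le) auto
      ultimately show ?thesis using n by (simp add: abs_divide divide_le_eq mult.commute)
    qed
    have "(\<integral>\<^sup>+\<omega>. avg_weight n \<omega> * avg_weight n \<omega> \<partial>M) \<le> ennreal (Q / real n + ((h\<^sup>2 + d\<^sup>2 / 2) + 2 * c * (\<kappa> * vol n)))"
    proof (rule avg_weight_second_moment[OF n Q])
      show "0 \<le> \<kappa> * vol n" using \<kappa> v by simp
      show "0 \<le> h\<^sup>2 + d\<^sup>2 / 2" by simp
      show "enn2real (mean_weight_pair n I) \<le> h\<^sup>2 + d\<^sup>2 / 2" if "I \<in> admissible n" for I
      proof -
        have "\<bar>enn2real (mean_weight_pair n I) - h\<^sup>2\<bar> < d\<^sup>2 / 2" using elim(5) that d unfolding h_def by auto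
        then show ?thesis by linarith
      qed
    qed (use elim(3) in auto)
    also have "\<dots> \<le> ennreal (h\<^sup>2 + d\<^sup>2)"
      using elim(1) divide_inverse[of Q "real n"] by (intro ennreal_leI) linarith
    also have "(\<integral>\<^sup>+\<omega>. avg_weight n \<omega> * avg_weight n \<omega> \<partial>M) = (\<integral>\<^sup>+\<omega>. ennreal ((H \<omega>)\<^sup>2) \<partial>M)"
      using He H0 by (intro nn_integral_cong) (simp add: power2_eq_square ennreal_mult)
    finally have nH2: "(\<integral>\<^sup>+\<omega>. ennreal ((H \<omega>)\<^sup>2) \<partial>M) \<le> ennreal (h\<^sup>2 + d\<^sup>2)" .
    have iH2: "integrable M (\<lambda>\<omega>. (H \<omega>)\<^sup>2)"
      using Hm le_less_trans[OF nH2 ennreal_less_top]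
      by (intro integrableI_nonneg borel_measurable_power) auto
    have EH2: "(\<integral>\<omega>. (H \<omega>)\<^sup>2 \<partial>M) \<le> h\<^sup>2 + d\<^sup>2"
    proof -
      have "(\<integral>\<^sup>+\<omega>. ennreal ((H \<omega>)\<^sup>2) \<partial>M) = ennreal (\<integral>\<omega>. (H \<omega>)\<^sup>2 \<partial>M)" by (rule nn_integral_eq_integral[OF iH2]) simp
      then show ?thesis using nH2 by (simp add: ennreal_le_iff del: ennreal_plus)
    qed
    \<comment> \<open>\<open>t \<le> d + t\<^sup>2 / d\<close> trades the first absolute moment for the variance.\<close>
    have "(\<integral>\<omega>. \<bar>H \<omega> - h\<bar> \<partial>M) \<le> (\<integral>\<omega>. d + ((H \<omega>)\<^sup>2 - 2 * h * H \<omega> + h\<^sup>2) / d \<partial>M)"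
    proof (rule integral_mono)
      show "integrable M (\<lambda>\<omega>. \<bar>H \<omega> - h\<bar>)" using iH by simp
      show "integrable M (\<lambda>\<omega>. d + ((H \<omega>)\<^sup>2 - 2 * h * H \<omega> + h\<^sup>2) / d)" using iH iH2 by simp
      fix \<omega>
      have "d * t \<le> d * d + t * t" if "0 \<le> t" for t :: real
      proof (cases "t \<le> d")
        case True
        then have "d * t \<le> d * d" using d by (intro mult_left_mono) auto
        then show ?thesis using zero_le_square[of t] by linarith
      next
        case False
        then have "d * t \<le> t * t" using that by (intro mult_right_mono) auto
        then show ?thesis using zero_le_square[of d] by linarith
      qed
      from this[of "\<bar>H \<omega> - h\<bar>"] have "d * \<bar>H \<omega> - h\<bar> \<le> d * d + (H \<omega> - h)\<^sup>2"
        by (simp add: power2_eq_square abs_mult_self_eq)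
      then show "\<bar>H \<omega> - h\<bar> \<le> d + ((H \<omega>)\<^sup>2 - 2 * h * H \<omega> + h\<^sup>2) / d"
        using d by (simp add: field_simps power2_eq_square)
    qed
    also have "\<dots> = d + ((\<integral>\<omega>. (H \<omega>)\<^sup>2 \<partial>M) - 2 * h * m + h\<^sup>2) / d"
      using iH iH2 by (simp add: prob_space EH[symmetric])
    also have "\<dots> \<le> d + 2 * d\<^sup>2 / d"
    proof -
      have "2 * h * (h - m) \<le> 2 * h * e" using \<open>\<bar>m - h\<bar> \<le> e\<close> h0 by (intro mult_left_mono) auto
      also have "\<dots> \<le> d\<^sup>2" using h0 by (simp add: e_def field_simps)
      finally have "(\<integral>\<omega>. (H \<omega>)\<^sup>2 \<partial>M) - 2 * h * m + h\<^sup>2 \<le> 2 * d\<^sup>2"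
        using EH2 by (simp add: algebra_simps power2_eq_square)
      then show ?thesis using d by (intro add_left_mono divide_right_mono) auto
    qed
    also have "\<dots> = 3 * d" using d by (simp add: power2_eq_square)
    also have "\<dots> < d0" using d0 by (simp add: d_def)
    finally have "(\<integral>\<omega>. \<bar>H \<omega> - h\<bar> \<partial>M) < d0" .
    then show ?case by (simp add: H_def h_def)
  qed
  then show "\<exists>N. \<forall>n\<ge>N. norm ((\<integral>\<omega>. \<bar>enn2real (avg_weight n \<omega>) - limit_mean_r\<bar> \<partial>M) - 0) < d0"
    by (simp add: eventually_sequentially)
qed

end

section \<open>The superposition and its thinning\<close>

lemma emeasure_superposition:
  assumes I: "finite I" and \<phi>: "\<And>i. i \<in> I \<Longrightarrow> sets (\<phi> i) = sets borel" and B: "B \<in> sets borel"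
  shows "emeasure (superposition I \<phi>) B = (\<Sum>i\<in>I. emeasure (\<phi> i) B)"
proof -
  have ca: "countably_additive (sets borel) (\<lambda>B. \<Sum>i\<in>I. emeasure (\<phi> i) B)"
  proof (rule countably_additiveI)
    fix A :: "nat \<Rightarrow> 'a set" assume A: "range A \<subseteq> sets borel" "disjoint_family A"
    have "(\<Sum>n. \<Sum>i\<in>I. emeasure (\<phi> i) (A n)) = (\<Sum>i\<in>I. \<Sum>n. emeasure (\<phi> i) (A n))"
      by (rule suminf_sum) auto
    also have "\<dots> = (\<Sum>i\<in>I. emeasure (\<phi> i) (\<Union>n. A n))"
      using A \<phi> by (intro sum.cong refl suminf_emeasure) auto
    finally show "(\<Sum>n. \<Sum>i\<in>I. emeasure (\<phi> i) (A n)) = (\<Sum>i\<in>I. emeasure (\<phi> i) (\<Union>n. A n))" .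
  qed
  have s: "sigma_sets UNIV (sets borel) = sets (borel :: 'a measure)"
    using sets.sigma_sets_eq[of "borel :: 'a measure"] by simp
  have m: "superposition I \<phi> = measure_of (space borel) (sets borel) (\<lambda>B. \<Sum>i\<in>I. emeasure (\<phi> i) B)"
    by (simp add: superposition_def)
  show ?thesis unfolding m
    by (rule emeasure_measure_of_sigma[OF sets.sigma_algebra_axioms _ ca B]) (simp add: positive_def)
qed

lemma sets_superposition: "sets (superposition I \<phi>) = sets borel"
  using sets.sigma_sets_eq[of "borel :: 'a measure"] by (simp add: superposition_def sets_measure_of)

lemma superposition_lf:
  assumes I: "finite I" and \<phi>: "\<And>i. i \<in> I \<Longrightarrow> \<phi> i \<in> lf_counting"
  shows "superposition I \<phi> \<in> lf_counting"
proof -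
  have "emeasure (superposition I \<phi>) B \<in> \<nat>" if B: "B \<in> sets borel" "bounded B" for B
  proof -
    have "emeasure (superposition I \<phi>) B = of_nat (\<Sum>i\<in>I. cnt (\<phi> i) B)"
      using \<phi> lf_sets B by (subst emeasure_superposition[OF I]) (auto simp: emeasure_lf_cnt)
    then show ?thesis by (simp only: of_nat_in_Nats)
  qed
  then show ?thesis by (simp add: lf_counting_def sets_superposition)
qed

lemma cnt_superposition:
  assumes I: "finite I" and \<phi>: "\<And>i. i \<in> I \<Longrightarrow> \<phi> i \<in> lf_counting" and B: "B \<in> sets borel" "bounded B"
  shows "cnt (superposition I \<phi>) B = (\<Sum>i\<in>I. cnt (\<phi> i) B)"
proof -
  have "superposition I \<phi> \<in> lf_counting" by (rule superposition_lf[OF I]) (rule \<phi>)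
  then have "(of_nat (cnt (superposition I \<phi>) B) :: ennreal) = emeasure (superposition I \<phi>) B"
    by (rule emeasure_lf_cnt[OF _ B, symmetric])
  also have "\<dots> = (\<Sum>i\<in>I. emeasure (\<phi> i) B)"
    using \<phi> lf_sets by (intro emeasure_superposition[OF I _ B(1)]) auto
  also have "\<dots> = of_nat (\<Sum>i\<in>I. cnt (\<phi> i) B)"
    using \<phi> B by (simp add: emeasure_lf_cnt)
  finally have "(of_nat (cnt (superposition I \<phi>) B) :: ennreal) = of_nat (\<Sum>i\<in>I. cnt (\<phi> i) B)" .
  then show ?thesis by (simp only: of_nat_eq_iff)
qed

lemma atoms_iff_cnt: "\<phi> \<in> lf_counting \<Longrightarrow> x \<in> atoms \<phi> \<longleftrightarrow> cnt \<phi> {x} \<noteq> 0"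
  using atoms_ge_1 cnt_not_atom by (metis not_one_le_zero)

lemma atoms_superposition:
  assumes I: "finite I" and \<phi>: "\<And>i. i \<in> I \<Longrightarrow> \<phi> i \<in> lf_counting"
  shows "atoms (superposition I \<phi>) = (\<Union>i\<in>I. atoms (\<phi> i))"
proof -
  have "x \<in> atoms (superposition I \<phi>) \<longleftrightarrow> x \<in> (\<Union>i\<in>I. atoms (\<phi> i))" for x
  proof -
    have "superposition I \<phi> \<in> lf_counting" by (rule superposition_lf[OF I]) (rule \<phi>)
    moreover have "cnt (superposition I \<phi>) {x} = (\<Sum>i\<in>I. cnt (\<phi> i) {x})"
      by (rule cnt_superposition[OF I]) (auto intro: \<phi>)
    ultimately have "x \<in> atoms (superposition I \<phi>) \<longleftrightarrow> (\<Sum>i\<in>I. cnt (\<phi> i) {x}) \<noteq> 0"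
      using atoms_iff_cnt by metis
    also have "\<dots> \<longleftrightarrow> (\<exists>i\<in>I. cnt (\<phi> i) {x} \<noteq> 0)" using I by (simp add: sum_eq_0_iff)
    also have "\<dots> \<longleftrightarrow> x \<in> (\<Union>i\<in>I. atoms (\<phi> i))" using atoms_iff_cnt[OF \<phi>] by auto
    finally show ?thesis .
  qed
  then show ?thesis by blast
qed

text \<open>All factors lie in the unit interval, so the difference of the products is at most the sum of the
  differences of the factors, and \<open>\<bar>1 - t - exp (- t)\<bar> \<le> t\<^sup>2\<close>.\<close>

lemma prod_one_minus_approx_exp:
  fixes y :: "'a \<Rightarrow> real"
  assumes A: "finite A" and y: "\<And>x. x \<in> A \<Longrightarrow> 0 \<le> y x \<and> y x \<le> 1"
  shows "\<bar>(\<Prod>x\<in>A. 1 - y x) - exp (- (\<Sum>x\<in>A. y x))\<bar> \<le> (\<Sum>x\<in>A. (y x)\<^sup>2)"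
proof -
  have one: "\<bar>(1 - t) - exp (- t)\<bar> \<le> t\<^sup>2" if t: "0 \<le> t" for t :: real
  proof -
    have lo: "1 - t \<le> exp (- t)" using exp_ge_add_one_self[of "- t"] by simp
    have "exp (- t) \<le> 1 / (1 + t)"
      using exp_ge_add_one_self[of t] t by (simp add: exp_minus divide_simps mult.commute)
    also have "\<dots> \<le> 1 - t + t\<^sup>2"
    proof -
      have "1 \<le> (1 - t + t\<^sup>2) * (1 + t)" using t by (simp add: algebra_simps power2_eq_square)
      then show ?thesis using t by (simp add: divide_le_eq)
    qed
    finally show ?thesis using lo by simp
  qed
  have "\<bar>(\<Prod>x\<in>A. 1 - y x) - (\<Prod>x\<in>A. exp (- y x))\<bar> \<le> (\<Sum>x\<in>A. \<bar>(1 - y x) - exp (- y x)\<bar>)"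
    using norm_prod_diff[of A "\<lambda>x. 1 - y x" "\<lambda>x. exp (- y x)"] y by auto
  also have "\<dots> \<le> (\<Sum>x\<in>A. (y x)\<^sup>2)" using one y by (intro sum_mono) auto
  finally have "\<bar>(\<Prod>x\<in>A. 1 - y x) - (\<Prod>x\<in>A. exp (- y x))\<bar> \<le> (\<Sum>x\<in>A. (y x)\<^sup>2)" .
  moreover have "(\<Prod>x\<in>A. exp (- y x)) = exp (- (\<Sum>x\<in>A. y x))"
    by (simp only: exp_sum[OF A, symmetric] sum_negf)
  ultimately show ?thesis by (simp only:)
qed

context superposed_sample
begin

text \<open>Given one configuration, the expected number of points of the other at its atoms is an integral
  of the intensity over a countable set, hence zero.\<close>

lemma AE_disjoint_atoms:
  assumes ij: "1 \<le> i" "1 \<le> j" "i \<noteq> j"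
  shows "AE \<omega> in M. atoms (X i \<omega>) \<inter> atoms (X j \<omega>) = {}"
proof -
  define f where "f x w = emeasure (w j) (cball x 0)" for x :: 'a and w :: "nat \<Rightarrow> 'a measure"
  have proj: "(\<lambda>p. snd p j) \<in> measurable ((borel :: 'a measure) \<Otimes>\<^sub>M PiM {j} (\<lambda>_. pp_space)) (pp_space :: 'a measure measure)"
    by (rule measurable_compose[OF measurable_snd measurable_component_singleton]) simp
  have fm: "(\<lambda>(x, w). f x w) \<in> borel_measurable (borel \<Otimes>\<^sub>M PiM {j} (\<lambda>_. pp_space))"
    unfolding f_def split_beta' by (rule measurable_emeasure_cball[OF proj measurable_fst])
  have "(\<integral>\<^sup>+\<omega>. (\<integral>\<^sup>+x. f x (\<lambda>l\<in>{j}. X l \<omega>) \<partial>X i \<omega>) \<partial>M) = (\<integral>\<^sup>+x. ennreal (lam x) * (\<integral>\<^sup>+\<omega>. f x (\<lambda>l\<in>{j}. X l \<omega>) \<partial>M) \<partial>lborel)"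
    using ij by (intro campbell_indep[OF prob_space_axioms X_measurable rest_measurable joint_law_X_rest law fm]) auto
  also have "\<dots> = (\<integral>\<^sup>+x. 0 \<partial>(lborel :: 'a measure))"
  proof (intro nn_integral_cong)
    fix x :: 'a
    have "(\<integral>\<^sup>+\<omega>. f x (\<lambda>l\<in>{j}. X l \<omega>) \<partial>M) = (\<integral>\<^sup>+\<phi>. emeasure \<phi> {x} \<partial>P0)"
      unfolding f_def by (simp add: nn_integral_X[OF ij(2) measurable_emeasure_pp_space])
    also have "\<dots> = (\<integral>\<^sup>+y\<in>{x}. ennreal (lam y) \<partial>lborel)" by (rule intensity) simp
    also have "\<dots> = 0"
    proof -
      have "AE y in lborel. y \<noteq> x" by (rule AE_lborel_singleton)
      then have "AE y in lborel. ennreal (lam y) * indicator {x} y = 0" by eventually_elim simp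
      then show ?thesis by (subst nn_integral_0_iff_AE) auto
    qed
    finally show "ennreal (lam x) * (\<integral>\<^sup>+\<omega>. f x (\<lambda>l\<in>{j}. X l \<omega>) \<partial>M) = 0" by simp
  qed
  finally have z: "(\<integral>\<^sup>+\<omega>. (\<integral>\<^sup>+x. emeasure (X j \<omega>) (cball x 0) \<partial>X i \<omega>) \<partial>M) = 0" by (simp add: f_def)
  have gm: "(\<lambda>\<omega>. \<integral>\<^sup>+x. emeasure (X j \<omega>) (cball x 0) \<partial>X i \<omega>) \<in> borel_measurable M"
  proof (rule measurable_nn_integral_kernel[OF X_measurable[OF ij(1)]])
    show "(\<lambda>(\<omega>, x). emeasure (X j \<omega>) (cball x 0)) \<in> borel_measurable (M \<Otimes>\<^sub>M borel)"
      unfolding split_beta'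
      by (rule measurable_emeasure_cball[OF measurable_compose[OF measurable_fst X_measurable[OF ij(2)]] measurable_snd])
  qed
  have "AE \<omega> in M. (\<integral>\<^sup>+x. emeasure (X j \<omega>) (cball x 0) \<partial>X i \<omega>) = 0"
    using z nn_integral_0_iff_AE[OF gm] by simp
  then show ?thesis using AE_space
  proof eventually_elim
    case (elim \<omega>)
    note lfi = X_lf[OF ij(1) elim(2)] and lfj = X_lf[OF ij(2) elim(2)]
    show ?case
    proof (rule ccontr)
      assume "atoms (X i \<omega>) \<inter> atoms (X j \<omega>) \<noteq> {}"
      then obtain x where x: "x \<in> atoms (X i \<omega>)" "x \<in> atoms (X j \<omega>)" by auto
      have "(\<integral>\<^sup>+y. emeasure (X j \<omega>) (cball y 0) * indicator {x} y \<partial>X i \<omega>) \<le> (\<integral>\<^sup>+y. emeasure (X j \<omega>) (cball y 0) \<partial>X i \<omega>)"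
        by (intro nn_integral_mono) (auto simp: indicator_def)
      then have "(\<integral>\<^sup>+y. emeasure (X j \<omega>) (cball y 0) * indicator {x} y \<partial>X i \<omega>) = 0" using elim(1) by simp
      moreover have "(\<integral>\<^sup>+y. emeasure (X j \<omega>) (cball y 0) * indicator {x} y \<partial>X i \<omega>)
        = (\<Sum>y\<in>atoms (X i \<omega>) \<inter> {x}. emeasure (X j \<omega>) (cball y 0) * of_nat (cnt (X i \<omega>) {y}))"
        by (rule nn_integral_lf_atoms[OF lfi _ _ cball_mass_measurable[OF lfj]]) auto
      moreover have "atoms (X i \<omega>) \<inter> {x} = {x}" using x by auto
      ultimately have "emeasure (X j \<omega>) {x} * of_nat (cnt (X i \<omega>) {x}) = 0" by simp
      then show False using x(2) atoms_ge_1[OF lfi x(1)] by (simp add: atoms_def)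
    qed
  qed
qed

end

context retention_setting
begin

text \<open>The number of points with a neighbour in their own summand, if the configuration is simple.
  Written as an integral it is visibly measurable in the configuration.\<close>

definition crowded :: "nat \<Rightarrow> 'a measure \<Rightarrow> ennreal" where
  "crowded n \<phi> = (\<integral>\<^sup>+x. of_bool (2 \<le> cnt \<phi> (cball x (r n))) * indicator W x \<partial>\<phi>)"

lemma close_measurable:
  "\<phi> \<in> lf_counting \<Longrightarrow> (\<lambda>x. of_bool (2 \<le> cnt \<phi> (cball x \<rho>)) :: ennreal) \<in> borel_measurable borel"
  by (rule measurable_compose[OF measurable_cnt_cball[where \<kappa> = "\<lambda>_. \<phi>" and x = "\<lambda>x. x"]]) auto

lemma crowded_measurable [measurable]: "crowded n \<in> borel_measurable pp_space"
  unfolding crowded_def[abs_def]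
proof (rule measurable_nn_integral_kernel[where \<kappa> = "\<lambda>\<phi>. \<phi>", OF measurable_ident_sets[OF refl]],
    unfold split_beta', intro borel_measurable_times_ennreal)
  show "(\<lambda>p. of_bool (2 \<le> cnt (fst p) (cball (snd p) (r n))) :: ennreal) \<in> borel_measurable (pp_space \<Otimes>\<^sub>M borel)"
    by (rule measurable_compose[OF measurable_cnt_cball[OF measurable_fst measurable_snd]]) simp
  show "(\<lambda>p. indicator W (snd p) :: ennreal) \<in> borel_measurable (pp_space \<Otimes>\<^sub>M borel)"
    by (rule measurable_compose[OF measurable_snd], intro borel_measurable_indicator) simp
qed

lemma crowded_eq:
  assumes lf: "\<phi> \<in> lf_counting" and s: "simple_config \<phi>"
  shows "crowded n \<phi> = of_nat (card {x \<in> atoms \<phi> \<inter> W. 2 \<le> cnt \<phi> (cball x (r n))})"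
proof -
  have fin: "finite (atoms \<phi> \<inter> W)" by (rule finite_atoms_Int[OF lf bounded_cball])
  have "crowded n \<phi> = (\<Sum>x\<in>atoms \<phi> \<inter> W. of_bool (2 \<le> cnt \<phi> (cball x (r n))) * of_nat (cnt \<phi> {x}))"
    unfolding crowded_def by (rule nn_integral_lf_atoms[OF lf bounded_cball W_borel close_measurable[OF lf]])
  also have "\<dots> = (\<Sum>x\<in>atoms \<phi> \<inter> W. of_nat (of_bool (2 \<le> cnt \<phi> (cball x (r n)))))"
    by (intro sum.cong refl) (simp add: simple_config_atom[OF lf s])
  also have "\<dots> = of_nat (\<Sum>x\<in>atoms \<phi> \<inter> W. of_bool (2 \<le> cnt \<phi> (cball x (r n))))" by (simp only: of_nat_sum)
  also have "(\<Sum>x\<in>atoms \<phi> \<inter> W. of_bool (2 \<le> cnt \<phi> (cball x (r n)))) = card {x \<in> atoms \<phi> \<inter> W. 2 \<le> cnt \<phi> (cball x (r n))}"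
    using fin by (simp add: of_bool_def sum.If_cases Int_def)
  finally show ?thesis .
qed

lemma crowded_le: "\<phi> \<in> lf_counting \<Longrightarrow> crowded n \<phi> \<le> emeasure \<phi> W"
proof -
  assume lf: "\<phi> \<in> lf_counting"
  have "crowded n \<phi> \<le> (\<integral>\<^sup>+x. indicator W x \<partial>\<phi>)"
    unfolding crowded_def by (intro nn_integral_mono) (auto simp: indicator_def)
  also have "\<dots> = emeasure \<phi> W" using lf_sets[OF lf] by (intro nn_integral_indicator) simp
  finally show ?thesis .
qed

text \<open>In a fixed simple configuration no point of the window has a neighbour once the radius is below
  the smallest distance; the number of points in the window is an integrable bound.\<close>

lemma expected_crowded: "(\<lambda>n. \<integral>\<^sup>+\<phi>. crowded n \<phi> \<partial>P0) \<longlonglongrightarrow> 0"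
proof -
  obtain L where L: "0 \<le> L" "\<And>x. x \<in> W \<Longrightarrow> lam x \<le> L" using lam_bounded[of R] by blast
  have "(\<lambda>n. \<integral>\<^sup>+\<phi>. crowded n \<phi> \<partial>P0) \<longlonglongrightarrow> (\<integral>\<^sup>+\<phi>. 0 \<partial>P0)"
  proof (rule nn_integral_dominated_convergence[where w = "\<lambda>\<phi>. emeasure \<phi> W"])
    show "crowded n \<in> borel_measurable P0" for n
      using crowded_measurable by (simp add: measurable_cong_sets[OF sets_P0 refl])
    show "(\<lambda>\<phi>. emeasure \<phi> W) \<in> borel_measurable P0"
      using measurable_emeasure_pp_space[OF W_borel] by (simp add: measurable_cong_sets[OF sets_P0 refl])
    show "AE \<phi> in P0. crowded n \<phi> \<le> emeasure \<phi> W" for n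
      using crowded_le by (intro AE_I2) (simp add: space_P0)
    have "(\<integral>\<^sup>+\<phi>. emeasure \<phi> W \<partial>P0) = (\<integral>\<^sup>+x\<in>W. ennreal (lam x) \<partial>lborel)" by (rule intensity) simp
    also have "\<dots> \<le> (\<integral>\<^sup>+x. ennreal L * indicator W x \<partial>lborel)"
      using L by (intro nn_integral_mono) (auto simp: indicator_def intro!: ennreal_leI)
    also have "\<dots> = ennreal L * emeasure lborel W" by (rule nn_integral_cmult_indicator) simp
    also have "\<dots> < \<infinity>" using emeasure_lborel_cball_finite[of "0::'a" R] by (simp add: ennreal_mult_less_top)
    finally show "(\<integral>\<^sup>+\<phi>. emeasure \<phi> W \<partial>P0) < \<infinity>" .
    show "AE \<phi> in P0. (\<lambda>n. crowded n \<phi>) \<longlonglongrightarrow> 0"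
      using AE_simple AE_space
    proof eventually_elim
      case (elim \<phi>)
      have lf: "\<phi> \<in> lf_counting" using elim(2) by (simp add: space_P0)
      define A where "A = atoms \<phi> \<inter> cball 0 (\<bar>R\<bar> + 1)"
      have fA: "finite A" unfolding A_def by (rule finite_atoms_Int[OF lf bounded_cball])
      define d where "d = Min (insert 1 ((\<lambda>(x, y). dist x y) ` {p \<in> A \<times> A. fst p \<noteq> snd p}))"
      have fin: "finite (insert 1 ((\<lambda>(x, y). dist x y) ` {p \<in> A \<times> A. fst p \<noteq> snd p}))" using fA by auto
      have d0: "0 < d" unfolding d_def using fin by (subst Min_gr_iff) auto
      have dle: "d \<le> dist x y" if "x \<in> A" "y \<in> A" "x \<noteq> y" for x y
        unfolding d_def using fin that by (intro Min_le) (auto intro!: rev_image_eqI[of "(x, y)"])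
      have "eventually (\<lambda>n. r n < min d 1) sequentially" by (rule order_tendstoD(2)[OF r_lim]) (use d0 in simp)
      then have "eventually (\<lambda>n. crowded n \<phi> = 0) sequentially"
      proof eventually_elim
        case (elim n)
        have "cnt \<phi> (cball x (r n)) < 2" if x: "x \<in> atoms \<phi> \<inter> W" for x
        proof -
          have "atoms \<phi> \<inter> cball x (r n) \<subseteq> {x}"
          proof
            fix y assume y: "y \<in> atoms \<phi> \<inter> cball x (r n)"
            have "norm x \<le> \<bar>R\<bar>" using x by auto
            moreover have "norm (y - x) \<le> 1" using y elim by (simp add: dist_norm norm_minus_commute)
            ultimately have "x \<in> A" "y \<in> A" using x y norm_triangle_sub[of y x] by (auto simp: A_def)
            then show "y \<in> {x}" using dle[of x y] y elim by auto
          qed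
          then have "card (atoms \<phi> \<inter> cball x (r n)) \<le> card {x}" by (intro card_mono) auto
          then show ?thesis using cnt_simple_config[OF lf \<open>simple_config \<phi>\<close> bounded_cball, of x "r n"] by simp
        qed
        then have "{x \<in> atoms \<phi> \<inter> W. 2 \<le> cnt \<phi> (cball x (r n))} = {}" by fastforce
        then show ?case unfolding crowded_eq[OF lf \<open>simple_config \<phi>\<close>] by (simp only: card.empty of_nat_0)
      qed
      then show ?case by (rule tendsto_eventually)
    qed
  qed auto
  then show ?thesis by simp
qed

lemma avg_weight_eq:
  assumes n: "1 \<le> n" and \<omega>: "\<omega> \<in> space M" and s: "\<And>i. i \<in> {1..n} \<Longrightarrow> simple_config (X i \<omega>)"
  shows "enn2real (avg_weight n \<omega>) = (\<Sum>i\<in>{1..n}. \<Sum>x\<in>atoms (X i \<omega>) \<inter> W. u x * a (nbrs ({1..n} - {i}) n x \<omega>)) / real n"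
proof -
  have weight_sum: "weight_sum n ({1..n} - {i}) i \<omega> = ennreal (\<Sum>x\<in>atoms (X i \<omega>) \<inter> W. u x * a (nbrs ({1..n} - {i}) n x \<omega>))" if i: "i \<in> {1..n}" for i
  proof -
    have i1: "1 \<le> i" using i by auto
    note lf = X_lf[OF i1 \<omega>]
    have wm: "(\<lambda>x. weight ({1..n} - {i}) n x \<omega>) \<in> borel_measurable borel"
      by (rule weight_measurable[where g = "\<lambda>y. y" and v = "\<lambda>_. \<omega>"]) (use \<omega> in auto)
    have "weight_sum n ({1..n} - {i}) i \<omega> = (\<integral>\<^sup>+x. weight ({1..n} - {i}) n x \<omega> * indicator W x \<partial>X i \<omega>)"
      unfolding weight_sum_def by (intro nn_integral_cong) (auto simp: weight_def indicator_def u_supp)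
    also have "\<dots> = (\<Sum>x\<in>atoms (X i \<omega>) \<inter> W. weight ({1..n} - {i}) n x \<omega> * of_nat (cnt (X i \<omega>) {x}))"
      by (rule nn_integral_lf_atoms[OF lf bounded_cball W_borel wm])
    also have "\<dots> = (\<Sum>x\<in>atoms (X i \<omega>) \<inter> W. ennreal (u x * a (nbrs ({1..n} - {i}) n x \<omega>)))"
      by (intro sum.cong refl) (simp add: simple_config_atom[OF lf s[OF i]] weight_def)
    also have "\<dots> = ennreal (\<Sum>x\<in>atoms (X i \<omega>) \<inter> W. u x * a (nbrs ({1..n} - {i}) n x \<omega>))"
      using u_bounds a_bounds by (intro sum_ennreal) simp
    finally show ?thesis .
  qed
  have nn: "0 \<le> (\<Sum>x\<in>atoms (X i \<omega>) \<inter> W. u x * a (nbrs ({1..n} - {i}) n x \<omega>))" for i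
    using u_bounds a_bounds by (intro sum_nonneg) simp
  have "avg_weight n \<omega> = ennreal (\<Sum>i\<in>{1..n}. \<Sum>x\<in>atoms (X i \<omega>) \<inter> W. u x * a (nbrs ({1..n} - {i}) n x \<omega>)) / of_nat n"
    unfolding avg_weight_def using weight_sum nn by (simp add: sum_ennreal)
  also have "\<dots> = ennreal ((\<Sum>i\<in>{1..n}. \<Sum>x\<in>atoms (X i \<omega>) \<inter> W. u x * a (nbrs ({1..n} - {i}) n x \<omega>)) / real n)"
    using n nn by (simp add: ennreal_of_nat_eq_real_of_nat divide_ennreal sum_nonneg)
  finally show ?thesis using nn by (simp add: sum_nonneg)
qed

text \<open>A point without neighbours in its own summand \<open>i\<close> has all its neighbours in the other summands,
  and the sum over these summands is independent of \<open>X i\<close>.\<close>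

lemma nbr_count_superposition:
  assumes n: "1 \<le> n" and \<omega>: "\<omega> \<in> space M" and s: "simple_config (superposition {1..n} (\<lambda>i. X i \<omega>))"
    and i: "i \<in> {1..n}" and x: "x \<in> atoms (X i \<omega>)" and one: "cnt (X i \<omega>) (cball x (r n)) < 2"
  shows "nbr_count (r n) x (atoms (superposition {1..n} (\<lambda>i. X i \<omega>))) = nbrs ({1..n} - {i}) n x \<omega>"
proof -
  define S where "S = superposition {1..n} (\<lambda>i. X i \<omega>)"
  have lfX: "X l \<omega> \<in> lf_counting" if "l \<in> {1..n}" for l using that by (intro X_lf \<omega>) auto
  have lfS: "S \<in> lf_counting" unfolding S_def by (rule superposition_lf) (use lfX in auto)
  have rn: "0 < r n" by (rule r_pos[OF n])
  have xS: "x \<in> atoms S \<inter> cball x (r n)"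
    unfolding S_def using atoms_superposition[of "{1..n}" "\<lambda>i. X i \<omega>"] lfX i x rn by auto
  have "nbr_count (r n) x (atoms S) = card (atoms S \<inter> cball x (r n)) - 1"
    unfolding nbr_count_def using xS by (simp add: card_Diff_singleton)
  also have "card (atoms S \<inter> cball x (r n)) = cnt S (cball x (r n))"
    using s by (intro cnt_simple_config[symmetric] lfS) (auto simp: S_def)
  also have "cnt S (cball x (r n)) = (\<Sum>l\<in>{1..n}. cnt (X l \<omega>) (cball x (r n)))"
    unfolding S_def by (rule cnt_superposition) (use lfX in auto)
  also have "\<dots> = cnt (X i \<omega>) (cball x (r n)) + nbrs ({1..n} - {i}) n x \<omega>"
    unfolding nbrs_def by (rule sum.remove[OF _ i]) simp
  also have "cnt (X i \<omega>) (cball x (r n)) = 1"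
  proof -
    note lf = lfX[OF i]
    have "(of_nat (cnt (X i \<omega>) {x}) :: ennreal) \<le> of_nat (cnt (X i \<omega>) (cball x (r n)))"
      using rn lf_sets[OF lf] unfolding emeasure_lf_cnt[OF lf, of "{x}", simplified, symmetric]
        emeasure_lf_cnt[OF lf, of "cball x (r n)", simplified, symmetric]
      by (intro emeasure_mono) auto
    then have "cnt (X i \<omega>) {x} \<le> cnt (X i \<omega>) (cball x (r n))" by (simp only: of_nat_le_iff)
    then show ?thesis using atoms_ge_1[OF lf x] one by linarith
  qed
  finally show ?thesis by (simp add: S_def)
qed

end

lemma exp_minus_lipschitz:
  fixes s t :: real
  assumes "0 \<le> s" "0 \<le> t"
  shows "\<bar>exp (- s) - exp (- t)\<bar> \<le> \<bar>s - t\<bar>"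
proof -
  have "exp (- s) - exp (- t) \<le> t - s" if "s \<le> t" "0 \<le> s" for s t :: real
  proof -
    have "1 - exp (- (t - s)) \<le> t - s" using exp_ge_add_one_self[of "- (t - s)"] by linarith
    then have "exp (- s) * (1 - exp (- (t - s))) \<le> 1 * (t - s)"
      using that by (intro mult_mono) auto
    then show ?thesis by (simp add: algebra_simps mult_exp_exp)
  qed
  from this[of s t] this[of t s] assms show ?thesis by (cases "s \<le> t") auto
qed

lemma (in superposed_sample) superposition_measurable:
  "(\<lambda>\<omega>. superposition {1..n} (\<lambda>i. X i \<omega>)) \<in> measurable M pp_space"
proof (rule measurable_pp_spaceI)
  show "superposition {1..n} (\<lambda>i. X i \<omega>) \<in> lf_counting" if "\<omega> \<in> space M" for \<omega>
    using that by (intro superposition_lf X_lf) auto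
  fix B :: "'a set" assume B: "B \<in> sets borel"
  have "(\<lambda>\<omega>. \<Sum>i\<in>{1..n}. emeasure (X i \<omega>) B) \<in> borel_measurable M"
    using B by (intro borel_measurable_sum measurable_compose[OF X_measurable measurable_emeasure_pp_space]) auto
  moreover have "emeasure (superposition {1..n} (\<lambda>i. X i \<omega>)) B = (\<Sum>i\<in>{1..n}. emeasure (X i \<omega>) B)"
    if "\<omega> \<in> space M" for \<omega>
    using that B by (intro emeasure_superposition lf_sets X_lf) auto
  ultimately show "(\<lambda>\<omega>. emeasure (superposition {1..n} (\<lambda>i. X i \<omega>)) B) \<in> borel_measurable M"
    by (subst measurable_cong[where g = "\<lambda>\<omega>. \<Sum>i\<in>{1..n}. emeasure (X i \<omega>) B"]) auto
qed

context retention_setting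
begin

text \<open>Averaged over its retention, the point \<open>x\<close> contributes \<open>1 - retained n \<omega> x\<close> to the generating
  functional.\<close>

definition retained :: "nat \<Rightarrow> 'w \<Rightarrow> 'a \<Rightarrow> real" where
  "retained n \<omega> x = a (nbr_count (r n) x (atoms (superposition {1..n} (\<lambda>i. X i \<omega>)))) / real n * u x"

text \<open>The three error terms come from replacing the product by an exponential, from the points with
  neighbours in their own summand, and from the fluctuation of the averaged weights.\<close>

lemma retained_product_error:
  assumes n: "1 \<le> n" "c \<le> real n" and \<omega>: "\<omega> \<in> space M"
    and s: "\<And>i. i \<in> {1..n} \<Longrightarrow> simple_config (X i \<omega>)"
    and d: "\<And>i j. i \<in> {1..n} \<Longrightarrow> j \<in> {1..n} \<Longrightarrow> i \<noteq> j \<Longrightarrow> atoms (X i \<omega>) \<inter> atoms (X j \<omega>) = {}"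
  shows "\<bar>(\<Prod>x\<in>atoms (superposition {1..n} (\<lambda>i. X i \<omega>)) \<inter> W. 1 - retained n \<omega> x) - exp (- limit_mean_r)\<bar>
    \<le> (c / real n)\<^sup>2 * (\<Sum>i\<in>{1..n}. real (cnt (X i \<omega>) W)) + c / real n * (\<Sum>i\<in>{1..n}. enn2real (crowded n (X i \<omega>)))
      + \<bar>enn2real (avg_weight n \<omega>) - limit_mean_r\<bar>"
proof -
  define S where "S = superposition {1..n} (\<lambda>i. X i \<omega>)"
  define A where "A i = atoms (X i \<omega>) \<inter> W" for i
  define y where "y = retained n \<omega>"
  have lfX: "X l \<omega> \<in> lf_counting" if "l \<in> {1..n}" for l using that by (intro X_lf \<omega>) auto
  have lfS: "S \<in> lf_counting" unfolding S_def by (rule superposition_lf) (use lfX in auto)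
  have atS: "atoms S = (\<Union>i\<in>{1..n}. atoms (X i \<omega>))"
    unfolding S_def by (rule atoms_superposition) (use lfX in auto)
  have simpS: "simple_config S"
    unfolding simple_config_def
  proof
    fix x
    have cS: "cnt S {x} = (\<Sum>i\<in>{1..n}. cnt (X i \<omega>) {x})"
      unfolding S_def by (rule cnt_superposition) (use lfX in auto)
    show "cnt S {x} \<le> 1"
    proof (cases "\<exists>i\<in>{1..n}. x \<in> atoms (X i \<omega>)")
      case True
      then obtain i where i: "i \<in> {1..n}" "x \<in> atoms (X i \<omega>)" by blast
      have "(\<Sum>j\<in>{1..n} - {i}. cnt (X j \<omega>) {x}) = 0"
        using d[OF i(1)] i(2) by (intro sum.neutral ballI cnt_not_atom) blast
      then have "cnt S {x} = cnt (X i \<omega>) {x}" unfolding cS using sum.remove[OF _ i(1), of "\<lambda>j. cnt (X j \<omega>) {x}"] by simp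
      then show ?thesis using s[OF i(1)] by (simp add: simple_config_def)
    next
      case False
      then show ?thesis unfolding cS by (simp add: cnt_not_atom)
    qed
  qed
  have fA: "finite (A i)" if "i \<in> {1..n}" for i unfolding A_def by (intro finite_atoms_Int lfX that bounded_cball)
  have AS: "atoms S \<inter> W = (\<Union>i\<in>{1..n}. A i)" unfolding atS A_def by auto
  have fS: "finite (atoms S \<inter> W)" by (rule finite_atoms_Int[OF lfS bounded_cball])
  have dA: "A i \<inter> A j = {}" if "i \<in> {1..n}" "j \<in> {1..n}" "i \<noteq> j" for i j
    using d[OF that] by (auto simp: A_def)
  have sumA: "(\<Sum>x\<in>atoms S \<inter> W. g x) = (\<Sum>i\<in>{1..n}. \<Sum>x\<in>A i. g x)" for g :: "'a \<Rightarrow> real"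
    unfolding AS using fA dA by (intro sum.UNION_disjoint) auto
  have y0: "0 \<le> y x" "y x \<le> c / real n" "y x \<le> 1" for x
  proof -
    have "a k / real n * u x \<le> c / real n * 1" for k
      using a_bounds u_bounds c_nonneg n by (intro mult_mono divide_right_mono) auto
    moreover have "c / real n \<le> 1" using n by simp
    ultimately show "0 \<le> y x" "y x \<le> c / real n" "y x \<le> 1"
      using a_bounds u_bounds unfolding y_def retained_def by (auto intro: order_trans)
  qed
  have e1: "\<bar>(\<Prod>x\<in>atoms S \<inter> W. 1 - y x) - exp (- (\<Sum>x\<in>atoms S \<inter> W. y x))\<bar> \<le> (c / real n)\<^sup>2 * (\<Sum>i\<in>{1..n}. real (cnt (X i \<omega>) W))"
  proof -
    have "\<bar>(\<Prod>x\<in>atoms S \<inter> W. 1 - y x) - exp (- (\<Sum>x\<in>atoms S \<inter> W. y x))\<bar> \<le> (\<Sum>x\<in>atoms S \<inter> W. (y x)\<^sup>2)"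
      using y0 by (intro prod_one_minus_approx_exp fS) auto
    also have "\<dots> \<le> (\<Sum>x\<in>atoms S \<inter> W. (c / real n)\<^sup>2)"
      using y0 by (intro sum_mono power_mono) auto
    also have "\<dots> = (\<Sum>i\<in>{1..n}. \<Sum>x\<in>A i. (c / real n)\<^sup>2)" by (rule sumA)
    also have "\<dots> = (c / real n)\<^sup>2 * (\<Sum>i\<in>{1..n}. real (card (A i)))" by (simp add: sum_distrib_left mult.commute)
    also have "(\<Sum>i\<in>{1..n}. real (card (A i))) = (\<Sum>i\<in>{1..n}. real (cnt (X i \<omega>) W))"
    proof (intro sum.cong refl)
      fix i assume i: "i \<in> {1..n}"
      show "real (card (A i)) = real (cnt (X i \<omega>) W)"
        unfolding A_def using cnt_simple_config[OF lfX[OF i] s[OF i] bounded_cball W_borel] by simp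
    qed
    finally show ?thesis .
  qed
  define m where "m = (\<Sum>i\<in>{1..n}. \<Sum>x\<in>A i. u x * a (nbrs ({1..n} - {i}) n x \<omega>)) / real n"
  have avg: "enn2real (avg_weight n \<omega>) = m" unfolding m_def A_def by (rule avg_weight_eq[OF n(1) \<omega> s])
  have e2: "\<bar>(\<Sum>x\<in>atoms S \<inter> W. y x) - m\<bar> \<le> c / real n * (\<Sum>i\<in>{1..n}. enn2real (crowded n (X i \<omega>)))"
  proof -
    have "(\<Sum>x\<in>atoms S \<inter> W. y x) - m = (\<Sum>i\<in>{1..n}. \<Sum>x\<in>A i. y x - u x * a (nbrs ({1..n} - {i}) n x \<omega>) / real n)"
      unfolding sumA m_def by (simp add: sum_subtractf sum_divide_distrib)
    also have "\<bar>\<dots>\<bar> \<le> (\<Sum>i\<in>{1..n}. \<Sum>x\<in>A i. \<bar>y x - u x * a (nbrs ({1..n} - {i}) n x \<omega>) / real n\<bar>)"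
      by (intro order_trans[OF sum_abs] sum_mono sum_abs)
    also have "\<dots> \<le> (\<Sum>i\<in>{1..n}. c / real n * enn2real (crowded n (X i \<omega>)))"
    proof (intro sum_mono)
      fix i assume i: "i \<in> {1..n}"
      have "\<bar>y x - u x * a (nbrs ({1..n} - {i}) n x \<omega>) / real n\<bar> \<le> (if 2 \<le> cnt (X i \<omega>) (cball x (r n)) then c / real n else 0)"
        if x: "x \<in> A i" for x
      proof (cases "2 \<le> cnt (X i \<omega>) (cball x (r n))")
        case True
        have "u x * a (nbrs ({1..n} - {i}) n x \<omega>) / real n \<le> 1 * c / real n"
          using a_bounds u_bounds c_nonneg by (intro divide_right_mono mult_mono) auto
        moreover have "0 \<le> u x * a (nbrs ({1..n} - {i}) n x \<omega>) / real n"
          using a_bounds u_bounds by (intro divide_nonneg_nonneg mult_nonneg_nonneg) auto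
        ultimately show ?thesis using True y0[of x] by (simp add: abs_le_iff) 
      next
        case False
        have "nbr_count (r n) x (atoms S) = nbrs ({1..n} - {i}) n x \<omega>"
          unfolding S_def using simpS x False i
          by (intro nbr_count_superposition[OF n(1) \<omega>]) (auto simp: S_def A_def)
        then show ?thesis using False by (simp add: y_def retained_def S_def)
      qed
      then have "(\<Sum>x\<in>A i. \<bar>y x - u x * a (nbrs ({1..n} - {i}) n x \<omega>) / real n\<bar>)
        \<le> (\<Sum>x\<in>A i. if 2 \<le> cnt (X i \<omega>) (cball x (r n)) then c / real n else 0)" by (rule sum_mono)
      also have "\<dots> = c / real n * real (card {x \<in> A i. 2 \<le> cnt (X i \<omega>) (cball x (r n))})"
        using fA[OF i] by (simp add: sum.If_cases Int_def)
      also have "real (card {x \<in> A i. 2 \<le> cnt (X i \<omega>) (cball x (r n))}) = enn2real (crowded n (X i \<omega>))"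
        unfolding A_def crowded_eq[OF lfX[OF i] s[OF i]] by (simp only: ennreal_of_nat_eq_real_of_nat enn2real_ennreal of_nat_0_le_iff)
      finally show "(\<Sum>x\<in>A i. \<bar>y x - u x * a (nbrs ({1..n} - {i}) n x \<omega>) / real n\<bar>) \<le> c / real n * enn2real (crowded n (X i \<omega>))" .
    qed
    also have "\<dots> = c / real n * (\<Sum>i\<in>{1..n}. enn2real (crowded n (X i \<omega>)))" by (rule sum_distrib_left[symmetric])
    finally show ?thesis .
  qed
  have "\<bar>exp (- (\<Sum>x\<in>atoms S \<inter> W. y x)) - exp (- limit_mean_r)\<bar> \<le> \<bar>(\<Sum>x\<in>atoms S \<inter> W. y x) - limit_mean_r\<bar>"
    using y0 by (intro exp_minus_lipschitz sum_nonneg) (auto simp: limit_mean_r_def)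
  also have "\<dots> \<le> \<bar>(\<Sum>x\<in>atoms S \<inter> W. y x) - m\<bar> + \<bar>m - limit_mean_r\<bar>" by linarith
  finally show ?thesis using e1 e2 unfolding avg S_def[symmetric] y_def[symmetric] by linarith
qed

lemma avg_weight_integrable: "1 \<le> n \<Longrightarrow> integrable M (\<lambda>\<omega>. enn2real (avg_weight n \<omega>))"
proof (rule integrableI_nonneg)
  assume n: "1 \<le> n"
  show "(\<lambda>\<omega>. enn2real (avg_weight n \<omega>)) \<in> borel_measurable M" by (intro borel_measurable_enn2real avg_weight_measurable)
  have "(\<integral>\<^sup>+\<omega>. ennreal (enn2real (avg_weight n \<omega>)) \<partial>M) = (\<integral>\<^sup>+\<omega>. avg_weight n \<omega> \<partial>M)"
    using avg_weight_finite[OF n] by (intro nn_integral_cong) simp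
  then show "(\<integral>\<^sup>+\<omega>. ennreal (enn2real (avg_weight n \<omega>)) \<partial>M) < \<infinity>" unfolding avg_weight_mean[OF n] by simp
qed simp

lemma AE_summands_simple_disjoint:
  "AE \<omega> in M. (\<forall>i\<in>{1..n}. simple_config (X i \<omega>)) \<and>
     (\<forall>i\<in>{1..n}. \<forall>j\<in>{1..n}. i \<noteq> j \<longrightarrow> atoms (X i \<omega>) \<inter> atoms (X j \<omega>) = {})"
proof -
  have "AE \<omega> in M. \<forall>i\<in>{1..n}. simple_config (X i \<omega>)"
    by (intro AE_finite_allI AE_X) auto
  moreover have "AE \<omega> in M. \<forall>i\<in>{1..n}. \<forall>j\<in>{1..n}. i \<noteq> j \<longrightarrow> atoms (X i \<omega>) \<inter> atoms (X j \<omega>) = {}"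
  proof (intro AE_finite_allI)
    fix i j assume ij: "i \<in> {1..n}" "j \<in> {1..n}"
    show "AE \<omega> in M. i \<noteq> j \<longrightarrow> atoms (X i \<omega>) \<inter> atoms (X j \<omega>) = {}"
      using AE_disjoint_atoms[of i j] ij by (cases "i = j") auto
  qed auto
  ultimately show ?thesis by (simp add: AE_conj_iff)
qed

text \<open>The three expected errors are of order \<open>1 / n\<close>, of the order of the expected number of crowded
  points of one summand, and the deviation in the law of large numbers.\<close>

lemma expectation_retained_limit:
  assumes hm: "\<And>n. n0 \<le> n \<Longrightarrow> h n \<in> borel_measurable M"
    and h: "\<And>n. n0 \<le> n \<Longrightarrow>
      AE \<omega> in M. h n \<omega> = (\<Prod>x\<in>atoms (superposition {1..n} (\<lambda>i. X i \<omega>)) \<inter> W. 1 - retained n \<omega> x)"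
  shows "(\<lambda>n. \<integral>\<omega>. h n \<omega> \<partial>M) \<longlonglongrightarrow> exp (- limit_mean_r)"
proof -
  define L where "L = exp (- limit_mean_r)"
  define mW where "mW = (\<integral>\<phi>. real (cnt \<phi> W) \<partial>P0)"
  define \<beta> where "\<beta> n = enn2real (\<integral>\<^sup>+\<phi>. crowded n \<phi> \<partial>P0)" for n
  define E where "E n = (\<integral>\<omega>. \<bar>enn2real (avg_weight n \<omega>) - limit_mean_r\<bar> \<partial>M)" for n
  have iW: "integrable P0 (\<lambda>\<phi>. real (cnt \<phi> W))" using moment_bounds[of R] W_borel by blast
  have cW: "integrable M (\<lambda>\<omega>. real (cnt (X i \<omega>) W))" "(\<integral>\<omega>. real (cnt (X i \<omega>) W) \<partial>M) = mW" if i: "1 \<le> i" for i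
  proof -
    have m: "(\<lambda>\<phi>. real (cnt \<phi> W)) \<in> borel_measurable pp_space"
      by (rule measurable_compose[OF measurable_cnt_pp_space[OF W_borel]]) simp
    show "integrable M (\<lambda>\<omega>. real (cnt (X i \<omega>) W))"
      using iW unfolding law[OF i, symmetric] by (subst (asm) integrable_distr_eq[OF X_measurable[OF i] m])
    show "(\<integral>\<omega>. real (cnt (X i \<omega>) W) \<partial>M) = mW"
      unfolding mW_def law[OF i, symmetric] by (rule integral_distr[OF X_measurable[OF i] m, symmetric])
  qed
  have clos: "integrable M (\<lambda>\<omega>. enn2real (crowded n (X i \<omega>)))" "(\<integral>\<omega>. enn2real (crowded n (X i \<omega>)) \<partial>M) = \<beta> n" if i: "1 \<le> i" for i n
  proof -
    have m: "(\<lambda>\<omega>. enn2real (crowded n (X i \<omega>))) \<in> borel_measurable M"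
      by (intro borel_measurable_enn2real measurable_compose[OF X_measurable[OF i] crowded_measurable])
    have le: "crowded n (X i \<omega>) \<le> ennreal (real (cnt (X i \<omega>) W))" if "\<omega> \<in> space M" for \<omega>
      using crowded_le[OF X_lf[OF i that], of n] emeasure_lf_cnt[OF X_lf[OF i that] W_borel bounded_cball]
      by (simp add: ennreal_of_nat_eq_real_of_nat)
    have "enn2real (crowded n (X i \<omega>)) \<le> real (cnt (X i \<omega>) W)" if "\<omega> \<in> space M" for \<omega>
      using enn2real_mono[OF le[OF that]] by simp
    then show "integrable M (\<lambda>\<omega>. enn2real (crowded n (X i \<omega>)))"
      by (intro Bochner_Integration.integrable_bound[OF cW(1)[OF i] m] AE_I2) auto
    have "crowded n (X i \<omega>) < top" if "\<omega> \<in> space M" for \<omega>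
      using le[OF that] ennreal_less_top by (rule le_less_trans)
    then have "(\<integral>\<^sup>+\<omega>. ennreal (enn2real (crowded n (X i \<omega>))) \<partial>M) = (\<integral>\<^sup>+\<omega>. crowded n (X i \<omega>) \<partial>M)"
      by (intro nn_integral_cong) simp
    then show "(\<integral>\<omega>. enn2real (crowded n (X i \<omega>)) \<partial>M) = \<beta> n"
      unfolding \<beta>_def nn_integral_X[OF i crowded_measurable, symmetric]
      by (subst integral_eq_nn_integral[OF m]) auto
  qed
  have "eventually (\<lambda>n. max n0 (max 1 (nat \<lceil>c\<rceil>)) \<le> n) sequentially" by (rule eventually_ge_at_top)
  then have ev: "eventually (\<lambda>n. norm ((\<integral>\<omega>. h n \<omega> \<partial>M) - L) \<le> c\<^sup>2 * mW * inverse (real n) + c * \<beta> n + E n) sequentially"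
  proof eventually_elim
    case (elim n)
    have n: "n0 \<le> n" "1 \<le> n" "c \<le> real n" using elim by (auto simp: nat_le_iff ceiling_le_iff)
    define b where "b \<omega> = (c / real n)\<^sup>2 * (\<Sum>i\<in>{1..n}. real (cnt (X i \<omega>) W)) + c / real n * (\<Sum>i\<in>{1..n}. enn2real (crowded n (X i \<omega>)))
      + \<bar>enn2real (avg_weight n \<omega>) - limit_mean_r\<bar>" for \<omega>
    have ib: "integrable M (\<lambda>\<omega>. \<Sum>i\<in>{1..n}. real (cnt (X i \<omega>) W))" "integrable M (\<lambda>\<omega>. \<Sum>i\<in>{1..n}. enn2real (crowded n (X i \<omega>)))"
      "integrable M (\<lambda>\<omega>. \<bar>enn2real (avg_weight n \<omega>) - limit_mean_r\<bar>)"
      using cW clos avg_weight_integrable[OF n(2)] by (auto intro!: Bochner_Integration.integrable_sum)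
    have intb: "integrable M b" unfolding b_def[abs_def] using ib by (intro Bochner_Integration.integrable_add integrable_mult_right)
    have ae: "AE \<omega> in M. \<bar>h n \<omega> - L\<bar> \<le> b \<omega>"
      using h[OF n(1)] AE_summands_simple_disjoint[of n] AE_space
    proof eventually_elim
      case (elim \<omega>)
      show ?case unfolding elim(1) L_def b_def using elim(2,3) n by (intro retained_product_error) auto
    qed
    have ih: "integrable M (\<lambda>\<omega>. h n \<omega> - L)"
      by (rule Bochner_Integration.integrable_bound[OF intb])
        (use hm[OF n(1)] ae in \<open>auto elim!: eventually_mono\<close>)
    have ih': "integrable M (h n)" using Bochner_Integration.integrable_add[OF ih integrable_const[of L]] by simp
    have "(\<integral>\<omega>. h n \<omega> \<partial>M) - L = (\<integral>\<omega>. h n \<omega> - L \<partial>M)" using ih' by (simp add: prob_space)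
    also have "norm \<dots> \<le> (\<integral>\<omega>. \<bar>h n \<omega> - L\<bar> \<partial>M)" unfolding real_norm_def by (rule integral_abs_bound)
    also have "\<dots> \<le> (\<integral>\<omega>. b \<omega> \<partial>M)" using ae ih intb by (intro integral_mono_AE) auto
    also have "\<dots> = (c / real n)\<^sup>2 * (\<Sum>i\<in>{1..n}. mW) + c / real n * (\<Sum>i\<in>{1..n}. \<beta> n) + E n"
    proof -
      have "(\<integral>\<omega>. (\<Sum>i\<in>{1..n}. real (cnt (X i \<omega>) W)) \<partial>M) = (\<Sum>i\<in>{1..n}. mW)"
        using cW by (subst Bochner_Integration.integral_sum) auto
      moreover have "(\<integral>\<omega>. (\<Sum>i\<in>{1..n}. enn2real (crowded n (X i \<omega>))) \<partial>M) = (\<Sum>i\<in>{1..n}. \<beta> n)"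
        using clos by (subst Bochner_Integration.integral_sum) auto
      ultimately show ?thesis unfolding b_def E_def using ib by simp
    qed
    also have "\<dots> = c\<^sup>2 * mW * inverse (real n) + c * \<beta> n + E n"
      using n(2) by (simp add: field_simps power2_eq_square)
    finally show ?case .
  qed
  have \<beta>0: "\<beta> \<longlonglongrightarrow> 0"
    unfolding \<beta>_def[abs_def] using expected_crowded by (intro tendsto_enn2real) auto
  have E0: "E \<longlonglongrightarrow> 0" unfolding E_def[abs_def] by (rule avg_weight_law_of_large_numbers)
  have "(\<lambda>n. c\<^sup>2 * mW * inverse (real n) + c * \<beta> n + E n) \<longlonglongrightarrow> c\<^sup>2 * mW * 0 + c * 0 + 0"
    by (intro tendsto_intros \<beta>0 E0 lim_inverse_n)
  then have "(\<lambda>n. (\<integral>\<omega>. h n \<omega> \<partial>M) - L) \<longlonglongrightarrow> 0" by (intro Lim_null_comparison[OF ev]) simp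
  then show ?thesis unfolding L_def by (rule LIM_zero_cancel)
qed

lemma limit_mean_r_eq: "limit_mean_r = (\<integral>x. u x * limit_intensity a \<tau> lam x \<partial>lborel)"
proof -
  have nn: "0 \<le> u x * limit_intensity a \<tau> lam x" for x
    using u_bounds lam_nonneg alpha_bounds[OF a_bounds] by (simp add: limit_intensity_def)
  have "limit_mean = (\<integral>\<^sup>+x. ennreal (u x * limit_intensity a \<tau> lam x) \<partial>lborel)"
    unfolding limit_mean_def limit_weight_def limit_intensity_def
    using u_bounds lam_nonneg alpha_bounds[OF a_bounds]
    by (intro nn_integral_cong) (simp add: ennreal_mult[symmetric] mult_ac)
  moreover have "(\<lambda>x. u x * limit_intensity a \<tau> lam x) \<in> borel_measurable lborel"
    unfolding limit_intensity_def by measurable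
  ultimately show ?thesis unfolding limit_mean_r_def using nn by (subst integral_eq_nn_integral) auto
qed

end

section \<open>The Poisson limit of the thinned superposition\<close>

lemma integral_step_fun:
  fixes \<Lambda> :: "'a::euclidean_space measure"
  assumes \<Lambda>: "sets \<Lambda> = sets borel" "\<And>B. B \<in> sets borel \<Longrightarrow> bounded B \<Longrightarrow> emeasure \<Lambda> B < \<infinity>"
    and C: "\<And>i. i \<in> I \<Longrightarrow> C i \<in> sets borel \<and> bounded (C i)"
  shows "(\<integral>x. step_fun I C z x \<partial>\<Lambda>) = (\<Sum>i\<in>I. (1 - z i) * measure \<Lambda> (C i))"
proof -
  have "integrable \<Lambda> (\<lambda>x. (1 - z i) * indicator (C i) x :: real)" if "i \<in> I" for i
    using \<Lambda>(2)[of "C i"] C[OF that] by (intro integrable_mult_right integrable_real_indicator) (auto simp: \<Lambda>(1))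
  then have "(\<integral>x. step_fun I C z x \<partial>\<Lambda>) = (\<Sum>i\<in>I. \<integral>x. (1 - z i) * indicator (C i) x \<partial>\<Lambda>)"
    unfolding step_fun_def by (rule Bochner_Integration.integral_sum)
  also have "\<dots> = (\<Sum>i\<in>I. (1 - z i) * measure \<Lambda> (C i))"
    using C sets_eq_imp_space_eq[OF \<Lambda>(1)] by (intro sum.cong refl) auto
  finally show ?thesis .
qed

text \<open>The generating functional at a step function is the joint generating function of the counts
  of its cells. Hence these counts become independent Poisson variables in the limit.\<close>

theorem pp_weak_conv_poisson_of_apgf:
  fixes Y :: "nat \<Rightarrow> 'w \<Rightarrow> 'a::euclidean_space measure"
  assumes M: "prob_space M" and Y: "\<And>n. n0 \<le> n \<Longrightarrow> Y n \<in> measurable M pp_space"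
    and \<Lambda>: "sets \<Lambda> = sets borel" "\<And>B. B \<in> sets borel \<Longrightarrow> bounded B \<Longrightarrow> emeasure \<Lambda> B < \<infinity>"
    and lim: "\<And>u. u \<in> test_functions \<Longrightarrow> (\<lambda>n. apgf M (Y n) u) \<longlonglongrightarrow> exp (- (\<integral>x. u x \<partial>\<Lambda>))"
  shows "\<exists>Q. poisson_process Q (\<lambda>\<phi>. \<phi>) \<Lambda> \<and> pp_weak_conv M Y Q (\<lambda>\<phi>. \<phi>)"
proof -
  obtain Q where Q: "prob_space Q" "sets Q = sets pp_space" and pgf: "poisson_pgf Q \<Lambda>"
    using poisson_process_exists[OF \<Lambda>] by blast
  have event: "measure P {\<omega> \<in> space P. \<forall>i\<in>I. cnt (Z \<omega>) (C i) = v i} = (\<integral>\<omega>. (\<Prod>i\<in>I. indicator {v i} (cnt (Z \<omega>) (C i))) \<partial>P)"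
    if P: "Z \<in> measurable P pp_space" and I: "finite I" and C: "\<And>i. i \<in> I \<Longrightarrow> C i \<in> sets borel \<and> bounded (C i)"
    for P :: "'p measure" and Z :: "'p \<Rightarrow> 'a measure" and I :: "nat set" and C v
  proof -
    have "{\<omega> \<in> space P. cnt (Z \<omega>) (C i) = v i} \<in> sets P" if "i \<in> I" for i
      using measurable_sets[OF measurable_compose[OF P measurable_cnt_pp_space[of "C i"]], of "{v i}"] C[OF that]
      by (simp add: vimage_def Int_def conj_commute)
    then have ms: "{\<omega> \<in> space P. \<forall>i\<in>I. cnt (Z \<omega>) (C i) = v i} \<in> sets P"
      using I by (intro sets.sets_Collect_finite_All) auto
    have "(\<integral>\<omega>. (\<Prod>i\<in>I. indicator {v i} (cnt (Z \<omega>) (C i))) \<partial>P)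
        = (\<integral>\<omega>. indicator {\<omega> \<in> space P. \<forall>i\<in>I. cnt (Z \<omega>) (C i) = v i} \<omega> \<partial>P :: real)"
      using I by (intro Bochner_Integration.integral_cong refl) (auto simp: indicator_def prod_zero_iff)
    then show ?thesis using ms by simp
  qed
  have "pp_weak_conv M Y Q (\<lambda>\<phi>. \<phi>)"
  proof (rule pp_weak_conv_of_counts[OF M Y Q(1)])
    show "(\<lambda>\<phi>. \<phi>) \<in> measurable Q pp_space" using Q(2) by (simp add: measurable_ident_sets)
    fix I :: "nat set" and C :: "nat \<Rightarrow> 'a set" and v :: "nat \<Rightarrow> nat"
    assume I: "finite I" "disjoint_family_on C I" and C: "\<And>i. i \<in> I \<Longrightarrow> C i \<in> sets borel \<and> bounded (C i)"
    have Y': "Y (n + n0) \<in> measurable M pp_space" for n by (rule Y) simp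
    have "(\<lambda>n. \<integral>\<omega>. (\<Prod>i\<in>I. indicator {v i} (cnt (Y (n + n0) \<omega>) (C i))) \<partial>M)
        \<longlonglongrightarrow> (\<Prod>i\<in>I. alpha (indicator {v i}) (measure \<Lambda> (C i)))"
    proof (rule prob_space.poisson_limit_of_joint_pgf[OF M I(1), where c = 1])
      show "(\<lambda>\<omega>. cnt (Y (n + n0) \<omega>) (C i)) \<in> measurable M (count_space UNIV)" if "i \<in> I" for n i
        using measurable_compose[OF Y' measurable_cnt_pp_space[of "C i"]] C[OF that] by simp
      fix z :: "nat \<Rightarrow> real" assume z: "\<And>i. i \<in> I \<Longrightarrow> 0 \<le> z i \<and> z i \<le> 1"
      have "(\<lambda>n. apgf M (Y (n + n0)) (step_fun I C z)) \<longlonglongrightarrow> exp (- (\<integral>x. step_fun I C z x \<partial>\<Lambda>))"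
        by (rule LIMSEQ_ignore_initial_segment[OF lim[OF step_fun_test[OF I C z]]])
      moreover have "apgf M (Y (n + n0)) (step_fun I C z) = (\<integral>\<omega>. (\<Prod>i\<in>I. z i ^ cnt (Y (n + n0) \<omega>) (C i)) \<partial>M)" for n
        unfolding apgf_eq_gfun using measurable_space[OF Y'] C
        by (intro Bochner_Integration.integral_cong refl gfun_step_fun I) auto
      ultimately show "(\<lambda>n. \<integral>\<omega>. (\<Prod>i\<in>I. z i ^ cnt (Y (n + n0) \<omega>) (C i)) \<partial>M)
          \<longlonglongrightarrow> exp (- (\<Sum>i\<in>I. (1 - z i) * measure \<Lambda> (C i)))"
        using integral_step_fun[OF \<Lambda>, of I C z] C by simp
    qed (auto simp: indicator_def)
    also have "(\<Prod>i\<in>I. alpha (indicator {v i}) (measure \<Lambda> (C i))) = (\<integral>\<phi>. (\<Prod>i\<in>I. indicator {v i} (cnt \<phi> (C i))) \<partial>Q)"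
      by (rule integral_prod_counts_of_poisson_pgf[OF Q pgf I C, symmetric]) (auto simp: indicator_def)
    finally have "(\<lambda>n. measure M {\<omega> \<in> space M. \<forall>i\<in>I. cnt (Y (n + n0) \<omega>) (C i) = v i})
        \<longlonglongrightarrow> measure Q {\<phi> \<in> space Q. \<forall>i\<in>I. cnt \<phi> (C i) = v i}"
      using event[OF Y' I(1) C] event[of "\<lambda>\<phi>. \<phi>" Q I C v] Q(2) I(1) C by (simp add: measurable_ident_sets)
    then show "(\<lambda>n. measure M {\<omega> \<in> space M. \<forall>i\<in>I. cnt (Y n \<omega>) (C i) = v i})
        \<longlonglongrightarrow> measure Q {\<phi> \<in> space Q. \<forall>i\<in>I. cnt \<phi> (C i) = v i}"
      by (rule LIMSEQ_offset)
  qed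
  then show ?thesis using poisson_process_of_pgf[OF Q pgf] by blast
qed

lemma (in superposed_sample) apgf_thinned_superposition_limit:
  assumes a: "\<And>k. 0 \<le> a k \<and> a k \<le> c" and n0: "1 \<le> n0" "c \<le> real n0"
    and thin: "\<And>n. n0 \<le> n \<Longrightarrow>
      nbr_thinning M (\<lambda>k. a k / real n) (r n) (\<lambda>\<omega>. superposition {1..n} (\<lambda>i. X i \<omega>)) (Y n)"
    and u: "u \<in> test_functions"
  shows "(\<lambda>n. apgf M (Y n) u) \<longlonglongrightarrow> exp (- (\<integral>x. u x * limit_intensity a \<tau> lam x \<partial>lborel))"
proof -
  obtain R where R: "{x. u x \<noteq> 0} \<subseteq> cball 0 R"
    using u bounded_subset_ballD[of "{x. u x \<noteq> 0}" 0] ball_subset_cball unfolding test_functions_def by blast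
  interpret retention_setting P0 lam r \<tau> M X a c u R
    by unfold_locales (use a u R in \<open>auto simp: test_functions_def\<close>)
  have "\<exists>h\<in>borel_measurable M. (AE \<omega> in M. h \<omega> = (\<Prod>x\<in>atoms (superposition {1..n} (\<lambda>i. X i \<omega>)) \<inter> W. 1 - retained n \<omega> x))
      \<and> apgf M (Y n) u = (\<integral>\<omega>. h \<omega> \<partial>M)" if n: "n0 \<le> n" for n
    unfolding retained_def
  proof (rule apgf_nbr_thinning[OF thin[OF n] _ superposition_measurable _ u])
    show "superposition {1..n} (\<lambda>i. X i \<omega>) \<in> lf_counting" if "\<omega> \<in> space M" for \<omega>
      using that by (intro superposition_lf X_lf) auto
    show "0 \<le> a k / real n \<and> a k / real n \<le> 1" for k
      using a[of k] n n0 by auto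
  qed (use R in auto)
  then have "\<forall>n. \<exists>h. n0 \<le> n \<longrightarrow> h \<in> borel_measurable M \<and>
      (AE \<omega> in M. h \<omega> = (\<Prod>x\<in>atoms (superposition {1..n} (\<lambda>i. X i \<omega>)) \<inter> W. 1 - retained n \<omega> x))
      \<and> apgf M (Y n) u = (\<integral>\<omega>. h \<omega> \<partial>M)" by blast
  from choice[OF this] obtain h where h: "\<And>n. n0 \<le> n \<Longrightarrow> h n \<in> borel_measurable M"
    "\<And>n. n0 \<le> n \<Longrightarrow> AE \<omega> in M. h n \<omega> = (\<Prod>x\<in>atoms (superposition {1..n} (\<lambda>i. X i \<omega>)) \<inter> W. 1 - retained n \<omega> x)"
    "\<And>n. n0 \<le> n \<Longrightarrow> apgf M (Y n) u = (\<integral>\<omega>. h n \<omega> \<partial>M)" by blast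
  have "(\<lambda>n. \<integral>\<omega>. h n \<omega> \<partial>M) \<longlonglongrightarrow> exp (- limit_mean_r)" by (rule expectation_retained_limit[OF h(1,2)])
  moreover have "eventually (\<lambda>n. (\<integral>\<omega>. h n \<omega> \<partial>M) = apgf M (Y n) u) sequentially"
    using h(3) by (intro eventually_sequentiallyI[of n0]) simp
  ultimately show ?thesis unfolding limit_mean_r_eq by (rule Lim_transform_eventually)
qed

lemma (in simple_point_law) limit_intensity_regular:
  assumes a: "\<And>k. 0 \<le> a k \<and> a k \<le> c" and \<tau>: "0 \<le> \<tau>"
  shows "limit_intensity a \<tau> lam \<in> borel_measurable borel" "0 \<le> limit_intensity a \<tau> lam x"
    and "B \<in> sets borel \<Longrightarrow> bounded B \<Longrightarrow>
      emeasure (density lborel (\<lambda>x. ennreal (limit_intensity a \<tau> lam x))) B < \<infinity>"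
proof -
  have al: "(\<lambda>x. alpha a (\<tau> * lam x)) \<in> borel_measurable borel"
    using a \<tau> lam_nonneg lam_measurable by (intro alpha_measurable[where c = c]) auto
  then show m: "limit_intensity a \<tau> lam \<in> borel_measurable borel"
    unfolding limit_intensity_def[abs_def] using lam_measurable by measurable
  have ab: "0 \<le> alpha a (\<tau> * lam x)" "alpha a (\<tau> * lam x) \<le> c" for x using alpha_bounds[OF a] by auto
  show "0 \<le> limit_intensity a \<tau> lam x" using ab lam_nonneg by (simp add: limit_intensity_def)
  assume B: "B \<in> sets borel" "bounded B"
  then obtain R where R: "B \<subseteq> cball 0 R" using bounded_subset_ballD[of B 0] ball_subset_cball by blast
  have "0 \<le> c" using a[of 0] by linarith
  have "emeasure (density lborel (\<lambda>x. ennreal (limit_intensity a \<tau> lam x))) B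
      = (\<integral>\<^sup>+x\<in>B. ennreal (limit_intensity a \<tau> lam x) \<partial>lborel)"
    using B m by (intro emeasure_density) auto
  also have "\<dots> \<le> (\<integral>\<^sup>+x. ennreal c * (ennreal (lam x) * indicator B x) \<partial>lborel)"
  proof (intro nn_integral_mono)
    fix x
    have "limit_intensity a \<tau> lam x \<le> c * lam x"
      unfolding limit_intensity_def using mult_right_mono[OF ab(2)[of x] lam_nonneg[of x]] by (simp add: mult.commute)
    then have "ennreal (limit_intensity a \<tau> lam x) \<le> ennreal c * ennreal (lam x)"
      unfolding ennreal_mult[OF \<open>0 \<le> c\<close> lam_nonneg, symmetric] by (rule ennreal_leI)
    then show "ennreal (limit_intensity a \<tau> lam x) * indicator B x \<le> ennreal c * (ennreal (lam x) * indicator B x)"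
      by (simp add: indicator_def)
  qed
  also have "\<dots> = ennreal c * (\<integral>\<^sup>+x\<in>B. ennreal (lam x) \<partial>lborel)"
    using B lam_measurable by (intro nn_integral_cmult) auto
  also have "\<dots> < \<infinity>"
  proof -
    obtain L where L: "\<And>x. x \<in> cball 0 R \<Longrightarrow> lam x \<le> L" using lam_bounded by metis
    have "(\<integral>\<^sup>+x\<in>B. ennreal (lam x) \<partial>lborel) \<le> (\<integral>\<^sup>+x\<in>B. ennreal L \<partial>lborel)"
      using L R by (intro nn_integral_mono) (auto simp: indicator_def intro!: ennreal_leI)
    also have "\<dots> = ennreal L * emeasure lborel B" using B by (intro nn_integral_cmult_indicator) auto
    also have "\<dots> < \<infinity>" using emeasure_bounded_finite[OF B(2)] by (simp add: ennreal_mult_less_top)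
    finally show ?thesis by (simp add: ennreal_mult_less_top)
  qed
  finally show "emeasure (density lborel (\<lambda>x. ennreal (limit_intensity a \<tau> lam x))) B < \<infinity>" .
qed

theorem theorem1:
  fixes N :: "'v measure" and X0 :: "'v \<Rightarrow> 'a::euclidean_space measure"
    and M :: "'w measure" and X S Y :: "nat \<Rightarrow> 'w \<Rightarrow> 'a measure"
    and lam :: "'a \<Rightarrow> real" and a :: "nat \<Rightarrow> real" and r :: "nat \<Rightarrow> real" and \<tau> :: real
  assumes "point_process N X0" and "simple_pp N X0"
    and "continuous_on UNIV lam" and "\<forall>x. lam x > 0" and "has_intensity N X0 lam"
    and "second_order_regular N X0"
    and "prob_space M"
    and "prob_space.indep_vars M (\<lambda>_. pp_space) X {1..}"
    and "\<forall>i\<ge>1. distr M pp_space (X i) = distr N pp_space X0"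
    and "\<forall>n \<omega>. S n \<omega> = superposition {1..n} (\<lambda>i. X i \<omega>)"
    and "\<forall>k. 0 \<le> a k" and "bdd_above (range a)"
    and "\<forall>n\<ge>1. 0 < r n" and "antimono_on {1..} r" and "r \<longlonglongrightarrow> 0"
    and "0 \<le> \<tau>"
    and "(\<lambda>n. real n * measure lborel (cball (0::'a) 1) * r n ^ DIM('a)) \<longlonglongrightarrow> \<tau>"
    and "\<forall>n\<ge>1. (SUP k. a k) \<le> real n \<longrightarrow> nbr_thinning M (\<lambda>k. a k / real n) (r n) (S n) (Y n)"
  shows "(\<exists>Q :: 'a measure measure.
            poisson_process Q (\<lambda>\<phi>. \<phi>) (density lborel (\<lambda>x. ennreal (limit_intensity a \<tau> lam x))) \<and>
            pp_weak_conv M Y Q (\<lambda>\<phi>. \<phi>)) \<and>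
         (\<forall>u\<in>test_functions.
            (\<lambda>n. apgf M (Y n) u) \<longlonglongrightarrow> exp (- (\<integral>x. u x * limit_intensity a \<tau> lam x \<partial>lborel)))"
proof -
  define P0 where "P0 = distr N pp_space X0"
  define c where "c = (SUP k. a k)"
  \<comment> \<open>From \<open>n0\<close> on, \<open>a k / n\<close> is a probability and \<open>Y n\<close> is a thinning.\<close>
  define n0 where "n0 = max 1 (nat \<lceil>c\<rceil>)"
  have spl: "simple_point_law P0 lam"
    unfolding P0_def using assms(1-6) by (intro simple_point_lawI) (auto intro: less_imp_le)
  have sample: "superposed_sample P0 lam r \<tau> M X"
    using spl assms(7-9,13,15-17)
    by (simp add: superposed_sample_def superposed_sample_axioms_def critical_radii_def critical_radii_axioms_def P0_def)
  interpret superposed_sample P0 lam r \<tau> M X by fact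
  have a: "0 \<le> a k \<and> a k \<le> c" for k
    unfolding c_def using assms(11) cSUP_upper[OF UNIV_I assms(12)] by simp
  have n0: "1 \<le> n0" "c \<le> real n0"
    unfolding n0_def by (simp, metis max.cobounded2 of_nat_ceiling of_nat_mono order_trans)
  have S: "S n = (\<lambda>\<omega>. superposition {1..n} (\<lambda>i. X i \<omega>))" for n using assms(10) by auto
  have thin: "nbr_thinning M (\<lambda>k. a k / real n) (r n) (\<lambda>\<omega>. superposition {1..n} (\<lambda>i. X i \<omega>)) (Y n)" if "n0 \<le> n" for n
  proof -
    have "1 \<le> n" "(SUP k. a k) \<le> real n" using that n0 unfolding c_def by linarith+
    then show ?thesis using assms(18) unfolding S by blast
  qed
  define \<Lambda> where "\<Lambda> = density lborel (\<lambda>x. ennreal (limit_intensity a \<tau> lam x))"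
  have lim: "(\<lambda>n. apgf M (Y n) u) \<longlonglongrightarrow> exp (- (\<integral>x. u x * limit_intensity a \<tau> lam x \<partial>lborel))"
    if "u \<in> test_functions" for u
    by (rule apgf_thinned_superposition_limit[OF a n0 _ that]) (rule thin)
  note reg = limit_intensity_regular[OF a assms(16)]
  have "(\<integral>x. u x \<partial>\<Lambda>) = (\<integral>x. u x * limit_intensity a \<tau> lam x \<partial>lborel)" if "u \<in> test_functions" for u
  proof -
    have "(\<integral>x. u x \<partial>\<Lambda>) = (\<integral>x. limit_intensity a \<tau> lam x *\<^sub>R u x \<partial>lborel)"
      unfolding \<Lambda>_def using that reg(1,2) by (intro integral_density) (auto simp: test_functions_def)
    then show ?thesis by (simp add: mult.commute)
  qed
  then have "\<exists>Q. poisson_process Q (\<lambda>\<phi>. \<phi>) \<Lambda> \<and> pp_weak_conv M Y Q (\<lambda>\<phi>. \<phi>)"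
    using lim thin reg(3) unfolding \<Lambda>_def
    by (intro pp_weak_conv_poisson_of_apgf[where ?n0.0 = n0] prob_space_axioms) (auto simp: nbr_thinning_def)
  then show ?thesis using lim unfolding \<Lambda>_def by blast
qed

end
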